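(* Let $(X,\tau,\mathsf d,\mathfrak m)$ be an extended metric measure space. Then $W_{\mathsf d}\le W_{\mathrm{Ch},*}\le W_{\mathrm{Ch}}$ on $\mathcal P^a(X)\times\mathcal P^a(X)$.
   Context: An extended metric space $(X,\mathsf d)$ is a set with a symmetric $\mathsf d:X\times X\to[0,\infty]$ satisfying the triangle inequality and $\mathsf d(x,y)=0$ iff $x=y$; for a semidistance the last condition is weakened to $\mathsf d(x,x)=0$. For a Hausdorff topology $\tau$ on $X$, $\mathrm{Lip}_b(X,\tau,\mathsf d)$ is the set of bounded, $\mathsf d$-Lipschitz, $\tau$-continuous functions $f:X\to\mathbb R$. $(X,\tau,\mathsf d)$ is an extended metric-topological space if (a) there are $(\tau\times\tau)$-continuous bounded semidistances $\mathsf d_i:X\times X\to[0,\infty)$, $i\in I$, with $\mathsf d=\sup_i\mathsf d_i$; (b) $\tau$ is generated by $\mathrm{Lip}_b(X,\tau,\mathsf d)$. $\mathcal P(X)$ is the set of Radon probability measures on the Borel sets of $\tau$; $(X,\tau,\mathsf d,\mathfrak m)$ is an extended metric measure space if moreover $\mathfrak m\in\mathcal P(X)$. $\mathcal P^a(X)=\{\mu\in\mathcal P(X):\mu\ll\mathfrak m\}$. $W_{\mathsf d}^2(\mu,\nu)=\inf\int\mathsf d^2\,d\boldsymbol\pi$ over Radon probability measures $\boldsymbol\pi$ on $X\times X$ with marginals $\mu,\nu$. Cheeger energy: for $f\in\mathrm{Lip}_b(X,\tau,\mathsf d)$, $\mathrm{Lip}_a(f,x)=\lim_{r\downarrow0}\sup\{|f(y)-f(z)|/\mathsf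 d(y,z):\ \mathsf d(y,x)\vee\mathsf d(z,x)<r,\ \mathsf d(y,z)>0\}$ ($=0$ at $\mathsf d$-isolated points), and $\mathrm{Lip}_a^*(f,\cdot)$ is the $\mathfrak m$-essentially smallest $\mathfrak m$-measurable function which is $\ge\mathrm{Lip}_a(f,\cdot)$ $\mathfrak m$-a.e. For $f\in L^2(X,\mathfrak m)$, $\mathrm{Ch}(f)=\inf\liminf_n\int(\mathrm{Lip}_a^*(f_n,\cdot))^2\,d\mathfrak m$ over sequences $f_n\in\mathrm{Lip}_b(X,\tau,\mathsf d)$ with $f_n\to f$ in $L^2(X,\mathfrak m)$; $D(\mathrm{Ch})=\{\mathrm{Ch}<\infty\}$. A relaxed slope of $f$ is any $G\ge g$ with $g$ a weak $L^2(X,\mathfrak m)$ limit point of $\mathrm{Lip}_a^*(f_n,\cdot)$ for some $f_n\in\mathrm{Lip}_b(X,\tau,\mathsf d)$, $f_n\to f$ in $L^2(X,\mathfrak m)$; $|\mathrm Df|_w$ is the relaxed slope of smallest $L^2$ norm, and $\mathrm{Ch}(f)=\int|\mathrm Df|_w^2d\mathfrak m$ on $D(\mathrm{Ch})$. $D(\mathrm{Ch})$ is normed by $\|f\|_{\mathrm{Ch}}=(\|f\|_2^2+\mathrm{Ch}(f))^{1/2}$. $\mathcal A_{\mathrm{Ch}}=\{f\in D(\mathrm{Ch}):\ f,|\mathrm Df|_w\in L^\infty(X,\mathfrak m)\}$. A family of probability densities $(\rho_t)_{t\in[0,1]}$ belongs to $\mathsf{CE}^2(X,\mathrm{Ch},\mathfrak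 m)$ if there is $c\in L^2(0,1)$ with $|\int f\rho_t\,d\mathfrak m-\int f\rho_s\,d\mathfrak m|\le\int_s^tc(r)(\int|\mathrm Df|_w^2\rho_r\,d\mathfrak m)^{1/2}dr$ for all $f\in\mathcal A_{\mathrm{Ch}}$, $0\le s\le t\le1$; the least such $c$ is $\|\rho_t'\|$. On $\mathcal P^a(X)$: $$W_{\mathrm{Ch}}^2(\rho_0\mathfrak m,\rho_1\mathfrak m)=\inf\Big\{\int_0^1\|\rho_t'\|^2dt:\ (\rho_t)\in\mathsf{CE}^2(X,\mathrm{Ch},\mathfrak m)\text{ joining }\rho_0\text{ to }\rho_1\Big\},$$ $$W_{\mathrm{Ch},*}^2(\rho_0\mathfrak m,\rho_1\mathfrak m)=2\sup_\phi\int(\phi_1\rho_1-\phi_0\rho_0)\,d\mathfrak m,$$ where the supremum runs over all bounded Borel maps $\phi(t,x)=\phi_t(x)$ on $[0,1]\times X$ with $t\mapsto\phi_t$ weakly$^*$ continuous from $[0,1]$ to $L^\infty(X,\mathfrak m)$, $\phi\in L^1(0,1;D(\mathrm{Ch}))$ (measurability w.r.t. the Borel $\sigma$-algebra of the $L^2$ topology, $\int_0^1\|\phi_t\|_{\mathrm{Ch}}dt<\infty$), and, for all nonnegative $\psi\in\mathcal A_{\mathrm{Ch}}$, $$\frac{d}{dt}\int\phi_t\psi\,d\mathfrak m+\frac12\int\psi|\mathrm D\phi_t|_w^2\,d\mathfrak m\le0\quad\text{in }\mathcal D'(0,1).$$ *)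

theory Defs
  imports "HOL-Probability.Probability"
begin

text \<open>
  The topological space \<open>(X, \<tau>)\<close> is a type of class \<^class>\<open>t2_space\<close>.  Elements of
  \<open>L\<^sup>p(X, m)\<close> are represented by functions on \<open>X\<close>; every notion below is invariant under
  \<open>m\<close>-a.e. equality.  Since \<open>m\<close> lives on the Borel sets, \<open>m\<close>-measurable functions are
  represented by their Borel versions.
\<close>

definition esqrt :: "ennreal \<Rightarrow> ennreal" where
  "esqrt x = (if x = top then top else ennreal (sqrt (enn2real x)))"

section \<open>Extended metric measure spaces\<close>

definition semidistance :: "('a \<Rightarrow> 'a \<Rightarrow> ennreal) \<Rightarrow> bool" where
  "semidistance d \<longleftrightarrow>
     (\<forall>x. d x x = 0) \<and> (\<forall>x y. d x y = d y x) \<and> (\<forall>x y z. d x z \<le> d x y + d y z)"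

definition ext_distance :: "('a \<Rightarrow> 'a \<Rightarrow> ennreal) \<Rightarrow> bool" where
  "ext_distance d \<longleftrightarrow> semidistance d \<and> (\<forall>x y. d x y = 0 \<longleftrightarrow> x = y)"

definition Lip_b :: "('a::topological_space \<Rightarrow> 'a \<Rightarrow> ennreal) \<Rightarrow> ('a \<Rightarrow> real) set" where
  "Lip_b d = {f. bounded (range f) \<and> continuous_on UNIV f \<and>
     (\<exists>L\<ge>0. \<forall>x y. ennreal \<bar>f x - f y\<bar> \<le> ennreal L * d x y)}"

definition ext_metric_topological_space :: "('a::t2_space \<Rightarrow> 'a \<Rightarrow> ennreal) \<Rightarrow> bool" where
  "ext_metric_topological_space d \<longleftrightarrow> ext_distance d \<and>
     (\<exists>\<Delta> :: ('a \<Rightarrow> 'a \<Rightarrow> real) set.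
        (\<forall>\<delta>\<in>\<Delta>. (\<forall>x y. 0 \<le> \<delta> x y) \<and> semidistance (\<lambda>x y. ennreal (\<delta> x y)) \<and>
               (\<exists>C. \<forall>x y. \<delta> x y \<le> C) \<and> continuous_on UNIV (\<lambda>(x, y). \<delta> x y)) \<and>
        (\<forall>x y. d x y = (SUP \<delta>\<in>\<Delta>. ennreal (\<delta> x y)))) \<and>
     open = generate_topology {f -` V | f V. f \<in> Lip_b d \<and> open V}"

definition radon_prob :: "'a::t2_space measure \<Rightarrow> bool" where
  "radon_prob \<mu> \<longleftrightarrow> prob_space \<mu> \<and> sets \<mu> = sets borel \<and>
     (\<forall>B\<in>sets borel. emeasure \<mu> B = (SUP K\<in>{K. compact K \<and> K \<subseteq> B}. emeasure \<mu> K))"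

definition ext_metric_measure_space ::
    "('a::t2_space \<Rightarrow> 'a \<Rightarrow> ennreal) \<Rightarrow> 'a measure \<Rightarrow> bool" where
  "ext_metric_measure_space d m \<longleftrightarrow> ext_metric_topological_space d \<and> radon_prob m"

definition Prob_ac :: "'a::t2_space measure \<Rightarrow> 'a measure set" where
  "Prob_ac m = {\<mu>. radon_prob \<mu> \<and> absolutely_continuous m \<mu>}"

text \<open>The density of \<open>\<mu> \<in> Prob_ac m\<close> with respect to \<open>m\<close>.\<close>

definition dens :: "'a measure \<Rightarrow> 'a measure \<Rightarrow> 'a \<Rightarrow> real" where
  "dens m \<mu> x = enn2real (RN_deriv m \<mu> x)"

section \<open>The Kantorovich distance\<close>

text \<open>Couplings are Radon measures on the Borel sets of \<open>X \<times> X\<close>, a sigma-algebra that may be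
  larger than the product of the Borel sigma-algebras.\<close>

definition couplings :: "'a::t2_space measure \<Rightarrow> 'a measure \<Rightarrow> ('a \<times> 'a) measure set" where
  "couplings \<mu> \<nu> = {\<pi>. radon_prob \<pi> \<and> distr \<pi> borel fst = \<mu> \<and> distr \<pi> borel snd = \<nu>}"

definition W_d ::
    "('a::t2_space \<Rightarrow> 'a \<Rightarrow> ennreal) \<Rightarrow> 'a measure \<Rightarrow> 'a measure \<Rightarrow> ennreal" where
  "W_d d \<mu> \<nu> = esqrt (INF \<pi>\<in>couplings \<mu> \<nu>. \<integral>\<^sup>+p. (d (fst p) (snd p))\<^sup>2 \<partial>\<pi>)"

section \<open>The space \<open>L\<^sup>2\<close>\<close>

definition L2 :: "'a measure \<Rightarrow> ('a \<Rightarrow> real) set" where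
  "L2 m = {f \<in> borel_measurable m. integrable m (\<lambda>x. (f x)\<^sup>2)}"

definition L2norm :: "'a measure \<Rightarrow> ('a \<Rightarrow> real) \<Rightarrow> ennreal" where
  "L2norm m f = esqrt (\<integral>\<^sup>+x. ennreal ((f x)\<^sup>2) \<partial>m)"

definition L2_tendsto :: "'a measure \<Rightarrow> (nat \<Rightarrow> 'a \<Rightarrow> real) \<Rightarrow> ('a \<Rightarrow> real) \<Rightarrow> bool" where
  "L2_tendsto m F f \<longleftrightarrow> (\<lambda>n. L2norm m (\<lambda>x. F n x - f x)) \<longlonglongrightarrow> 0"

definition L2_weak_tendsto :: "'a measure \<Rightarrow> (nat \<Rightarrow> 'a \<Rightarrow> real) \<Rightarrow> ('a \<Rightarrow> real) \<Rightarrow> bool" where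
  "L2_weak_tendsto m F f \<longleftrightarrow>
     (\<forall>h\<in>L2 m. (\<lambda>n. \<integral>x. F n x * h x \<partial>m) \<longlonglongrightarrow> (\<integral>x. f x * h x \<partial>m))"

definition L2_open :: "'a measure \<Rightarrow> ('a \<Rightarrow> real) set \<Rightarrow> bool" where
  "L2_open m U \<longleftrightarrow> U \<subseteq> L2 m \<and>
     (\<forall>f\<in>U. \<exists>e>0. \<forall>g\<in>L2 m. L2norm m (\<lambda>x. g x - f x) < ennreal e \<longrightarrow> g \<in> U)"

definition L2_borel :: "'a measure \<Rightarrow> ('a \<Rightarrow> real) measure" where
  "L2_borel m = sigma (L2 m) {U. L2_open m U}"

section \<open>The Cheeger energy\<close>

text \<open>The supremum is over the empty set, hence \<open>0\<close>, at \<open>d\<close>-isolated points for small \<open>r\<close>.  The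
  limit is finite, being bounded by a Lipschitz constant of \<open>f\<close>.\<close>

definition lip_a :: "('a \<Rightarrow> 'a \<Rightarrow> ennreal) \<Rightarrow> ('a \<Rightarrow> real) \<Rightarrow> 'a \<Rightarrow> real" where
  "lip_a d f x = enn2real (Lim (at_right 0) (\<lambda>r::real.
     SUP (y, z)\<in>{(y, z). max (d y x) (d z x) < ennreal r \<and> 0 < d y z}.
       ennreal \<bar>f y - f z\<bar> / d y z))"

definition is_ess_envelope :: "'a measure \<Rightarrow> ('a \<Rightarrow> real) \<Rightarrow> ('a \<Rightarrow> real) \<Rightarrow> bool" where
  "is_ess_envelope m g h \<longleftrightarrow> h \<in> borel_measurable m \<and> (AE x in m. g x \<le> h x) \<and>
     (\<forall>k\<in>borel_measurable m. (AE x in m. g x \<le> k x) \<longrightarrow> (AE x in m. h x \<le> k x))"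

definition lip_a_star ::
    "('a \<Rightarrow> 'a \<Rightarrow> ennreal) \<Rightarrow> 'a measure \<Rightarrow> ('a \<Rightarrow> real) \<Rightarrow> 'a \<Rightarrow> real" where
  "lip_a_star d m f = (SOME h. is_ess_envelope m (lip_a d f) h)"

definition Ch ::
    "('a::t2_space \<Rightarrow> 'a \<Rightarrow> ennreal) \<Rightarrow> 'a measure \<Rightarrow> ('a \<Rightarrow> real) \<Rightarrow> ennreal" where
  "Ch d m f = (INF F\<in>{F. (\<forall>n. F n \<in> Lip_b d) \<and> L2_tendsto m F f}.
     liminf (\<lambda>n. \<integral>\<^sup>+x. ennreal ((lip_a_star d m (F n) x)\<^sup>2) \<partial>m))"

definition D_Ch ::
    "('a::t2_space \<Rightarrow> 'a \<Rightarrow> ennreal) \<Rightarrow> 'a measure \<Rightarrow> ('a \<Rightarrow> real) set" where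
  "D_Ch d m = {f \<in> L2 m. Ch d m f < top}"

text \<open>A weak limit point of a sequence is a weak limit of one of its subsequences.\<close>

definition relaxed_slope ::
    "('a::t2_space \<Rightarrow> 'a \<Rightarrow> ennreal) \<Rightarrow> 'a measure \<Rightarrow> ('a \<Rightarrow> real) \<Rightarrow> ('a \<Rightarrow> real) \<Rightarrow> bool" where
  "relaxed_slope d m f G \<longleftrightarrow> G \<in> L2 m \<and>
     (\<exists>g F r. g \<in> L2 m \<and> (AE x in m. g x \<le> G x) \<and>
        (\<forall>n. F n \<in> Lip_b d) \<and> L2_tendsto m F f \<and>
        strict_mono r \<and> L2_weak_tendsto m (\<lambda>n. lip_a_star d m (F (r n))) g)"

definition wgrad ::
    "('a::t2_space \<Rightarrow> 'a \<Rightarrow> ennreal) \<Rightarrow> 'a measure \<Rightarrow> ('a \<Rightarrow> real) \<Rightarrow> 'a \<Rightarrow> real" where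
  "wgrad d m f = (SOME G. relaxed_slope d m f G \<and>
     (\<forall>H. relaxed_slope d m f H \<longrightarrow> L2norm m G \<le> L2norm m H))"

definition Ch_norm ::
    "('a::t2_space \<Rightarrow> 'a \<Rightarrow> ennreal) \<Rightarrow> 'a measure \<Rightarrow> ('a \<Rightarrow> real) \<Rightarrow> ennreal" where
  "Ch_norm d m f = esqrt ((L2norm m f)\<^sup>2 + Ch d m f)"

definition A_Ch ::
    "('a::t2_space \<Rightarrow> 'a \<Rightarrow> ennreal) \<Rightarrow> 'a measure \<Rightarrow> ('a \<Rightarrow> real) set" where
  "A_Ch d m = {f \<in> D_Ch d m. \<exists>C. AE x in m. \<bar>f x\<bar> \<le> C \<and> \<bar>wgrad d m f x\<bar> \<le> C}"

section \<open>The dynamic distance\<close>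

definition prob_density :: "'a measure \<Rightarrow> ('a \<Rightarrow> real) \<Rightarrow> bool" where
  "prob_density m \<rho> \<longleftrightarrow> \<rho> \<in> borel_measurable m \<and> (AE x in m. 0 \<le> \<rho> x) \<and>
     (\<integral>\<^sup>+x. ennreal (\<rho> x) \<partial>m) = 1"

text \<open>The bound \<open>c\<close> is taken nonnegative: otherwise there is no least one when the right-hand
  side vanishes identically for all \<open>f\<close>.  The time integral is then the integral of a nonnegative
  function.\<close>

definition CE_bound ::
    "('a::t2_space \<Rightarrow> 'a \<Rightarrow> ennreal) \<Rightarrow> 'a measure \<Rightarrow> (real \<Rightarrow> 'a \<Rightarrow> real) \<Rightarrow> (real \<Rightarrow> real) \<Rightarrow> bool"
  where
  "CE_bound d m \<rho> c \<longleftrightarrow>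
     c \<in> L2 (lebesgue_on {0<..<1}) \<and> (AE t in lebesgue_on {0<..<1}. 0 \<le> c t) \<and>
     (\<forall>f\<in>A_Ch d m. \<forall>s t. 0 \<le> s \<and> s \<le> t \<and> t \<le> 1 \<longrightarrow>
        ennreal \<bar>(\<integral>x. f x * \<rho> t x \<partial>m) - (\<integral>x. f x * \<rho> s x \<partial>m)\<bar>
          \<le> (\<integral>\<^sup>+r. ennreal (c r * sqrt (\<integral>x. (wgrad d m f x)\<^sup>2 * \<rho> r x \<partial>m))
                \<partial>lebesgue_on {s<..<t}))"

definition CE2 ::
    "('a::t2_space \<Rightarrow> 'a \<Rightarrow> ennreal) \<Rightarrow> 'a measure \<Rightarrow> (real \<Rightarrow> 'a \<Rightarrow> real) set" where
  "CE2 d m = {\<rho>. (\<forall>t\<in>{0..1}. prob_density m (\<rho> t)) \<and> (\<exists>c. CE_bound d m \<rho> c)}"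

definition CE_speed ::
    "('a::t2_space \<Rightarrow> 'a \<Rightarrow> ennreal) \<Rightarrow> 'a measure \<Rightarrow> (real \<Rightarrow> 'a \<Rightarrow> real) \<Rightarrow> real \<Rightarrow> real" where
  "CE_speed d m \<rho> = (SOME c. CE_bound d m \<rho> c \<and>
     (\<forall>c'. CE_bound d m \<rho> c' \<longrightarrow> (AE t in lebesgue_on {0<..<1}. c t \<le> c' t)))"

definition W_Ch ::
    "('a::t2_space \<Rightarrow> 'a \<Rightarrow> ennreal) \<Rightarrow> 'a measure \<Rightarrow> 'a measure \<Rightarrow> 'a measure \<Rightarrow> ennreal" where
  "W_Ch d m \<mu> \<nu> = esqrt (INF \<rho>\<in>{\<rho> \<in> CE2 d m.
       (AE x in m. \<rho> 0 x = dens m \<mu> x) \<and> (AE x in m. \<rho> 1 x = dens m \<nu> x)}.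
     \<integral>\<^sup>+t. ennreal ((CE_speed d m \<rho> t)\<^sup>2) \<partial>lebesgue_on {0<..<1})"

section \<open>The dual distance\<close>

definition test_fun_01 :: "(real \<Rightarrow> real) \<Rightarrow> bool" where
  "test_fun_01 \<eta> \<longleftrightarrow> (\<forall>n t. ((deriv ^^ n) \<eta>) differentiable (at t)) \<and>
     (\<exists>a b. 0 < a \<and> b < 1 \<and> (\<forall>t. t \<notin> {a..b} \<longrightarrow> \<eta> t = 0))"

text \<open>The inequality in \<open>D'(0,1)\<close> is tested against nonnegative \<open>\<eta>\<close>.  The second term is a
  Lebesgue integral of a nonnegative function that is not known to be finite a priori, hence the
  extended values.\<close>

definition HJ_subsolution ::
    "('a::t2_space \<Rightarrow> 'a \<Rightarrow> ennreal) \<Rightarrow> 'a measure \<Rightarrow> (real \<Rightarrow> 'a \<Rightarrow> real) \<Rightarrow> bool" where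
  "HJ_subsolution d m \<phi> \<longleftrightarrow>
     (\<forall>\<psi>\<in>A_Ch d m. (AE x in m. 0 \<le> \<psi> x) \<longrightarrow>
       (\<forall>\<eta>. test_fun_01 \<eta> \<and> (\<forall>t. 0 \<le> \<eta> t) \<longrightarrow>
          ereal (- (\<integral>t. deriv \<eta> t * (\<integral>x. \<phi> t x * \<psi> x \<partial>m) \<partial>lebesgue_on {0<..<1}))
          + ereal (1/2) * enn2ereal (\<integral>\<^sup>+t. ennreal (\<eta> t)
              * (\<integral>\<^sup>+x. ennreal (\<psi> x * (wgrad d m (\<phi> t) x)\<^sup>2) \<partial>m) \<partial>lebesgue_on {0<..<1})
          \<le> 0))"

definition weak_star_continuous_01 :: "'a measure \<Rightarrow> (real \<Rightarrow> 'a \<Rightarrow> real) \<Rightarrow> bool" where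
  "weak_star_continuous_01 m \<phi> \<longleftrightarrow>
     (\<forall>g. integrable m g \<longrightarrow> continuous_on {0..1} (\<lambda>t. \<integral>x. \<phi> t x * g x \<partial>m))"

definition L1_D_Ch ::
    "('a::t2_space \<Rightarrow> 'a \<Rightarrow> ennreal) \<Rightarrow> 'a measure \<Rightarrow> (real \<Rightarrow> 'a \<Rightarrow> real) \<Rightarrow> bool" where
  "L1_D_Ch d m \<phi> \<longleftrightarrow>
     \<phi> \<in> measurable (lebesgue_on {0<..<1}) (L2_borel m) \<and>
     (AE t in lebesgue_on {0<..<1}. \<phi> t \<in> D_Ch d m) \<and>
     (\<integral>\<^sup>+t. Ch_norm d m (\<phi> t) \<partial>lebesgue_on {0<..<1}) < top"

definition dual_admissible ::
    "('a::t2_space \<Rightarrow> 'a \<Rightarrow> ennreal) \<Rightarrow> 'a measure \<Rightarrow> (real \<Rightarrow> 'a \<Rightarrow> real) set" where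
  "dual_admissible d m = {\<phi>.
     (\<lambda>(t, x). \<phi> t x) \<in> borel_measurable (restrict_space borel ({0..1} \<times> UNIV)) \<and>
     (\<exists>C. \<forall>t\<in>{0..1}. \<forall>x. \<bar>\<phi> t x\<bar> \<le> C) \<and>
     weak_star_continuous_01 m \<phi> \<and> L1_D_Ch d m \<phi> \<and> HJ_subsolution d m \<phi>}"

text \<open>The supremum is nonnegative since \<open>\<phi> = 0\<close> is admissible, so \<^const>\<open>e2ennreal\<close> loses
  nothing.\<close>

definition W_Ch_dual ::
    "('a::t2_space \<Rightarrow> 'a \<Rightarrow> ennreal) \<Rightarrow> 'a measure \<Rightarrow> 'a measure \<Rightarrow> 'a measure \<Rightarrow> ennreal" where
  "W_Ch_dual d m \<mu> \<nu> = esqrt (e2ennreal (2 * (SUP \<phi>\<in>dual_admissible d m.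
     ereal (\<integral>x. \<phi> 1 x * dens m \<nu> x - \<phi> 0 x * dens m \<mu> x \<partial>m))))"

end

theory Submission
  imports Defs
begin

text \<open>
  For \<open>W_Ch_dual \<le> W_Ch\<close>, regularize an admissible potential in time by a smooth kernel.  The averages
  \<open>f\<close> lie in \<open>A_Ch\<close>, and the Hamilton--Jacobi inequality together with the convexity and lower
  semicontinuity of the weighted energies gives the pointwise bound \<open>\<bar>Df\<bar>\<^sup>2 \<le> - 2 \<partial>\<^sub>t f\<close>.  Along a curve of
  densities, Young's inequality bounds the increment due to the motion of the density by half of the
  action plus half of the energy of the potential, and the latter is absorbed by \<open>\<partial>\<^sub>t f\<close>.

  For \<open>W_d \<le> W_Ch_dual\<close>, let \<open>2 b\<close> be the square of the right-hand side.  The Hopf--Lax potentials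
  \<open>Min\<^sub>i (u\<^sub>i + e\<^sub>i\<^sup>2 / (2 (t + \<epsilon>)))\<close> of finitely many bounded continuous \<open>1\<close>-Lipschitz functions \<open>e\<^sub>i\<close> are
  admissible.  Taking for \<open>e\<^sub>i\<close> the distances from finitely many Borel cells in a continuous bounded
  semidistance below \<open>d\<close>, finite-dimensional transport duality produces a discrete plan of cost at
  most \<open>2 b\<close> with the right masses of the cells.  Tychonoff's theorem gives a finitely additive plan
  satisfying all these constraints at once; it is tight because its marginals are, and it is replaced
  by a Radon measure that is smaller on open sets and therefore has the same marginals and no larger
  cost, because \<open>{d\<^sup>2 > r}\<close> is open.
\<close>

section \<open>The Hilbert space \<open>L\<^sup>2\<close>\<close>

text \<open>The distance \<open>d\<close> need not be continuous for the topology and may be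
  infinite, and \<open>X\<close> is in general neither separable nor metrizable. Hence the
  \<open>d\<close>-distance from a set is no datum for a bounded continuous Hopf--Lax potential, and
  compactness theorems for measures on Polish spaces do not apply. Both obstacles are met by working
  with one continuous semidistance below \<open>d\<close> at a time: these form a directed family,
  so finitely many constraints reduce to one, and the compactness used is that of a power of [0, 1].
  On the dynamic side a curve of densities is known only through its integrals against functions in
  \<open>A_Ch\<close>, whereas the slope of an admissible potential is merely integrable in time.
  Averaging over a window of length \<open>\<epsilon>\<close> makes the slopes bounded but confines
  the averaged potential to [0, 1 - \<epsilon>]. Running through this interval during the unit time
  of the curve costs the factor 1 / (1 - \<epsilon>), which disappears in the limit.\<close>

definition L2sq :: "'a measure \<Rightarrow> ('a \<Rightarrow> real) \<Rightarrow> real" where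
  "L2sq M f = (\<integral>x. (f x)^2 \<partial>M)"

lemma esqrt_ennreal: "0 \<le> r \<Longrightarrow> esqrt (ennreal r) = ennreal (sqrt r)"
  by (simp add: esqrt_def)

lemma esqrt_top [simp]: "esqrt top = top"
  by (simp add: esqrt_def)

lemma esqrt_mono:
  assumes "x \<le> y" shows "esqrt x \<le> esqrt y"
proof (cases "y = top")
  case False
  then have "x \<noteq> top" using assms top.extremum_unique by auto
  with False assms show ?thesis
    by (auto simp: esqrt_def less_top intro!: ennreal_leI real_sqrt_le_mono enn2real_mono)
qed simp

lemma L2D [dest]:
  assumes "f \<in> L2 M"
  shows "f \<in> borel_measurable M" "integrable M (\<lambda>x. (f x)^2)"
  using assms by (auto simp: L2_def)

lemma L2_mult_integrable:
  assumes f: "f \<in> L2 M" and g: "g \<in> L2 M" shows "integrable M (\<lambda>x. f x * g x)"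
proof (rule Bochner_Integration.integrable_bound)
  show "integrable M (\<lambda>x. (f x)^2 + (g x)^2)" using f g by (auto)
  show "(\<lambda>x. f x * g x) \<in> borel_measurable M" using L2D(1)[OF f] L2D(1)[OF g] by measurable
  show "AE x in M. norm (f x * g x) \<le> norm ((f x)^2 + (g x)^2)"
  proof (rule AE_I2)
    fix x
    have "0 \<le> (\<bar>f x\<bar> - \<bar>g x\<bar>)^2" by simp
    then have "2 * (\<bar>f x\<bar> * \<bar>g x\<bar>) \<le> (f x)^2 + (g x)^2" by (simp add: power2_diff)
    moreover have "0 \<le> \<bar>f x\<bar> * \<bar>g x\<bar>" by (intro mult_nonneg_nonneg) auto
    ultimately have "\<bar>f x\<bar> * \<bar>g x\<bar> \<le> (f x)^2 + (g x)^2" by linarith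
    then show "norm (f x * g x) \<le> norm ((f x)^2 + (g x)^2)" by (simp add: abs_mult)
  qed
qed

lemma L2_lincomb:
  assumes f: "f \<in> L2 M" and g: "g \<in> L2 M" shows "(\<lambda>x. a * f x + b * g x) \<in> L2 M"
proof -
  have "(\<lambda>x. (a * f x + b * g x)^2) = (\<lambda>x. a^2 * (f x)^2 + 2 * a * b * (f x * g x) + b^2 * (g x)^2)"
    by (auto simp: power2_eq_square algebra_simps)
  moreover have "integrable M (\<lambda>x. a^2 * (f x)^2 + 2 * a * b * (f x * g x) + b^2 * (g x)^2)"
    using L2D(2)[OF f] L2D(2)[OF g] L2_mult_integrable[OF f g] by simp
  ultimately show ?thesis using f g by (auto simp: L2_def)
qed

lemma L2_add: "f \<in> L2 M \<Longrightarrow> g \<in> L2 M \<Longrightarrow> (\<lambda>x. f x + g x) \<in> L2 M"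
  using L2_lincomb[of f M g 1 1] by simp

lemma L2_diff: "f \<in> L2 M \<Longrightarrow> g \<in> L2 M \<Longrightarrow> (\<lambda>x. f x - g x) \<in> L2 M"
  using L2_lincomb[of f M g 1 "-1"] by simp

lemma L2_cmult: "f \<in> L2 M \<Longrightarrow> (\<lambda>x. a * f x) \<in> L2 M"
  using L2_lincomb[of f M f a 0] by simp

lemma L2_bound:
  assumes "g \<in> L2 M" "f \<in> borel_measurable M" "AE x in M. \<bar>f x\<bar> \<le> \<bar>g x\<bar>"
  shows "f \<in> L2 M"
proof -
  have "integrable M (\<lambda>x. (f x)^2)"
  proof (rule Bochner_Integration.integrable_bound)
    show "integrable M (\<lambda>x. (g x)^2)" using assms by auto
    show "(\<lambda>x. (f x)^2) \<in> borel_measurable M" using assms by auto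
    show "AE x in M. norm ((f x)^2) \<le> norm ((g x)^2)"
      using assms(3) by eventually_elim (simp add: abs_le_square_iff)
  qed
  then show ?thesis using assms by (simp add: L2_def)
qed

lemma (in finite_measure) L2_bounded:
  assumes "f \<in> borel_measurable M" "AE x in M. \<bar>f x\<bar> \<le> C"
  shows "f \<in> L2 M"
  by (rule L2_bound[of "\<lambda>_. C"]) (use assms in \<open>auto simp: L2_def\<close>)

lemma (in finite_measure) L2_integrable:
  assumes "f \<in> L2 M" shows "integrable M f"
proof -
  have "(\<lambda>_. 1) \<in> L2 M" by (simp add: L2_def)
  from L2_mult_integrable[OF assms this] show ?thesis by simp
qed

lemma L2sq_nonneg [simp]: "0 \<le> L2sq M f"
  by (simp add: L2sq_def)

lemma L2sq_mono:
  assumes g: "g \<in> L2 M" and "f \<in> borel_measurable M" and le: "AE x in M. \<bar>f x\<bar> \<le> \<bar>g x\<bar>"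
  shows "L2sq M f \<le> L2sq M g"
  unfolding L2sq_def
proof (rule integral_mono_AE)
  show "integrable M (\<lambda>x. (f x)^2)" using L2_bound[OF assms] by auto
  show "AE x in M. (f x)^2 \<le> (g x)^2" using le by eventually_elim (simp add: abs_le_square_iff)
qed (use g in auto)

lemma L2sq_cmult: "L2sq M (\<lambda>x. a * f x) = a^2 * L2sq M f"
  by (simp add: L2sq_def power_mult_distrib)

lemma L2sq_minus_commute: "L2sq M (\<lambda>x. f x - g x) = L2sq M (\<lambda>x. g x - f x)"
  by (simp add: L2sq_def power2_commute)

lemma L2sq_lincomb:
  assumes f: "f \<in> L2 M" and g: "g \<in> L2 M"
  shows "L2sq M (\<lambda>x. a * f x + b * g x)
    = a^2 * L2sq M f + 2 * a * b * (\<integral>x. f x * g x \<partial>M) + b^2 * L2sq M g"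
proof -
  have "(\<lambda>x. (a * f x + b * g x)^2) = (\<lambda>x. a^2 * (f x)^2 + 2 * a * b * (f x * g x) + b^2 * (g x)^2)"
    by (auto simp: power2_eq_square algebra_simps)
  then show ?thesis
    using f g L2_mult_integrable[OF f g] by (simp add: L2sq_def L2D)
qed

text \<open>The parallelogram identity without its difference term. It takes the place of the
  triangle inequality, since the factor 2 is harmless where only smallness matters.\<close>

lemma L2sq_add_le:
  assumes f: "f \<in> L2 M" and g: "g \<in> L2 M"
  shows "L2sq M (\<lambda>x. f x + g x) \<le> 2 * L2sq M f + 2 * L2sq M g"
  using L2sq_lincomb[OF f g, of 1 1] L2sq_lincomb[OF f g, of 1 "-1"]
    L2sq_nonneg[of M "\<lambda>x. 1 * f x + - 1 * g x"] by simp

lemma L2sq_diff_le: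
  assumes f: "f \<in> L2 M" and g: "g \<in> L2 M" and h: "h \<in> L2 M"
  shows "L2sq M (\<lambda>x. f x - h x) \<le> 2 * L2sq M (\<lambda>x. f x - g x) + 2 * L2sq M (\<lambda>x. g x - h x)"
  using L2sq_add_le[OF L2_diff[OF f g] L2_diff[OF g h]] by simp

lemma L2_Cauchy_Schwarz:
  assumes f: "f \<in> L2 M" and g: "g \<in> L2 M"
  shows "\<bar>\<integral>x. f x * g x \<partial>M\<bar> \<le> sqrt (L2sq M f) * sqrt (L2sq M g)"
proof -
  define p where "p = (\<integral>x. f x * g x \<partial>M)"
  have *: "0 \<le> a^2 * L2sq M f + 2 * a * b * p + b^2 * L2sq M g" for a b
    using L2sq_lincomb[OF f g, of a b] L2sq_nonneg[of M "\<lambda>x. a * f x + b * g x"] by (simp add: p_def)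
  have "p^2 \<le> L2sq M f * L2sq M g"
  proof (cases "L2sq M f = 0")
    case True
    show ?thesis
    proof (rule ccontr)
      assume "\<not> p\<^sup>2 \<le> L2sq M f * L2sq M g"
      then have "p \<noteq> 0" using True by auto
      \<comment> \<open>When \<open>L2sq M f\<close> is 0 the quadratic form in \<open>*\<close> is
        affine in \<open>a\<close>, and this value of \<open>a\<close> makes it equal to
        \<open>- L2sq M g - 2\<close>.\<close>
      with *[of "- (L2sq M g + 1) / p" 1] True L2sq_nonneg[of M g] show False by simp
    qed
  next
    case False
    then have pos: "L2sq M f > 0" using L2sq_nonneg[of M f] by linarith
    have "0 \<le> L2sq M f * (L2sq M f * L2sq M g - p\<^sup>2)"
      using *[of "-p" "L2sq M f"] by (simp add: power2_eq_square algebra_simps)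
    then show ?thesis using pos by (simp add: zero_le_mult_iff)
  qed
  then have "\<bar>p\<bar> \<le> sqrt (L2sq M f * L2sq M g)"
    using real_le_rsqrt[of "\<bar>p\<bar>"] by simp
  then show ?thesis by (simp add: real_sqrt_mult p_def)
qed

lemma L2_tendsto_ip:
  assumes F: "\<And>n. F n \<in> L2 M" and f: "f \<in> L2 M" and h: "h \<in> L2 M"
    and lim: "(\<lambda>n. L2sq M (\<lambda>x. F n x - f x)) \<longlonglongrightarrow> 0"
  shows "(\<lambda>n. \<integral>x. F n x * h x \<partial>M) \<longlonglongrightarrow> (\<integral>x. f x * h x \<partial>M)"
proof -
  have eq: "(\<integral>x. F n x * h x \<partial>M) - (\<integral>x. f x * h x \<partial>M) = (\<integral>x. (F n x - f x) * h x \<partial>M)" for n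
    using L2_mult_integrable[OF F h] L2_mult_integrable[OF f h] by (simp add: left_diff_distrib)
  have "(\<lambda>n. sqrt (L2sq M (\<lambda>x. F n x - f x)) * sqrt (L2sq M h)) \<longlonglongrightarrow> 0"
    using tendsto_mult[OF tendsto_real_sqrt[OF lim] tendsto_const, of "sqrt (L2sq M h)"] by simp
  then have "(\<lambda>n. (\<integral>x. F n x * h x \<partial>M) - (\<integral>x. f x * h x \<partial>M)) \<longlonglongrightarrow> 0"
    by (rule Lim_null_comparison[rotated])
      (auto simp: eq intro!: always_eventually L2_Cauchy_Schwarz L2_diff F f h)
  then show ?thesis by (simp add: LIM_zero_iff)
qed

lemma L2sq_tendsto:
  assumes F: "\<And>n. F n \<in> L2 M" and f: "f \<in> L2 M"
    and lim: "(\<lambda>n. L2sq M (\<lambda>x. F n x - f x)) \<longlonglongrightarrow> 0"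
  shows "(\<lambda>n. L2sq M (F n)) \<longlonglongrightarrow> L2sq M f"
proof -
  have "L2sq M (F n) = L2sq M (\<lambda>x. F n x - f x) + 2 * (\<integral>x. (F n x - f x) * f x \<partial>M) + L2sq M f" for n
    using L2sq_lincomb[OF L2_diff[OF F f] f, of 1 n 1] by simp
  moreover have "(\<lambda>n. \<integral>x. (F n x - f x) * f x \<partial>M) \<longlonglongrightarrow> (\<integral>x. 0 * f x \<partial>M)"
    by (rule L2_tendsto_ip[OF L2_diff[OF F f] _ f]) (use lim in \<open>auto simp: L2_def\<close>)
  ultimately show ?thesis
    using tendsto_add[OF tendsto_add[OF lim tendsto_mult_left[of _ 0 _ 2]] tendsto_const, of "\<lambda>n. \<integral>x. (F n x - f x) * f x \<partial>M" "L2sq M f"]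
    by simp
qed

lemma nn_integral_L2sq:
  assumes "f \<in> L2 M" shows "(\<integral>\<^sup>+x. ennreal ((f x)^2) \<partial>M) = ennreal (L2sq M f)"
  unfolding L2sq_def using assms by (intro nn_integral_eq_integral) auto

lemma L2norm_eq: "f \<in> L2 M \<Longrightarrow> L2norm M f = ennreal (sqrt (L2sq M f))"
  by (simp add: L2norm_def nn_integral_L2sq esqrt_ennreal)

lemma L2_tendsto_iff:
  assumes F: "\<And>n. F n \<in> L2 M" and f: "f \<in> L2 M"
  shows "L2_tendsto M F f \<longleftrightarrow> (\<lambda>n. L2sq M (\<lambda>x. F n x - f x)) \<longlonglongrightarrow> 0"
proof -
  have "L2_tendsto M F f \<longleftrightarrow> (\<lambda>n. ennreal (sqrt (L2sq M (\<lambda>x. F n x - f x)))) \<longlonglongrightarrow> ennreal 0"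
    unfolding L2_tendsto_def using L2norm_eq[OF L2_diff[OF F f]] by simp
  also have "\<dots> \<longleftrightarrow> (\<lambda>n. sqrt (L2sq M (\<lambda>x. F n x - f x))) \<longlonglongrightarrow> 0"
    by (rule tendsto_ennreal_iff) auto
  also have "\<dots> \<longleftrightarrow> (\<lambda>n. L2sq M (\<lambda>x. F n x - f x)) \<longlonglongrightarrow> 0"
    using tendsto_real_sqrt[of "\<lambda>n. L2sq M (\<lambda>x. F n x - f x)" 0 sequentially]
      tendsto_power[of "\<lambda>n. sqrt (L2sq M (\<lambda>x. F n x - f x))" 0 sequentially 2] by auto
  finally show ?thesis .
qed

text \<open>Riesz--Fischer: a subsequence whose increments have squared norm below
  \<open>(1/4)^k\<close> converges almost everywhere, and Fatou's lemma turns the Cauchy property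
  into convergence in norm.\<close>

lemma (in finite_measure) L2_complete:
  assumes F: "\<And>n. F n \<in> L2 M"
    and Cau: "\<And>e. 0 < e \<Longrightarrow> \<exists>N. \<forall>m\<ge>N. \<forall>n\<ge>N. L2sq M (\<lambda>x. F m x - F n x) < e"
  shows "\<exists>f\<in>L2 M. (\<lambda>n. L2sq M (\<lambda>x. F n x - f x)) \<longlonglongrightarrow> 0"
proof -
  have [measurable]: "F n \<in> borel_measurable M" for n using F by auto
  obtain N where N: "\<And>k m n. N k \<le> m \<Longrightarrow> N k \<le> n \<Longrightarrow> L2sq M (\<lambda>x. F m x - F n x) < (1/4)^k"
    using Cau[of "(1/4)^k" for k] by (metis zero_less_divide_1_iff zero_less_numeral zero_less_power)
  define r where "r k = (\<Sum>i\<le>k. N i)" for k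
  have r: "N k \<le> r k" "N k \<le> r (Suc k)" for k
    unfolding r_def by (auto intro: member_le_sum trans_le_add1)
  define D where "D k x = F (r (Suc k)) x - F (r k) x" for k x
  have D: "D k \<in> L2 M" for k unfolding D_def by (intro L2_diff F)
  have [measurable]: "D k \<in> borel_measurable M" for k using D by auto
  have Dq: "L2sq M (D k) < (1/4)^k" for k unfolding D_def by (intro N r)
  define V where "V = measure M (space M)"
  have "(\<integral>\<^sup>+x. ennreal \<bar>D k x\<bar> \<partial>M) \<le> ennreal ((V + 1) * (1/2)^k)" for k
  proof -
    \<comment> \<open>Splitting at the height \<open>(1/2)^k\<close> bounds the integral of the
      increment by means of its squared norm; with \<open>Dq\<close> both terms are of order
      \<open>(1/2)^k\<close>, so the increments are absolutely summable in the mean.\<close>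
    have bd: "\<bar>D k x\<bar> \<le> (1/2)^k + 2^k * (D k x)^2" for x
    proof (cases "\<bar>D k x\<bar> \<le> (1/2)^k")
      case False
      then have "1 \<le> 2^k * \<bar>D k x\<bar>" by (simp add: field_simps power_one_over)
      then have "1 * \<bar>D k x\<bar> \<le> (2^k * \<bar>D k x\<bar>) * \<bar>D k x\<bar>" by (rule mult_right_mono) auto
      then show ?thesis by (simp add: power2_eq_square mult.assoc add_increasing)
    qed (simp add: add_increasing2)
    have "(\<integral>\<^sup>+x. ennreal \<bar>D k x\<bar> \<partial>M) \<le> (\<integral>\<^sup>+x. ennreal ((1/2)^k + 2^k * (D k x)^2) \<partial>M)"
      by (intro nn_integral_mono ennreal_leI bd)
    also have "\<dots> = ennreal (\<integral>x. (1/2)^k + 2^k * (D k x)^2 \<partial>M)"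
      using L2D(2)[OF D] by (intro nn_integral_eq_integral) auto
    also have "(\<integral>x. (1/2)^k + 2^k * (D k x)^2 \<partial>M) = (1/2)^k * V + 2^k * L2sq M (D k)"
      using L2D(2)[OF D] by (simp add: L2sq_def V_def)
    also have "\<dots> \<le> (1/2)^k * V + 2^k * (1/4)^k" using Dq[of k] by (intro add_left_mono mult_left_mono) auto
    also have "\<dots> = (V + 1) * (1/2)^k" by (simp add: algebra_simps flip: power_mult_distrib)
    finally show ?thesis by (simp add: ennreal_leI)
  qed
  then have "(\<Sum>k. \<integral>\<^sup>+x. ennreal \<bar>D k x\<bar> \<partial>M) \<le> (\<Sum>k. ennreal ((V + 1) * (1/2)^k))"
    by (intro suminf_le) auto
  also have "\<dots> = ennreal (\<Sum>k. (V + 1) * (1/2)^k)"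
    by (intro suminf_ennreal2) (auto simp: V_def intro!: summable_mult)
  also have "\<dots> < top" by simp
  finally have "(\<integral>\<^sup>+x. (\<Sum>k. ennreal \<bar>D k x\<bar>) \<partial>M) < top" by (simp add: nn_integral_suminf)
  then have "AE x in M. (\<Sum>k. ennreal \<bar>D k x\<bar>) \<noteq> \<infinity>"
    by (intro nn_integral_PInf_AE) auto
  then have conv: "AE x in M. convergent (\<lambda>k. F (r k) x)"
  proof eventually_elim
    case (elim x)
    then have "summable (\<lambda>k. \<bar>D k x\<bar>)" by (intro summable_suminf_not_top) auto
    then have "summable (\<lambda>k. D k x)" by (rule summable_rabs_cancel)
    then have "convergent (\<lambda>n. \<Sum>k<n. D k x)" by (simp add: summable_iff_convergent)
    moreover have "(\<Sum>k<n. D k x) = F (r n) x - F (r 0) x" for n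
      unfolding D_def by (rule sum_lessThan_telescope)
    ultimately show ?case
      using convergent_diff_const_right_iff by force
  qed
  define f where "f x = lim (\<lambda>k. F (r k) x)" for x
  have [measurable]: "f \<in> borel_measurable M" unfolding f_def by measurable
  have lim: "AE x in M. (\<lambda>k. F (r k) x) \<longlonglongrightarrow> f x"
    using conv by eventually_elim (simp add: f_def convergent_LIMSEQ_iff)
  have key: "(\<integral>\<^sup>+x. ennreal ((F n x - f x)^2) \<partial>M) \<le> ennreal ((1/4)^k)" if n: "N k \<le> n" for k n
  proof -
    have "(\<integral>\<^sup>+x. ennreal ((F n x - f x)^2) \<partial>M) = (\<integral>\<^sup>+x. liminf (\<lambda>j. ennreal ((F n x - F (r j) x)^2)) \<partial>M)"
    proof (rule nn_integral_cong_AE)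
      show "AE x in M. ennreal ((F n x - f x)^2) = liminf (\<lambda>j. ennreal ((F n x - F (r j) x)^2))"
        using lim
      proof eventually_elim
        case (elim x)
        have "(\<lambda>j. ennreal ((F n x - F (r j) x)^2)) \<longlonglongrightarrow> ennreal ((F n x - f x)^2)"
          by (intro tendsto_ennrealI tendsto_intros elim)
        then show ?case by (rule lim_imp_Liminf[OF sequentially_bot, symmetric])
      qed
    qed
    also have "\<dots> \<le> liminf (\<lambda>j. \<integral>\<^sup>+x. ennreal ((F n x - F (r j) x)^2) \<partial>M)"
      by (rule nn_integral_liminf) auto
    also have "\<dots> \<le> limsup (\<lambda>j. \<integral>\<^sup>+x. ennreal ((F n x - F (r j) x)^2) \<partial>M)"
      by (rule Liminf_le_Limsup) simp
    also have "\<dots> \<le> ennreal ((1/4)^k)"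
    proof (rule Limsup_bounded)
      show "\<forall>\<^sub>F j in sequentially. (\<integral>\<^sup>+x. ennreal ((F n x - F (r j) x)^2) \<partial>M) \<le> ennreal ((1/4)^k)"
        using eventually_ge_at_top[of k]
      proof eventually_elim
        case (elim j)
        have "N k \<le> r j" using elim unfolding r_def by (intro member_le_sum) auto
        then have "L2sq M (\<lambda>x. F n x - F (r j) x) < (1/4)^k" by (intro N n)
        then show ?case using nn_integral_L2sq[OF L2_diff[OF F F], of n "r j"] by (simp add: ennreal_leI)
      qed
    qed
    finally show ?thesis .
  qed
  have dif: "(\<lambda>x. F (N 0) x - f x) \<in> L2 M"
    using key[of 0 "N 0"] by (auto simp: L2_def integrable_iff_bounded intro: le_less_trans)
  have f: "f \<in> L2 M" using L2_diff[OF F dif, of "N 0"] by simp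
  have "(\<lambda>n. L2sq M (\<lambda>x. F n x - f x)) \<longlonglongrightarrow> 0"
  proof (rule LIMSEQ_I)
    fix e :: real assume "0 < e"
    then obtain k where k: "(1/4)^k < e" using real_arch_pow_inv[of e "1/4"] by auto
    show "\<exists>no. \<forall>n\<ge>no. norm (L2sq M (\<lambda>x. F n x - f x) - 0) < e"
    proof (intro exI allI impI)
      fix n assume "N k \<le> n"
      from key[OF this] have "L2sq M (\<lambda>x. F n x - f x) \<le> (1/4)^k"
        using nn_integral_L2sq[OF L2_diff[OF F f], of n] by simp
      then show "norm (L2sq M (\<lambda>x. F n x - f x) - 0) < e" using k by simp
    qed
  qed
  with f show ?thesis by blast
qed

section \<open>Nearest points and separation for convex sets of pairs\<close>

context finite_measure begin

text \<open>The projection argument for a decreasing sequence of midpoint-convex sets that may fail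
  to be closed. The midpoint of two near-minimizers of the norm competes in the larger of the two
  sets, so the parallelogram identity bounds their distance by the difference of their norms. The
  real coordinate serves the separation of points from epigraphs and is 0 where only slopes are
  minimized.\<close>

lemma near_minimizers_converge:
  fixes C :: "nat \<Rightarrow> (('a \<Rightarrow> real) \<times> real) set"
  assumes C: "\<And>n x b. (x, b) \<in> C n \<Longrightarrow> x \<in> L2 M"
    and dec: "\<And>m n. m \<le> n \<Longrightarrow> C n \<subseteq> C m"
    and mid: "\<And>n x a y b. (x, a) \<in> C n \<Longrightarrow> (y, b) \<in> C n \<Longrightarrow>
      ((\<lambda>z. (x z + y z) / 2), (a + b) / 2) \<in> C n"
    and X: "\<And>n. (X n, r n) \<in> C n"
    and near: "\<And>n x b. (x, b) \<in> C n \<Longrightarrow> L2sq M (X n) + (r n)^2 \<le> L2sq M x + b^2 + 1 / Suc n"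
    and bd: "\<And>n. L2sq M (X n) + (r n)^2 \<le> B"
  obtains v \<beta> where "v \<in> L2 M" "(\<lambda>n. L2sq M (\<lambda>x. X n x - v x)) \<longlonglongrightarrow> 0" "r \<longlonglongrightarrow> \<beta>"
proof -
  have XL: "X n \<in> L2 M" for n using C[OF X] .
  define a where "a n = L2sq M (X n) + (r n)^2" for n
  have a_le: "a n \<le> a m + 1 / Suc n" if "n \<le> m" for m n
    using near[of "X m" "r m" n] X[of m] dec[OF that] by (auto simp: a_def)
  have a0: "0 \<le> a n" for n by (simp add: a_def)
  have dist: "L2sq M (\<lambda>x. X n x - X m x) + (r n - r m)^2 \<le> 2 * (a m - a n) + 4 / Suc n"
    if "n \<le> m" for m n
  proof -
    have "((\<lambda>z. (X n z + X m z) / 2), (r n + r m) / 2) \<in> C n"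
      using X[of n] X[of m] dec[OF that] by (intro mid) auto
    from near[OF this]
    have "a n \<le> L2sq M (\<lambda>z. 1/2 * X n z + 1/2 * X m z) + ((r n + r m) / 2)^2 + 1 / Suc n"
      by (simp add: a_def add_divide_distrib)
    moreover have "L2sq M (\<lambda>z. 1/2 * X n z + 1/2 * X m z)
        = L2sq M (X n) / 4 + (\<integral>x. X n x * X m x \<partial>M) / 2 + L2sq M (X m) / 4"
      using L2sq_lincomb[OF XL XL, of "1/2" n "1/2" m] by (simp add: power2_eq_square)
    moreover have "L2sq M (\<lambda>x. X n x - X m x)
        = L2sq M (X n) - 2 * (\<integral>x. X n x * X m x \<partial>M) + L2sq M (X m)"
      using L2sq_lincomb[OF XL XL, of 1 n "-1" m] by simp
    moreover have "((r n + r m) / 2)^2 = (r n)^2/4 + r n * r m / 2 + (r m)^2/4"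
      by (simp add: power2_eq_square field_simps)
    moreover have "(r n - r m)^2 = (r n)^2 - 2 * (r n * r m) + (r m)^2"
      by (simp add: power2_eq_square algebra_simps)
    ultimately show ?thesis by (simp add: a_def)
  qed
  have "Cauchy a"
  proof -
    \<comment> \<open>The infima over tails increase and are bounded, and \<open>a n\<close> exceeds
      the infimum of its own tail by at most \<open>1 / Suc n\<close>. This makes \<open>a\<close>
      converge although it need not be monotone.\<close>
    define b where "b n = Inf (a ` {n..})" for n
    have bb: "bdd_below (a ` S)" for S using a0 by (auto intro: bdd_belowI[of _ 0])
    have b1: "b n \<le> a n" for n unfolding b_def by (intro cInf_lower bb) auto
    have b2: "a n - 1 / Suc n \<le> b n" for n unfolding b_def
    proof (rule cInf_greatest)
      fix y assume "y \<in> a ` {n..}"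
      then obtain m where "n \<le> m" "y = a m" by auto
      then show "a n - 1 / Suc n \<le> y" using a_le[of n m] by simp
    qed auto
    have "incseq b"
      unfolding incseq_def b_def by (auto intro!: cInf_superset_mono bb)
    moreover have "\<forall>n. b n \<le> B" using b1 bd by (auto simp: a_def intro: order_trans)
    ultimately obtain L where L: "b \<longlonglongrightarrow> L" using incseq_convergent by blast
    have "(\<lambda>n. b n + 1 / Suc n) \<longlonglongrightarrow> L + 0"
      by (intro tendsto_add L) (use LIMSEQ_inverse_real_of_nat in \<open>simp add: inverse_eq_divide\<close>)
    then have "(\<lambda>n. b n + 1 / Suc n) \<longlonglongrightarrow> L" by simp
    with L have "a \<longlonglongrightarrow> L"
      by (rule tendsto_sandwich[rotated 2]) (use b1 b2 in \<open>auto intro!: always_eventually simp: algebra_simps\<close>)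
    then show ?thesis by (rule LIMSEQ_imp_Cauchy)
  qed
  have Cau: "\<exists>N. \<forall>n\<ge>N. \<forall>m\<ge>n. L2sq M (\<lambda>x. X n x - X m x) + (r n - r m)^2 < e" if e: "0 < e" for e
  proof -
    obtain N1 where N1: "\<And>m n. N1 \<le> m \<Longrightarrow> N1 \<le> n \<Longrightarrow> \<bar>a m - a n\<bar> < e/4"
      using CauchyD[OF \<open>Cauchy a\<close>, of "e/4"] e unfolding real_norm_def by force
    obtain j where j: "1 / real (Suc j) < e/8" using e nat_approx_posE[of "e/8"] by auto
    show ?thesis
    proof (intro exI allI impI)
      fix n m assume n: "max N1 j \<le> n" and m: "n \<le> m"
      have "1 / real (Suc n) \<le> 1 / real (Suc j)" using n by (intro divide_left_mono) auto
      moreover have "\<bar>a m - a n\<bar> < e/4" using N1[of m n] n m by auto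
      then have "a m - a n < e/4" by linarith
      ultimately show "L2sq M (\<lambda>x. X n x - X m x) + (r n - r m)^2 < e"
        using dist[OF m] j by simp
    qed
  qed
  have "\<exists>f\<in>L2 M. (\<lambda>n. L2sq M (\<lambda>x. X n x - f x)) \<longlonglongrightarrow> 0"
  proof (rule L2_complete[OF XL])
    fix e :: real assume "0 < e"
    then obtain N where N: "\<And>n m. N \<le> n \<Longrightarrow> n \<le> m \<Longrightarrow> L2sq M (\<lambda>x. X n x - X m x) + (r n - r m)^2 < e"
      using Cau by meson
    show "\<exists>N. \<forall>m\<ge>N. \<forall>n\<ge>N. L2sq M (\<lambda>x. X m x - X n x) < e"
    proof (intro exI allI impI)
      fix m n assume "N \<le> m" "N \<le> n"
      then show "L2sq M (\<lambda>x. X m x - X n x) < e"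
        using N[of m n] N[of n m] L2sq_minus_commute[of M "X m" "X n"] zero_le_power2[of "r n - r m"]
          zero_le_power2[of "r m - r n"] by (cases "m \<le> n") linarith+
    qed
  qed
  moreover have "Cauchy r"
  proof (rule CauchyI)
    fix e :: real assume "0 < e"
    then obtain N where N: "\<And>n m. N \<le> n \<Longrightarrow> n \<le> m \<Longrightarrow> L2sq M (\<lambda>x. X n x - X m x) + (r n - r m)^2 < e^2"
      using Cau[of "e^2"] by (auto simp: power2_eq_square)
    have *: "\<bar>r n - r m\<bar> < e" if "N \<le> n" "n \<le> m" for n m
    proof -
      have "(r n - r m)^2 < e^2" using N[OF that] L2sq_nonneg[of M "\<lambda>x. X n x - X m x"] by linarith
      then show ?thesis using \<open>0 < e\<close> by (metis abs_less_iff abs_le_square_iff abs_of_pos linorder_not_le power2_abs)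
    qed
    show "\<exists>N. \<forall>m\<ge>N. \<forall>n\<ge>N. norm (r m - r n) < e"
    proof (intro exI allI impI)
      fix m n assume "N \<le> m" "N \<le> n"
      then show "norm (r m - r n) < e" using *[of m n] *[of n m] by (cases "m \<le> n") (auto simp: abs_minus_commute)
    qed
  qed
  then have "convergent r" by (simp add: Cauchy_convergent_iff)
  ultimately show ?thesis using that by (auto simp: convergent_def)
qed

text \<open>The direction \<open>(h, \<beta>)\<close> is the limit of elements of the translate of
  \<open>C\<close> by \<open>- (f, e)\<close> of nearly minimal norm. It may lie outside the
  translate, because \<open>C\<close> need not be closed, so the variational inequality is obtained
  from the approximants. The pairing with this direction is then at least the squared norm of the
  limit, hence at least \<open>\<delta>\<close>.\<close>

lemma L2_separation:
  fixes C :: "(('a \<Rightarrow> real) \<times> real) set"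
  assumes C: "\<And>x b. (x, b) \<in> C \<Longrightarrow> x \<in> L2 M"
    and cvx: "\<And>x a y b s. (x, a) \<in> C \<Longrightarrow> (y, b) \<in> C \<Longrightarrow> 0 < s \<Longrightarrow> s < 1 \<Longrightarrow>
      ((\<lambda>z. (1 - s) * x z + s * y z), (1 - s) * a + s * b) \<in> C"
    and ne: "C \<noteq> {}"
    and f: "f \<in> L2 M" and "0 < \<delta>"
    and away: "\<And>x b. (x, b) \<in> C \<Longrightarrow> \<delta> \<le> L2sq M (\<lambda>z. x z - f z) + (b - e)^2"
  obtains h \<beta> where "h \<in> L2 M"
    "\<And>x b. (x, b) \<in> C \<Longrightarrow> \<delta> \<le> (\<integral>z. (x z - f z) * h z \<partial>M) + (b - e) * \<beta>"
proof -
  define D where "D = (\<lambda>(x, b). ((\<lambda>z. x z - f z), b - e)) ` C"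
  have DL: "x \<in> L2 M" if "(x, b) \<in> D" for x b using that C f by (auto simp: D_def intro: L2_diff)
  have Dd: "\<delta> \<le> L2sq M x + b^2" if "(x, b) \<in> D" for x b using that away by (auto simp: D_def)
  have Dc: "((\<lambda>z. (1 - s) * x z + s * y z), (1 - s) * a + s * b) \<in> D"
    if "(x, a) \<in> D" "(y, b) \<in> D" "0 < s" "s < 1" for x a y b s
  proof -
    from that obtain x' a' y' b' where *: "(x', a') \<in> C" "(y', b') \<in> C"
      "x = (\<lambda>z. x' z - f z)" "a = a' - e" "y = (\<lambda>z. y' z - f z)" "b = b' - e"
      by (auto simp: D_def)
    show ?thesis unfolding D_def
      by (rule image_eqI[OF _ cvx[OF *(1,2) that(3,4)]]) (auto simp: * algebra_simps)
  qed
  define I where "I = Inf ((\<lambda>(x, b). L2sq M x + b^2) ` D)"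
  have bb: "bdd_below ((\<lambda>(x, b). L2sq M x + b^2) ` D)" by (rule bdd_belowI[of _ 0]) auto
  have "\<exists>p\<in>D. (\<lambda>(x, b). L2sq M x + b^2) p < I + 1 / Suc n" for n
  proof -
    have "I < I + 1 / Suc n" by simp
    moreover have "(\<lambda>(x, b). L2sq M x + b^2) ` D \<noteq> {}" using ne by (auto simp: D_def)
    ultimately show ?thesis using cInf_lessD[of "(\<lambda>(x, b). L2sq M x + b^2) ` D"] unfolding I_def by blast
  qed
  then obtain P where P: "\<And>n. P n \<in> D" "\<And>n. (\<lambda>(x, b). L2sq M x + b^2) (P n) < I + 1 / Suc n"
    by metis
  define X where "X n = fst (P n)" for n
  define r where "r n = snd (P n)" for n
  have XD: "(X n, r n) \<in> D" for n using P(1) by (simp add: X_def r_def)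
  have XI: "L2sq M (X n) + (r n)^2 < I + 1 / Suc n" for n using P(2)[of n] by (simp add: X_def r_def split_beta)
  have I_le: "I \<le> L2sq M x + b^2" if "(x, b) \<in> D" for x b
    unfolding I_def using cInf_lower[OF imageI[OF that] bb] by simp
  have XL: "X n \<in> L2 M" for n using DL[OF XD] .
  obtain v \<beta> where v: "v \<in> L2 M" "(\<lambda>n. L2sq M (\<lambda>x. X n x - v x)) \<longlonglongrightarrow> 0" "r \<longlonglongrightarrow> \<beta>"
  proof (rule near_minimizers_converge[of "\<lambda>_. D" X r "I + 1"])
    fix n x a y b assume "(x, a) \<in> D" "(y, b) \<in> D"
    from Dc[OF this, of "1/2"] show "((\<lambda>z. (x z + y z) / 2), (a + b) / 2) \<in> D"
      by (simp add: add_divide_distrib)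
  next
    fix n x b assume "(x, b) \<in> D"
    from I_le[OF this] XI[of n] show "L2sq M (X n) + (r n)^2 \<le> L2sq M x + b^2 + 1 / Suc n" by simp
  next
    fix n
    have "1 / real (Suc n) \<le> 1" by simp
    with XI[of n] show "L2sq M (X n) + (r n)^2 \<le> I + 1" by linarith
  qed (use DL XD in auto)
  have Xlim: "(\<lambda>n. L2sq M (X n)) \<longlonglongrightarrow> L2sq M v" by (rule L2sq_tendsto[OF XL v(1,2)])
  have rlim: "(\<lambda>n. (r n)^2) \<longlonglongrightarrow> \<beta>\<^sup>2" by (intro tendsto_intros v(3))
  have lim0: "(\<lambda>n. 1 / real (Suc n)) \<longlonglongrightarrow> 0"
    using LIMSEQ_inverse_real_of_nat by (simp add: inverse_eq_divide)
  have dv: "\<delta> \<le> L2sq M v + \<beta>^2"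
    by (rule LIMSEQ_le_const[OF tendsto_add[OF Xlim rlim]]) (use Dd[OF XD] in auto)
  have I_eq: "L2sq M v + \<beta>^2 \<le> I"
  proof (rule LIMSEQ_le[OF tendsto_add[OF Xlim rlim]])
    show "(\<lambda>n. I + 1 / real (Suc n)) \<longlonglongrightarrow> I" using tendsto_add[OF tendsto_const lim0, of I] by simp
    show "\<exists>N. \<forall>n\<ge>N. L2sq M (X n) + (r n)^2 \<le> I + 1 / real (Suc n)" using XI less_imp_le by blast
  qed
  have key: "L2sq M v + \<beta>^2 \<le> (\<integral>z. y z * v z \<partial>M) + b * \<beta>" if yb: "(y, b) \<in> D" for y b
  proof -
    have yL: "y \<in> L2 M" using DL[OF yb] .
    define p where "p = (\<integral>z. v z * y z \<partial>M) + b * \<beta>"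
    define V where "V = L2sq M v + \<beta>^2"
    define Y where "Y = L2sq M y + b^2"
    have q: "V \<le> (1 - s)^2 * V + 2 * (1 - s) * s * p + s^2 * Y" if s: "0 < s" "s < 1" for s
    proof (rule LIMSEQ_le_const)
      have "(\<lambda>n. (1 - s)^2 * (L2sq M (X n) + (r n)^2) + 2 * (1 - s) * s * ((\<integral>z. X n z * y z \<partial>M) + b * r n) + s^2 * Y)
         \<longlonglongrightarrow> (1 - s)^2 * V + 2 * (1 - s) * s * p + s^2 * Y"
        unfolding V_def p_def
        by (intro tendsto_intros Xlim rlim v(3) L2_tendsto_ip[OF XL v(1) yL v(2)])
      moreover have "L2sq M (\<lambda>z. (1 - s) * X n z + s * y z) + ((1 - s) * r n + s * b)^2
        = (1 - s)^2 * (L2sq M (X n) + (r n)^2) + 2 * (1 - s) * s * ((\<integral>z. X n z * y z \<partial>M) + b * r n) + s^2 * Y" for n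
        unfolding L2sq_lincomb[OF XL yL] Y_def by (simp add: power2_eq_square algebra_simps)
      ultimately show "(\<lambda>n. L2sq M (\<lambda>z. (1 - s) * X n z + s * y z) + ((1 - s) * r n + s * b)^2)
         \<longlonglongrightarrow> (1 - s)^2 * V + 2 * (1 - s) * s * p + s^2 * Y"
        by simp
      show "\<exists>N. \<forall>n\<ge>N. V \<le> L2sq M (\<lambda>z. (1 - s) * X n z + s * y z) + ((1 - s) * r n + s * b)^2"
        using I_eq I_le[OF Dc[OF XD yb s]] by (auto simp: V_def intro: order_trans)
    qed
    \<comment> \<open>The quadratic comparison along a segment, divided by \<open>s\<close>; letting
      \<open>s\<close> tend to 0 gives the variational inequality.\<close>
    have q': "(2 - s) * V \<le> 2 * (1 - s) * p + s * Y" if s: "0 < s" "s < 1" for s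
    proof -
      have "s * ((2 - s) * V) \<le> s * (2 * (1 - s) * p + s * Y)"
        using q[OF s] by (simp add: power2_eq_square algebra_simps)
      then show ?thesis using s by simp
    qed
    have t: "((\<lambda>s. (2 - s) * V) \<longlongrightarrow> (2 - 0) * V) (at_right 0)"
      "((\<lambda>s. 2 * (1 - s) * p + s * Y) \<longlongrightarrow> 2 * (1 - 0) * p + 0 * Y) (at_right 0)"
      by (intro tendsto_intros)+
    have "(2 - 0) * V \<le> 2 * (1 - 0) * p + 0 * Y"
      by (rule tendsto_le[OF _ t(2) t(1)]) (use q' in \<open>auto simp: eventually_at_right_less eventually_at_right[of 0 1] intro!: exI[of _ 1]\<close>)
    then show ?thesis by (simp add: V_def p_def mult.commute)
  qed
  show ?thesis
  proof (rule that[of v \<beta>])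
    fix x b assume "(x, b) \<in> C"
    then have "((\<lambda>z. x z - f z), b - e) \<in> D" by (force simp: D_def)
    from key[OF this] dv show "\<delta> \<le> (\<integral>z. (x z - f z) * v z \<partial>M) + (b - e) * \<beta>" by simp
  qed (use v in auto)
qed

end

section \<open>Bounded Lipschitz functions\<close>

text \<open>For \<open>L = 0\<close> the product \<open>ennreal L * \<infinity>\<close> is \<open>0\<close>; passing to \<open>L + 1\<close> shows that pairs at
  infinite distance impose no condition.\<close>

lemma Lip_b_iff:
  "f \<in> Lip_b d \<longleftrightarrow> (\<exists>C. \<forall>x. \<bar>f x\<bar> \<le> C) \<and> continuous_on UNIV f \<and>
     (\<exists>L\<ge>0. \<forall>x y. d x y < top \<longrightarrow> \<bar>f x - f y\<bar> \<le> L * enn2real (d x y))"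
proof -
  have "(\<exists>L\<ge>0. \<forall>x y. ennreal \<bar>f x - f y\<bar> \<le> ennreal L * d x y) \<longleftrightarrow>
    (\<exists>L\<ge>0. \<forall>x y. d x y < top \<longrightarrow> \<bar>f x - f y\<bar> \<le> L * enn2real (d x y))"
  proof safe
    fix L :: real assume L: "0 \<le> L" "\<forall>x y. ennreal \<bar>f x - f y\<bar> \<le> ennreal L * d x y"
    show "\<exists>L\<ge>0. \<forall>x y. d x y < top \<longrightarrow> \<bar>f x - f y\<bar> \<le> L * enn2real (d x y)"
    proof (intro exI[of _ L] conjI allI impI)
      fix x y assume "d x y < top"
      then have "d x y = ennreal (enn2real (d x y))" by simp
      then have "ennreal \<bar>f x - f y\<bar> \<le> ennreal (L * enn2real (d x y))"
        using L by (metis enn2real_nonneg ennreal_mult)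
      then show "\<bar>f x - f y\<bar> \<le> L * enn2real (d x y)" using L by simp
    qed (use L in auto)
  next
    fix L :: real assume L: "0 \<le> L" "\<forall>x y. d x y < top \<longrightarrow> \<bar>f x - f y\<bar> \<le> L * enn2real (d x y)"
    show "\<exists>L\<ge>0. \<forall>x y. ennreal \<bar>f x - f y\<bar> \<le> ennreal L * d x y"
    proof (intro exI[of _ "L + 1"] conjI allI)
      fix x y
      show "ennreal \<bar>f x - f y\<bar> \<le> ennreal (L + 1) * d x y"
      proof (cases "d x y < top")
        case True
        then have eq: "d x y = ennreal (enn2real (d x y))" by simp
        have "\<bar>f x - f y\<bar> \<le> (L + 1) * enn2real (d x y)"
          using L True by (auto simp: algebra_simps intro: add_increasing)
        then have "ennreal \<bar>f x - f y\<bar> \<le> ennreal (L + 1) * ennreal (enn2real (d x y))"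
          using L by (subst ennreal_mult[symmetric]) (auto intro: ennreal_leI)
        then show ?thesis using eq by simp
      next
        case False
        then have "ennreal (L + 1) * d x y = top" using L by (auto simp: ennreal_mult_top less_top[symmetric])
        then show ?thesis by simp
      qed
    qed (use L in auto)
  qed
  moreover have "bounded (range f) \<longleftrightarrow> (\<exists>C. \<forall>x. \<bar>f x\<bar> \<le> C)" by (auto simp: bounded_iff)
  ultimately show ?thesis unfolding Lip_b_def by auto
qed

lemma Lip_bI:
  assumes "\<And>x. \<bar>f x\<bar> \<le> C" "continuous_on UNIV f" "0 \<le> L"
    "\<And>x y. d x y < top \<Longrightarrow> \<bar>f x - f y\<bar> \<le> L * enn2real (d x y)"
  shows "f \<in> Lip_b d"
  unfolding Lip_b_iff using assms by blast

lemma Lip_bE: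
  assumes "f \<in> Lip_b d"
  obtains C L where "0 \<le> C" "\<And>x. \<bar>f x\<bar> \<le> C" "continuous_on UNIV f" "0 \<le> L"
    "\<And>x y. d x y < top \<Longrightarrow> \<bar>f x - f y\<bar> \<le> L * enn2real (d x y)"
proof -
  from assms obtain C L where *: "\<And>x. \<bar>f x\<bar> \<le> C" "continuous_on UNIV f" "0 \<le> L"
    "\<And>x y. d x y < top \<Longrightarrow> \<bar>f x - f y\<bar> \<le> L * enn2real (d x y)"
    unfolding Lip_b_iff by blast
  have "0 \<le> C" using *(1)[of undefined] abs_ge_zero order_trans by blast
  with * show ?thesis using that by blast
qed

lemma Lip_b_const: "(\<lambda>_. c) \<in> Lip_b d"
  by (rule Lip_bI[where C = "\<bar>c\<bar>" and L = 0]) auto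

text \<open>Both functions are bounded, so a Lipschitz constant of \<open>\<phi>\<close> on bounded
  sets is enough; this covers products.\<close>

lemma Lip_b_compose2:
  fixes \<phi> :: "real \<Rightarrow> real \<Rightarrow> real"
  assumes f: "f \<in> Lip_b d" and g: "g \<in> Lip_b d"
    and cont: "continuous_on UNIV (\<lambda>(a, b). \<phi> a b)"
    and lip: "\<And>C. \<exists>K\<ge>0. \<forall>a b a' b'. \<bar>a\<bar> \<le> C \<and> \<bar>b\<bar> \<le> C \<and> \<bar>a'\<bar> \<le> C \<and> \<bar>b'\<bar> \<le> C \<longrightarrow>
      \<bar>\<phi> a b - \<phi> a' b'\<bar> \<le> K * (\<bar>a - a'\<bar> + \<bar>b - b'\<bar>)"
  shows "(\<lambda>x. \<phi> (f x) (g x)) \<in> Lip_b d"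
proof -
  obtain C1 L1 where 1: "0 \<le> C1" "\<And>x. \<bar>f x\<bar> \<le> C1" "continuous_on UNIV f" "0 \<le> L1"
    "\<And>x y. d x y < top \<Longrightarrow> \<bar>f x - f y\<bar> \<le> L1 * enn2real (d x y)" using f by (rule Lip_bE) blast
  obtain C2 L2 where 2: "0 \<le> C2" "\<And>x. \<bar>g x\<bar> \<le> C2" "continuous_on UNIV g" "0 \<le> L2"
    "\<And>x y. d x y < top \<Longrightarrow> \<bar>g x - g y\<bar> \<le> L2 * enn2real (d x y)" using g by (rule Lip_bE) blast
  obtain K where K: "0 \<le> K" "\<And>a b a' b'. \<bar>a\<bar> \<le> max C1 C2 \<Longrightarrow> \<bar>b\<bar> \<le> max C1 C2 \<Longrightarrow> \<bar>a'\<bar> \<le> max C1 C2 \<Longrightarrow>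
      \<bar>b'\<bar> \<le> max C1 C2 \<Longrightarrow> \<bar>\<phi> a b - \<phi> a' b'\<bar> \<le> K * (\<bar>a - a'\<bar> + \<bar>b - b'\<bar>)"
    using lip[of "max C1 C2"] by blast
  have fb: "\<bar>f x\<bar> \<le> max C1 C2" "\<bar>g x\<bar> \<le> max C1 C2" for x using 1(2) 2(2) by (auto simp: le_max_iff_disj)
  show ?thesis
  proof (rule Lip_bI[where C = "K * (2 * max C1 C2) + \<bar>\<phi> 0 0\<bar>" and L = "K * (L1 + L2)"])
    fix x
    have "\<bar>\<phi> (f x) (g x) - \<phi> 0 0\<bar> \<le> K * (\<bar>f x - 0\<bar> + \<bar>g x - 0\<bar>)"
      by (rule K(2)) (use fb 1(1) in auto)
    also have "\<dots> \<le> K * (2 * max C1 C2)" using fb[of x] K(1) by (intro mult_left_mono) auto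
    finally show "\<bar>\<phi> (f x) (g x)\<bar> \<le> K * (2 * max C1 C2) + \<bar>\<phi> 0 0\<bar>" by linarith
  next
    show "continuous_on UNIV (\<lambda>x. \<phi> (f x) (g x))"
      using continuous_on_compose2[OF cont continuous_on_Pair[OF 1(3) 2(3)]] by simp
  next
    fix x y assume fin: "d x y < top"
    have "\<bar>\<phi> (f x) (g x) - \<phi> (f y) (g y)\<bar> \<le> K * (\<bar>f x - f y\<bar> + \<bar>g x - g y\<bar>)"
      by (rule K(2)) (use fb in auto)
    also have "\<dots> \<le> K * (L1 * enn2real (d x y) + L2 * enn2real (d x y))"
      using 1(5)[OF fin] 2(5)[OF fin] K(1) by (intro mult_left_mono add_mono) auto
    finally show "\<bar>\<phi> (f x) (g x) - \<phi> (f y) (g y)\<bar> \<le> K * (L1 + L2) * enn2real (d x y)"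
      by (simp add: algebra_simps)
  qed (use K 1 2 in auto)
qed

lemma Lip_b_add:
  assumes "f \<in> Lip_b d" "g \<in> Lip_b d" shows "(\<lambda>x. f x + g x) \<in> Lip_b d"
proof (rule Lip_b_compose2[OF assms, where \<phi> = "(+)"])
  fix C :: real
  have *: "\<bar>a + b - (a' + b')\<bar> \<le> 1 * (p + q)"
    if "a - a' \<le> p" "a' - a \<le> p" "b - b' \<le> q" "b' - b \<le> q" for a b a' b' p q :: real
    using that by (auto simp: max_def min_def abs_le_iff)
  have "\<bar>a + b - (a' + b')\<bar> \<le> 1 * (\<bar>a - a'\<bar> + \<bar>b - b'\<bar>)" for a b a' b' :: real
    by (rule *) simp_all
  then show "\<exists>K\<ge>0. \<forall>a b a' b'. \<bar>a\<bar> \<le> C \<and> \<bar>b\<bar> \<le> C \<and> \<bar>a'\<bar> \<le> C \<and> \<bar>b'\<bar> \<le> C \<longrightarrow>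
      \<bar>a + b - (a' + b')\<bar> \<le> K * (\<bar>a - a'\<bar> + \<bar>b - b'\<bar>)"
    using zero_le_one by blast
qed (simp add: split_beta, intro continuous_intros)

lemma Lip_b_mult:
  assumes "f \<in> Lip_b d" "g \<in> Lip_b d" shows "(\<lambda>x. f x * g x) \<in> Lip_b d"
proof (rule Lip_b_compose2[OF assms, where \<phi> = "(*)"])
  fix C :: real
  show "\<exists>K\<ge>0. \<forall>a b a' b'. \<bar>a\<bar> \<le> C \<and> \<bar>b\<bar> \<le> C \<and> \<bar>a'\<bar> \<le> C \<and> \<bar>b'\<bar> \<le> C \<longrightarrow>
      \<bar>a * b - a' * b'\<bar> \<le> K * (\<bar>a - a'\<bar> + \<bar>b - b'\<bar>)"
  proof (intro exI[of _ "\<bar>C\<bar>"] conjI allI impI)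
    fix a b a' b' :: real assume *: "\<bar>a\<bar> \<le> C \<and> \<bar>b\<bar> \<le> C \<and> \<bar>a'\<bar> \<le> C \<and> \<bar>b'\<bar> \<le> C"
    have "a * b - a' * b' = (a - a') * b + a' * (b - b')" by (simp add: algebra_simps)
    then have "\<bar>a * b - a' * b'\<bar> \<le> \<bar>a - a'\<bar> * \<bar>b\<bar> + \<bar>a'\<bar> * \<bar>b - b'\<bar>"
      by (metis abs_mult abs_triangle_ineq)
    also have "\<dots> \<le> \<bar>a - a'\<bar> * \<bar>C\<bar> + \<bar>C\<bar> * \<bar>b - b'\<bar>"
      using * by (intro add_mono mult_left_mono mult_right_mono) auto
    finally show "\<bar>a * b - a' * b'\<bar> \<le> \<bar>C\<bar> * (\<bar>a - a'\<bar> + \<bar>b - b'\<bar>)" by (simp add: algebra_simps)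
  qed auto
qed (simp add: split_beta, intro continuous_intros)

lemma Lip_b_cmult: "f \<in> Lip_b d \<Longrightarrow> (\<lambda>x. c * f x) \<in> Lip_b d"
  by (rule Lip_b_mult[OF Lip_b_const])

lemma Lip_b_max:
  assumes "f \<in> Lip_b d" "g \<in> Lip_b d" shows "(\<lambda>x. max (f x) (g x)) \<in> Lip_b d"
proof (rule Lip_b_compose2[OF assms, where \<phi> = "max"])
  fix C :: real
  have *: "\<bar>max a b - max a' b'\<bar> \<le> 1 * (p + q)"
    if "a - a' \<le> p" "a' - a \<le> p" "b - b' \<le> q" "b' - b \<le> q" for a b a' b' p q :: real
    using that by (auto simp: max_def min_def abs_le_iff)
  have "\<bar>max a b - max a' b'\<bar> \<le> 1 * (\<bar>a - a'\<bar> + \<bar>b - b'\<bar>)" for a b a' b' :: real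
    by (rule *) simp_all
  then show "\<exists>K\<ge>0. \<forall>a b a' b'. \<bar>a\<bar> \<le> C \<and> \<bar>b\<bar> \<le> C \<and> \<bar>a'\<bar> \<le> C \<and> \<bar>b'\<bar> \<le> C \<longrightarrow>
      \<bar>max a b - max a' b'\<bar> \<le> K * (\<bar>a - a'\<bar> + \<bar>b - b'\<bar>)"
    using zero_le_one by blast
qed (simp add: split_beta, intro continuous_intros)

lemma Lip_b_min:
  assumes "f \<in> Lip_b d" "g \<in> Lip_b d" shows "(\<lambda>x. min (f x) (g x)) \<in> Lip_b d"
proof (rule Lip_b_compose2[OF assms, where \<phi> = "min"])
  fix C :: real
  have *: "\<bar>min a b - min a' b'\<bar> \<le> 1 * (p + q)"
    if "a - a' \<le> p" "a' - a \<le> p" "b - b' \<le> q" "b' - b \<le> q" for a b a' b' p q :: real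
    using that by (auto simp: max_def min_def abs_le_iff)
  have "\<bar>min a b - min a' b'\<bar> \<le> 1 * (\<bar>a - a'\<bar> + \<bar>b - b'\<bar>)" for a b a' b' :: real
    by (rule *) simp_all
  then show "\<exists>K\<ge>0. \<forall>a b a' b'. \<bar>a\<bar> \<le> C \<and> \<bar>b\<bar> \<le> C \<and> \<bar>a'\<bar> \<le> C \<and> \<bar>b'\<bar> \<le> C \<longrightarrow>
      \<bar>min a b - min a' b'\<bar> \<le> K * (\<bar>a - a'\<bar> + \<bar>b - b'\<bar>)"
    using zero_le_one by blast
qed (simp add: split_beta, intro continuous_intros)

lemma Lip_b_sum: "(\<And>i. i \<in> I \<Longrightarrow> f i \<in> Lip_b d) \<Longrightarrow> (\<lambda>x. \<Sum>i\<in>I. f i x) \<in> Lip_b d"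
  by (induction I rule: infinite_finite_induct) (auto intro: Lip_b_const Lip_b_add)

lemma Lip_b_lincomb: "f \<in> Lip_b d \<Longrightarrow> g \<in> Lip_b d \<Longrightarrow> (\<lambda>x. a * f x + b * g x) \<in> Lip_b d"
  by (intro Lip_b_add Lip_b_cmult)

section \<open>Abundance of bounded Lipschitz functions\<close>

locale ext_mm_space =
  fixes d :: "'a::t2_space \<Rightarrow> 'a \<Rightarrow> ennreal" and m :: "'a measure"
  assumes emms: "ext_metric_measure_space d m"
begin

lemma d_refl [simp]: "d x x = 0"
  and d_sym: "d x y = d y x"
  and d_triangle: "d x z \<le> d x y + d y z"
  and d_eq_0: "d x y = 0 \<longleftrightarrow> x = y"
  and open_generated: "open = generate_topology {f -` V | f V. f \<in> Lip_b d \<and> open V}"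
  using emms unfolding ext_metric_measure_space_def ext_metric_topological_space_def
    ext_distance_def semidistance_def by metis+

lemma sets_m [measurable_cong, simp]: "sets m = sets borel"
  and inner_regular: "B \<in> sets borel \<Longrightarrow> emeasure m B = (SUP K\<in>{K. compact K \<and> K \<subseteq> B}. emeasure m K)"
  using emms unfolding ext_metric_measure_space_def radon_prob_def by blast+

lemma space_m [simp]: "space m = UNIV"
  using sets_eq_imp_space_eq[OF sets_m] by simp

sublocale prob_space m
  using emms unfolding ext_metric_measure_space_def radon_prob_def by blast

lemma Lip_b_measurable: "f \<in> Lip_b d \<Longrightarrow> f \<in> borel_measurable m"
  by (subst measurable_cong_sets[OF sets_m refl]) (auto simp: Lip_b_def intro: borel_measurable_continuous_onI)

lemma Lip_b_L2: "f \<in> Lip_b d \<Longrightarrow> f \<in> L2 m"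
  by (rule Lip_bE, assumption, rule L2_bounded) (auto intro: Lip_b_measurable)

text \<open>This is where the axiom that the topology is generated by \<open>Lip_b d\<close> enters,
  by induction on the generation of \<open>U\<close>. All later approximation by Lipschitz functions
  rests on it.\<close>

lemma Lip_b_bump:
  assumes "open U" "x \<in> U"
  shows "\<exists>h\<in>Lip_b d. (\<forall>y. 0 \<le> h y \<and> h y \<le> 1) \<and> h x = 1 \<and> (\<forall>y. y \<notin> U \<longrightarrow> h y = 0)"
proof -
  have "generate_topology {f -` V | f V. f \<in> Lip_b d \<and> open V} U" using assms(1) open_generated by metis
  then show ?thesis using assms(2)
  proof (induction U)
    case UNIV
    show ?case by (rule bexI[OF _ Lip_b_const[of 1]]) auto
  next
    case (Int A B)
    then obtain h k where "h \<in> Lip_b d" "\<forall>y. 0 \<le> h y \<and> h y \<le> 1" "h x = 1" "\<forall>y. y \<notin> A \<longrightarrow> h y = 0"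
      "k \<in> Lip_b d" "\<forall>y. 0 \<le> k y \<and> k y \<le> 1" "k x = 1" "\<forall>y. y \<notin> B \<longrightarrow> k y = 0" by auto
    then show ?case by (intro bexI[OF _ Lip_b_min[of h d k]]) (auto simp: min_def intro: order_antisym)
  next
    case (UN K)
    then obtain A where "A \<in> K" "x \<in> A" by auto
    with UN.IH[of A] show ?case by blast
  next
    case (Basis S)
    then obtain f V where f: "f \<in> Lip_b d" "open V" "S = f -` V" by auto
    then obtain e where e: "0 < e" "\<And>z. dist z (f x) < e \<Longrightarrow> z \<in> V"
      using Basis(2) unfolding open_dist by (metis vimageE)
    \<comment> \<open>The tent \<open>max 0 (1 - \<bar>f y - f x\<bar> / e)\<close>, with the
      absolute value expressed by a minimum of two affine functions of \<open>f\<close>.\<close>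
    define h where "h y = max 0 (min (1 + (1/e) * (f y - f x)) (1 + (- (1/e)) * (f y - f x)))" for y
    have g: "(\<lambda>y. f y + - f x) \<in> Lip_b d" by (intro Lip_b_add f Lip_b_const)
    have "h \<in> Lip_b d" unfolding h_def diff_conv_add_uminus
      by (intro Lip_b_max Lip_b_min Lip_b_add Lip_b_const Lip_b_cmult f)
    moreover have "h y = 0" if "y \<notin> S" for y
    proof -
      have "e \<le> \<bar>f y - f x\<bar>" using that f e(2)[of "f y"] by (force simp: dist_real_def)
      then have "1 \<le> (1/e) * (f y - f x) \<or> 1 \<le> - (1/e) * (f y - f x)"
        using e(1) by (auto simp: field_simps abs_if split: if_splits)
      then show ?thesis by (auto simp: h_def)
    qed
    moreover have "0 \<le> h y \<and> h y \<le> 1" for y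
    proof -
      have "0 \<le> (1/e) * (f y - f x) \<or> 0 \<le> - (1/e) * (f y - f x)" by auto
      then show ?thesis by (auto simp: h_def)
    qed
    moreover have "h x = 1" by (simp add: h_def)
    ultimately show ?case by blast
  qed
qed

text \<open>Bumps that exceed 1/2 near points of \<open>K\<close> are added up over a finite
  subcover, doubled and cut off at 1. All of them vanish on \<open>L\<close>, which is closed as a
  compact subset of a Hausdorff space.\<close>

lemma Lip_b_separates:
  assumes K: "compact K" and L: "compact L" and "K \<inter> L = {}"
  shows "\<exists>h\<in>Lip_b d. (\<forall>y. 0 \<le> h y \<and> h y \<le> 1) \<and> (\<forall>y\<in>K. h y = 1) \<and> (\<forall>y\<in>L. h y = 0)"
proof -
  have "open (- L)" using compact_imp_closed[OF L] by auto
  then have "\<forall>x\<in>K. \<exists>h. h \<in> Lip_b d \<and> (\<forall>y. 0 \<le> h y \<and> h y \<le> 1) \<and> h x = 1 \<and> (\<forall>y. y \<notin> - L \<longrightarrow> h y = 0)"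
    using Lip_b_bump[of "- L"] assms(3) by blast
  then obtain h where h: "\<And>x. x \<in> K \<Longrightarrow> h x \<in> Lip_b d" "\<And>x y. x \<in> K \<Longrightarrow> 0 \<le> h x y"
    "\<And>x. x \<in> K \<Longrightarrow> h x x = 1" "\<And>x y. x \<in> K \<Longrightarrow> y \<in> L \<Longrightarrow> h x y = 0"
    by (metis Compl_iff)
  have op: "open {y. 1/2 < h x y}" if "x \<in> K" for x
  proof -
    have "continuous_on UNIV (h x)" using h(1)[OF that] by (simp add: Lip_b_def)
    then show ?thesis by (intro open_Collect_less continuous_intros)
  qed
  obtain D where D: "D \<subseteq> K" "finite D" "K \<subseteq> (\<Union>x\<in>D. {y. 1/2 < h x y})"
    by (rule compactE_image[OF K, of K "\<lambda>x. {y. 1/2 < h x y}"]) (use op h(3) in \<open>auto simp: UN_iff\<close>)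
  define cut where "cut y = min 1 (2 * (\<Sum>x\<in>D. h x y))" for y
  have "cut \<in> Lip_b d" unfolding cut_def
    by (intro Lip_b_min Lip_b_const Lip_b_cmult Lip_b_sum h(1)) (use D in auto)
  moreover have "0 \<le> cut y \<and> cut y \<le> 1" for y using D h(2) by (auto simp: cut_def intro!: sum_nonneg)
  moreover have "cut y = 1" if y: "y \<in> K" for y
  proof -
    obtain x where x: "x \<in> D" "1/2 < h x y" using D(3) y by blast
    have "h x y \<le> (\<Sum>x\<in>D. h x y)" using D h(2) x by (intro member_le_sum) auto
    then show ?thesis using x by (auto simp: cut_def)
  qed
  moreover have "cut y = 0" if "y \<in> L" for y
    using D h(4)[OF _ that] by (auto simp: cut_def subset_iff)
  ultimately show ?thesis by blast
qed

lemma compact_exhaustion: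
  assumes B: "B \<in> sets borel"
  obtains K where "\<And>n. compact (K n)" "\<And>n. K n \<subseteq> B" "incseq K" "emeasure m (B - (\<Union>n. K n)) = 0"
proof -
  have "\<exists>K. compact K \<and> K \<subseteq> B \<and> emeasure m B \<le> emeasure m K + ennreal (1 / Suc n)" for n
  proof (rule ccontr)
    assume "\<not> ?thesis"
    then have *: "\<And>K. compact K \<Longrightarrow> K \<subseteq> B \<Longrightarrow> emeasure m K + ennreal (1 / Suc n) \<le> emeasure m B"
      by (meson linear)
    have "(SUP K\<in>{K. compact K \<and> K \<subseteq> B}. emeasure m K) + ennreal (1 / Suc n)
        = (SUP K\<in>{K. compact K \<and> K \<subseteq> B}. emeasure m K + ennreal (1 / Suc n))"
      by (subst ennreal_SUP_add_left) (auto intro: exI[of _ "{}"])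
    also have "\<dots> \<le> emeasure m B" by (rule SUP_least) (use * in auto)
    finally have "emeasure m B + ennreal (1 / Suc n) \<le> emeasure m B" using inner_regular[OF B] by simp
    then have "ennreal (1 / Suc n) \<le> 0"
      by (metis add.right_neutral emeasure_finite ennreal_add_left_cancel_le infinity_ennreal_def)
    then show False by simp
  qed
  then obtain J where J: "\<And>n. compact (J n)" "\<And>n. J n \<subseteq> B" "\<And>n. emeasure m B \<le> emeasure m (J n) + ennreal (1 / Suc n)"
    by metis
  define K where "K n = (\<Union>i\<le>n. J i)" for n
  have Jm: "J n \<in> sets borel" for n by (intro borel_closed compact_imp_closed J(1))
  show ?thesis
  proof (rule that[of K])
    show "compact (K n)" for n unfolding K_def using J(1) by (intro compact_UN) auto
    show "K n \<subseteq> B" for n using J(2) by (auto simp: K_def)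
    show "incseq K" unfolding incseq_def K_def by (intro allI impI UN_mono) auto
    have "emeasure m (B - (\<Union>n. K n)) \<le> ennreal (1 / Suc n)" for n
    proof -
      have "emeasure m (B - (\<Union>n. K n)) \<le> emeasure m (B - J n)"
        by (rule emeasure_mono) (auto simp: K_def Jm B)
      also have "\<dots> = emeasure m B - emeasure m (J n)"
        using J(2) Jm B by (intro emeasure_Diff) auto
      also have "\<dots> \<le> ennreal (1 / Suc n)" using J(3)[of n]
        by (simp add: ennreal_minus_le_iff add.commute)
      finally show ?thesis .
    qed
    moreover have "(\<lambda>n. ennreal (1 / Suc n)) \<longlonglongrightarrow> ennreal 0"
      using LIMSEQ_inverse_real_of_nat by (intro tendsto_ennrealI) (simp add: inverse_eq_divide)
    ultimately have "emeasure m (B - (\<Union>n. K n)) \<le> ennreal 0"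
      by (intro LIMSEQ_le_const) auto
    then show "emeasure m (B - (\<Union>n. K n)) = 0" by simp
  qed
qed

text \<open>Inner regularity is used for \<open>B\<close> and for its complement: functions that are
  1 on a compact part of \<open>B\<close> and 0 on a compact part of the complement converge almost
  everywhere once both parts exhaust.\<close>

lemma indicator_approx:
  assumes B: "B \<in> sets borel"
  obtains cut where "\<And>n::nat. cut n \<in> Lip_b d" "\<And>n y. 0 \<le> cut n y" "\<And>n y. cut n y \<le> 1"
    "AE y in m. (\<lambda>n. cut n y) \<longlonglongrightarrow> indicator B y"
proof -
  obtain K where K: "\<And>n. compact (K n)" "\<And>n. K n \<subseteq> B" "incseq K" "emeasure m (B - (\<Union>n. K n)) = 0"
    using compact_exhaustion[OF B] by blast
  have B': "- B \<in> sets borel" using B by auto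
  obtain L where L: "\<And>n. compact (L n)" "\<And>n. L n \<subseteq> - B" "incseq L" "emeasure m (- B - (\<Union>n. L n)) = 0"
    using compact_exhaustion[OF B'] by blast
  have "\<exists>h\<in>Lip_b d. (\<forall>y. 0 \<le> h y \<and> h y \<le> 1) \<and> (\<forall>y\<in>K n. h y = 1) \<and> (\<forall>y\<in>L n. h y = 0)" for n
    using K(2)[of n] L(2)[of n] by (intro Lip_b_separates K L) blast
  then obtain cut where cut: "\<And>n. cut n \<in> Lip_b d" "\<And>n y. 0 \<le> cut n y" "\<And>n y. cut n y \<le> 1"
    "\<And>n y. y \<in> K n \<Longrightarrow> cut n y = 1" "\<And>n y. y \<in> L n \<Longrightarrow> cut n y = 0" by metis
  have Km: "K n \<in> sets borel" "L n \<in> sets borel" for n by (intro borel_closed compact_imp_closed K(1) L(1))+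
  have "(B - (\<Union>n. K n)) \<in> null_sets m" "(- B - (\<Union>n. L n)) \<in> null_sets m"
    using K(4) L(4) Km B by (auto intro!: null_setsI)
  then have "AE y in m. y \<notin> B - (\<Union>n. K n)" "AE y in m. y \<notin> - B - (\<Union>n. L n)"
    by (auto dest: AE_not_in)
  then have "AE y in m. (\<lambda>n. cut n y) \<longlonglongrightarrow> indicator B y"
  proof eventually_elim
    case (elim y)
    show ?case
    proof (cases "y \<in> B")
      case True
      then obtain n where "y \<in> K n" using elim by auto
      then have "\<forall>\<^sub>F k in sequentially. cut k y = 1"
        unfolding eventually_sequentially using K(3) cut(4) unfolding incseq_def by blast
      then show ?thesis using True by (auto intro: tendsto_eventually)
    next
      case False
      then obtain n where "y \<in> L n" using elim by auto
      then have "\<forall>\<^sub>F k in sequentially. cut k y = 0"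
        unfolding eventually_sequentially using L(3) cut(5) unfolding incseq_def by blast
      then show ?thesis using False by (auto intro: tendsto_eventually)
    qed
  qed
  with cut(1-3) show ?thesis using that by blast
qed

text \<open>Approximating the indicator of the set where \<open>g\<close> is positive shows that the
  positive part of \<open>g\<close> has integral at most 0.\<close>

lemma AE_nonpos_if_Lip_b_tests:
  assumes g: "integrable m g"
    and test: "\<And>\<psi>. \<psi> \<in> Lip_b d \<Longrightarrow> (\<And>x. 0 \<le> \<psi> x) \<Longrightarrow> (\<integral>x. \<psi> x * g x \<partial>m) \<le> 0"
  shows "AE x in m. g x \<le> 0"
proof -
  have [measurable]: "g \<in> borel_measurable m" using g by auto
  define B where "B = {x. 0 < g x}"
  have "{x\<in>space m. 0 < g x} \<in> sets m" by measurable
  then have B[measurable]: "B \<in> sets borel" by (simp add: B_def)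
  obtain cut where cut: "\<And>n::nat. cut n \<in> Lip_b d" "\<And>n y. 0 \<le> cut n y" "\<And>n y. cut n y \<le> 1"
    "AE y in m. (\<lambda>n. cut n y) \<longlonglongrightarrow> indicator B y" using indicator_approx[OF B] by blast
  have [measurable]: "cut n \<in> borel_measurable m" for n using Lip_b_measurable cut by auto
  have "(\<lambda>n. \<integral>x. cut n x * g x \<partial>m) \<longlonglongrightarrow> (\<integral>x. indicator B x * g x \<partial>m)"
  proof (rule integral_dominated_convergence[where w = "\<lambda>x. norm (g x)"])
    show "AE x in m. (\<lambda>n. cut n x * g x) \<longlonglongrightarrow> indicator B x * g x"
      using cut(4) by eventually_elim (intro tendsto_intros)
    show "AE x in m. norm (cut n x * g x) \<le> norm (g x)" for n
      using cut(2,3) by (auto simp: abs_mult intro!: mult_left_le_one_le)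
  qed (use g in auto)
  then have "(\<integral>x. indicator B x * g x \<partial>m) \<le> 0"
    by (rule LIMSEQ_le_const2) (use test[OF cut(1,2)] in auto)
  moreover have "0 \<le> indicator B x * g x" for x by (auto simp: B_def indicator_def)
  ultimately have "(\<integral>x. indicator B x * g x \<partial>m) = 0"
    by (intro antisym) (auto intro: integral_nonneg_AE)
  then have "AE x in m. indicator B x * g x = 0"
    using \<open>\<And>x. 0 \<le> indicator B x * g x\<close> integrable_mult_indicator[OF _ g, of B]
    by (subst (asm) integral_nonneg_eq_0_iff_AE) auto
  then show ?thesis by eventually_elim (auto simp: B_def indicator_def split: if_splits)
qed

end

section \<open>The asymptotic Lipschitz constant\<close>

text \<open>An essential infimum, found by minimizing the integral: if \<open>h\<close> is a
  minimizer, then so is its minimum with any other member, and equality of the integrals forces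
  \<open>h\<close> to lie below. It produces both \<open>lip_a_star\<close> and the least velocity
  bound \<open>CE_speed\<close>.\<close>

lemma ex_AE_least:
  fixes K :: "('a \<Rightarrow> real) set"
  assumes ne: "K \<noteq> {}"
    and int: "\<And>k. k \<in> K \<Longrightarrow> integrable M k"
    and nn: "\<And>k x. k \<in> K \<Longrightarrow> 0 \<le> k x"
    and min: "\<And>k l. k \<in> K \<Longrightarrow> l \<in> K \<Longrightarrow> (\<lambda>x. min (k x) (l x)) \<in> K"
    and inf: "\<And>F. (\<And>n::nat. F n \<in> K) \<Longrightarrow> (\<And>n x. F (Suc n) x \<le> F n x) \<Longrightarrow> (\<lambda>x. INF n. F n x) \<in> K"
  obtains h where "h \<in> K" "\<And>k. k \<in> K \<Longrightarrow> AE x in M. h x \<le> k x"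
proof -
  define I where "I = Inf ((\<lambda>k. \<integral>x. k x \<partial>M) ` K)"
  have bb: "bdd_below ((\<lambda>k. \<integral>x. k x \<partial>M) ` K)"
    by (rule bdd_belowI[of _ 0]) (auto intro: integral_nonneg_AE nn)
  have "\<exists>k\<in>K. (\<integral>x. k x \<partial>M) < I + 1 / Suc n" for n
  proof -
    have "I < I + 1 / Suc n" by simp
    then show ?thesis using cInf_lessD[of "(\<lambda>k. \<integral>x. k x \<partial>M) ` K"] ne unfolding I_def by blast
  qed
  then obtain k where k: "\<And>n. k n \<in> K" "\<And>n. (\<integral>x. k n x \<partial>M) < I + 1 / Suc n" by metis
  define F where "F = rec_nat (k 0) (\<lambda>n f x. min (f x) (k (Suc n) x))"
  have F_Suc: "F (Suc n) = (\<lambda>x. min (F n x) (k (Suc n) x))" and F_0: "F 0 = k 0" for n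
    by (auto simp: F_def)
  have FK: "F n \<in> K" for n
    by (induction n) (auto simp: F_Suc F_0 k intro: min)
  have Fk: "F n x \<le> k n x" for n x by (cases n) (auto simp: F_Suc F_0)
  define h where "h x = (INF n. F n x)" for x
  have h: "h \<in> K" unfolding h_def by (rule inf[OF FK]) (simp add: F_Suc)
  have hF: "h x \<le> F n x" for n x
    unfolding h_def using nn[OF FK] by (intro cINF_lower bdd_belowI[of _ 0]) auto
  have "(\<integral>x. h x \<partial>M) \<le> I + 1 / Suc n" for n
  proof -
    have "(\<integral>x. h x \<partial>M) \<le> (\<integral>x. k n x \<partial>M)"
      using hF[of _ n] Fk[of n] by (intro integral_mono int h k) (auto intro: order_trans)
    then show ?thesis using k(2)[of n] by simp
  qed
  then have hI: "(\<integral>x. h x \<partial>M) \<le> I"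
    by (intro LIMSEQ_le_const[of "\<lambda>n. I + 1 / Suc n"])
       (use tendsto_add[OF tendsto_const LIMSEQ_inverse_real_of_nat, of I] in \<open>auto simp: inverse_eq_divide\<close>)
  show ?thesis
  proof (rule that[OF h])
    fix l assume l: "l \<in> K"
    define g where "g x = min (h x) (l x)" for x
    have g: "g \<in> K" unfolding g_def by (rule min[OF h l])
    have "I \<le> (\<integral>x. g x \<partial>M)" unfolding I_def by (rule cInf_lower[OF imageI[OF g] bb])
    then have "(\<integral>x. h x - g x \<partial>M) \<le> 0" using hI int[OF h] int[OF g] by simp
    moreover have nn': "0 \<le> h x - g x" for x by (simp add: g_def)
    ultimately have "(\<integral>x. h x - g x \<partial>M) = 0" by (intro antisym) (auto intro: integral_nonneg_AE)
    then have "AE x in M. h x - g x = 0"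
      using int[OF h] int[OF g] nn' by (subst (asm) integral_nonneg_eq_0_iff_AE) auto
    then show "AE x in M. h x \<le> l x" by eventually_elim (auto simp: g_def)
  qed
qed

context ext_mm_space begin

lemma rd_triangle:
  assumes "d x y < top" "d y z < top"
  shows "d x z < top" "enn2real (d x z) \<le> enn2real (d x y) + enn2real (d y z)"
proof -
  have le: "d x z \<le> d x y + d y z" by (rule d_triangle)
  have fin: "d x y + d y z < top" using assms by simp
  then show "d x z < top" using le le_less_trans by blast
  have "enn2real (d x z) \<le> enn2real (d x y + d y z)" using le fin by (rule enn2real_mono)
  also have "\<dots> = enn2real (d x y) + enn2real (d y z)" using assms by (simp add: enn2real_plus)
  finally show "enn2real (d x z) \<le> enn2real (d x y) + enn2real (d y z)" .
qed

lemma less_ennreal_iff_rd: "0 < r \<Longrightarrow> d x y < ennreal r \<longleftrightarrow> d x y < top \<and> enn2real (d x y) < r"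
  by (cases "d x y" rule: ennreal_cases) (auto simp: ennreal_less_iff less_top)

definition lip_quot :: "('a \<Rightarrow> real) \<Rightarrow> 'a \<Rightarrow> real \<Rightarrow> ennreal" where
  "lip_quot f x r = (SUP (y, z)\<in>{(y, z). max (d y x) (d z x) < ennreal r \<and> 0 < d y z}.
     ennreal \<bar>f y - f z\<bar> / d y z)"

lemma lip_quot_mono: "r \<le> s \<Longrightarrow> lip_quot f x r \<le> lip_quot f x s"
  unfolding lip_quot_def by (rule SUP_subset_mono) (auto intro: less_le_trans[OF _ ennreal_leI])

lemma lip_a_eq: "lip_a d f x = enn2real (INF r\<in>{0<..}. lip_quot f x r)"
proof -
  have "(lip_quot f x \<longlongrightarrow> (INF r\<in>{0<..}. lip_quot f x r)) (at_right 0)"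
  proof (rule order_tendstoI)
    fix a assume "a < (INF r\<in>{0<..}. lip_quot f x r)"
    then have "a < lip_quot f x r" if "0 < r" for r
      using that by (auto intro: less_le_trans INF_lower)
    then show "\<forall>\<^sub>F r in at_right 0. a < lip_quot f x r"
      unfolding eventually_at_right_field by (auto intro: exI[of _ 1])
  next
    fix a assume "(INF r\<in>{0<..}. lip_quot f x r) < a"
    then obtain r where r: "0 < r" "lip_quot f x r < a" by (auto simp: INF_less_iff)
    then show "\<forall>\<^sub>F r in at_right 0. lip_quot f x r < a"
      unfolding eventually_at_right_field
      by (intro exI[of _ r]) (auto intro: le_less_trans[OF lip_quot_mono[OF less_imp_le]])
  qed
  then have "Lim (at_right 0) (lip_quot f x) = (INF r\<in>{0<..}. lip_quot f x r)"
    by (intro tendsto_Lim) auto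
  then show ?thesis unfolding lip_a_def lip_quot_def by simp
qed

lemma lip_a_nonneg [simp]: "0 \<le> lip_a d f x"
  by (simp add: lip_a_eq)

lemma less_ennreal_min: "a < ennreal (min r s) \<longleftrightarrow> a < ennreal r \<and> a < ennreal s"
  by (cases "r \<le> s") (auto simp: min_def not_le intro: less_le_trans ennreal_leI less_imp_le)

lemma lip_quot_le:
  assumes "0 \<le> k" "0 < r"
    and "\<And>y z. d y x < ennreal r \<Longrightarrow> d z x < ennreal r \<Longrightarrow> \<bar>f y - f z\<bar> \<le> k * enn2real (d y z)"
  shows "lip_quot f x r \<le> ennreal k"
  unfolding lip_quot_def
proof (rule SUP_least, clarify)
  fix y z assume *: "max (d y x) (d z x) < ennreal r" "0 < d y z"
  then have "d y x < top" "d x z < top" by (auto simp: d_sym[of x z] intro: less_le_trans)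
  then have fin: "d y z < top" by (rule rd_triangle)
  then have pos: "0 < enn2real (d y z)" using * by (simp add: enn2real_positive_iff)
  have "ennreal \<bar>f y - f z\<bar> / d y z = ennreal (\<bar>f y - f z\<bar> / enn2real (d y z))"
    using fin pos by (subst divide_ennreal[symmetric]) auto
  also have "\<dots> \<le> ennreal k"
    using assms(3)[of y z] * pos by (intro ennreal_leI) (auto simp: field_simps)
  finally show "ennreal \<bar>f y - f z\<bar> / d y z \<le> ennreal k" .
qed

lemma lip_a_le:
  assumes "0 \<le> k" "0 < r"
    and "\<And>y z. d y x < ennreal r \<Longrightarrow> d z x < ennreal r \<Longrightarrow> \<bar>f y - f z\<bar> \<le> k * enn2real (d y z)"
  shows "lip_a d f x \<le> k"
proof -
  have "(INF r\<in>{0<..}. lip_quot f x r) \<le> ennreal k"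
    by (rule INF_lower2[of r]) (use assms lip_quot_le[OF assms] in auto)
  then show ?thesis unfolding lip_a_eq using assms(1) by (simp add: enn2real_leI)
qed

lemma lip_a_local:
  assumes f: "f \<in> Lip_b d" and k: "lip_a d f x < k"
  obtains r where "0 < r"
    "\<And>y z. d y x < ennreal r \<Longrightarrow> d z x < ennreal r \<Longrightarrow> \<bar>f y - f z\<bar> \<le> k * enn2real (d y z)"
proof -
  obtain C L where L: "0 \<le> L" "\<And>x y. d x y < top \<Longrightarrow> \<bar>f x - f y\<bar> \<le> L * enn2real (d x y)"
    using f by (rule Lip_bE) blast
  have fin: "d y z < top" if "d y x < ennreal r" "d z x < ennreal r" for y z r
  proof -
    have "d y x < top" "d x z < top" using that by (auto simp: d_sym[of x z] intro: less_le_trans)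
    then show ?thesis by (rule rd_triangle)
  qed
  \<comment> \<open>An infinite infimum would be turned into 0 by \<open>enn2real\<close>, and the
    assumption on \<open>k\<close> would say nothing; the global Lipschitz constant excludes
    this.\<close>
  have "lip_quot f x 1 \<le> ennreal L" by (rule lip_quot_le) (use L fin[of _ 1] in auto)
  then have "(INF r\<in>{0<..}. lip_quot f x r) \<le> ennreal L" by (intro INF_lower2[of 1]) auto
  then have "(INF r\<in>{0<..}. lip_quot f x r) < top" using le_less_trans by fastforce
  then have "(INF r\<in>{0<..}. lip_quot f x r) = ennreal (lip_a d f x)" by (simp add: lip_a_eq)
  moreover have "ennreal (lip_a d f x) < ennreal k" using k by (simp add: ennreal_less_iff)
  ultimately have "(INF r\<in>{0<..}. lip_quot f x r) < ennreal k" by simp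
  then obtain r where r: "0 < r" "lip_quot f x r < ennreal k" by (auto simp: INF_less_iff)
  have k0: "0 \<le> k" using k lip_a_nonneg[of f x] by linarith
  show ?thesis
  proof (rule that[OF r(1)])
    fix y z assume yz: "d y x < ennreal r" "d z x < ennreal r"
    note fin = fin[OF yz]
    show "\<bar>f y - f z\<bar> \<le> k * enn2real (d y z)"
    proof (cases "y = z")
      case False
      then have p: "0 < d y z" using d_eq_0[of y z] by (simp add: zero_less_iff_neq_zero)
      then have pos: "0 < enn2real (d y z)" using fin by (simp add: enn2real_positive_iff)
      have "ennreal \<bar>f y - f z\<bar> / d y z \<le> lip_quot f x r"
        unfolding lip_quot_def by (rule SUP_upper2[of "(y, z)"]) (use yz p in auto)
      also have "ennreal \<bar>f y - f z\<bar> / d y z = ennreal (\<bar>f y - f z\<bar> / enn2real (d y z))"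
        using fin pos by (subst divide_ennreal[symmetric]) auto
      finally have "ennreal (\<bar>f y - f z\<bar> / enn2real (d y z)) < ennreal k" using r(2) by simp
      then have "\<bar>f y - f z\<bar> / enn2real (d y z) \<le> k" using pos k0 by (simp add: ennreal_less_iff)
      then show ?thesis using pos by (simp add: field_simps)
    qed simp
  qed
qed

lemma lip_a_le_Lipschitz:
  assumes "0 \<le> L" "\<And>x y. d x y < top \<Longrightarrow> \<bar>f x - f y\<bar> \<le> L * enn2real (d x y)"
  shows "lip_a d f x \<le> L"
proof (rule lip_a_le[where r = 1])
  fix y z assume *: "d y x < ennreal 1" "d z x < ennreal 1"
  then have "d y x < top" "d x z < top" by (auto simp: d_sym[of x z] intro: less_le_trans)
  then show "\<bar>f y - f z\<bar> \<le> L * enn2real (d y z)" using assms(2) rd_triangle(1) by blast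
qed (use assms in auto)

lemma lip_a_lincomb:
  assumes f: "f \<in> Lip_b d" and g: "g \<in> Lip_b d"
  shows "lip_a d (\<lambda>y. a * f y + b * g y) x \<le> \<bar>a\<bar> * lip_a d f x + \<bar>b\<bar> * lip_a d g x"
proof (rule field_le_epsilon)
  fix e :: real assume e: "0 < e"
  define e' where "e' = e / (\<bar>a\<bar> + \<bar>b\<bar> + 1)"
  have e': "0 < e'" "(\<bar>a\<bar> + \<bar>b\<bar>) * e' \<le> e" using e by (auto simp: e'_def field_simps)
  obtain r1 where r1: "0 < r1" "\<And>y z. d y x < ennreal r1 \<Longrightarrow> d z x < ennreal r1 \<Longrightarrow>
      \<bar>f y - f z\<bar> \<le> (lip_a d f x + e') * enn2real (d y z)"
    using lip_a_local[OF f, of x "lip_a d f x + e'"] e' by auto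
  obtain r2 where r2: "0 < r2" "\<And>y z. d y x < ennreal r2 \<Longrightarrow> d z x < ennreal r2 \<Longrightarrow>
      \<bar>g y - g z\<bar> \<le> (lip_a d g x + e') * enn2real (d y z)"
    using lip_a_local[OF g, of x "lip_a d g x + e'"] e' by auto
  have "lip_a d (\<lambda>y. a * f y + b * g y) x \<le> \<bar>a\<bar> * (lip_a d f x + e') + \<bar>b\<bar> * (lip_a d g x + e')"
  proof (rule lip_a_le[where r = "min r1 r2"])
    fix y z assume *: "d y x < ennreal (min r1 r2)" "d z x < ennreal (min r1 r2)"
    then have "d y x < ennreal r1" "d z x < ennreal r1" "d y x < ennreal r2" "d z x < ennreal r2"
      by (auto simp: less_ennreal_min)
    then have b: "\<bar>f y - f z\<bar> \<le> (lip_a d f x + e') * enn2real (d y z)"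
      "\<bar>g y - g z\<bar> \<le> (lip_a d g x + e') * enn2real (d y z)" using r1(2) r2(2) by auto
    have "\<bar>a * f y + b * g y - (a * f z + b * g z)\<bar> = \<bar>a * (f y - f z) + b * (g y - g z)\<bar>"
      by (simp add: algebra_simps)
    also have "\<dots> \<le> \<bar>a\<bar> * \<bar>f y - f z\<bar> + \<bar>b\<bar> * \<bar>g y - g z\<bar>"
      by (metis abs_mult abs_triangle_ineq)
    also have "\<dots> \<le> \<bar>a\<bar> * ((lip_a d f x + e') * enn2real (d y z)) + \<bar>b\<bar> * ((lip_a d g x + e') * enn2real (d y z))"
      using b by (intro add_mono mult_left_mono) auto
    finally show "\<bar>a * f y + b * g y - (a * f z + b * g z)\<bar> \<le>
      (\<bar>a\<bar> * (lip_a d f x + e') + \<bar>b\<bar> * (lip_a d g x + e')) * enn2real (d y z)"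
      by (simp add: algebra_simps)
  qed (use e' r1 r2 in \<open>auto intro!: add_nonneg_nonneg mult_nonneg_nonneg\<close>)
  also have "\<dots> \<le> \<bar>a\<bar> * lip_a d f x + \<bar>b\<bar> * lip_a d g x + e" using e'(2) by (simp add: algebra_simps)
  finally show "lip_a d (\<lambda>y. a * f y + b * g y) x \<le> \<bar>a\<bar> * lip_a d f x + \<bar>b\<bar> * lip_a d g x + e" .
qed

text \<open>The Leibniz rule for gluing two functions by a cutoff \<open>u\<close>: besides the
  convex combination of the slopes there is an error proportional to the difference of the
  functions. The error vanishes when both approximate the same limit, which is what makes slopes
  local.\<close>

lemma lip_a_Leibniz:
  assumes u: "u \<in> Lip_b d" "\<And>y. 0 \<le> u y" "\<And>y. u y \<le> 1"
    and L: "0 \<le> L" "\<And>x y. d x y < top \<Longrightarrow> \<bar>u x - u y\<bar> \<le> L * enn2real (d x y)"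
    and f: "f \<in> Lip_b d" and g: "g \<in> Lip_b d"
  shows "lip_a d (\<lambda>y. u y * f y + (1 - u y) * g y) x
    \<le> u x * lip_a d f x + (1 - u x) * lip_a d g x + L * \<bar>f x - g x\<bar>"
proof -
  obtain C1 L1 where L1: "0 \<le> L1" "\<And>x y. d x y < top \<Longrightarrow> \<bar>f x - f y\<bar> \<le> L1 * enn2real (d x y)"
    using f by (rule Lip_bE) blast
  obtain C2 L2 where L2: "0 \<le> L2" "\<And>x y. d x y < top \<Longrightarrow> \<bar>g x - g y\<bar> \<le> L2 * enn2real (d x y)"
    using g by (rule Lip_bE) blast
  define p q where "p = lip_a d f x" and "q = lip_a d g x"
  have pq: "0 \<le> p" "0 \<le> q" by (auto simp: p_def q_def)
  \<comment> \<open>Near \<open>x\<close>, within distance \<open>r\<close>, the values of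
    \<open>u\<close> move by at most \<open>L * r\<close> and those of \<open>f - g\<close> by at
    most \<open>(L1 + L2) * r\<close>, while the local Lipschitz constants exceed the slopes by
    \<open>r\<close>. All these errors vanish with \<open>r\<close>.\<close>
  have bound: "lip_a d (\<lambda>y. u y * f y + (1 - u y) * g y) x
    \<le> (u x + L * r) * (p + r) + (1 - u x + L * r) * (q + r) + L * (\<bar>f x - g x\<bar> + (L1 + L2) * r)"
    if r: "0 < r" for r
  proof -
    obtain r1 where r1: "0 < r1" "\<And>y z. d y x < ennreal r1 \<Longrightarrow> d z x < ennreal r1 \<Longrightarrow>
        \<bar>f y - f z\<bar> \<le> (p + r) * enn2real (d y z)"
      using lip_a_local[OF f, of x "p + r"] r by (auto simp: p_def)
    obtain r2 where r2: "0 < r2" "\<And>y z. d y x < ennreal r2 \<Longrightarrow> d z x < ennreal r2 \<Longrightarrow>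
        \<bar>g y - g z\<bar> \<le> (q + r) * enn2real (d y z)"
      using lip_a_local[OF g, of x "q + r"] r by (auto simp: q_def)
    show ?thesis
    proof (rule lip_a_le[where r = "min r (min r1 r2)"])
      fix y z assume *: "d y x < ennreal (min r (min r1 r2))" "d z x < ennreal (min r (min r1 r2))"
      then have y: "d y x < ennreal r" "d y x < ennreal r1" "d y x < ennreal r2"
        and z: "d z x < ennreal r" "d z x < ennreal r1" "d z x < ennreal r2"
        by (auto simp: less_ennreal_min)
      have fy: "d y x < top" "enn2real (d y x) < r" and fz: "d z x < top" "enn2real (d z x) < r"
        using y(1) z(1) r by (auto simp: less_ennreal_iff_rd)
      have yz: "d y z < top" using rd_triangle(1)[of y x z] fy fz d_sym[of x z] by simp
      define D where "D = enn2real (d y z)"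
      have uy: "\<bar>u y - u x\<bar> \<le> L * r" using L(2)[OF fy(1)] mult_left_mono[OF less_imp_le[OF fy(2)] L(1)] by linarith
      have fgz: "\<bar>f z - g z\<bar> \<le> \<bar>f x - g x\<bar> + (L1 + L2) * r"
      proof -
        have "\<bar>f z - f x\<bar> \<le> L1 * r" "\<bar>g z - g x\<bar> \<le> L2 * r"
          using L1(2)[OF fz(1)] mult_left_mono[OF less_imp_le[OF fz(2)] L1(1)]
            L2(2)[OF fz(1)] mult_left_mono[OF less_imp_le[OF fz(2)] L2(1)] by linarith+
        then show ?thesis by (simp add: algebra_simps)
      qed
      have "u y * f y + (1 - u y) * g y - (u z * f z + (1 - u z) * g z)
        = u y * (f y - f z) + (1 - u y) * (g y - g z) + (u y - u z) * (f z - g z)"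
        by (simp add: algebra_simps)
      also have "\<bar>\<dots>\<bar> \<le> \<bar>u y * (f y - f z)\<bar> + \<bar>(1 - u y) * (g y - g z)\<bar> + \<bar>(u y - u z) * (f z - g z)\<bar>"
        by linarith
      also have "\<dots> = u y * \<bar>f y - f z\<bar> + (1 - u y) * \<bar>g y - g z\<bar> + \<bar>u y - u z\<bar> * \<bar>f z - g z\<bar>"
        using u(2,3)[of y] by (simp add: abs_mult)
      also have "\<dots> \<le> (u x + L * r) * ((p + r) * D) + (1 - u x + L * r) * ((q + r) * D)
          + (L * D) * (\<bar>f x - g x\<bar> + (L1 + L2) * r)"
      proof (intro add_mono mult_mono)
        show "\<bar>u y - u z\<bar> \<le> L * D" unfolding D_def by (rule L(2)[OF yz])
        show "0 \<le> u x + L * r" using u(2)[of x] L(1) r by simp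
        show "0 \<le> 1 - u x + L * r" using u(3)[of x] L(1) r by simp
        show "0 \<le> L * D" using L(1) by (simp add: D_def)
      qed (use uy fgz r1(2)[OF y(2) z(2)] r2(2)[OF y(3) z(3)] in \<open>auto simp: D_def\<close>)
      finally show "\<bar>u y * f y + (1 - u y) * g y - (u z * f z + (1 - u z) * g z)\<bar>
        \<le> ((u x + L * r) * (p + r) + (1 - u x + L * r) * (q + r) + L * (\<bar>f x - g x\<bar> + (L1 + L2) * r)) * enn2real (d y z)"
        unfolding D_def by (simp add: algebra_simps)
    next
      have "0 \<le> u x + L * r" "0 \<le> 1 - u x + L * r" using u(2,3)[of x] L(1) r by auto
      then show "0 \<le> (u x + L * r) * (p + r) + (1 - u x + L * r) * (q + r) + L * (\<bar>f x - g x\<bar> + (L1 + L2) * r)"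
        using pq L1 L2 L r u(2,3) by (intro add_nonneg_nonneg mult_nonneg_nonneg) auto
    qed (use r r1 r2 in auto)
  qed
  have "((\<lambda>r. (u x + L * r) * (p + r) + (1 - u x + L * r) * (q + r) + L * (\<bar>f x - g x\<bar> + (L1 + L2) * r))
    \<longlongrightarrow> (u x + L * 0) * (p + 0) + (1 - u x + L * 0) * (q + 0) + L * (\<bar>f x - g x\<bar> + (L1 + L2) * 0)) (at_right 0)"
    by (intro tendsto_intros)
  then have "lip_a d (\<lambda>y. u y * f y + (1 - u y) * g y) x
    \<le> (u x + L * 0) * (p + 0) + (1 - u x + L * 0) * (q + 0) + L * (\<bar>f x - g x\<bar> + (L1 + L2) * 0)"
    by (rule tendsto_lowerbound) (use bound in \<open>auto simp: eventually_at_right_field intro: exI[of _ 1]\<close>)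
  then show ?thesis by (simp add: p_def q_def)
qed

text \<open>An essentially smallest measurable majorant exists by \<open>ex_AE_least\<close>, so the
  \<open>SOME\<close> in \<open>lip_a_star\<close> does pick one.\<close>

lemma lip_a_star_envelope:
  assumes f: "f \<in> Lip_b d" shows "is_ess_envelope m (lip_a d f) (lip_a_star d m f)"
proof -
  obtain C L where L: "0 \<le> L" "\<And>x y. d x y < top \<Longrightarrow> \<bar>f x - f y\<bar> \<le> L * enn2real (d x y)"
    using f by (rule Lip_bE) blast
  define K where "K = {k. integrable m k \<and> (\<forall>x. 0 \<le> k x) \<and> (AE x in m. lip_a d f x \<le> k x)}"
  have KL: "(\<lambda>_. L) \<in> K" using L lip_a_le_Lipschitz[OF L] by (auto simp: K_def)
  obtain h where h: "h \<in> K" "\<And>k. k \<in> K \<Longrightarrow> AE x in m. h x \<le> k x"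
  proof (rule ex_AE_least[of K m])
    show "K \<noteq> {}" using KL by auto
    show "(\<lambda>x. min (k x) (l x)) \<in> K" if "k \<in> K" "l \<in> K" for k l
      using that by (auto simp: K_def intro: Bochner_Integration.integrable_min)
    show "(\<lambda>x. INF n. F n x) \<in> K" if F: "\<And>n::nat. F n \<in> K" "\<And>n x. F (Suc n) x \<le> F n x" for F
    proof -
      have F0: "0 \<le> F n x" and Fi: "integrable m (F n)" and Fl: "AE x in m. lip_a d f x \<le> F n x" for n x
        using F(1)[of n] by (auto simp: K_def)
      have [measurable]: "F n \<in> borel_measurable m" for n using Fi by auto
      have le: "0 \<le> (INF n. F n x)" "(INF n. F n x) \<le> F 0 x" for x
        using F0 by (auto intro!: cINF_greatest cINF_lower bdd_belowI[of _ 0])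
      have "integrable m (\<lambda>x. INF n. F n x)"
      proof (rule Bochner_Integration.integrable_bound[OF Fi[of 0]])
        show "(\<lambda>x. INF n. F n x) \<in> borel_measurable m"
          using F0 by (intro borel_measurable_cINF) (auto intro!: bdd_belowI[of _ 0])
        show "AE x in m. norm (INF n. F n x) \<le> norm (F 0 x)" using le F0 by auto
      qed
      moreover have "AE x in m. \<forall>n. lip_a d f x \<le> F n x" using Fl by (simp add: AE_all_countable)
      then have "AE x in m. lip_a d f x \<le> (INF n. F n x)"
        by eventually_elim (auto intro: cINF_greatest)
      ultimately show ?thesis using le by (auto simp: K_def)
    qed
  qed (auto simp: K_def)
  have "is_ess_envelope m (lip_a d f) h"
    unfolding is_ess_envelope_def
  proof (intro conjI ballI impI)
    fix k assume k: "k \<in> borel_measurable m" "AE x in m. lip_a d f x \<le> k x"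
    \<comment> \<open>Truncation to \<open>[0, L]\<close> brings an arbitrary measurable majorant
      into the class \<open>K\<close> of integrable ones without spoiling the bound, since the slope
      takes its values in this interval.\<close>
    have "(\<lambda>x. min (max 0 (k x)) L) \<in> K"
      unfolding K_def
    proof (safe)
      show "integrable m (\<lambda>x. min (max 0 (k x)) L)"
        using k(1) L(1) by (intro integrable_const_bound[of _ L]) auto
      show "AE x in m. lip_a d f x \<le> min (max 0 (k x)) L"
        using k(2) by eventually_elim (use lip_a_le_Lipschitz[OF L] in auto)
    qed (use L in auto)
    from h(2)[OF this] k(2) show "AE x in m. h x \<le> k x"
    proof eventually_elim
      case (elim x)
      have "0 \<le> k x" using elim(2) lip_a_nonneg[of f x] by linarith
      then show ?case using elim(1) by auto
    qed
  qed (use h in \<open>auto simp: K_def\<close>)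
  then show ?thesis unfolding lip_a_star_def by (rule someI[where P = "is_ess_envelope m (lip_a d f)"])
qed

lemma lip_a_star_measurable: "f \<in> Lip_b d \<Longrightarrow> lip_a_star d m f \<in> borel_measurable m"
  and lip_a_star_ge: "f \<in> Lip_b d \<Longrightarrow> AE x in m. lip_a d f x \<le> lip_a_star d m f x"
  and lip_a_star_least: "f \<in> Lip_b d \<Longrightarrow> k \<in> borel_measurable m \<Longrightarrow>
    AE x in m. lip_a d f x \<le> k x \<Longrightarrow> AE x in m. lip_a_star d m f x \<le> k x"
  using lip_a_star_envelope unfolding is_ess_envelope_def by blast+

lemma lip_a_star_nonneg: "f \<in> Lip_b d \<Longrightarrow> AE x in m. 0 \<le> lip_a_star d m f x"
  using lip_a_star_ge by (rule AE_mp) (auto intro: order_trans[OF lip_a_nonneg])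

lemma lip_a_star_bounded:
  assumes "f \<in> Lip_b d" "0 \<le> L" "\<And>x y. d x y < top \<Longrightarrow> \<bar>f x - f y\<bar> \<le> L * enn2real (d x y)"
  shows "AE x in m. \<bar>lip_a_star d m f x\<bar> \<le> L"
proof -
  have "AE x in m. lip_a_star d m f x \<le> L"
    using lip_a_le_Lipschitz[OF assms(2,3)] by (intro lip_a_star_least assms) auto
  with lip_a_star_nonneg[OF assms(1)] show ?thesis by eventually_elim auto
qed

lemma lip_a_star_L2: "f \<in> Lip_b d \<Longrightarrow> lip_a_star d m f \<in> L2 m"
  by (rule Lip_bE, assumption, rule L2_bounded) (auto intro: lip_a_star_measurable lip_a_star_bounded)

lemma lip_a_star_lincomb:
  assumes f: "f \<in> Lip_b d" and g: "g \<in> Lip_b d"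
  shows "AE x in m. lip_a_star d m (\<lambda>y. a * f y + b * g y) x
    \<le> \<bar>a\<bar> * lip_a_star d m f x + \<bar>b\<bar> * lip_a_star d m g x"
proof (rule lip_a_star_least[OF Lip_b_lincomb[OF f g]])
  have [measurable]: "lip_a_star d m f \<in> borel_measurable m" "lip_a_star d m g \<in> borel_measurable m"
    using f g by (auto intro: lip_a_star_measurable)
  show "(\<lambda>x. \<bar>a\<bar> * lip_a_star d m f x + \<bar>b\<bar> * lip_a_star d m g x) \<in> borel_measurable m" by measurable
  show "AE x in m. lip_a d (\<lambda>y. a * f y + b * g y) x \<le> \<bar>a\<bar> * lip_a_star d m f x + \<bar>b\<bar> * lip_a_star d m g x"
    using lip_a_star_ge[OF f] lip_a_star_ge[OF g]
    by eventually_elim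
      (rule order_trans[OF lip_a_lincomb[OF f g]], intro add_mono mult_left_mono, auto)
qed

lemma lip_a_star_Leibniz:
  assumes u: "u \<in> Lip_b d" "\<And>y. 0 \<le> u y" "\<And>y. u y \<le> 1"
    and L: "0 \<le> L" "\<And>x y. d x y < top \<Longrightarrow> \<bar>u x - u y\<bar> \<le> L * enn2real (d x y)"
    and f: "f \<in> Lip_b d" and g: "g \<in> Lip_b d"
  shows "AE x in m. lip_a_star d m (\<lambda>y. u y * f y + (1 - u y) * g y) x
    \<le> u x * lip_a_star d m f x + (1 - u x) * lip_a_star d m g x + L * \<bar>f x - g x\<bar>"
proof (rule lip_a_star_least)
  have "(\<lambda>y. 1 + (- 1) * u y) \<in> Lip_b d" by (intro Lip_b_add Lip_b_const Lip_b_cmult u)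
  then show "(\<lambda>y. u y * f y + (1 - u y) * g y) \<in> Lip_b d"
    by (intro Lip_b_add Lip_b_mult u f g) simp
  have [measurable]: "lip_a_star d m f \<in> borel_measurable m" "lip_a_star d m g \<in> borel_measurable m"
    "f \<in> borel_measurable m" "g \<in> borel_measurable m" "u \<in> borel_measurable m"
    using f g u by (auto intro: lip_a_star_measurable Lip_b_measurable)
  show "(\<lambda>x. u x * lip_a_star d m f x + (1 - u x) * lip_a_star d m g x + L * \<bar>f x - g x\<bar>) \<in> borel_measurable m"
    by measurable
  show "AE x in m. lip_a d (\<lambda>y. u y * f y + (1 - u y) * g y) x
    \<le> u x * lip_a_star d m f x + (1 - u x) * lip_a_star d m g x + L * \<bar>f x - g x\<bar>"
    using lip_a_star_ge[OF f] lip_a_star_ge[OF g]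
  proof eventually_elim
    case (elim x)
    have "u x * lip_a d f x \<le> u x * lip_a_star d m f x"
      "(1 - u x) * lip_a d g x \<le> (1 - u x) * lip_a_star d m g x"
      using elim u(2,3) by (auto intro: mult_left_mono)
    then show ?case using lip_a_Leibniz[OF u L f g, of x] by linarith
  qed
qed

end

section \<open>Relaxed slopes\<close>

lemma L2_ball_convex:
  assumes F: "F \<in> L2 M" "F' \<in> L2 M" and f: "f \<in> L2 M"
    and close: "L2sq M (\<lambda>x. F x - f x) < e" "L2sq M (\<lambda>x. F' x - f x) < e" and s: "0 \<le> s" "s \<le> 1"
  shows "L2sq M (\<lambda>x. (1 - s) * F x + s * F' x - f x) < e"
proof -
  note D = L2_diff[OF F(1) f] L2_diff[OF F(2) f]
  define p q r where "p = L2sq M (\<lambda>x. F x - f x)" and "q = L2sq M (\<lambda>x. F' x - f x)"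
    and "r = (\<integral>x. (F x - f x) * (F' x - f x) \<partial>M)"
  have r: "2 * r \<le> p + q"
    using L2sq_lincomb[OF D, of 1 "-1"] L2sq_nonneg[of m "\<lambda>x. 1 * (F x - f x) + - 1 * (F' x - f x)"]
    L2sq_nonneg[of M "\<lambda>x. F x - F' x"] by (simp add: p_def q_def r_def)
  have "(\<lambda>x. (1 - s) * F x + s * F' x - f x) = (\<lambda>x. (1 - s) * (F x - f x) + s * (F' x - f x))"
    by (auto simp: algebra_simps)
  then have "L2sq M (\<lambda>x. (1 - s) * F x + s * F' x - f x) = (1 - s)^2 * p + (1 - s) * s * (2 * r) + s^2 * q"
    using L2sq_lincomb[OF D, of "1 - s" s] by (simp add: p_def q_def r_def)
  also have "\<dots> \<le> (1 - s)^2 * p + (1 - s) * s * (p + q) + s^2 * q"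
    using r s by (intro add_mono mult_left_mono) auto
  also have "\<dots> = (1 - s) * p + s * q" by (simp add: power2_eq_square algebra_simps)
  also have "\<dots> < e"
  proof (cases "s = 0")
    case False
    then have "s * q < s * e" using s close by (simp add: q_def)
    moreover have "(1 - s) * p \<le> (1 - s) * e" using s close by (intro mult_left_mono) (auto simp: p_def)
    ultimately show ?thesis by (simp add: algebra_simps)
  qed (use close in \<open>simp add: p_def\<close>)
  finally show ?thesis .
qed

context ext_mm_space begin

text \<open>Pairs \<open>(f, G)\<close> in the strong closure of the pairs \<open>(F, H)\<close> with \<open>F\<close> Lipschitz and
  \<open>H\<close> above \<open>lip_a_star F\<close>: by Mazur's lemma these are the relaxed slopes, without weak limits.\<close>

definition strong_slope :: "('a \<Rightarrow> real) \<Rightarrow> ('a \<Rightarrow> real) \<Rightarrow> bool" where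
  "strong_slope f G \<longleftrightarrow> f \<in> L2 m \<and> G \<in> L2 m \<and> (\<forall>e>0. \<exists>F H. F \<in> Lip_b d \<and> H \<in> L2 m \<and>
     (AE x in m. lip_a_star d m F x \<le> H x) \<and>
     L2sq m (\<lambda>x. F x - f x) < e \<and> L2sq m (\<lambda>x. H x - G x) < e)"

lemma strong_slopeD:
  assumes "strong_slope f G" shows "f \<in> L2 m" "G \<in> L2 m"
  using assms by (auto simp: strong_slope_def)

lemma strong_slopeE:
  assumes "strong_slope f G" "0 < e"
  obtains F H where "F \<in> Lip_b d" "H \<in> L2 m" "AE x in m. lip_a_star d m F x \<le> H x"
    "L2sq m (\<lambda>x. F x - f x) < e" "L2sq m (\<lambda>x. H x - G x) < e"
  using assms unfolding strong_slope_def by blast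

lemma Lip_b_strong_slope:
  assumes "F \<in> Lip_b d" shows "strong_slope F (lip_a_star d m F)"
  unfolding strong_slope_def
proof (intro conjI allI impI)
  fix e :: real assume "0 < e"
  show "\<exists>F' H. F' \<in> Lip_b d \<and> H \<in> L2 m \<and> (AE x in m. lip_a_star d m F' x \<le> H x) \<and>
     L2sq m (\<lambda>x. F' x - F x) < e \<and> L2sq m (\<lambda>x. H x - lip_a_star d m F x) < e"
    by (rule exI[of _ F], rule exI[of _ "lip_a_star d m F"])
       (use \<open>0 < e\<close> in \<open>auto simp: L2sq_def assms lip_a_star_L2\<close>)
qed (auto intro: Lip_b_L2 lip_a_star_L2 assms)

lemma L2sq_close_half:
  assumes "f \<in> L2 m" "g \<in> L2 m" "h \<in> L2 m"
    and "L2sq m (\<lambda>x. f x - g x) < e / 4" "L2sq m (\<lambda>x. g x - h x) < e / 4"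
  shows "L2sq m (\<lambda>x. f x - h x) < e"
  using L2sq_diff_le[OF assms(1-3)] assms(4,5) by simp

lemma strong_slope_closed:
  assumes f: "f \<in> L2 m" and G: "G \<in> L2 m"
    and close: "\<And>e. 0 < e \<Longrightarrow> \<exists>f' G'. strong_slope f' G' \<and> L2sq m (\<lambda>x. f' x - f x) < e \<and> L2sq m (\<lambda>x. G' x - G x) < e"
  shows "strong_slope f G"
  unfolding strong_slope_def
proof (intro conjI allI impI f G)
  fix e :: real assume e: "0 < e"
  then obtain f' G' where 1: "strong_slope f' G'" "L2sq m (\<lambda>x. f' x - f x) < e/4" "L2sq m (\<lambda>x. G' x - G x) < e/4"
    using close[of "e/4"] by auto
  note L = strong_slopeD[OF 1(1)]
  from e obtain F H where 2: "F \<in> Lip_b d" "H \<in> L2 m" "AE x in m. lip_a_star d m F x \<le> H x"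
    "L2sq m (\<lambda>x. F x - f' x) < e/4" "L2sq m (\<lambda>x. H x - G' x) < e/4"
    using strong_slopeE[OF 1(1), of "e/4"] by auto
  have "L2sq m (\<lambda>x. F x - f x) < e" "L2sq m (\<lambda>x. H x - G x) < e"
    using L2sq_close_half[OF Lip_b_L2[OF 2(1)] L(1) f 2(4) 1(2)] L2sq_close_half[OF 2(2) L(2) G 2(5) 1(3)] by auto
  with 2 show "\<exists>F H. F \<in> Lip_b d \<and> H \<in> L2 m \<and> (AE x in m. lip_a_star d m F x \<le> H x) \<and>
     L2sq m (\<lambda>x. F x - f x) < e \<and> L2sq m (\<lambda>x. H x - G x) < e" by blast
qed

lemma strong_slope_mono:
  assumes s: "strong_slope f G" and G': "G' \<in> L2 m" and le: "AE x in m. G x \<le> G' x"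
  shows "strong_slope f G'"
  unfolding strong_slope_def
proof (intro conjI allI impI G' strong_slopeD(1)[OF s])
  fix e :: real assume "0 < e"
  with s obtain F H where 1: "F \<in> Lip_b d" "H \<in> L2 m" "AE x in m. lip_a_star d m F x \<le> H x"
    "L2sq m (\<lambda>x. F x - f x) < e" "L2sq m (\<lambda>x. H x - G x) < e" by (rule strong_slopeE)
  show "\<exists>F H. F \<in> Lip_b d \<and> H \<in> L2 m \<and> (AE x in m. lip_a_star d m F x \<le> H x) \<and>
     L2sq m (\<lambda>x. F x - f x) < e \<and> L2sq m (\<lambda>x. H x - G' x) < e"
  proof (intro exI conjI)
    show "(\<lambda>x. H x + (G' x - G x)) \<in> L2 m"
      by (intro L2_add L2_diff 1 G' strong_slopeD(2)[OF s])
    show "AE x in m. lip_a_star d m F x \<le> H x + (G' x - G x)"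
      using 1(3) le by eventually_elim auto
    show "L2sq m (\<lambda>x. H x + (G' x - G x) - G' x) < e" using 1(5) by simp
  qed (use 1 in auto)
qed

text \<open>An approximating \<open>H\<close> is nonnegative almost everywhere, so the negative part
  of \<open>G\<close> is pointwise at most the difference of \<open>H\<close> and
  \<open>G\<close>.\<close>

lemma strong_slope_nonneg:
  assumes s: "strong_slope f G" shows "AE x in m. 0 \<le> G x"
proof -
  note L = strong_slopeD[OF s]
  have [measurable]: "G \<in> borel_measurable m" using L by auto
  define n where "n x = max 0 (- G x)" for x
  have [measurable]: "n \<in> borel_measurable m" unfolding n_def by measurable
  have nL: "n \<in> L2 m"
    by (rule L2_bound[OF L(2)]) (auto simp: n_def)
  have "L2sq m n \<le> e" if e: "0 < e" for e
  proof -
    from s e obtain F H where 1: "F \<in> Lip_b d" "H \<in> L2 m" "AE x in m. lip_a_star d m F x \<le> H x"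
      "L2sq m (\<lambda>x. F x - f x) < e" "L2sq m (\<lambda>x. H x - G x) < e" by (rule strong_slopeE)
    have "L2sq m n \<le> L2sq m (\<lambda>x. H x - G x)"
    proof (rule L2sq_mono[OF L2_diff[OF 1(2) L(2)]])
      show "AE x in m. \<bar>n x\<bar> \<le> \<bar>H x - G x\<bar>"
        using 1(3) lip_a_star_nonneg[OF 1(1)] by eventually_elim (auto simp: n_def)
    qed (use nL in auto)
    then show ?thesis using 1(5) by simp
  qed
  then have "L2sq m n = 0" using field_le_epsilon[of "L2sq m n" 0] L2sq_nonneg[of m n] by force
  then have "AE x in m. (n x)^2 = 0"
    unfolding L2sq_def using nL by (subst (asm) integral_nonneg_eq_0_iff_AE) auto
  then show ?thesis by eventually_elim (auto simp: n_def max_def split: if_splits)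
qed

lemma strong_slope_lincomb:
  assumes 1: "strong_slope f G" and 2: "strong_slope g H"
  shows "strong_slope (\<lambda>x. a * f x + b * g x) (\<lambda>x. \<bar>a\<bar> * G x + \<bar>b\<bar> * H x)"
  unfolding strong_slope_def
proof (intro conjI allI impI)
  note L1 = strong_slopeD[OF 1] note L2' = strong_slopeD[OF 2]
  show "(\<lambda>x. a * f x + b * g x) \<in> L2 m" "(\<lambda>x. \<bar>a\<bar> * G x + \<bar>b\<bar> * H x) \<in> L2 m"
    using L1 L2' by (auto intro: L2_lincomb)
  fix e :: real assume e: "0 < e"
  \<comment> \<open>The estimate \<open>est\<close> costs the factor
    \<open>2 * a^2 + 2 * b^2\<close>; the added 1 keeps \<open>c\<close> positive and the final
    inequality strict.\<close>
  define c where "c = 2 * a^2 + 2 * b^2 + 1"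
  have c: "0 < c" by (simp add: c_def add_nonneg_pos)
  have c1: "c - 1 = 2 * a^2 + 2 * b^2" by (simp add: c_def)
  have ec: "0 < e / c" using e c by simp
  from strong_slopeE[OF 1 ec] obtain F1 H1 where 3: "F1 \<in> Lip_b d" "H1 \<in> L2 m" "AE x in m. lip_a_star d m F1 x \<le> H1 x"
    "L2sq m (\<lambda>x. F1 x - f x) < e / c" "L2sq m (\<lambda>x. H1 x - G x) < e / c" .
  from strong_slopeE[OF 2 ec] obtain F2 H2 where 4: "F2 \<in> Lip_b d" "H2 \<in> L2 m" "AE x in m. lip_a_star d m F2 x \<le> H2 x"
    "L2sq m (\<lambda>x. F2 x - g x) < e / c" "L2sq m (\<lambda>x. H2 x - H x) < e / c" .
  \<comment> \<open>Only the squares of the coefficients matter, so one estimate serves the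
    functions, with \<open>a\<close> and \<open>b\<close>, and the slopes, with their absolute
    values.\<close>
  have est: "L2sq m (\<lambda>x. (s * p x + t * q x) - (s * p' x + t * q' x)) < e"
    if L: "p \<in> L2 m" "q \<in> L2 m" "p' \<in> L2 m" "q' \<in> L2 m" and st: "s^2 = a^2" "t^2 = b^2"
      and le: "L2sq m (\<lambda>x. p x - p' x) < e / c" "L2sq m (\<lambda>x. q x - q' x) < e / c" for p q p' q' s t
  proof -
    have eq: "(\<lambda>x. (s * p x + t * q x) - (s * p' x + t * q' x)) = (\<lambda>x. s * (p x - p' x) + t * (q x - q' x))"
      by (auto simp: algebra_simps)
    have "L2sq m (\<lambda>x. s * (p x - p' x) + t * (q x - q' x)) \<le> 2 * L2sq m (\<lambda>x. s * (p x - p' x)) + 2 * L2sq m (\<lambda>x. t * (q x - q' x))"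
      by (intro L2sq_add_le L2_cmult L2_diff L)
    also have "\<dots> = 2 * a^2 * L2sq m (\<lambda>x. p x - p' x) + 2 * b^2 * L2sq m (\<lambda>x. q x - q' x)"
      by (simp add: L2sq_cmult st)
    also have "\<dots> \<le> 2 * a^2 * (e / c) + 2 * b^2 * (e / c)"
      using le by (intro add_mono mult_left_mono) auto
    also have "\<dots> = (c - 1) * (e / c)" unfolding c1 by (simp only: distrib_right)
    also have "\<dots> < c * (e / c)" using ec by (simp only: mult_less_cancel_right) simp
    also have "\<dots> = e" using c by simp
    finally show ?thesis unfolding eq .
  qed
  show "\<exists>F K. F \<in> Lip_b d \<and> K \<in> L2 m \<and> (AE x in m. lip_a_star d m F x \<le> K x) \<and>
     L2sq m (\<lambda>x. F x - (a * f x + b * g x)) < e \<and> L2sq m (\<lambda>x. K x - (\<bar>a\<bar> * G x + \<bar>b\<bar> * H x)) < e"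
  proof (intro exI conjI)
    show "(\<lambda>x. a * F1 x + b * F2 x) \<in> Lip_b d" by (intro Lip_b_lincomb 3 4)
    show "(\<lambda>x. \<bar>a\<bar> * H1 x + \<bar>b\<bar> * H2 x) \<in> L2 m" by (intro L2_lincomb 3 4)
    show "AE x in m. lip_a_star d m (\<lambda>x. a * F1 x + b * F2 x) x \<le> \<bar>a\<bar> * H1 x + \<bar>b\<bar> * H2 x"
      using lip_a_star_lincomb[OF 3(1) 4(1), of a b] 3(3) 4(3)
    proof eventually_elim
      case (elim x)
      then show ?case
        using mult_left_mono[OF elim(2), of "\<bar>a\<bar>"] mult_left_mono[OF elim(3), of "\<bar>b\<bar>"] by linarith
    qed
    show "L2sq m (\<lambda>x. a * F1 x + b * F2 x - (a * f x + b * g x)) < e"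
      by (rule est) (use 3 4 L1 L2' Lip_b_L2 in auto)
    show "L2sq m (\<lambda>x. \<bar>a\<bar> * H1 x + \<bar>b\<bar> * H2 x - (\<bar>a\<bar> * G x + \<bar>b\<bar> * H x)) < e"
      by (rule est) (use 3 4 L1 L2' in auto)
  qed
qed

lemma strong_slope_convex:
  assumes 1: "strong_slope f G" and 2: "strong_slope g H" and s: "0 \<le> s" "s \<le> 1"
  shows "strong_slope (\<lambda>x. (1 - s) * f x + s * g x) (\<lambda>x. (1 - s) * G x + s * H x)"
  using strong_slope_lincomb[OF 1 2, of "1 - s" s] s by simp

lemma L2_mult_bounded:
  assumes "u \<in> borel_measurable m" "\<And>x. 0 \<le> u x" "\<And>x. u x \<le> 1" "f \<in> L2 m"
  shows "(\<lambda>x. u x * f x) \<in> L2 m"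
proof (rule L2_bound[OF assms(4)])
  show "(\<lambda>x. u x * f x) \<in> borel_measurable m" using assms L2D(1)[OF assms(4)] by measurable
  show "AE x in m. \<bar>u x * f x\<bar> \<le> \<bar>f x\<bar>"
    using assms by (auto simp: abs_mult intro!: mult_left_le_one_le)
qed

text \<open>Both slopes belong to the same \<open>f\<close>, so the approximating functions
  \<open>F1\<close> and \<open>F2\<close> come close to each other and the Leibniz error
  \<open>L * \<bar>F1 x - F2 x\<bar>\<close> disappears in the limit.\<close>

lemma strong_slope_Leibniz:
  assumes u: "u \<in> Lip_b d" "\<And>y. 0 \<le> u y" "\<And>y. u y \<le> 1"
    and 1: "strong_slope f G" and 2: "strong_slope f H"
  shows "strong_slope f (\<lambda>x. u x * G x + (1 - u x) * H x)"
  unfolding strong_slope_def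
proof (intro conjI allI impI)
  note L1 = strong_slopeD[OF 1] note L2' = strong_slopeD[OF 2]
  have um[measurable]: "u \<in> borel_measurable m" using Lip_b_measurable u by auto
  have uL: "(\<lambda>x. u x * p x + (1 - u x) * q x) \<in> L2 m" if "p \<in> L2 m" "q \<in> L2 m" for p q
    using that u by (intro L2_add L2_mult_bounded) auto
  show "f \<in> L2 m" "(\<lambda>x. u x * G x + (1 - u x) * H x) \<in> L2 m" using L1 L2' uL by auto
  obtain C L where L: "0 \<le> L" "\<And>x y. d x y < top \<Longrightarrow> \<bar>u x - u y\<bar> \<le> L * enn2real (d x y)"
    using u(1) by (rule Lip_bE) blast
  fix e :: real assume e: "0 < e"
  \<comment> \<open>The convex combination of slopes contributes \<open>2 * 4\<close> and the
    Leibniz error \<open>2 * 4 * L^2\<close>, both times \<open>e / c\<close>; the remaining 1 makes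
    the inequality strict.\<close>
  define c where "c = 9 + 8 * L^2"
  have c: "9 \<le> c" by (simp add: c_def)
  have c1: "c - 1 = 8 + 8 * L^2" by (simp add: c_def)
  have ec: "0 < e / c" using e c by simp
  from strong_slopeE[OF 1 ec] obtain F1 H1 where 3: "F1 \<in> Lip_b d" "H1 \<in> L2 m" "AE x in m. lip_a_star d m F1 x \<le> H1 x"
    "L2sq m (\<lambda>x. F1 x - f x) < e / c" "L2sq m (\<lambda>x. H1 x - G x) < e / c" .
  from strong_slopeE[OF 2 ec] obtain F2 H2 where 4: "F2 \<in> Lip_b d" "H2 \<in> L2 m" "AE x in m. lip_a_star d m F2 x \<le> H2 x"
    "L2sq m (\<lambda>x. F2 x - f x) < e / c" "L2sq m (\<lambda>x. H2 x - H x) < e / c" .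
  note F12 = Lip_b_L2[OF 3(1)] Lip_b_L2[OF 4(1)]
  have est: "L2sq m (\<lambda>x. (u x * p x + (1 - u x) * q x) - (u x * p' x + (1 - u x) * q' x)) \<le> 4 * (e / c)"
    if L: "p \<in> L2 m" "q \<in> L2 m" "p' \<in> L2 m" "q' \<in> L2 m"
      and le: "L2sq m (\<lambda>x. p x - p' x) < e / c" "L2sq m (\<lambda>x. q x - q' x) < e / c" for p q p' q'
  proof -
    have m: "L2sq m (\<lambda>x. v x * r x) \<le> L2sq m r"
      if "r \<in> L2 m" "v \<in> borel_measurable m" "\<And>x. 0 \<le> v x" "\<And>x. v x \<le> 1" for r v
      using L2_mult_bounded[OF that(2-4,1)] that
      by (intro L2sq_mono) (auto simp: abs_mult intro!: mult_left_le_one_le)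
    have eq: "(\<lambda>x. (u x * p x + (1 - u x) * q x) - (u x * p' x + (1 - u x) * q' x))
      = (\<lambda>x. u x * (p x - p' x) + (1 - u x) * (q x - q' x))" by (auto simp: algebra_simps)
    have "L2sq m (\<lambda>x. u x * (p x - p' x) + (1 - u x) * (q x - q' x)) \<le> 2 * L2sq m (\<lambda>x. u x * (p x - p' x)) + 2 * L2sq m (\<lambda>x. (1 - u x) * (q x - q' x))"
      using u by (intro L2sq_add_le L2_mult_bounded L2_diff L) auto
    also have "\<dots> \<le> 2 * L2sq m (\<lambda>x. p x - p' x) + 2 * L2sq m (\<lambda>x. q x - q' x)"
      using u L by (intro add_mono mult_left_mono m L2_diff) auto
    also have "\<dots> \<le> 4 * (e / c)" using le by simp
    finally show ?thesis unfolding eq .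
  qed
  have c4: "4 * (e / c) < e" using c e by (simp add: field_simps)
  have D: "L2sq m (\<lambda>x. F1 x - F2 x) < 4 * (e / c)"
    using L2sq_diff_le[OF F12(1) L1(1) F12(2)] 3(4) 4(4) L2sq_minus_commute[of m f F2] by simp
  have absL: "(\<lambda>x. L * \<bar>F1 x - F2 x\<bar>) \<in> L2 m"
  proof (rule L2_bound[OF L2_cmult[OF L2_diff[OF F12], of L]])
    show "(\<lambda>x. L * \<bar>F1 x - F2 x\<bar>) \<in> borel_measurable m"
      using L2D(1)[OF F12(1)] L2D(1)[OF F12(2)] by measurable
  qed (simp add: abs_mult)
  show "\<exists>F K. F \<in> Lip_b d \<and> K \<in> L2 m \<and> (AE x in m. lip_a_star d m F x \<le> K x) \<and>
     L2sq m (\<lambda>x. F x - f x) < e \<and> L2sq m (\<lambda>x. K x - (u x * G x + (1 - u x) * H x)) < e"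
  proof (intro exI conjI)
    have "(\<lambda>y. 1 + (- 1) * u y) \<in> Lip_b d" by (intro Lip_b_add Lip_b_const Lip_b_cmult u)
    then show "(\<lambda>y. u y * F1 y + (1 - u y) * F2 y) \<in> Lip_b d"
      by (intro Lip_b_add Lip_b_mult u 3 4) simp
    show "(\<lambda>x. (u x * H1 x + (1 - u x) * H2 x) + L * \<bar>F1 x - F2 x\<bar>) \<in> L2 m"
      by (intro L2_add[OF uL absL] 3 4)
    have leib: "AE x in m. lip_a_star d m (\<lambda>y. u y * F1 y + (1 - u y) * F2 y) x
      \<le> u x * lip_a_star d m F1 x + (1 - u x) * lip_a_star d m F2 x + L * \<bar>F1 x - F2 x\<bar>"
      by (rule lip_a_star_Leibniz[OF u _ _ 3(1) 4(1)]) (use L in auto)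
    show "AE x in m. lip_a_star d m (\<lambda>y. u y * F1 y + (1 - u y) * F2 y) x
      \<le> (u x * H1 x + (1 - u x) * H2 x) + L * \<bar>F1 x - F2 x\<bar>"
      using leib 3(3) 4(3)
    proof eventually_elim
      case (elim x)
      then show ?case
        using mult_left_mono[OF elim(2), of "u x"] mult_left_mono[OF elim(3), of "1 - u x"] u(2,3)[of x] by linarith
    qed
    have "(\<lambda>x. u x * F1 x + (1 - u x) * F2 x - f x)
      = (\<lambda>x. (u x * F1 x + (1 - u x) * F2 x) - (u x * f x + (1 - u x) * f x))" by (auto simp: algebra_simps)
    then show "L2sq m (\<lambda>x. u x * F1 x + (1 - u x) * F2 x - f x) < e"
      using est[OF F12 L1(1) L1(1) 3(4) 4(4)] c4 by simp
    have eq: "(\<lambda>x. (u x * H1 x + (1 - u x) * H2 x) + L * \<bar>F1 x - F2 x\<bar> - (u x * G x + (1 - u x) * H x))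
      = (\<lambda>x. ((u x * H1 x + (1 - u x) * H2 x) - (u x * G x + (1 - u x) * H x)) + L * \<bar>F1 x - F2 x\<bar>)" by auto
    have "L2sq m (\<lambda>x. ((u x * H1 x + (1 - u x) * H2 x) - (u x * G x + (1 - u x) * H x)) + L * \<bar>F1 x - F2 x\<bar>)
      \<le> 2 * L2sq m (\<lambda>x. (u x * H1 x + (1 - u x) * H2 x) - (u x * G x + (1 - u x) * H x))
        + 2 * L2sq m (\<lambda>x. L * \<bar>F1 x - F2 x\<bar>)"
      by (intro L2sq_add_le L2_diff uL absL 3 4 L1 L2')
    also have "L2sq m (\<lambda>x. L * \<bar>F1 x - F2 x\<bar>) = L^2 * L2sq m (\<lambda>x. F1 x - F2 x)"
      by (simp add: L2sq_cmult) (simp add: L2sq_def)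
    also have "2 * L2sq m (\<lambda>x. (u x * H1 x + (1 - u x) * H2 x) - (u x * G x + (1 - u x) * H x))
        + 2 * (L^2 * L2sq m (\<lambda>x. F1 x - F2 x)) \<le> 2 * (4 * (e/c)) + 2 * (L^2 * (4 * (e / c)))"
      using est[OF 3(2) 4(2) L1(2) L2'(2) 3(5) 4(5)] D by (intro add_mono mult_left_mono) auto
    also have "\<dots> = (c - 1) * (e / c)" unfolding c1 by (simp add: distrib_right add_divide_distrib)
    also have "\<dots> < c * (e / c)" using ec by (simp only: mult_less_cancel_right) simp
    also have "\<dots> = e" using c by simp
    finally show "L2sq m (\<lambda>x. (u x * H1 x + (1 - u x) * H2 x) + L * \<bar>F1 x - F2 x\<bar> - (u x * G x + (1 - u x) * H x)) < e"
      unfolding eq .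
  qed
qed

text \<open>Cutoffs converging to the indicator of \<open>B\<close> turn the Leibniz rule into
  locality: slopes of the same function may be patched along Borel sets. Patching along
  \<open>{x. G x \<le> H x}\<close> gives the stability under minima in
  \<open>strong_slope_min\<close>.\<close>

lemma strong_slope_indicator:
  assumes B: "B \<in> sets borel" and 1: "strong_slope f G" and 2: "strong_slope f H"
  shows "strong_slope f (\<lambda>x. if x \<in> B then G x else H x)"
proof (rule strong_slope_closed)
  note L1 = strong_slopeD[OF 1] note L2' = strong_slopeD[OF 2]
  have [measurable]: "G \<in> borel_measurable m" "H \<in> borel_measurable m" using L1 L2' by auto
  have [measurable]: "B \<in> sets borel" by fact
  show "f \<in> L2 m" by fact
  have "(\<lambda>x. \<bar>G x\<bar> + \<bar>H x\<bar>) \<in> L2 m"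
    by (intro L2_add) (rule L2_bound[OF L1(2)] L2_bound[OF L2'(2)]; simp)+
  then show GH: "(\<lambda>x. if x \<in> B then G x else H x) \<in> L2 m"
    by (rule L2_bound) auto
  fix e :: real assume e: "0 < e"
  obtain u where u: "\<And>n::nat. u n \<in> Lip_b d" "\<And>n y. 0 \<le> u n y" "\<And>n y. u n y \<le> 1"
    "AE y in m. (\<lambda>n. u n y) \<longlonglongrightarrow> indicator B y" using indicator_approx[OF B] by blast
  have [measurable]: "u n \<in> borel_measurable m" for n using Lip_b_measurable u by auto
  have "(\<lambda>n. L2sq m (\<lambda>x. u n x * G x + (1 - u n x) * H x - (if x \<in> B then G x else H x)))
    \<longlonglongrightarrow> (\<integral>x. 0 \<partial>m)"
    unfolding L2sq_def
  proof (rule integral_dominated_convergence[where w = "\<lambda>x. (G x - H x)^2"])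
    show "integrable m (\<lambda>x. (G x - H x)^2)" using L2_diff[OF L1(2) L2'(2)] by auto
    show "AE x in m. (\<lambda>n. (u n x * G x + (1 - u n x) * H x - (if x \<in> B then G x else H x))^2) \<longlonglongrightarrow> 0"
      using u(4)
    proof eventually_elim
      case (elim x)
      have "(\<lambda>n. (u n x * G x + (1 - u n x) * H x - (if x \<in> B then G x else H x))^2) \<longlonglongrightarrow>
        (indicator B x * G x + (1 - indicator B x) * H x - (if x \<in> B then G x else H x))^2"
        by (intro tendsto_intros elim)
      then show ?case by (simp add: indicator_def split: if_splits)
    qed
    fix n
    show "AE x in m. norm ((u n x * G x + (1 - u n x) * H x - (if x \<in> B then G x else H x))^2) \<le> (G x - H x)^2"
    proof (rule AE_I2)
      fix x
      have *: "u n x * G x + (1 - u n x) * H x - (if x \<in> B then G x else H x)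
        = (u n x - (if x \<in> B then 1 else 0)) * (G x - H x)" by (auto simp: algebra_simps)
      have "\<bar>u n x - (if x \<in> B then 1 else 0)\<bar> \<le> 1" using u(2,3)[of n x] by auto
      then have "\<bar>(u n x - (if x \<in> B then 1 else 0)) * (G x - H x)\<bar> \<le> \<bar>G x - H x\<bar>"
        by (simp add: abs_mult mult_left_le_one_le)
      then show "norm ((u n x * G x + (1 - u n x) * H x - (if x \<in> B then G x else H x))^2) \<le> (G x - H x)^2"
        unfolding * by (simp add: abs_le_square_iff)
    qed
  qed auto
  then have "\<forall>\<^sub>F n in sequentially. L2sq m (\<lambda>x. u n x * G x + (1 - u n x) * H x - (if x \<in> B then G x else H x)) < e"
    using e by (auto dest: order_tendstoD(2))
  then obtain n where n: "L2sq m (\<lambda>x. u n x * G x + (1 - u n x) * H x - (if x \<in> B then G x else H x)) < e"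
    by (auto simp: eventually_sequentially)
  show "\<exists>f' G'. strong_slope f' G' \<and> L2sq m (\<lambda>x. f' x - f x) < e \<and>
      L2sq m (\<lambda>x. G' x - (if x \<in> B then G x else H x)) < e"
    using strong_slope_Leibniz[OF u(1-3)[of n] 1 2] n e
    by (intro exI[of _ f] exI[of _ "\<lambda>x. u n x * G x + (1 - u n x) * H x"]) (auto simp: L2sq_def)
qed

lemma strong_slope_min:
  assumes 1: "strong_slope f G" and 2: "strong_slope f H"
  shows "strong_slope f (\<lambda>x. min (G x) (H x))"
proof -
  have [measurable]: "G \<in> borel_measurable m" "H \<in> borel_measurable m" using 1 2 by (auto dest: strong_slopeD)
  have "{x\<in>space m. G x \<le> H x} \<in> sets m" by measurable
  then have B: "{x. G x \<le> H x} \<in> sets borel" by simp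
  show ?thesis using strong_slope_indicator[OF B 1 2] by (simp add: min_def)
qed

lemma slope_ball_midpoint:
  assumes F: "F \<in> Lip_b d" "F' \<in> Lip_b d" and H: "H \<in> L2 m" "H' \<in> L2 m" and f: "f \<in> L2 m"
    and le: "AE x in m. lip_a_star d m F x \<le> H x" "AE x in m. lip_a_star d m F' x \<le> H' x"
    and close: "L2sq m (\<lambda>x. F x - f x) < e" "L2sq m (\<lambda>x. F' x - f x) < e" and s: "0 \<le> s" "s \<le> 1"
  shows "\<exists>K\<in>Lip_b d. (AE x in m. lip_a_star d m K x \<le> (1 - s) * H x + s * H' x) \<and> L2sq m (\<lambda>x. K x - f x) < e"
proof (intro bexI conjI)
  show "(\<lambda>x. (1 - s) * F x + s * F' x) \<in> Lip_b d" by (intro Lip_b_lincomb F)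
  show "AE x in m. lip_a_star d m (\<lambda>x. (1 - s) * F x + s * F' x) x \<le> (1 - s) * H x + s * H' x"
    using lip_a_star_lincomb[OF F, of "1 - s" s] le
  proof eventually_elim
    case (elim x)
    then show ?case
      using mult_left_mono[OF elim(2), of "1 - s"] mult_left_mono[OF elim(3), of s] s by simp
  qed
  show "L2sq m (\<lambda>x. (1 - s) * F x + s * F' x - f x) < e"
    by (intro L2_ball_convex Lip_b_L2 F f close s)
qed

text \<open>\<open>S n\<close> collects majorants of slopes of Lipschitz functions close to
  \<open>f\<close>. Replacing a near-minimizer in \<open>S n\<close> by the
  \<open>lip_a_star\<close> below it does not increase the norm, so the minimum is a strong limit of
  true slopes \<open>lip_a_star d m (F n)\<close> and can be recognized as a relaxed slope in the
  original sense.\<close>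

lemma ex_minimal_slope:
  assumes f: "f \<in> L2 m"
    and bd: "\<And>e. 0 < e \<Longrightarrow> \<exists>F\<in>Lip_b d. L2sq m (\<lambda>x. F x - f x) < e \<and> L2sq m (lip_a_star d m F) \<le> B"
  obtains G F where "strong_slope f G" "\<And>n::nat. F n \<in> Lip_b d"
    "(\<lambda>n. L2sq m (\<lambda>x. F n x - f x)) \<longlonglongrightarrow> 0" "(\<lambda>n. L2sq m (\<lambda>x. lip_a_star d m (F n) x - G x)) \<longlonglongrightarrow> 0"
    "\<And>H. strong_slope f H \<Longrightarrow> L2sq m G \<le> L2sq m H"
proof -
  define S where "S n = {H \<in> L2 m. \<exists>F\<in>Lip_b d. (AE x in m. lip_a_star d m F x \<le> H x) \<and>
    L2sq m (\<lambda>x. F x - f x) < 1 / Suc n}" for n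
  define C where "C n = (\<lambda>H. (H, 0::real)) ` S n" for n
  define I where "I n = Inf (L2sq m ` S n)" for n
  have bb: "bdd_below (L2sq m ` S n)" for n by (rule bdd_belowI[of _ 0]) auto
  have SL: "lip_a_star d m F \<in> S n" if "F \<in> Lip_b d" "L2sq m (\<lambda>x. F x - f x) < 1 / Suc n" for F n
    using that lip_a_star_L2 by (auto simp: S_def)
  have bdn: "\<exists>F. F \<in> Lip_b d \<and> L2sq m (\<lambda>x. F x - f x) < 1 / Suc n \<and> L2sq m (lip_a_star d m F) \<le> B" for n
    using bd[of "1 / Suc n"] by auto
  have ne: "S n \<noteq> {}" for n using bdn[of n] SL by blast
  have IB: "I n \<le> B" for n
  proof -
    obtain F where F: "F \<in> Lip_b d" "L2sq m (\<lambda>x. F x - f x) < 1 / Suc n" "L2sq m (lip_a_star d m F) \<le> B"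
      using bdn by blast
    show ?thesis unfolding I_def using cInf_lower[OF imageI[OF SL[OF F(1,2)]] bb] F(3) by linarith
  qed
  have "\<exists>F. F \<in> Lip_b d \<and> L2sq m (\<lambda>x. F x - f x) < 1 / Suc n \<and> L2sq m (lip_a_star d m F) < I n + 1 / Suc n" for n
  proof -
    have "I n < I n + 1 / Suc n" by simp
    then obtain H where H: "H \<in> S n" "L2sq m H < I n + 1 / Suc n"
      using cInf_lessD[of "L2sq m ` S n"] ne unfolding I_def by blast
    then obtain F where F: "F \<in> Lip_b d" "AE x in m. lip_a_star d m F x \<le> H x" "L2sq m (\<lambda>x. F x - f x) < 1 / Suc n"
      and HL: "H \<in> L2 m" by (auto simp: S_def)
    have "L2sq m (lip_a_star d m F) \<le> L2sq m H"
      by (rule L2sq_mono[OF HL lip_a_star_measurable[OF F(1)]])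
         (use F(2) lip_a_star_nonneg[OF F(1)] in eventually_elim, auto)
    with F H show ?thesis by (intro exI[of _ F]) auto
  qed
  then obtain F where F: "\<And>n. F n \<in> Lip_b d" "\<And>n. L2sq m (\<lambda>x. F n x - f x) < 1 / Suc n"
    "\<And>n. L2sq m (lip_a_star d m (F n)) < I n + 1 / Suc n" by metis
  have Imin: "I n \<le> L2sq m H" if "H \<in> S n" for n H
    unfolding I_def using cInf_lower[OF imageI[OF that] bb] .
  have XL: "lip_a_star d m (F n) \<in> L2 m" for n by (rule lip_a_star_L2[OF F(1)])
  obtain G \<beta> where G: "G \<in> L2 m" "(\<lambda>n. L2sq m (\<lambda>x. lip_a_star d m (F n) x - G x)) \<longlonglongrightarrow> 0"
  proof (rule near_minimizers_converge[of C "\<lambda>n. lip_a_star d m (F n)" "\<lambda>_. 0" "B + 1"])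
    show "x \<in> L2 m" if "(x, b) \<in> C n" for x b n using that by (auto simp: C_def S_def)
    show "C n \<subseteq> C k" if kn: "k \<le> n" for k n
    proof -
      have "1 / real (Suc n) \<le> 1 / real (Suc k)" using kn by (intro divide_left_mono) auto
      then show ?thesis by (force simp: C_def S_def)
    qed
    show "((\<lambda>z. (x z + y z) / 2), (a + b) / 2) \<in> C n" if "(x, a) \<in> C n" "(y, b) \<in> C n" for n x a y b
    proof -
      from that have x: "x \<in> S n" "a = 0" and y: "y \<in> S n" "b = 0" by (auto simp: C_def)
      from x y obtain F1 F2 where *: "F1 \<in> Lip_b d" "F2 \<in> Lip_b d" "x \<in> L2 m" "y \<in> L2 m"
        "AE z in m. lip_a_star d m F1 z \<le> x z" "AE z in m. lip_a_star d m F2 z \<le> y z"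
        "L2sq m (\<lambda>x. F1 x - f x) < 1 / Suc n" "L2sq m (\<lambda>x. F2 x - f x) < 1 / Suc n" by (auto simp: S_def)
      have "(\<lambda>z. (1 - 1/2) * x z + 1/2 * y z) \<in> S n"
        unfolding S_def using slope_ball_midpoint[OF *(1-4) f *(5-8), of "1/2"] L2_lincomb[OF *(3,4), of "1 - 1/2" "1/2"] by auto
      then show ?thesis using x y by (auto simp: C_def field_simps)
    qed
    show "(lip_a_star d m (F n), 0) \<in> C n" for n using SL[OF F(1,2)] by (auto simp: C_def)
    show "L2sq m (lip_a_star d m (F n)) + 0^2 \<le> L2sq m x + b^2 + 1 / Suc n" if "(x, b) \<in> C n" for n x b
      using F(3)[of n] Imin[of x n] that by (auto simp: C_def)
    show "L2sq m (lip_a_star d m (F n)) + 0^2 \<le> B + 1" for n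
    proof -
      have "1 / real (Suc n) \<le> 1" by simp
      with F(3)[of n] IB[of n] show ?thesis unfolding zero_power2 by linarith
    qed
  qed blast
  have lim0: "(\<lambda>n. 1 / real (Suc n)) \<longlonglongrightarrow> 0"
    using LIMSEQ_inverse_real_of_nat by (simp add: inverse_eq_divide)
  have Ff: "(\<lambda>n. L2sq m (\<lambda>x. F n x - f x)) \<longlonglongrightarrow> 0"
    by (rule tendsto_sandwich[OF _ _ tendsto_const lim0]) (use F(2) less_imp_le in \<open>auto intro!: always_eventually\<close>)
  have sG: "strong_slope f G"
    unfolding strong_slope_def
  proof (intro conjI allI impI f G(1))
    fix e :: real assume "0 < e"
    then have "\<forall>\<^sub>F n in sequentially. L2sq m (\<lambda>x. F n x - f x) < e \<and> L2sq m (\<lambda>x. lip_a_star d m (F n) x - G x) < e"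
      using order_tendstoD(2)[OF Ff] order_tendstoD(2)[OF G(2)] by (auto intro: eventually_conj)
    then obtain n where "L2sq m (\<lambda>x. F n x - f x) < e" "L2sq m (\<lambda>x. lip_a_star d m (F n) x - G x) < e"
      by (auto simp: eventually_sequentially)
    then show "\<exists>F H. F \<in> Lip_b d \<and> H \<in> L2 m \<and> (AE x in m. lip_a_star d m F x \<le> H x) \<and>
       L2sq m (\<lambda>x. F x - f x) < e \<and> L2sq m (\<lambda>x. H x - G x) < e"
      using F(1) XL by (intro exI[of _ "F n"] exI[of _ "lip_a_star d m (F n)"]) auto
  qed
  have "L2sq m G \<le> L2sq m H" if H: "strong_slope f H" for H
  proof -
    have "\<exists>K. K \<in> S n \<and> L2sq m (\<lambda>x. K x - H x) < 1 / Suc n" for n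
    proof -
      have "0 < 1 / real (Suc n)" by simp
      from strong_slopeE[OF H this] show ?thesis unfolding S_def by blast
    qed
    then obtain K where K: "\<And>n. K n \<in> S n" "\<And>n. L2sq m (\<lambda>x. K n x - H x) < 1 / Suc n" by metis
    have "(\<lambda>n. L2sq m (\<lambda>x. K n x - H x)) \<longlonglongrightarrow> 0"
      by (rule tendsto_sandwich[OF _ _ tendsto_const lim0]) (use K(2) less_imp_le in \<open>auto intro!: always_eventually\<close>)
    then have "(\<lambda>n. L2sq m (K n)) \<longlonglongrightarrow> L2sq m H"
      by (rule L2sq_tendsto[rotated 2]) (use K(1) strong_slopeD[OF H] in \<open>auto simp: S_def\<close>)
    then have "(\<lambda>n. L2sq m (K n) + 1 / Suc n) \<longlonglongrightarrow> L2sq m H" using tendsto_add[OF _ lim0] by force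
    moreover have "(\<lambda>n. L2sq m (lip_a_star d m (F n))) \<longlonglongrightarrow> L2sq m G" by (rule L2sq_tendsto[OF XL G])
    moreover have "L2sq m (lip_a_star d m (F n)) \<le> L2sq m (K n) + 1 / Suc n" for n
      using F(3)[of n] Imin[OF K(1), of n] by linarith
    ultimately show ?thesis by (intro LIMSEQ_le) auto
  qed
  with that F(1) Ff G(2) sG show ?thesis by blast
qed

text \<open>If \<open>g\<close> were outside the strong closure, a separating functional would keep
  the pairings of all slopes of functions near \<open>f\<close> at distance \<open>e\<close> from
  that of \<open>g\<close>, against weak convergence.\<close>

lemma relaxed_slope_imp_strong_slope:
  assumes f: "f \<in> L2 m" and r: "relaxed_slope d m f G"
  shows "strong_slope f G"
proof -
  obtain g F r where g: "g \<in> L2 m" "AE x in m. g x \<le> G x" and F: "\<And>n. F n \<in> Lip_b d"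
    and lim: "L2_tendsto m F f" and r: "strict_mono r"
    and wk: "L2_weak_tendsto m (\<lambda>n. lip_a_star d m (F (r n))) g" and G: "G \<in> L2 m"
    using r unfolding relaxed_slope_def by blast
  have lim': "(\<lambda>n. L2sq m (\<lambda>x. F n x - f x)) \<longlonglongrightarrow> 0" using lim L2_tendsto_iff[OF Lip_b_L2[OF F] f] by simp
  have "strong_slope f g"
  proof (rule ccontr)
    assume "\<not> strong_slope f g"
    then obtain e where e: "0 < e" "\<And>F H. F \<in> Lip_b d \<Longrightarrow> H \<in> L2 m \<Longrightarrow> (AE x in m. lip_a_star d m F x \<le> H x) \<Longrightarrow>
       L2sq m (\<lambda>x. F x - f x) < e \<Longrightarrow> e \<le> L2sq m (\<lambda>x. H x - g x)"
      using f g unfolding strong_slope_def by (auto simp: not_less) (meson linorder_not_less)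
    define C where "C = (\<lambda>H. (H, 0::real)) ` {H \<in> L2 m. \<exists>F\<in>Lip_b d. (AE x in m. lip_a_star d m F x \<le> H x) \<and>
      L2sq m (\<lambda>x. F x - f x) < e}"
    have inC: "(lip_a_star d m K, 0) \<in> C" if "K \<in> Lip_b d" "L2sq m (\<lambda>x. K x - f x) < e" for K
      using that lip_a_star_L2 unfolding C_def by auto
    obtain N where N: "\<And>n. N \<le> n \<Longrightarrow> L2sq m (\<lambda>x. F n x - f x) < e"
      using order_tendstoD(2)[OF lim' e(1)] by (auto simp: eventually_sequentially)
    obtain h \<beta> where h: "h \<in> L2 m" "\<And>x b. (x, b) \<in> C \<Longrightarrow> e \<le> (\<integral>z. (x z - g z) * h z \<partial>m) + (b - 0) * \<beta>"
    proof (rule L2_separation[of C g e 0])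
      show "x \<in> L2 m" if "(x, b) \<in> C" for x b using that by (auto simp: C_def)
      show "C \<noteq> {}" using inC[OF F N] by blast
      show "e \<le> L2sq m (\<lambda>z. x z - g z) + (b - 0)^2" if "(x, b) \<in> C" for x b
        using that e(2) by (auto simp: C_def)
      show "((\<lambda>z. (1 - s) * x z + s * y z), (1 - s) * a + s * b) \<in> C"
        if "(x, a) \<in> C" "(y, b) \<in> C" "0 < s" "s < 1" for x a y b s
      proof -
        from that obtain F1 F2 where *: "F1 \<in> Lip_b d" "F2 \<in> Lip_b d" "x \<in> L2 m" "y \<in> L2 m"
          "AE z in m. lip_a_star d m F1 z \<le> x z" "AE z in m. lip_a_star d m F2 z \<le> y z"
          "L2sq m (\<lambda>x. F1 x - f x) < e" "L2sq m (\<lambda>x. F2 x - f x) < e" "a = 0" "b = 0" by (auto simp: C_def)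
        show ?thesis unfolding C_def
          using slope_ball_midpoint[OF *(1-4) f *(5-8), of s] L2_lincomb[OF *(3,4), of "1 - s" s] that *(9,10) by auto
      qed
    qed (use g e in auto)
    have "(\<lambda>n. (\<integral>z. lip_a_star d m (F (r n)) z * h z \<partial>m) - (\<integral>z. g z * h z \<partial>m)) \<longlonglongrightarrow> 0"
      using wk h(1) unfolding L2_weak_tendsto_def by (auto simp: LIM_zero_iff)
    moreover have "e \<le> (\<integral>z. lip_a_star d m (F (r n)) z * h z \<partial>m) - (\<integral>z. g z * h z \<partial>m)" if "N \<le> n" for n
    proof -
      have "N \<le> r n" using that seq_suble[OF r, of n] by linarith
      from h(2)[OF inC[OF F N[OF this]]]
      have "e \<le> (\<integral>z. (lip_a_star d m (F (r n)) z - g z) * h z \<partial>m)" by simp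
      then show ?thesis
        using L2_mult_integrable[OF lip_a_star_L2[OF F] h(1)] L2_mult_integrable[OF g(1) h(1)]
        by (simp add: left_diff_distrib)
    qed
    ultimately have "e \<le> 0" by (intro LIMSEQ_le_const) auto
    with e show False by simp
  qed
  then show ?thesis using G g(2) by (rule strong_slope_mono)
qed

lemma Lip_b_Ch_le:
  assumes f: "f \<in> Lip_b d" shows "Ch d m f \<le> ennreal (L2sq m (lip_a_star d m f))"
  unfolding Ch_def
proof (rule INF_lower2[of "\<lambda>_. f"])
  have "L2_tendsto m (\<lambda>_. f) f"
    by (subst L2_tendsto_iff) (use Lip_b_L2[OF f] in \<open>auto simp: L2sq_def\<close>)
  then show "(\<lambda>_. f) \<in> {F. (\<forall>n. F n \<in> Lip_b d) \<and> L2_tendsto m F f}" using f by simp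
  show "liminf (\<lambda>n. \<integral>\<^sup>+x. ennreal ((lip_a_star d m f x)^2) \<partial>m) \<le> ennreal (L2sq m (lip_a_star d m f))"
    by (simp add: nn_integral_L2sq lip_a_star_L2 f Liminf_const)
qed

lemma strong_slope_imp_D_Ch:
  assumes s: "strong_slope f G" shows "f \<in> D_Ch d m"
proof -
  note L = strong_slopeD[OF s]
  have "\<exists>F. F \<in> Lip_b d \<and> L2sq m (\<lambda>x. F x - f x) < 1 / Suc n \<and> L2sq m (lip_a_star d m F) \<le> 2 + 2 * L2sq m G" for n
  proof -
    have "0 < 1 / real (Suc n)" by simp
    from strong_slopeE[OF s this] obtain F H where 1: "F \<in> Lip_b d" "H \<in> L2 m" "AE x in m. lip_a_star d m F x \<le> H x"
      "L2sq m (\<lambda>x. F x - f x) < 1 / Suc n" "L2sq m (\<lambda>x. H x - G x) < 1 / Suc n" .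
    have "L2sq m (lip_a_star d m F) \<le> L2sq m H"
      by (rule L2sq_mono[OF 1(2) lip_a_star_measurable[OF 1(1)]])
         (use 1(3) lip_a_star_nonneg[OF 1(1)] in eventually_elim, auto)
    also have "\<dots> \<le> 2 * L2sq m (\<lambda>x. H x - G x) + 2 * L2sq m G"
      using L2sq_add_le[OF L2_diff[OF 1(2) L(2)] L(2)] by simp
    also have "\<dots> \<le> 2 * 1 + 2 * L2sq m G"
    proof -
      have "1 / real (Suc n) \<le> 1" by simp
      then show ?thesis using 1(5) by linarith
    qed
    finally show ?thesis using 1 by auto
  qed
  then obtain F where F: "\<And>n. F n \<in> Lip_b d" "\<And>n. L2sq m (\<lambda>x. F n x - f x) < 1 / Suc n"
    "\<And>n. L2sq m (lip_a_star d m (F n)) \<le> 2 + 2 * L2sq m G" by metis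
  have lim0: "(\<lambda>n. 1 / real (Suc n)) \<longlonglongrightarrow> 0"
    using LIMSEQ_inverse_real_of_nat by (simp add: inverse_eq_divide)
  have "(\<lambda>n. L2sq m (\<lambda>x. F n x - f x)) \<longlonglongrightarrow> 0"
    by (rule tendsto_sandwich[OF _ _ tendsto_const lim0]) (use F(2) less_imp_le in \<open>auto intro!: always_eventually\<close>)
  then have "L2_tendsto m F f" using L2_tendsto_iff[OF Lip_b_L2[OF F(1)] L(1)] by simp
  then have "Ch d m f \<le> liminf (\<lambda>n. \<integral>\<^sup>+x. ennreal ((lip_a_star d m (F n) x)^2) \<partial>m)"
    unfolding Ch_def using F by (intro INF_lower) auto
  also have "\<dots> \<le> limsup (\<lambda>n. \<integral>\<^sup>+x. ennreal ((lip_a_star d m (F n) x)^2) \<partial>m)"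
    by (rule Liminf_le_Limsup) simp
  also have "\<dots> \<le> ennreal (2 + 2 * L2sq m G)"
    by (rule Limsup_bounded) (auto simp: nn_integral_L2sq lip_a_star_L2 F simp del: ennreal_plus intro!: always_eventually ennreal_leI)
  also have "\<dots> < top" by simp
  finally show ?thesis using L by (simp add: D_Ch_def)
qed

text \<open>The minimal strong slope is itself a relaxed slope, with the whole sequence as its
  subsequence, while every relaxed slope is strong. Hence the minimum in \<open>wgrad\<close> is
  attained and is the same for both notions.\<close>

lemma wgrad_minimal:
  assumes f: "f \<in> D_Ch d m"
  shows "strong_slope f (wgrad d m f)" "strong_slope f H \<Longrightarrow> L2sq m (wgrad d m f) \<le> L2sq m H"
proof -
  have fL: "f \<in> L2 m" and "Ch d m f < top" using f by (auto simp: D_Ch_def)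
  then obtain F where F: "\<And>n. F n \<in> Lip_b d" "L2_tendsto m F f"
    and fin: "liminf (\<lambda>n. \<integral>\<^sup>+x. ennreal ((lip_a_star d m (F n) x)^2) \<partial>m) < top"
    unfolding Ch_def INF_less_iff by auto
  have lim: "(\<lambda>n. L2sq m (\<lambda>x. F n x - f x)) \<longlonglongrightarrow> 0" using F(2) L2_tendsto_iff[OF Lip_b_L2[OF F(1)] fL] by simp
  have fin': "liminf (\<lambda>n. ennreal (L2sq m (lip_a_star d m (F n)))) < top"
    using fin by (simp add: nn_integral_L2sq lip_a_star_L2 F(1))
  obtain B where B: "0 \<le> B" "liminf (\<lambda>n. ennreal (L2sq m (lip_a_star d m (F n)))) < ennreal B"
  proof -
    obtain l where "0 \<le> l" "liminf (\<lambda>n. ennreal (L2sq m (lip_a_star d m (F n)))) = ennreal l"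
      using fin' by (cases "liminf (\<lambda>n. ennreal (L2sq m (lip_a_star d m (F n))))" rule: ennreal_cases) auto
    then show ?thesis using that[of "l + 1"] by (simp add: ennreal_less_iff del: ennreal_plus)
  qed
  \<comment> \<open>Otherwise the energies of all \<open>F n\<close> close to \<open>f\<close> would
    be at least \<open>B\<close>, and so would their lower limit. Finiteness of the lower limit thus
    gives functions of bounded energy arbitrarily close to \<open>f\<close>.\<close>
  have bd: "\<exists>F\<in>Lip_b d. L2sq m (\<lambda>x. F x - f x) < e \<and> L2sq m (lip_a_star d m F) \<le> B" if e: "0 < e" for e
  proof (rule ccontr)
    assume neg: "\<not> ?thesis"
    have "\<forall>\<^sub>F n in sequentially. ennreal B \<le> ennreal (L2sq m (lip_a_star d m (F n)))"
      using order_tendstoD(2)[OF lim e]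
    proof eventually_elim
      case (elim n)
      then have "B \<le> L2sq m (lip_a_star d m (F n))" using neg F(1) by force
      then show ?case by (rule ennreal_leI)
    qed
    then have "ennreal B \<le> liminf (\<lambda>n. ennreal (L2sq m (lip_a_star d m (F n))))" by (rule Liminf_bounded)
    with B show False by simp
  qed
  obtain G K where G: "strong_slope f G" and K: "\<And>n::nat. K n \<in> Lip_b d"
    "(\<lambda>n. L2sq m (\<lambda>x. K n x - f x)) \<longlonglongrightarrow> 0" "(\<lambda>n. L2sq m (\<lambda>x. lip_a_star d m (K n) x - G x)) \<longlonglongrightarrow> 0"
    and min: "\<And>H. strong_slope f H \<Longrightarrow> L2sq m G \<le> L2sq m H"
    using ex_minimal_slope[OF fL bd] by blast
  note GL = strong_slopeD(2)[OF G]
  have "relaxed_slope d m f G"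
    unfolding relaxed_slope_def
  proof (intro conjI exI)
    show "L2_tendsto m K f" using K(2) L2_tendsto_iff[OF Lip_b_L2[OF K(1)] fL] by simp
    show "strict_mono (id :: nat \<Rightarrow> nat)" by (simp add: strict_mono_def)
    show "L2_weak_tendsto m (\<lambda>n. lip_a_star d m (K (id n))) G"
      unfolding L2_weak_tendsto_def id_apply
      by (intro ballI L2_tendsto_ip[OF lip_a_star_L2[OF K(1)] GL _ K(3)])
  qed (use GL K in auto)
  moreover have "L2norm m G \<le> L2norm m H" if "relaxed_slope d m f H" for H
  proof -
    have H: "strong_slope f H" by (rule relaxed_slope_imp_strong_slope[OF fL that])
    show ?thesis using min[OF H] strong_slopeD(2)[OF H] GL by (simp add: L2norm_eq ennreal_leI)
  qed
  ultimately have ex: "relaxed_slope d m f G \<and> (\<forall>H. relaxed_slope d m f H \<longrightarrow> L2norm m G \<le> L2norm m H)" by blast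
  have w: "relaxed_slope d m f (wgrad d m f) \<and> (\<forall>H. relaxed_slope d m f H \<longrightarrow> L2norm m (wgrad d m f) \<le> L2norm m H)"
    unfolding wgrad_def by (rule someI[of "\<lambda>G. relaxed_slope d m f G \<and> (\<forall>H. relaxed_slope d m f H \<longrightarrow> L2norm m G \<le> L2norm m H)", OF ex])
  show s: "strong_slope f (wgrad d m f)" by (rule relaxed_slope_imp_strong_slope[OF fL]) (use w in blast)
  assume "strong_slope f H"
  from min[OF this] have "L2sq m G \<le> L2sq m H" .
  moreover have "L2norm m (wgrad d m f) \<le> L2norm m G" using w ex by blast
  then have "L2sq m (wgrad d m f) \<le> L2sq m G" using strong_slopeD(2)[OF s] GL by (simp add: L2norm_eq)
  ultimately show "L2sq m (wgrad d m f) \<le> L2sq m H" by linarith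
qed

lemma wgrad_L2: "f \<in> D_Ch d m \<Longrightarrow> wgrad d m f \<in> L2 m"
  using wgrad_minimal(1) strong_slopeD by blast

lemma wgrad_nonneg: "f \<in> D_Ch d m \<Longrightarrow> AE x in m. 0 \<le> wgrad d m f x"
  using wgrad_minimal(1) strong_slope_nonneg by blast

text \<open>From minimal norm to pointwise minimality: the minimum of \<open>wgrad\<close> and
  \<open>G\<close> is again a slope, and its norm is not smaller only if it equals
  \<open>wgrad\<close> almost everywhere.\<close>

lemma wgrad_le_slope:
  assumes s: "strong_slope f G" shows "AE x in m. wgrad d m f x \<le> G x"
proof -
  have f: "f \<in> D_Ch d m" by (rule strong_slope_imp_D_Ch[OF s])
  define w where "w = wgrad d m f"
  have w: "strong_slope f w" unfolding w_def by (rule wgrad_minimal[OF f])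
  define k where "k x = min (w x) (G x)" for x
  have k: "strong_slope f k" unfolding k_def by (rule strong_slope_min[OF w s])
  note L = strong_slopeD(2)[OF w] strong_slopeD(2)[OF k]
  have le: "AE x in m. (k x)^2 \<le> (w x)^2"
    using strong_slope_nonneg[OF k] by eventually_elim (auto simp: k_def intro!: power_mono)
  have "L2sq m w \<le> L2sq m k" unfolding w_def by (rule wgrad_minimal(2)[OF f k])
  then have "(\<integral>x. (w x)^2 - (k x)\<^sup>2 \<partial>m) \<le> 0" using L by (simp add: L2sq_def L2D)
  moreover have "0 \<le> (\<integral>x. (w x)^2 - (k x)\<^sup>2 \<partial>m)" using le by (intro integral_nonneg_AE) auto
  ultimately have "(\<integral>x. (w x)^2 - (k x)\<^sup>2 \<partial>m) = 0" by simp
  then have "AE x in m. (w x)^2 - (k x)\<^sup>2 = 0"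
    using le L by (subst (asm) integral_nonneg_eq_0_iff_AE) auto
  then show ?thesis unfolding w_def[symmetric] using strong_slope_nonneg[OF k] strong_slope_nonneg[OF w]
  proof eventually_elim
    case (elim x)
    then have "w x = k x" by (simp add: power2_eq_iff_nonneg)
    then show ?case by (simp add: k_def)
  qed
qed

lemma A_ChI:
  assumes "strong_slope f G" "AE x in m. \<bar>f x\<bar> \<le> C" "AE x in m. G x \<le> C"
  shows "f \<in> A_Ch d m"
proof -
  have f: "f \<in> D_Ch d m" by (rule strong_slope_imp_D_Ch[OF assms(1)])
  have "AE x in m. \<bar>f x\<bar> \<le> C \<and> \<bar>wgrad d m f x\<bar> \<le> C"
    using assms(2,3) wgrad_le_slope[OF assms(1)] wgrad_nonneg[OF f] by eventually_elim auto
  then show ?thesis using f by (auto simp: A_Ch_def)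
qed

lemma Lip_b_A_Ch:
  assumes f: "f \<in> Lip_b d" shows "f \<in> A_Ch d m"
proof -
  obtain C L where L: "\<And>x. \<bar>f x\<bar> \<le> C" "0 \<le> L" "\<And>x y. d x y < top \<Longrightarrow> \<bar>f x - f y\<bar> \<le> L * enn2real (d x y)"
    using f by (rule Lip_bE) blast
  show ?thesis
  proof (rule A_ChI[OF Lip_b_strong_slope[OF f]])
    show "AE x in m. \<bar>f x\<bar> \<le> max C L" using L(1) by (auto simp: le_max_iff_disj)
    show "AE x in m. lip_a_star d m f x \<le> max C L"
    proof -
      have "AE x in m. \<bar>lip_a_star d m f x\<bar> \<le> L" by (rule lip_a_star_bounded[OF f]) (use L in auto)
      then show ?thesis by eventually_elim auto
    qed
  qed
qed

lemma wgrad_le_lip_a_star: "f \<in> Lip_b d \<Longrightarrow> AE x in m. wgrad d m f x \<le> lip_a_star d m f x"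
  by (intro wgrad_le_slope Lip_b_strong_slope)

end

section \<open>Regularization in time\<close>

context ext_mm_space begin

text \<open>The weight lies between two positive constants, so the measure with density
  \<open>\<psi>\<close> has the same square-integrable functions with an equivalent norm. The
  weighted energy becomes a squared Hilbert norm, to which the projection argument applies.\<close>

lemma weighted_slope_lsc:
  assumes \<psi>: "\<psi> \<in> borel_measurable m" "\<And>x. c \<le> \<psi> x" "\<And>x. \<psi> x \<le> C" and c: "0 < c"
    and f: "f \<in> L2 m"
    and close: "\<And>e. 0 < e \<Longrightarrow> \<exists>g G. strong_slope g G \<and> L2sq m (\<lambda>x. g x - f x) < e \<and> (\<integral>x. \<psi> x * (G x)^2 \<partial>m) \<le> b + e"
  shows "\<exists>G. strong_slope f G \<and> (\<integral>x. \<psi> x * (G x)^2 \<partial>m) \<le> b"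
proof -
  note [measurable] = \<psi>(1)
  have \<psi>0: "0 \<le> \<psi> x" for x using \<psi>(2)[of x] c by linarith
  define M where "M = density m (\<lambda>x. ennreal (\<psi> x))"
  interpret M: finite_measure M
  proof (rule finite_measureI)
    have "emeasure M (space M) = (\<integral>\<^sup>+x. ennreal (\<psi> x) \<partial>m)" by (simp add: M_def emeasure_density)
    also have "\<dots> \<le> (\<integral>\<^sup>+x. ennreal C \<partial>m)" by (intro nn_integral_mono ennreal_leI \<psi>)
    also have "\<dots> < top" using emeasure_space_1 by simp
    finally show "emeasure M (space M) \<noteq> \<infinity>" by simp
  qed
  have int_iff: "integrable M g \<longleftrightarrow> integrable m (\<lambda>x. \<psi> x * g x)" if "g \<in> borel_measurable m" for g :: "'a \<Rightarrow> real"
    unfolding M_def using that \<psi>0 by (subst integrable_density) auto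
  have L2M: "G \<in> L2 M" if G: "G \<in> L2 m" for G
  proof -
    have [measurable]: "G \<in> borel_measurable m" using L2D(1)[OF G] .
    have i: "integrable m (\<lambda>x. \<psi> x * (G x)^2)"
    proof (rule Bochner_Integration.integrable_bound)
      show "integrable m (\<lambda>x. C * (G x)^2)" using G by auto
      show "AE x in m. norm (\<psi> x * (G x)^2) \<le> norm (C * (G x)^2)"
      proof (rule AE_I2)
        fix x
        have "\<psi> x \<le> \<bar>C\<bar>" using \<psi>(3)[of x] by linarith
        then show "norm (\<psi> x * (G x)^2) \<le> norm (C * (G x)^2)"
          using \<psi>0[of x] by (auto simp: abs_mult intro: mult_right_mono)
      qed
    qed measurable
    have "(\<lambda>x. (G x)^2) \<in> borel_measurable m" by measurable
    from int_iff[OF this] i have "integrable M (\<lambda>x. (G x)^2)" by simp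
    then show ?thesis by (simp add: L2_def M_def)
  qed
  have L2m: "G \<in> L2 m" if G: "G \<in> L2 M" for G
  proof -
    have [measurable]: "G \<in> borel_measurable m" using L2D(1)[OF G] by (simp add: M_def)
    have i: "integrable m (\<lambda>x. \<psi> x * (G x)^2)" using L2D(2)[OF G] by (subst int_iff[symmetric]) auto
    have "integrable m (\<lambda>x. (G x)^2)"
    proof (rule Bochner_Integration.integrable_bound[OF integrable_mult_right[OF i, of "1/c"]])
      show "AE x in m. norm ((G x)^2) \<le> norm (1 / c * (\<psi> x * (G x)^2))"
      proof (rule AE_I2)
        fix x
        have "1 * (G x)^2 \<le> (\<psi> x / c) * (G x)^2" using \<psi>(2)[of x] c by (intro mult_right_mono) auto
        then show "norm ((G x)^2) \<le> norm (1 / c * (\<psi> x * (G x)^2))" using \<psi>0[of x] c by (simp add: abs_mult)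
      qed
    qed auto
    then show ?thesis by (simp add: L2_def)
  qed
  have sqM: "L2sq M G = (\<integral>x. \<psi> x * (G x)^2 \<partial>m)" if "G \<in> L2 m" for G
    unfolding L2sq_def M_def using L2D(1)[OF that] \<psi>0 by (subst integral_density) auto
  have cle: "c * L2sq m G \<le> L2sq M G" if G: "G \<in> L2 m" for G
  proof -
    have "c * L2sq m G = (\<integral>x. c * (G x)^2 \<partial>m)" by (simp add: L2sq_def)
    also have "\<dots> \<le> (\<integral>x. \<psi> x * (G x)^2 \<partial>m)"
    proof (rule integral_mono)
      have "(\<lambda>x. (G x)^2) \<in> borel_measurable m" using L2D(1)[OF G] by measurable
      from int_iff[OF this] show "integrable m (\<lambda>x. \<psi> x * (G x)^2)" using L2D(2)[OF L2M[OF G]] by simp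
    qed (use L2D(2)[OF G] \<psi>(2) in \<open>auto intro!: mult_right_mono\<close>)
    finally show ?thesis using sqM[OF G] by simp
  qed
  define S where "S n = {G. \<exists>g. strong_slope g G \<and> L2sq m (\<lambda>x. g x - f x) < 1 / Suc n}" for n
  have SL: "G \<in> L2 m" if "G \<in> S n" for G n using that by (auto simp: S_def dest: strong_slopeD)
  have bdn: "\<exists>G\<in>S n. L2sq M G \<le> b + 1 / Suc n" for n
  proof -
    have "0 < 1 / real (Suc n)" by simp
    from close[OF this] obtain g G where "strong_slope g G" "L2sq m (\<lambda>x. g x - f x) < 1 / Suc n"
      "(\<integral>x. \<psi> x * (G x)^2 \<partial>m) \<le> b + 1 / Suc n" by blast
    then show ?thesis using sqM strong_slopeD(2) by (intro bexI[of _ G]) (auto simp: S_def)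
  qed
  define I where "I n = Inf (L2sq M ` S n)" for n
  have bb: "bdd_below (L2sq M ` S n)" for n by (rule bdd_belowI[of _ 0]) auto
  have Imin: "I n \<le> L2sq M G" if "G \<in> S n" for G n
    unfolding I_def using cInf_lower[OF imageI[OF that] bb] .
  have Ib: "I n \<le> b + 1 / Suc n" for n using bdn[of n] Imin by force
  have "\<exists>G. G \<in> S n \<and> L2sq M G < I n + 1 / Suc n" for n
  proof -
    have "I n < I n + 1 / Suc n" by simp
    moreover have "L2sq M ` S n \<noteq> {}" using bdn[of n] by auto
    ultimately show ?thesis using cInf_lessD[of "L2sq M ` S n"] unfolding I_def by blast
  qed
  then obtain X where X: "\<And>n. X n \<in> S n" "\<And>n. L2sq M (X n) < I n + 1 / Suc n" by metis
  obtain v \<beta> where v: "v \<in> L2 M" "(\<lambda>n. L2sq M (\<lambda>x. X n x - v x)) \<longlonglongrightarrow> 0"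
  proof (rule M.near_minimizers_converge[of "\<lambda>n. (\<lambda>G. (G, 0::real)) ` S n" X "\<lambda>_. 0" "b + 2"])
    show "x \<in> L2 M" if "(x, r) \<in> (\<lambda>G. (G, 0::real)) ` S n" for x r n using that SL L2M by auto
    show "(\<lambda>G. (G, 0::real)) ` S n \<subseteq> (\<lambda>G. (G, 0::real)) ` S k" if kn: "k \<le> n" for k n
    proof -
      have "1 / real (Suc n) \<le> 1 / real (Suc k)" using kn by (intro divide_left_mono) auto
      then show ?thesis by (force simp: S_def)
    qed
    show "((\<lambda>z. (x z + y z) / 2), (r + s) / 2) \<in> (\<lambda>G. (G, 0::real)) ` S n"
      if "(x, r) \<in> (\<lambda>G. (G, 0::real)) ` S n" "(y, s) \<in> (\<lambda>G. (G, 0::real)) ` S n" for n x r y s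
    proof -
      from that obtain g h where *: "strong_slope g x" "strong_slope h y"
        "L2sq m (\<lambda>x. g x - f x) < 1 / Suc n" "L2sq m (\<lambda>x. h x - f x) < 1 / Suc n" "r = 0" "s = 0"
        by (auto simp: S_def)
      have "(\<lambda>z. (1 - 1/2) * x z + 1/2 * y z) \<in> S n"
        unfolding S_def
        using strong_slope_convex[OF *(1,2), of "1/2"]
          L2_ball_convex[OF strong_slopeD(1)[OF *(1)] strong_slopeD(1)[OF *(2)] f *(3,4), of "1/2"] by auto
      then show ?thesis using *(5,6) by (auto simp: field_simps)
    qed
    show "(X n, 0) \<in> (\<lambda>G. (G, 0::real)) ` S n" for n using X by auto
    show "L2sq M (X n) + 0^2 \<le> L2sq M x + r^2 + 1 / Suc n" if "(x, r) \<in> (\<lambda>G. (G, 0::real)) ` S n" for n x r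
      using X(2)[of n] Imin[of x n] that by auto
    show "L2sq M (X n) + 0^2 \<le> b + 2" for n
    proof -
      have "1 / real (Suc n) \<le> 1" by simp
      with X(2)[of n] Ib[of n] show ?thesis unfolding zero_power2 by linarith
    qed
  qed blast
  have vL: "v \<in> L2 m" by (rule L2m[OF v(1)])
  note XL = SL[OF X(1)]
  have L0: "(\<lambda>n. L2sq M (\<lambda>x. X n x - v x) / c) \<longlonglongrightarrow> 0"
    using tendsto_divide[OF v(2) tendsto_const, of c] c by simp
  have vlim: "(\<lambda>n. L2sq m (\<lambda>x. X n x - v x)) \<longlonglongrightarrow> 0"
    by (rule tendsto_sandwich[OF _ _ tendsto_const L0])
       (use cle[OF L2_diff[OF XL vL]] c in \<open>auto intro!: always_eventually simp: field_simps\<close>)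
  have lim0: "(\<lambda>n. 1 / real (Suc n)) \<longlonglongrightarrow> 0"
    using LIMSEQ_inverse_real_of_nat by (simp add: inverse_eq_divide)
  have "strong_slope f v"
  proof (rule strong_slope_closed[OF f vL])
    fix e :: real assume "0 < e"
    then have "\<forall>\<^sub>F n in sequentially. 1 / real (Suc n) < e \<and> L2sq m (\<lambda>x. X n x - v x) < e"
      using order_tendstoD(2)[OF lim0] order_tendstoD(2)[OF vlim] by (auto intro: eventually_conj)
    then obtain n where n: "1 / real (Suc n) < e" "L2sq m (\<lambda>x. X n x - v x) < e"
      by (auto simp: eventually_sequentially)
    obtain g where "strong_slope g (X n)" "L2sq m (\<lambda>x. g x - f x) < 1 / Suc n"
      using X(1)[of n] by (auto simp: S_def)
    then show "\<exists>f' G'. strong_slope f' G' \<and> L2sq m (\<lambda>x. f' x - f x) < e \<and> L2sq m (\<lambda>x. G' x - v x) < e"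
      using n by (intro exI[of _ g] exI[of _ "X n"]) auto
  qed
  moreover have "L2sq M v \<le> b"
  proof (rule LIMSEQ_le)
    show "(\<lambda>n. L2sq M (X n)) \<longlonglongrightarrow> L2sq M v" by (rule L2sq_tendsto[OF L2M[OF XL] v])
    show "(\<lambda>n. b + 1 / Suc n + 1 / Suc n) \<longlonglongrightarrow> b"
      using tendsto_add[OF tendsto_add[OF tendsto_const lim0] lim0, of b] by simp
    show "\<exists>N. \<forall>n\<ge>N. L2sq M (X n) \<le> b + 1 / Suc n + 1 / Suc n"
      using X(2) Ib by (meson add_right_mono less_imp_le order_trans)
  qed
  ultimately show ?thesis using sqM[OF vL] by auto
qed

end

text \<open>Time has a countable base and \<open>X\<close> may have none; one countable base is
  enough. It makes potentials that are Borel on the product space measurable for the product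
  sigma-algebra, as Fubini's theorem demands.\<close>

lemma sets_borel_prod_subset:
  "sets (borel :: ('b::second_countable_topology \<times> 'c::topological_space) measure) \<subseteq> sets (borel \<Otimes>\<^sub>M borel)"
proof -
  have "U \<in> sets (borel \<Otimes>\<^sub>M borel)" if U: "open U" for U :: "('b \<times> 'c) set"
  proof -
    obtain B :: "'b set set" where B: "countable B" "topological_basis B" using ex_countable_basis by blast
    \<comment> \<open>Collecting all open partners of \<open>b\<close> in a single open set leaves a
      union over the countable base only.\<close>
    define W where "W b = \<Union>{V. open V \<and> b \<times> V \<subseteq> U}" for b
    have "U = (\<Union>b\<in>B. b \<times> W b)"
    proof (intro equalityI subsetI)
      fix p assume p: "p \<in> U"
      obtain A V where A: "open A" "open V" "p \<in> A \<times> V" "A \<times> V \<subseteq> U" using open_prod_elim[OF U p] by blast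
      have "fst p \<in> A" using A(3) by auto
      then obtain b where b: "b \<in> B" "fst p \<in> b" "b \<subseteq> A"
        using topological_basisE[OF B(2) A(1)] by metis
      have "V \<subseteq> W b" unfolding W_def using A b by blast
      then show "p \<in> (\<Union>b\<in>B. b \<times> W b)" using b A(3) by (auto simp: mem_Times_iff)
    qed (auto simp: W_def)
    moreover have m1: "b \<times> W b \<in> sets (borel \<Otimes>\<^sub>M borel)" if "b \<in> B" for b
      using topological_basis_open[OF B(2) that] by (intro pair_measureI borel_open) (auto simp: W_def)
    have "(\<Union>b\<in>B. b \<times> W b) \<in> sets (borel \<Otimes>\<^sub>M borel)"
      by (rule sets.countable_UN'[OF B(1)]) (use m1 in auto)
    ultimately show ?thesis by simp
  qed
  then have "sigma_sets (space (borel \<Otimes>\<^sub>M borel :: ('b \<times> 'c) measure)) {U. open U} \<subseteq> sets (borel \<Otimes>\<^sub>M borel)"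
    by (intro sets.sigma_sets_subset) auto
  moreover have "sets (borel :: ('b \<times> 'c) measure) = sigma_sets UNIV {U. open U}"
    unfolding borel_def by (rule sets_measure_of) simp
  ultimately show ?thesis by (simp add: space_pair_measure)
qed

section \<open>Test functions and integrals on the unit interval\<close>

lemma test_fun_01E:
  assumes "test_fun_01 \<eta>"
  obtains a b where "0 < a" "b < 1" "\<And>t. t \<notin> {a..b} \<Longrightarrow> \<eta> t = 0" "\<And>t. t \<notin> {a..b} \<Longrightarrow> deriv \<eta> t = 0"
    "\<And>t. (\<eta> has_real_derivative deriv \<eta> t) (at t)" "continuous_on UNIV \<eta>" "continuous_on UNIV (deriv \<eta>)"
proof -
  obtain a b where ab: "0 < a" "b < 1" "\<And>t. t \<notin> {a..b} \<Longrightarrow> \<eta> t = 0" using assms unfolding test_fun_01_def by blast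
  have d: "((deriv ^^ n) \<eta>) differentiable (at t)" for n t using assms unfolding test_fun_01_def by blast
  have D: "(\<eta> has_real_derivative deriv \<eta> t) (at t)" for t
    using d[of 0 t] by (simp add: DERIV_deriv_iff_real_differentiable)
  have "continuous_on UNIV \<eta>" using D by (auto intro!: continuous_at_imp_continuous_on DERIV_isCont)
  moreover have "continuous_on UNIV (deriv \<eta>)"
    using d[of 1] by (auto intro!: continuous_at_imp_continuous_on differentiable_imp_continuous_within)
  moreover have "deriv \<eta> t = 0" if t: "t \<notin> {a..b}" for t
  proof -
    have "open (- {a..b})" by auto
    then have "\<forall>\<^sub>F s in nhds t. \<eta> s = 0"
      using t ab(3) unfolding eventually_nhds by (intro exI[of _ "- {a..b}"]) auto
    then have "deriv \<eta> t = deriv (\<lambda>_. 0) t" by (intro deriv_cong_ev) auto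
    then show ?thesis by simp
  qed
  ultimately show ?thesis using that ab D by blast
qed

lemma integrable_compact_support:
  fixes g :: "real \<Rightarrow> real"
  assumes "continuous_on UNIV g" "\<And>t. t \<notin> {a..b} \<Longrightarrow> g t = 0"
  shows "integrable lborel g"
proof -
  have "integrable lborel (\<lambda>t. indicator {a..b} t *\<^sub>R g t)"
    by (rule borel_integrable_compact) (use assms in \<open>auto intro: continuous_on_subset\<close>)
  moreover have "(\<lambda>t. indicator {a..b} t *\<^sub>R g t) = g"
  proof
    show "indicator {a..b} t *\<^sub>R g t = g t" for t using assms(2)[of t] by (cases "t \<in> {a..b}") auto
  qed
  ultimately show ?thesis by (simp only:)
qed

lemma ennreal_integral_le:
  assumes "integrable M f" shows "ennreal (\<integral>x. f x \<partial>M) \<le> (\<integral>\<^sup>+x. ennreal (f x) \<partial>M)"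
proof -
  have "ennreal (\<integral>x. f x \<partial>M) \<le> ennreal (\<integral>x. max 0 (f x) \<partial>M)"
    using assms by (intro ennreal_leI integral_mono) auto
  also have "\<dots> = (\<integral>\<^sup>+x. ennreal (max 0 (f x)) \<partial>M)"
    using assms by (intro nn_integral_eq_integral[symmetric]) auto
  also have "\<dots> = (\<integral>\<^sup>+x. ennreal (f x) \<partial>M)" by (simp add: ennreal_max_0)
  finally show ?thesis .
qed

lemma integral_lebesgue_on_01:
  fixes g :: "real \<Rightarrow> real"
  assumes "g \<in> borel_measurable borel" "\<And>t. t \<notin> {0<..<1} \<Longrightarrow> g t = 0" "\<And>t. t \<in> {0<..<1} \<Longrightarrow> f t = g t"
  shows "(\<integral>t. f t \<partial>lebesgue_on {0<..<1}) = (\<integral>t. g t \<partial>lborel)"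
proof -
  have "(\<integral>t. f t \<partial>lebesgue_on {0<..<1}) = (\<integral>t. g t \<partial>lebesgue_on {0<..<1})"
    using assms(3) by (intro Bochner_Integration.integral_cong) auto
  also have "\<dots> = (\<integral>t. indicator {0<..<1} t *\<^sub>R g t \<partial>lebesgue)" by (subst integral_restrict_space) auto
  also have "(\<lambda>t. indicator {0<..<1} t *\<^sub>R g t) = g"
  proof
    show "indicator {0<..<1} t *\<^sub>R g t = g t" for t using assms(2)[of t] by (cases "t \<in> {0<..<1}") auto
  qed
  also have "(\<integral>t. g t \<partial>lebesgue) = (\<integral>t. g t \<partial>lborel)" using assms(1) by (intro integral_completion) simp
  finally show ?thesis .
qed

lemma nn_integral_lebesgue_on_01:
  fixes g :: "real \<Rightarrow> ennreal"
  assumes "g \<in> borel_measurable borel" "\<And>t. t \<notin> {0<..<1} \<Longrightarrow> g t = 0"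
  shows "(\<integral>\<^sup>+t. g t \<partial>lebesgue_on {0<..<1}) = (\<integral>\<^sup>+t. g t \<partial>lborel)"
proof -
  have "(\<integral>\<^sup>+t. g t \<partial>lebesgue_on {0<..<1}) = (\<integral>\<^sup>+t. g t * indicator {0<..<1} t \<partial>lebesgue)"
    by (subst nn_integral_restrict_space) auto
  also have "(\<lambda>t. g t * indicator {0<..<1} t) = g"
  proof
    show "g t * indicator {0<..<1} t = g t" for t using assms(2)[of t] by (cases "t \<in> {0<..<1}") auto
  qed
  also have "(\<integral>\<^sup>+t. g t \<partial>lebesgue) = (\<integral>\<^sup>+t. g t \<partial>lborel)" by (rule nn_integral_completion)
  finally show ?thesis .
qed

section \<open>Time averages of an admissible potential\<close>

locale dual_potential = ext_mm_space +
  fixes \<phi> :: "real \<Rightarrow> 'a \<Rightarrow> real"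
  assumes admissible: "\<phi> \<in> dual_admissible d m"
begin

text \<open>The potential is unconstrained outside [0, 1]; cutting it off there makes it Borel and
  bounded on the whole line times \<open>X\<close>.\<close>

definition \<Phi> :: "real \<Rightarrow> 'a \<Rightarrow> real" where
  "\<Phi> t x = indicator {0..1} t * \<phi> t x"

text \<open>The kernel is arbitrary because averages against a test function and against its
  derivative are both needed: the latter is minus the derivative of the former under translation of
  the kernel.\<close>

definition time_avg :: "(real \<Rightarrow> real) \<Rightarrow> 'a \<Rightarrow> real" where
  "time_avg \<kappa> x = (\<integral>t. \<kappa> t * \<Phi> t x \<partial>lborel)"

lemma \<Phi>_bounded: obtains C where "0 \<le> C" "\<And>t x. \<bar>\<Phi> t x\<bar> \<le> C"
proof -
  obtain C where C: "\<And>t x. t \<in> {0..1} \<Longrightarrow> \<bar>\<phi> t x\<bar> \<le> C" using admissible unfolding dual_admissible_def by blast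
  have C0: "0 \<le> C" using C[of 0 undefined] by (auto intro: order_trans[OF abs_ge_zero])
  then show ?thesis using C by (intro that[of C]) (auto simp: \<Phi>_def indicator_def)
qed

lemma \<Phi>_measurable_pair: "(\<lambda>p. \<Phi> (fst p) (snd p)) \<in> borel_measurable (lborel \<Otimes>\<^sub>M m)"
proof -
  have "(\<lambda>(t, x). \<phi> t x) \<in> borel_measurable (restrict_space borel ({0..1} \<times> UNIV))"
    using admissible unfolding dual_admissible_def by blast
  moreover have "{0..1::real} \<times> (UNIV :: 'a set) \<in> sets borel" by (intro borel_closed closed_Times) auto
  ultimately have "(\<lambda>p. indicator ({0..1} \<times> UNIV) p *\<^sub>R (case p of (t, x) \<Rightarrow> \<phi> t x)) \<in> borel_measurable borel"
    by (subst (asm) borel_measurable_restrict_space_iff) auto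
  moreover have "(\<lambda>p. indicator ({0..1} \<times> UNIV) p *\<^sub>R (case p of (t, x) \<Rightarrow> \<phi> t x)) = (\<lambda>p. \<Phi> (fst p) (snd p))"
    by (auto simp: \<Phi>_def indicator_def split_beta mem_Times_iff)
  ultimately have "(\<lambda>p. \<Phi> (fst p) (snd p)) \<in> borel_measurable borel" by simp
  moreover have "borel_measurable (borel :: (real \<times> 'a) measure) \<subseteq> (borel_measurable (lborel \<Otimes>\<^sub>M m) :: ((real \<times> 'a) \<Rightarrow> real) set)"
  proof (rule measurable_mono)
    have "sets (lborel \<Otimes>\<^sub>M m) = sets (borel \<Otimes>\<^sub>M borel :: (real \<times> 'a) measure)" by (rule sets_pair_measure_cong) auto
    then show "sets (borel :: (real \<times> 'a) measure) \<subseteq> sets (lborel \<Otimes>\<^sub>M m)" using sets_borel_prod_subset by blast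
  qed (auto simp: space_pair_measure)
  ultimately show ?thesis by blast
qed

lemma \<Phi>_measurable [measurable (raw)]:
  assumes "f \<in> measurable N borel" "g \<in> measurable N m"
  shows "(\<lambda>\<omega>. \<Phi> (f \<omega>) (g \<omega>)) \<in> borel_measurable N"
proof -
  have "f \<in> measurable N lborel" using assms(1) by simp
  from measurable_compose[OF measurable_Pair[OF this assms(2)] \<Phi>_measurable_pair] show ?thesis by simp
qed

lemma time_avg_measurable [measurable]:
  assumes [measurable]: "\<kappa> \<in> borel_measurable borel" shows "time_avg \<kappa> \<in> borel_measurable m"
  unfolding time_avg_def by measurable

lemma time_avg_integrable: "integrable lborel \<kappa> \<Longrightarrow> integrable lborel (\<lambda>t. \<kappa> t * \<Phi> t x)"
proof -
  assume \<kappa>: "integrable lborel \<kappa>"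
  obtain C where C: "0 \<le> C" "\<And>t x. \<bar>\<Phi> t x\<bar> \<le> C" using \<Phi>_bounded by blast
  have [measurable]: "\<kappa> \<in> borel_measurable borel" using \<kappa> by auto
  have [measurable]: "(\<lambda>t. \<Phi> t x) \<in> borel_measurable borel" by measurable
  have "\<bar>\<kappa> t * \<Phi> t x\<bar> \<le> C * \<bar>\<kappa> t\<bar>" for t
    using mult_left_mono[OF C(2), of "\<bar>\<kappa> t\<bar>"] by (simp add: abs_mult mult.commute)
  then show "integrable lborel (\<lambda>t. \<kappa> t * \<Phi> t x)"
    by (intro Bochner_Integration.integrable_bound[OF integrable_mult_right[OF \<kappa>, of C]])
       (use C(1) in \<open>auto simp: abs_mult\<close>)
qed

lemma time_avg_bound:
  assumes "integrable lborel \<kappa>" "\<And>t x. \<bar>\<Phi> t x\<bar> \<le> C"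
  shows "\<bar>time_avg \<kappa> x\<bar> \<le> C * (\<integral>t. \<bar>\<kappa> t\<bar> \<partial>lborel)"
proof -
  have "\<bar>time_avg \<kappa> x\<bar> \<le> (\<integral>t. \<bar>\<kappa> t * \<Phi> t x\<bar> \<partial>lborel)"
    unfolding time_avg_def by (rule integral_abs_bound)
  also have "\<dots> \<le> (\<integral>t. C * \<bar>\<kappa> t\<bar> \<partial>lborel)"
  proof (rule integral_mono)
    show "\<bar>\<kappa> t * \<Phi> t x\<bar> \<le> C * \<bar>\<kappa> t\<bar>" for t
      using mult_left_mono[OF assms(2), of "\<bar>\<kappa> t\<bar>"] by (simp add: abs_mult mult.commute)
  qed (use time_avg_integrable[OF assms(1)] assms(1) in auto)
  finally show ?thesis by simp
qed

lemma time_avg_integral: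
  assumes \<kappa>: "integrable lborel \<kappa>" and h: "integrable m h"
  shows "integrable m (\<lambda>x. time_avg \<kappa> x * h x)"
    "(\<integral>x. time_avg \<kappa> x * h x \<partial>m) = (\<integral>t. \<kappa> t * (\<integral>x. \<Phi> t x * h x \<partial>m) \<partial>lborel)"
    "integrable lborel (\<lambda>t. \<kappa> t * (\<integral>x. \<Phi> t x * h x \<partial>m))"
proof -
  obtain C where C: "0 \<le> C" "\<And>t x. \<bar>\<Phi> t x\<bar> \<le> C" using \<Phi>_bounded by blast
  have [measurable]: "\<kappa> \<in> borel_measurable borel" "h \<in> borel_measurable m" using \<kappa> h by auto
  interpret pair_sigma_finite lborel m ..
  have hi: "integrable m (\<lambda>x. \<Phi> t x * h x)" for t
  proof (rule Bochner_Integration.integrable_bound[OF integrable_mult_right[OF h, of C]])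
    show "(\<lambda>x. \<Phi> t x * h x) \<in> borel_measurable m" by measurable
    show "AE x in m. norm (\<Phi> t x * h x) \<le> norm (C * h x)"
      using C by (auto simp: abs_mult intro!: mult_right_mono)
  qed
  have I: "integrable (lborel \<Otimes>\<^sub>M m) (\<lambda>(t, x). \<kappa> t * \<Phi> t x * h x)"
  proof (rule Fubini_integrable)
    show "(\<lambda>(t, x). \<kappa> t * \<Phi> t x * h x) \<in> borel_measurable (lborel \<Otimes>\<^sub>M m)" by measurable
    show "integrable lborel (\<lambda>t. \<integral>x. norm (case (t, x) of (t, x) \<Rightarrow> \<kappa> t * \<Phi> t x * h x) \<partial>m)"
    proof (rule Bochner_Integration.integrable_bound[OF integrable_mult_right[OF \<kappa>, of "C * (\<integral>x. \<bar>h x\<bar> \<partial>m)"]])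
      show "AE t in lborel. norm (\<integral>x. norm (case (t, x) of (t, x) \<Rightarrow> \<kappa> t * \<Phi> t x * h x) \<partial>m) \<le> norm (C * (\<integral>x. \<bar>h x\<bar> \<partial>m) * \<kappa> t)"
      proof (rule AE_I2)
        fix t
        have "(\<integral>x. \<bar>\<kappa> t * \<Phi> t x * h x\<bar> \<partial>m) \<le> (\<integral>x. \<bar>\<kappa> t\<bar> * C * \<bar>h x\<bar> \<partial>m)"
          using C h integrable_mult_right[OF hi[of t], of "\<kappa> t"]
          by (intro integral_mono integrable_abs integrable_mult_right)
             (auto simp: abs_mult mult.assoc intro!: mult_left_mono mult_right_mono)
        then show "norm (\<integral>x. norm (case (t, x) of (t, x) \<Rightarrow> \<kappa> t * \<Phi> t x * h x) \<partial>m) \<le> norm (C * (\<integral>x. \<bar>h x\<bar> \<partial>m) * \<kappa> t)"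
          using C by (simp add: abs_mult mult_ac)
      qed
    qed measurable
    show "AE t in lborel. integrable m (\<lambda>x. case (t, x) of (t, x) \<Rightarrow> \<kappa> t * \<Phi> t x * h x)"
      using integrable_mult_right[OF hi] by (auto simp: mult.assoc)
  qed
  have e2: "(\<integral>x. \<kappa> t * \<Phi> t x * h x \<partial>m) = \<kappa> t * (\<integral>x. \<Phi> t x * h x \<partial>m)" for t
    by (simp add: mult.assoc)
  show "integrable m (\<lambda>x. time_avg \<kappa> x * h x)" using integrable_snd[OF I] by (simp add: time_avg_def)
  show "integrable lborel (\<lambda>t. \<kappa> t * (\<integral>x. \<Phi> t x * h x \<partial>m))" using integrable_fst[OF I] by (simp add: e2)
  show "(\<integral>x. time_avg \<kappa> x * h x \<partial>m) = (\<integral>t. \<kappa> t * (\<integral>x. \<Phi> t x * h x \<partial>m) \<partial>lborel)"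
    using Fubini_integral[OF I] by (simp add: time_avg_def e2)
qed

text \<open>The subsolution property read as a bound on the weighted energy. The extended-real
  inequality forces this energy to be finite, and since it is nonnegative, so is the other
  side.\<close>

lemma HJ_test:
  assumes \<psi>: "\<psi> \<in> Lip_b d" "\<And>x. 0 \<le> \<psi> x" and \<eta>: "test_fun_01 \<eta>" "\<And>t. 0 \<le> \<eta> t"
  shows "(\<integral>\<^sup>+t. ennreal (\<eta> t) * (\<integral>\<^sup>+x. ennreal (\<psi> x * (wgrad d m (\<phi> t) x)^2) \<partial>m) \<partial>lebesgue_on {0<..<1})
      \<le> ennreal (2 * (\<integral>x. time_avg (deriv \<eta>) x * \<psi> x \<partial>m))"
    "0 \<le> (\<integral>x. time_avg (deriv \<eta>) x * \<psi> x \<partial>m)"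
proof -
  obtain a b where ab: "0 < a" "b < 1" "\<And>t. t \<notin> {a..b} \<Longrightarrow> deriv \<eta> t = 0"
    and c: "continuous_on UNIV (deriv \<eta>)" using \<eta>(1) by (rule test_fun_01E) blast
  have i: "integrable lborel (deriv \<eta>)" by (rule integrable_compact_support[OF c ab(3)])
  have [measurable]: "deriv \<eta> \<in> borel_measurable borel" using i by auto
  have \<psi>i: "integrable m \<psi>" by (rule L2_integrable[OF Lip_b_L2[OF \<psi>(1)]])
  have [measurable]: "\<psi> \<in> borel_measurable m" using \<psi>i by auto
  define N where "N = (\<integral>\<^sup>+t. ennreal (\<eta> t) * (\<integral>\<^sup>+x. ennreal (\<psi> x * (wgrad d m (\<phi> t) x)^2) \<partial>m) \<partial>lebesgue_on {0<..<1})"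
  define A where "A = (\<integral>x. time_avg (deriv \<eta>) x * \<psi> x \<partial>m)"
  have "(\<integral>t. deriv \<eta> t * (\<integral>x. \<phi> t x * \<psi> x \<partial>m) \<partial>lebesgue_on {0<..<1})
    = (\<integral>t. deriv \<eta> t * (\<integral>x. \<Phi> t x * \<psi> x \<partial>m) \<partial>lborel)"
  proof (rule integral_lebesgue_on_01)
    show "(\<lambda>t. deriv \<eta> t * (\<integral>x. \<Phi> t x * \<psi> x \<partial>m)) \<in> borel_measurable borel" by measurable
    show "deriv \<eta> t * (\<integral>x. \<Phi> t x * \<psi> x \<partial>m) = 0" if "t \<notin> {0<..<1}" for t
      using ab that by auto
  qed (simp add: \<Phi>_def)
  also have "\<dots> = A" unfolding A_def by (rule time_avg_integral(2)[OF i \<psi>i, symmetric])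
  finally have eq: "(\<integral>t. deriv \<eta> t * (\<integral>x. \<phi> t x * \<psi> x \<partial>m) \<partial>lebesgue_on {0<..<1}) = A" .
  have "HJ_subsolution d m \<phi>" using admissible unfolding dual_admissible_def by blast
  then have HJ: "ereal (- A) + ereal (1/2) * enn2ereal N \<le> 0"
    using Lip_b_A_Ch[OF \<psi>(1)] \<psi>(2) \<eta> unfolding HJ_subsolution_def eq[symmetric] N_def by auto
  have "N \<noteq> top"
  proof
    assume "N = top"
    with HJ show False by (simp add: top_ereal_def)
  qed
  then obtain n where n: "0 \<le> n" "N = ennreal n" by (cases N rule: ennreal_cases) auto
  have "n / 2 \<le> A" using HJ n by (simp add: enn2ereal_ennreal)
  then show "N \<le> ennreal (2 * A)" "0 \<le> A" using n by (auto intro: ennreal_leI)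
qed

text \<open>Jensen's inequality for the weighted slope energy, which is convex and lower semicontinuous, by
  separating \<open>time_avg \<eta>\<close> from its epigraph.  This way only linear functionals of \<open>\<phi> t\<close> are integrated
  in time and the measurability of the energy along \<open>\<phi>\<close> plays no role.\<close>

lemma time_avg_weighted_slope:
  assumes \<psi>: "\<psi> \<in> Lip_b d" "\<And>x. c \<le> \<psi> x" "0 < c" and \<eta>: "test_fun_01 \<eta>" "\<And>t. 0 \<le> \<eta> t" "(\<integral>t. \<eta> t \<partial>lborel) = 1"
  shows "\<exists>G. strong_slope (time_avg \<eta>) G \<and> (\<integral>x. \<psi> x * (G x)^2 \<partial>m) \<le> 2 * (\<integral>x. time_avg (deriv \<eta>) x * \<psi> x \<partial>m)"
proof -
  obtain a b where ab: "0 < a" "b < 1" "\<And>t. t \<notin> {a..b} \<Longrightarrow> \<eta> t = 0"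
    and cont: "continuous_on UNIV \<eta>" using \<eta>(1) by (rule test_fun_01E) blast
  have \<eta>i: "integrable lborel \<eta>" by (rule integrable_compact_support[OF cont ab(3)])
  have [measurable]: "\<eta> \<in> borel_measurable borel" using \<eta>i by auto
  have \<psi>0: "0 \<le> \<psi> x" for x using \<psi>(2)[of x] \<psi>(3) by linarith
  have \<psi>m[measurable]: "\<psi> \<in> borel_measurable m" using \<psi>(1) by (rule Lip_b_measurable)
  obtain C\<psi> where C\<psi>: "\<And>x. \<bar>\<psi> x\<bar> \<le> C\<psi>" using \<psi>(1) by (rule Lip_bE) blast
  obtain C where C: "0 \<le> C" "\<And>t x. \<bar>\<Phi> t x\<bar> \<le> C" using \<Phi>_bounded by blast
  define f where "f = time_avg \<eta>"
  define e0 where "e0 = 2 * (\<integral>x. time_avg (deriv \<eta>) x * \<psi> x \<partial>m)"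
  have [measurable]: "f \<in> borel_measurable m" unfolding f_def by measurable
  have fL: "f \<in> L2 m"
    by (rule L2_bounded) (use time_avg_bound[OF \<eta>i C(2)] in \<open>auto simp: f_def\<close>)
  have \<Phi>L: "\<Phi> t \<in> L2 m" for t
  proof (rule L2_bounded)
    have "(\<lambda>x. \<Phi> t x) \<in> borel_measurable m" by measurable
    then show "\<Phi> t \<in> borel_measurable m" by simp
  qed (use C in auto)
  define En where "En G = (\<integral>x. \<psi> x * (G x)^2 \<partial>m)" for G
  have Ei: "integrable m (\<lambda>x. \<psi> x * (G x)^2)" if "G \<in> L2 m" for G
    by (rule Bochner_Integration.integrable_bound[OF integrable_mult_right[OF L2D(2)[OF that], of C\<psi>]])
       (use C\<psi> L2D(1)[OF that] \<psi>0 order_trans[OF abs_ge_zero C\<psi>] in \<open>auto simp: abs_mult intro!: mult_right_mono\<close>)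
  \<comment> \<open>The epigraph of the energy. It is enough that \<open>(f, e0)\<close> lies in its
    closure, since lower semicontinuity then supplies a slope of \<open>f\<close> itself.\<close>
  define Ep where "Ep = {(g, b). \<exists>G. strong_slope g G \<and> En G \<le> b}"
  have "\<exists>g b. (g, b) \<in> Ep \<and> L2sq m (\<lambda>x. g x - f x) + (b - e0)^2 < \<delta>" if \<delta>: "0 < \<delta>" for \<delta>
  proof (rule ccontr)
    assume neg: "\<not> ?thesis"
    have zero: "(\<lambda>_. 0, k) \<in> Ep" if "En (lip_a_star d m (\<lambda>_. 0)) \<le> k" for k
      unfolding Ep_def using Lip_b_strong_slope[OF Lip_b_const[of 0]] that by auto
    obtain h \<beta> where h: "h \<in> L2 m" and
      sep: "\<And>g b. (g, b) \<in> Ep \<Longrightarrow> \<delta> \<le> (\<integral>z. (g z - f z) * h z \<partial>m) + (b - e0) * \<beta>"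
    proof (rule L2_separation[of Ep f \<delta> e0])
      show "x \<in> L2 m" if "(x, b) \<in> Ep" for x b using that by (auto simp: Ep_def dest: strong_slopeD)
      show "Ep \<noteq> {}" using zero by blast
      show "\<delta> \<le> L2sq m (\<lambda>z. x z - f z) + (b - e0)^2" if "(x, b) \<in> Ep" for x b
        using neg that by (auto simp: not_less)
      show "((\<lambda>z. (1 - s) * x z + s * y z), (1 - s) * p + s * q) \<in> Ep"
        if xy: "(x, p) \<in> Ep" "(y, q) \<in> Ep" and s: "0 < s" "s < 1" for x p y q s
      proof -
        obtain G H where *: "strong_slope x G" "En G \<le> p" "strong_slope y H" "En H \<le> q"
          using xy by (auto simp: Ep_def)
        note L = strong_slopeD(2)[OF *(1)] strong_slopeD(2)[OF *(3)]
        have sc: "strong_slope (\<lambda>z. (1 - s) * x z + s * y z) (\<lambda>z. (1 - s) * G z + s * H z)"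
          using s by (intro strong_slope_convex *) auto
        have "En (\<lambda>z. (1 - s) * G z + s * H z) \<le> (\<integral>z. (1 - s) * (\<psi> z * (G z)^2) + s * (\<psi> z * (H z)^2) \<partial>m)"
          unfolding En_def
        proof (rule integral_mono)
          show "integrable m (\<lambda>z. \<psi> z * ((1 - s) * G z + s * H z)^2)" by (rule Ei[OF L2_lincomb[OF L]])
          show "integrable m (\<lambda>z. (1 - s) * (\<psi> z * (G z)^2) + s * (\<psi> z * (H z)^2))" using Ei L by auto
          fix z
          have "((1 - s) * G z + s * H z)^2 = (1 - s) * (G z)^2 + s * (H z)^2 - (1 - s) * s * (G z - H z)^2"
            by (simp add: power2_eq_square algebra_simps)
          also have "\<dots> \<le> (1 - s) * (G z)^2 + s * (H z)^2" using s by simp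
          finally have "\<psi> z * ((1 - s) * G z + s * H z)^2 \<le> \<psi> z * ((1 - s) * (G z)^2 + s * (H z)^2)"
            using \<psi>0 by (rule mult_left_mono)
          then show "\<psi> z * ((1 - s) * G z + s * H z)^2 \<le> (1 - s) * (\<psi> z * (G z)^2) + s * (\<psi> z * (H z)^2)"
            by (simp add: algebra_simps)
        qed
        also have "\<dots> = (1 - s) * En G + s * En H" unfolding En_def using Ei L by simp
        also have "\<dots> \<le> (1 - s) * p + s * q" using * s by (intro add_mono mult_left_mono) auto
        finally show ?thesis using sc by (auto simp: Ep_def)
      qed
    qed (use fL \<delta> in auto)
    \<comment> \<open>Above the zero function the epigraph is unbounded upwards, so a negative
      \<open>\<beta>\<close> would violate the separation.\<close>
    have \<beta>: "0 \<le> \<beta>"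
    proof (rule ccontr)
      assume "\<not> 0 \<le> \<beta>"
      define w where "w = (\<integral>z. (0 - f z) * h z \<partial>m)"
      define k where "k = max (En (lip_a_star d m (\<lambda>_. 0))) (e0 + \<bar>w\<bar> / (- \<beta>))"
      have "\<delta> \<le> w + (k - e0) * \<beta>" unfolding w_def by (rule sep, rule zero) (simp add: k_def)
      also have "(k - e0) * \<beta> \<le> (\<bar>w\<bar> / (- \<beta>)) * \<beta>"
        using \<open>\<not> 0 \<le> \<beta>\<close> by (intro mult_right_mono_neg) (auto simp: k_def)
      also have "\<dots> = - \<bar>w\<bar>" using \<open>\<not> 0 \<le> \<beta>\<close> by simp
      finally show False using \<delta> by simp
    qed
    define l where "l t = (\<integral>z. \<Phi> t z * h z \<partial>m) - (\<integral>z. f z * h z \<partial>m)" for t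
    have hi: "integrable m h" by (rule L2_integrable[OF h])
    have [measurable]: "h \<in> borel_measurable m" using hi by auto
    have [measurable]: "l \<in> borel_measurable borel" unfolding l_def by measurable
    have li: "integrable lborel (\<lambda>t. \<eta> t * l t)" "(\<integral>t. \<eta> t * l t \<partial>lborel) = 0"
      using time_avg_integral[OF \<eta>i hi] \<eta>i \<eta>(3) by (auto simp: l_def right_diff_distrib f_def)
    define E where "E t = En (wgrad d m (\<phi> t))" for t
    have "AE t in lebesgue_on {0<..<1}. \<phi> t \<in> D_Ch d m"
      using admissible unfolding dual_admissible_def L1_D_Ch_def by blast
    then have AEt: "AE t in lebesgue_on {0<..<1}. \<delta> \<le> l t + (E t - e0) * \<beta> \<and> \<phi> t \<in> D_Ch d m"
      using AE_space
    proof eventually_elim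
      case (elim t)
      then have t: "t \<in> {0<..<1}" by simp
      then have "\<Phi> t = \<phi> t" by (auto simp: \<Phi>_def)
      have "(\<Phi> t, E t) \<in> Ep" unfolding Ep_def E_def \<open>\<Phi> t = \<phi> t\<close> using wgrad_minimal(1)[OF elim(1)] by auto
      from sep[OF this] have "\<delta> \<le> (\<integral>z. (\<Phi> t z - f z) * h z \<partial>m) + (E t - e0) * \<beta>" .
      also have "(\<integral>z. (\<Phi> t z - f z) * h z \<partial>m) = l t"
        using L2_mult_integrable[OF \<Phi>L h] L2_mult_integrable[OF fL h] by (simp add: l_def left_diff_distrib)
      finally show ?case using elim by simp
    qed
    have e0: "0 \<le> e0" unfolding e0_def using HJ_test(2)[OF \<psi>(1) \<psi>0 \<eta>(1,2)] by simp
    show False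
    \<comment> \<open>A vertical hyperplane would separate the functions \<open>\<Phi> t\<close>
      from their own average \<open>f\<close>, which averaging against \<open>\<eta>\<close>
      refutes. Otherwise division by \<open>\<beta>\<close> gives the lower bound \<open>k t\<close>
      for the energy, whose average \<open>e0 + \<delta> / \<beta>\<close> exceeds what the
      Hamilton--Jacobi inequality allows.\<close>
    proof (cases "\<beta> = 0")
      case True
      have eq: "(\<lambda>t. \<eta> t * (\<delta> - l t)) = (\<lambda>t. \<delta> * \<eta> t - \<eta> t * l t)" by (auto simp: algebra_simps)
      have "integrable lborel (\<lambda>t. \<eta> t * (\<delta> - l t))" "(\<integral>t. \<eta> t * (\<delta> - l t) \<partial>lborel) = \<delta>"
        unfolding eq using li \<eta>i \<eta>(3) by auto
      then have "ennreal \<delta> \<le> (\<integral>\<^sup>+t. ennreal (\<eta> t * (\<delta> - l t)) \<partial>lborel)"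
        using ennreal_integral_le by metis
      also have "\<dots> = (\<integral>\<^sup>+t. ennreal (\<eta> t * (\<delta> - l t)) \<partial>lebesgue_on {0<..<1})"
        by (rule nn_integral_lebesgue_on_01[symmetric]) (use ab in auto)
      also have "\<dots> \<le> (\<integral>\<^sup>+t. 0 \<partial>lebesgue_on {0<..<1::real})"
      proof (rule nn_integral_mono_AE)
        show "AE t in lebesgue_on {0<..<1}. ennreal (\<eta> t * (\<delta> - l t)) \<le> 0"
          using AEt by eventually_elim (use True \<eta>(2) in \<open>auto simp: ennreal_eq_0_iff mult_le_0_iff\<close>)
      qed
      finally show False using \<delta> by simp
    next
      case False
      then have \<beta>: "0 < \<beta>" using \<beta> by simp
      define k where "k t = e0 + (\<delta> - l t) / \<beta>" for t
      have ki: "integrable lborel (\<lambda>t. \<eta> t * k t)" "(\<integral>t. \<eta> t * k t \<partial>lborel) = e0 + \<delta> / \<beta>"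
      proof -
        have "(\<lambda>t. \<eta> t * k t) = (\<lambda>t. (e0 + \<delta> / \<beta>) * \<eta> t - (1 / \<beta>) * (\<eta> t * l t))"
          by (auto simp: k_def field_simps diff_divide_distrib)
        then show "integrable lborel (\<lambda>t. \<eta> t * k t)" "(\<integral>t. \<eta> t * k t \<partial>lborel) = e0 + \<delta> / \<beta>"
          using li \<eta>i \<eta>(3) by auto
      qed
      have "ennreal (e0 + \<delta> / \<beta>) \<le> (\<integral>\<^sup>+t. ennreal (\<eta> t * k t) \<partial>lborel)"
        unfolding ki(2)[symmetric] by (rule ennreal_integral_le[OF ki(1)])
      also have "\<dots> = (\<integral>\<^sup>+t. ennreal (\<eta> t * k t) \<partial>lebesgue_on {0<..<1})"
        by (rule nn_integral_lebesgue_on_01[symmetric]) (use ab in \<open>auto simp: k_def\<close>)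
      also have "\<dots> \<le> (\<integral>\<^sup>+t. ennreal (\<eta> t) * (\<integral>\<^sup>+x. ennreal (\<psi> x * (wgrad d m (\<phi> t) x)^2) \<partial>m) \<partial>lebesgue_on {0<..<1})"
      proof (rule nn_integral_mono_AE)
        show "AE t in lebesgue_on {0<..<1}. ennreal (\<eta> t * k t) \<le> ennreal (\<eta> t) * (\<integral>\<^sup>+x. ennreal (\<psi> x * (wgrad d m (\<phi> t) x)^2) \<partial>m)"
          using AEt
        proof eventually_elim
          case (elim t)
          have "k t \<le> E t" using elim \<beta> by (simp add: k_def field_simps)
          then have "\<eta> t * k t \<le> \<eta> t * E t" using \<eta>(2) by (rule mult_left_mono)
          then have "ennreal (\<eta> t * k t) \<le> ennreal (\<eta> t) * ennreal (E t)"
            by (subst ennreal_mult'[symmetric]) (auto intro!: ennreal_leI \<eta>)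
          also have "ennreal (E t) = (\<integral>\<^sup>+x. ennreal (\<psi> x * (wgrad d m (\<phi> t) x)^2) \<partial>m)"
            unfolding E_def En_def using Ei[OF wgrad_L2] elim \<psi>0 by (subst nn_integral_eq_integral) auto
          finally show ?case .
        qed
      qed
      also have "\<dots> \<le> ennreal e0" unfolding e0_def by (rule HJ_test(1)[OF \<psi>(1) \<psi>0 \<eta>(1,2)])
      finally have "e0 + \<delta> / \<beta> \<le> e0" using e0 by simp
      then show False using \<delta> \<beta> by (simp add: field_simps)
    qed
  qed
  note approx = this
  have "\<exists>G. strong_slope f G \<and> (\<integral>x. \<psi> x * (G x)^2 \<partial>m) \<le> e0"
  proof (rule weighted_slope_lsc[OF \<psi>m \<psi>(2) _ \<psi>(3) fL])
    show "\<psi> x \<le> C\<psi>" for x using C\<psi>[of x] by linarith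
    fix e :: real assume e: "0 < e"
    \<comment> \<open>One tolerance for two scales: the first coordinate is needed up to
      \<open>e\<close> in the squared norm, the second up to \<open>e\<close> in absolute
      value.\<close>
    obtain g b where gb: "(g, b) \<in> Ep" "L2sq m (\<lambda>x. g x - f x) + (b - e0)^2 < min e (e^2)"
      using approx[of "min e (e^2)"] e by auto
    then obtain G where G: "strong_slope g G" "En G \<le> b" by (auto simp: Ep_def)
    have "(b - e0)^2 < e^2" using gb(2) L2sq_nonneg[of m "\<lambda>x. g x - f x"] by linarith
    then have "b - e0 < e" using e by (meson less_imp_le power_mono not_less)
    moreover have "L2sq m (\<lambda>x. g x - f x) < e" using gb(2) zero_le_power2[of "b - e0"] by linarith
    ultimately show "\<exists>g G. strong_slope g G \<and> L2sq m (\<lambda>x. g x - f x) < e \<and> (\<integral>x. \<psi> x * (G x)^2 \<partial>m) \<le> e0 + e"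
      using G by (intro exI[of _ g] exI[of _ G]) (auto simp: En_def)
  qed
  then show ?thesis by (simp add: f_def e0_def)
qed

text \<open>The slope supplied by \<open>time_avg_weighted_slope\<close> depends on the weight, but
  \<open>wgrad\<close> lies below all of them. The integral inequality therefore holds for one
  function and every weight, and becomes pointwise.\<close>

lemma time_avg_slope:
  assumes \<eta>: "test_fun_01 \<eta>" "\<And>t. 0 \<le> \<eta> t" "(\<integral>t. \<eta> t \<partial>lborel) = 1"
  shows "time_avg \<eta> \<in> D_Ch d m" "AE x in m. (wgrad d m (time_avg \<eta>) x)^2 \<le> 2 * time_avg (deriv \<eta>) x"
proof -
  show f: "time_avg \<eta> \<in> D_Ch d m"
    using time_avg_weighted_slope[OF Lip_b_const[of 1] _ _ \<eta>, of 1] strong_slope_imp_D_Ch by auto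
  define w where "w = wgrad d m (time_avg \<eta>)"
  define g where "g = time_avg (deriv \<eta>)"
  define k where "k x = (w x)^2 - 2 * g x" for x
  obtain a b where ab: "\<And>t. t \<notin> {a..b} \<Longrightarrow> deriv \<eta> t = 0" and c: "continuous_on UNIV (deriv \<eta>)"
    using \<eta>(1) by (rule test_fun_01E) blast
  have i: "integrable lborel (deriv \<eta>)" by (rule integrable_compact_support[OF c ab])
  have gi: "integrable m (\<lambda>x. g x * h x)" if "integrable m h" for h
    unfolding g_def by (rule time_avg_integral(1)[OF i that])
  have wL: "w \<in> L2 m" unfolding w_def by (rule wgrad_L2[OF f])
  have bi: "integrable m (\<lambda>x. \<psi> x * (G x)^2)" if \<psi>: "\<psi> \<in> Lip_b d" and G: "G \<in> L2 m" for \<psi> G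
  proof -
    obtain C where C: "\<And>x. \<bar>\<psi> x\<bar> \<le> C" "0 \<le> C" using \<psi> by (rule Lip_bE) blast
    have [measurable]: "\<psi> \<in> borel_measurable m" "G \<in> borel_measurable m"
      using Lip_b_measurable[OF \<psi>] L2D(1)[OF G] by auto
    show ?thesis
      by (rule Bochner_Integration.integrable_bound[OF integrable_mult_right[OF L2D(2)[OF G], of C]])
         (use C in \<open>auto simp: abs_mult intro!: mult_right_mono\<close>)
  qed
  have gi1: "integrable m g" using gi[of "\<lambda>_. 1"] by simp
  have ki: "integrable m k" unfolding k_def using L2D(2)[OF wL] gi1 by auto
  have pos: "(\<integral>x. \<psi> x * k x \<partial>m) \<le> 0" if \<psi>: "\<psi> \<in> Lip_b d" "\<And>x. c \<le> \<psi> x" "0 < c" for \<psi> c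
  proof -
    obtain G where G: "strong_slope (time_avg \<eta>) G" "(\<integral>x. \<psi> x * (G x)^2 \<partial>m) \<le> 2 * (\<integral>x. g x * \<psi> x \<partial>m)"
      using time_avg_weighted_slope[OF \<psi> \<eta>] by (auto simp: g_def)
    note GL = strong_slopeD(2)[OF G(1)]
    have "(\<integral>x. \<psi> x * (w x)^2 \<partial>m) \<le> (\<integral>x. \<psi> x * (G x)^2 \<partial>m)"
    proof (rule integral_mono_AE[OF bi[OF \<psi>(1) wL] bi[OF \<psi>(1) GL]])
      show "AE x in m. \<psi> x * (w x)^2 \<le> \<psi> x * (G x)^2"
        using wgrad_le_slope[OF G(1)] wgrad_nonneg[OF f]
      proof eventually_elim
        case (elim x)
        have "0 \<le> \<psi> x" using \<psi>(2)[of x] \<psi>(3) by linarith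
        then show ?case using elim by (auto simp: w_def intro!: mult_left_mono power_mono)
      qed
    qed
    moreover have "(\<integral>x. \<psi> x * k x \<partial>m) = (\<integral>x. \<psi> x * (w x)^2 \<partial>m) - 2 * (\<integral>x. g x * \<psi> x \<partial>m)"
    proof -
      have "(\<lambda>x. \<psi> x * k x) = (\<lambda>x. \<psi> x * (w x)^2 - 2 * (g x * \<psi> x))" by (auto simp: k_def algebra_simps)
      then show ?thesis using bi[OF \<psi>(1) wL] gi[OF L2_integrable[OF Lip_b_L2[OF \<psi>(1)]]] by simp
    qed
    ultimately show ?thesis using G(2) by linarith
  qed
  have "AE x in m. k x \<le> 0"
  proof (rule AE_nonpos_if_Lip_b_tests[OF ki])
    fix \<psi> assume \<psi>: "\<psi> \<in> Lip_b d" "\<And>x. 0 \<le> \<psi> x"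
    show "(\<integral>x. \<psi> x * k x \<partial>m) \<le> 0"
    proof (rule field_le_epsilon)
      fix e :: real assume e: "0 < e"
      \<comment> \<open>Weights bounded away from 0 are reached by adding \<open>c\<close>; this
        choice changes the integral by at most \<open>e\<close>.\<close>
      define c where "c = e / (\<bar>\<integral>x. k x \<partial>m\<bar> + 1)"
      have c: "0 < c" using e by (simp add: c_def add_nonneg_pos)
      obtain C where C: "\<And>x. \<bar>\<psi> x\<bar> \<le> C" using \<psi>(1) by (rule Lip_bE) blast
      have pi: "integrable m (\<lambda>x. \<psi> x * k x)"
      proof -
        have "(\<lambda>x. \<psi> x * k x) = (\<lambda>x. \<psi> x * (w x)^2 - 2 * (g x * \<psi> x))" by (auto simp: k_def algebra_simps)
        then show ?thesis using bi[OF \<psi>(1) wL] gi[OF L2_integrable[OF Lip_b_L2[OF \<psi>(1)]]] by simp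
      qed
      have "(\<integral>x. (\<psi> x + c) * k x \<partial>m) \<le> 0"
        by (rule pos[OF Lip_b_add[OF \<psi>(1) Lip_b_const] _ c]) (use \<psi> in auto)
      then have "(\<integral>x. \<psi> x * k x \<partial>m) \<le> - c * (\<integral>x. k x \<partial>m)" using pi ki by (simp add: distrib_right)
      also have "\<dots> \<le> c * \<bar>\<integral>x. k x \<partial>m\<bar>" using c
        by (metis abs_ge_minus_self less_imp_le minus_mult_commute mult_left_mono)
      also have "\<dots> \<le> e" using e by (simp add: c_def field_simps)
      finally show "(\<integral>x. \<psi> x * k x \<partial>m) \<le> 0 + e" by simp
    qed
  qed
  then show "AE x in m. (wgrad d m (time_avg \<eta>) x)^2 \<le> 2 * time_avg (deriv \<eta>) x"
    by eventually_elim (simp add: k_def w_def g_def)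
qed

end

section \<open>A smooth kernel\<close>

text \<open>The functions \<open>p (1 / x) * exp (- 1 / x)\<close>, \<open>p\<close> a polynomial, extended by \<open>0\<close>, are closed under
  differentiation.\<close>

definition flat :: "real poly \<Rightarrow> real \<Rightarrow> real" where
  "flat p x = (if x \<le> 0 then 0 else poly p (1 / x) * exp (- (1 / x)))"

lemma power_poly_exp_tendsto_0: "((\<lambda>u::real. u ^ k * poly p u * exp (- u)) \<longlongrightarrow> 0) at_top"
proof (induction p arbitrary: k)
  case (pCons a p)
  have "((\<lambda>u::real. a * (u ^ k / exp u) + u ^ Suc k * poly p u * exp (- u)) \<longlongrightarrow> a * 0 + 0) at_top"
    by (intro tendsto_intros tendsto_power_div_exp_0 pCons.IH)
  then show ?case by (simp add: algebra_simps exp_minus divide_inverse)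
qed simp

text \<open>With \<open>y = 1 / x\<close>, the derivative of \<open>poly p y * exp (- y)\<close> in
  \<open>y\<close> is multiplied by \<open>- y^2\<close>, whence the polynomial
  \<open>[:0, 0, 1:] * (p - pderiv p)\<close>. At 0 the difference quotient from the right is again
  such a product and tends to 0.\<close>

lemma flat_has_derivative:
  "(flat p has_real_derivative flat ([:0, 0, 1:] * (p - pderiv p)) x) (at x)"
proof -
  consider "x < 0" | "x > 0" | "x = 0" by linarith
  then show ?thesis
  proof cases
    case 1
    have "((\<lambda>_. 0) has_real_derivative 0) (at x)" by simp
    moreover have "\<forall>\<^sub>F y in nhds x. flat p y = 0"
      using 1 by (intro eventually_mono[OF eventually_nhds_in_open[of "{..<0}"]]) (auto simp: flat_def)
    ultimately have "(flat p has_real_derivative 0) (at x)"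
      by (subst DERIV_cong_ev[OF refl _ refl, of _ "\<lambda>_. 0"]) auto
    then show ?thesis using 1 by (simp add: flat_def)
  next
    case 2
    have "((\<lambda>y. poly p (1 / y) * exp (- (1 / y))) has_real_derivative
      flat ([:0, 0, 1:] * (p - pderiv p)) x) (at x)"
      using 2 by (auto intro!: derivative_eq_intros DERIV_chain2[OF poly_DERIV]
          simp: flat_def power2_eq_square field_simps)
    moreover have "\<forall>\<^sub>F y in nhds x. flat p y = poly p (1 / y) * exp (- (1 / y))"
      using 2 by (intro eventually_mono[OF eventually_nhds_in_open[of "{0<..}"]]) (auto simp: flat_def)
    ultimately show ?thesis
      by (subst DERIV_cong_ev[OF refl _ refl, of _ "\<lambda>y. poly p (1 / y) * exp (- (1 / y))"]) auto
  next
    case 3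
    have l: "((\<lambda>h. flat p h / h) \<longlongrightarrow> 0) (at_left 0)"
      by (rule tendsto_eventually) (auto simp: eventually_at_filter flat_def)
    have "((\<lambda>h. (1 / h) ^ 1 * poly p (1 / h) * exp (- (1 / h))) \<longlongrightarrow> 0) (at_right 0)"
      using filterlim_compose[OF power_poly_exp_tendsto_0[of 1 p] filterlim_inverse_at_top_right]
      by (simp add: inverse_eq_divide)
    then have r: "((\<lambda>h. flat p h / h) \<longlongrightarrow> 0) (at_right 0)"
      by (rule Lim_transform_eventually) (auto simp: eventually_at_filter flat_def)
    have "((\<lambda>h. flat p h / h) \<longlongrightarrow> 0) (at 0)" using l r by (simp add: filterlim_at_split)
    then show ?thesis using 3 by (simp add: DERIV_def flat_def)
  qed
qed

text \<open>What \<open>test_fun_01\<close> asks for follows from membership in a class that is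
  closed under \<open>deriv\<close> and contains the kernel; generating the class from
  \<open>flat\<close> makes its closure an induction.\<close>

inductive smooth :: "(real \<Rightarrow> real) \<Rightarrow> bool" where
  flat: "smooth (\<lambda>t. flat p (a + s * t))"
| const: "smooth (\<lambda>_. c)"
| add: "smooth f \<Longrightarrow> smooth g \<Longrightarrow> smooth (\<lambda>t. f t + g t)"
| mult: "smooth f \<Longrightarrow> smooth g \<Longrightarrow> smooth (\<lambda>t. f t * g t)"

lemma smooth_affine: "smooth f \<Longrightarrow> smooth (\<lambda>t. f (b + r * t))"
proof (induction rule: smooth.induct)
  case (flat p a s)
  show ?case using smooth.flat[of p "a + s * b" "s * r"] by (simp add: algebra_simps)
qed (auto intro: smooth.intros)

lemma smooth_has_derivative:
  "smooth f \<Longrightarrow> \<exists>g. smooth g \<and> (\<forall>t. (f has_real_derivative g t) (at t))"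
proof (induction rule: smooth.induct)
  case (flat p a s)
  have "((\<lambda>t. flat p (a + s * t)) has_real_derivative flat ([:0, 0, 1:] * (p - pderiv p)) (a + s * t) * s) (at t)" for t
    by (rule DERIV_chain2[OF flat_has_derivative]) (auto intro!: derivative_eq_intros)
  moreover have "smooth (\<lambda>t. flat ([:0, 0, 1:] * (p - pderiv p)) (a + s * t) * s)"
    by (intro smooth.mult smooth.flat smooth.const)
  ultimately show ?case by blast
next
  case (const c)
  show ?case by (intro exI[of _ "\<lambda>_. 0"]) (auto intro: smooth.intros)
next
  case (add f g)
  then obtain f' g' where "smooth f'" "\<And>t. (f has_real_derivative f' t) (at t)"
    "smooth g'" "\<And>t. (g has_real_derivative g' t) (at t)" by blast
  then show ?case by (intro exI[of _ "\<lambda>t. f' t + g' t"]) (auto intro!: smooth.add derivative_intros)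
next
  case (mult f g)
  then obtain f' g' where "smooth f'" "\<And>t. (f has_real_derivative f' t) (at t)"
    "smooth g'" "\<And>t. (g has_real_derivative g' t) (at t)" by blast
  with mult show ?case
    by (intro exI[of _ "\<lambda>t. f' t * g t + g' t * f t"] conjI allI DERIV_mult smooth.add smooth.mult) auto
qed

lemma smooth_deriv:
  assumes "smooth f" shows "smooth (deriv f)" "(f has_real_derivative deriv f t) (at t)"
proof -
  obtain g where g: "smooth g" "\<And>t. (f has_real_derivative g t) (at t)" using smooth_has_derivative[OF assms] by blast
  then have "deriv f = g" by (auto intro!: DERIV_imp_deriv)
  with g show "smooth (deriv f)" "(f has_real_derivative deriv f t) (at t)" by auto
qed

lemma smooth_deriv_funpow: "smooth f \<Longrightarrow> smooth ((deriv ^^ n) f)"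
  by (induction n) (auto intro: smooth_deriv)

lemma smooth_continuous: "smooth f \<Longrightarrow> continuous_on UNIV f"
  by (auto intro!: continuous_at_imp_continuous_on DERIV_isCont smooth_deriv(2))

lemma test_fun_01I:
  assumes "smooth f" "0 < a" "b < 1" "\<And>t. t \<notin> {a..b} \<Longrightarrow> f t = 0" shows "test_fun_01 f"
  unfolding test_fun_01_def
proof (intro conjI allI exI)
  show "((deriv ^^ n) f) differentiable (at t)" for n t
    using smooth_deriv(2)[OF smooth_deriv_funpow[OF assms(1)]] unfolding real_differentiable_def by blast
qed (use assms in auto)

lemma deriv_zero_outside:
  fixes f :: "real \<Rightarrow> real"
  assumes "\<And>t. t \<notin> {a..b} \<Longrightarrow> f t = 0" "t \<notin> {a..b}" shows "deriv f t = 0"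
proof -
  have "\<forall>\<^sub>F s in nhds t. f s = 0"
    using assms unfolding eventually_nhds by (intro exI[of _ "- {a..b}"]) auto
  then have "deriv f t = deriv (\<lambda>_. 0) t" by (intro deriv_cong_ev) auto
  then show ?thesis by simp
qed

lemma bounded_compact_support:
  fixes f :: "real \<Rightarrow> real"
  assumes "continuous_on UNIV f" "\<And>t. t \<notin> {a..b} \<Longrightarrow> f t = 0"
  obtains B where "0 \<le> B" "\<And>t. \<bar>f t\<bar> \<le> B"
proof -
  have "compact (f ` {a..b})" using assms(1) by (intro compact_continuous_image) (auto intro: continuous_on_subset)
  then have "bounded (f ` {a..b})" by (rule compact_imp_bounded)
  then obtain B where B: "\<And>y. y \<in> f ` {a..b} \<Longrightarrow> norm y \<le> B" by (auto simp: bounded_iff)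
  have "\<bar>f t\<bar> \<le> \<bar>B\<bar>" for t
  proof (cases "t \<in> {a..b}")
    case True
    then have "norm (f t) \<le> B" by (intro B imageI)
    then show ?thesis by simp
  qed (simp add: assms(2))
  then show ?thesis using that[of "\<bar>B\<bar>"] by simp
qed

text \<open>The support in the middle third leaves room: for \<open>\<tau>\<close> between 0 and
  \<open>1 - \<epsilon>\<close> the rescaled kernel lives strictly inside (0, 1), even after a
  forward shift by less than \<open>\<epsilon> / 3\<close>. The constant \<open>K\<close> is a
  second-order Taylor bound, used to differentiate time averages with a uniform error.\<close>

lemma ex_time_kernel:
  obtains \<kappa> \<kappa>' :: "real \<Rightarrow> real" and K where
    "\<And>t. 0 \<le> \<kappa> t" "(\<integral>t. \<kappa> t \<partial>lborel) = 1" "\<And>t. t \<notin> {1/3..2/3} \<Longrightarrow> \<kappa> t = 0" "\<And>t. t \<notin> {1/3..2/3} \<Longrightarrow> \<kappa>' t = 0"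
    "continuous_on UNIV \<kappa>" "continuous_on UNIV \<kappa>'"
    "0 \<le> K" "\<And>x h. \<bar>\<kappa> (x + h) - \<kappa> x - h * \<kappa>' x\<bar> \<le> K * h^2"
    "\<And>\<epsilon> \<tau>. 0 < \<epsilon> \<Longrightarrow> 0 < \<tau> + \<epsilon>/3 \<Longrightarrow> \<tau> + 2*\<epsilon>/3 < 1 \<Longrightarrow> test_fun_01 (\<lambda>r. \<kappa> ((r - \<tau>) / \<epsilon>) / \<epsilon>)"
    "\<And>\<epsilon> \<tau>. 0 < \<epsilon> \<Longrightarrow> deriv (\<lambda>r. \<kappa> ((r - \<tau>) / \<epsilon>) / \<epsilon>) = (\<lambda>r. \<kappa>' ((r - \<tau>) / \<epsilon>) / \<epsilon>^2)"
proof -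
  define k where "k t = flat 1 (- 1/3 + 1 * t) * flat 1 (2/3 + (-1) * t)" for t
  have k: "smooth k" unfolding k_def by (intro smooth.intros)
  have k0: "0 \<le> k t" for t by (simp add: k_def flat_def)
  have kz: "k t = 0" if "t \<notin> {1/3..2/3}" for t using that by (auto simp: k_def flat_def)
  have kp: "0 < k t" if "1/3 < t" "t < 2/3" for t using that by (auto simp: k_def flat_def)
  have ki: "integrable lborel k"
  proof -
    have "integrable lborel (\<lambda>t. indicator {1/3..2/3} t *\<^sub>R k t)"
      by (rule borel_integrable_compact) (use smooth_continuous[OF k] in \<open>auto intro: continuous_on_subset\<close>)
    moreover have "(\<lambda>t. indicator {1/3..2/3} t *\<^sub>R k t) = k"
    proof
      show "indicator {1/3..2/3} t *\<^sub>R k t = k t" for t using kz[of t] by (cases "t \<in> {1/3..2/3}") auto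
    qed
    ultimately show ?thesis by (simp only:)
  qed
  define J where "J = (\<integral>t. k t \<partial>lborel)"
  have "J \<noteq> 0"
  proof
    assume "J = 0"
    then have "AE t in lborel. k t = 0" unfolding J_def using ki k0 by (subst (asm) integral_nonneg_eq_0_iff_AE) auto
    then have "AE t in lborel. t \<notin> {1/3<..<2/3::real}" by eventually_elim (use kp in force)
    then have "{1/3<..<2/3::real} \<in> null_sets lborel" by (subst (asm) AE_iff_null_sets[symmetric]) auto
    then show False by (auto simp: null_sets_def)
  qed
  moreover have "0 \<le> J" unfolding J_def by (rule integral_nonneg_AE) (use k0 in auto)
  ultimately have J: "0 < J" by simp
  define \<kappa> where "\<kappa> t = (1 / J) * k t" for t
  have s: "smooth \<kappa>" unfolding \<kappa>_def by (intro smooth.intros k)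
  have s1: "smooth (deriv \<kappa>)" and s2: "smooth (deriv (deriv \<kappa>))" by (intro smooth_deriv s)+
  have z: "\<kappa> t = 0" if "t \<notin> {1/3..2/3}" for t using kz[OF that] by (simp add: \<kappa>_def)
  have z1: "deriv \<kappa> t = 0" if "t \<notin> {1/3..2/3}" for t by (rule deriv_zero_outside[OF _ that]) (rule z)
  have z2: "deriv (deriv \<kappa>) t = 0" if "t \<notin> {1/3..2/3}" for t by (rule deriv_zero_outside[OF _ that]) (rule z1)
  obtain B where B: "0 \<le> B" "\<And>t. \<bar>deriv (deriv \<kappa>) t\<bar> \<le> B"
    using bounded_compact_support[OF smooth_continuous[OF s2] z2] by blast
  have mvt: "\<exists>\<xi>. \<bar>\<xi> - x\<bar> \<le> \<bar>h\<bar> \<and> f (x + h) - f x = h * deriv f \<xi>" if f: "smooth f" for f x h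
  proof -
    consider "h = 0" | "0 < h" | "h < 0" by linarith
    then show ?thesis
    proof cases
      case 2
      then obtain \<xi> where "x < \<xi>" "\<xi> < x + h" "f (x + h) - f x = (x + h - x) * deriv f \<xi>"
        using MVT2[of x "x + h" f "deriv f"] smooth_deriv(2)[OF f] by auto
      then show ?thesis by (intro exI[of _ \<xi>]) auto
    next
      case 3
      then obtain \<xi> where "x + h < \<xi>" "\<xi> < x" "f x - f (x + h) = (x - (x + h)) * deriv f \<xi>"
        using MVT2[of "x + h" x f "deriv f"] smooth_deriv(2)[OF f] by auto
      then show ?thesis by (intro exI[of _ \<xi>]) auto
    qed auto
  qed
  have T: "\<bar>\<kappa> (x + h) - \<kappa> x - h * deriv \<kappa> x\<bar> \<le> B * h^2" for x h
  proof -
    obtain \<xi> where \<xi>: "\<bar>\<xi> - x\<bar> \<le> \<bar>h\<bar>" "\<kappa> (x + h) - \<kappa> x = h * deriv \<kappa> \<xi>" using mvt[OF s] by blast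
    obtain \<zeta> where "deriv \<kappa> (x + (\<xi> - x)) - deriv \<kappa> x = (\<xi> - x) * deriv (deriv \<kappa>) \<zeta>" using mvt[OF s1] by blast
    then have e: "deriv \<kappa> \<xi> = deriv \<kappa> x + (\<xi> - x) * deriv (deriv \<kappa>) \<zeta>" by simp
    have "\<kappa> (x + h) - \<kappa> x - h * deriv \<kappa> x = h * ((\<xi> - x) * deriv (deriv \<kappa>) \<zeta>)"
      unfolding \<xi>(2) e by (simp add: algebra_simps)
    then have "\<bar>\<kappa> (x + h) - \<kappa> x - h * deriv \<kappa> x\<bar> = \<bar>h\<bar> * (\<bar>\<xi> - x\<bar> * \<bar>deriv (deriv \<kappa>) \<zeta>\<bar>)"
      by (simp add: abs_mult)
    also have "\<dots> \<le> \<bar>h\<bar> * (\<bar>h\<bar> * B)" using \<xi>(1) B by (intro mult_left_mono mult_mono) auto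
    also have "\<dots> = B * h^2" by (simp add: power2_eq_square)
    finally show ?thesis .
  qed
  have aff: "smooth (\<lambda>r. \<kappa> ((r - \<tau>) / \<epsilon>) / \<epsilon>)" for \<epsilon> \<tau>
  proof -
    have "smooth (\<lambda>r. (1 / \<epsilon>) * \<kappa> (- \<tau> / \<epsilon> + (1 / \<epsilon>) * r))"
      by (intro smooth.mult smooth.const smooth_affine s)
    then show ?thesis by (simp add: diff_divide_distrib add.commute)
  qed
  show ?thesis
  proof (rule that[of \<kappa> "deriv \<kappa>" B])
    show "0 \<le> \<kappa> t" for t using k0 J by (simp add: \<kappa>_def)
    show "(\<integral>t. \<kappa> t \<partial>lborel) = 1" using J by (simp add: \<kappa>_def J_def[symmetric])
    show "test_fun_01 (\<lambda>r. \<kappa> ((r - \<tau>) / \<epsilon>) / \<epsilon>)" if "0 < \<epsilon>" "0 < \<tau> + \<epsilon>/3" "\<tau> + 2*\<epsilon>/3 < 1" for \<epsilon> \<tau>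
    proof (rule test_fun_01I[OF aff that(2,3)])
      fix t assume t: "t \<notin> {\<tau> + \<epsilon>/3..\<tau> + 2*\<epsilon>/3}"
      have "(t - \<tau>) / \<epsilon> \<notin> {1/3..2/3}" using t that(1) by (auto simp: field_simps)
      then show "\<kappa> ((t - \<tau>) / \<epsilon>) / \<epsilon> = 0" using z by simp
    qed
    show "deriv (\<lambda>r. \<kappa> ((r - \<tau>) / \<epsilon>) / \<epsilon>) = (\<lambda>r. deriv \<kappa> ((r - \<tau>) / \<epsilon>) / \<epsilon>^2)" if "0 < \<epsilon>" for \<epsilon> \<tau>
    proof
      fix r
      have "((\<lambda>r. \<kappa> ((r - \<tau>) / \<epsilon>)) has_real_derivative deriv \<kappa> ((r - \<tau>) / \<epsilon>) * (1 / \<epsilon>)) (at r)"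
        by (rule DERIV_chain2[OF smooth_deriv(2)[OF s]]) (use that in \<open>auto intro!: derivative_eq_intros\<close>)
      from DERIV_cdivide[OF this, of \<epsilon>]
      have "((\<lambda>r. \<kappa> ((r - \<tau>) / \<epsilon>) / \<epsilon>) has_real_derivative deriv \<kappa> ((r - \<tau>) / \<epsilon>) / \<epsilon>^2) (at r)"
        by (simp add: power2_eq_square)
      then show "deriv (\<lambda>r. \<kappa> ((r - \<tau>) / \<epsilon>) / \<epsilon>) r = deriv \<kappa> ((r - \<tau>) / \<epsilon>) / \<epsilon>^2" by (rule DERIV_imp_deriv)
    qed
  qed (use z z1 smooth_continuous[OF s] smooth_continuous[OF s1] B T in auto)
qed

section \<open>Curves of densities\<close>

lemma prob_density_integrable:
  assumes "prob_density m \<rho>" shows "integrable m \<rho>" "(\<integral>x. \<rho> x \<partial>m) = 1"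
proof -
  have *: "\<rho> \<in> borel_measurable m" "AE x in m. 0 \<le> \<rho> x" "(\<integral>\<^sup>+x. ennreal (\<rho> x) \<partial>m) = 1"
    using assms by (auto simp: prob_density_def)
  show i: "integrable m \<rho>" using * by (intro integrableI_nonneg) auto
  have "ennreal (\<integral>x. \<rho> x \<partial>m) = ennreal 1" using * i by (subst nn_integral_eq_integral[symmetric]) auto
  then show "(\<integral>x. \<rho> x \<partial>m) = 1" using * by (subst (asm) ennreal_inj) (auto intro: integral_nonneg_AE)
qed

lemma prob_density_bounded:
  assumes \<rho>: "prob_density m \<rho>" and g: "g \<in> borel_measurable m" "AE x in m. \<bar>g x\<bar> \<le> C"
  shows "integrable m (\<lambda>x. g x * \<rho> x)" "\<bar>\<integral>x. g x * \<rho> x \<partial>m\<bar> \<le> C"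
proof -
  note i = prob_density_integrable[OF \<rho>]
  have nn: "AE x in m. 0 \<le> \<rho> x" using \<rho> by (simp add: prob_density_def)
  have le: "AE x in m. \<bar>g x * \<rho> x\<bar> \<le> C * \<rho> x"
    using g(2) nn by eventually_elim (auto simp: abs_mult intro!: mult_right_mono)
  show i': "integrable m (\<lambda>x. g x * \<rho> x)"
  proof (rule Bochner_Integration.integrable_bound[OF integrable_mult_right[OF i(1), of C]])
    show "AE x in m. norm (g x * \<rho> x) \<le> norm (C * \<rho> x)" using le by eventually_elim auto
    show "(\<lambda>x. g x * \<rho> x) \<in> borel_measurable m" using g i(1) by measurable
  qed
  have "\<bar>\<integral>x. g x * \<rho> x \<partial>m\<bar> \<le> (\<integral>x. \<bar>g x * \<rho> x\<bar> \<partial>m)" by (rule integral_abs_bound)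
  also have "\<dots> \<le> (\<integral>x. C * \<rho> x \<partial>m)" by (rule integral_mono_AE) (use i i' le in auto)
  finally show "\<bar>\<integral>x. g x * \<rho> x \<partial>m\<bar> \<le> C" using i by simp
qed

locale density_curve = ext_mm_space +
  fixes \<rho> :: "real \<Rightarrow> 'a \<Rightarrow> real"
  assumes \<rho>: "\<And>t. t \<in> {0..1} \<Longrightarrow> prob_density m (\<rho> t)"
    and ex_bound: "\<exists>c. CE_bound d m \<rho> c"
begin

text \<open>Cut off outside [0, 1], where the curve is unconstrained, so that it becomes a Borel
  function on the whole line.\<close>

definition slope_norm :: "('a \<Rightarrow> real) \<Rightarrow> real \<Rightarrow> real" where
  "slope_norm f r = (if r \<in> {0..1} then sqrt (\<integral>x. (wgrad d m f x)^2 * \<rho> r x \<partial>m) else 0)"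

lemma slope_norm_bounded:
  assumes "f \<in> A_Ch d m"
  obtains C where "0 \<le> C" "\<And>r. 0 \<le> slope_norm f r" "\<And>r. slope_norm f r \<le> C"
proof -
  obtain C where C: "AE x in m. \<bar>f x\<bar> \<le> C \<and> \<bar>wgrad d m f x\<bar> \<le> C" and f: "f \<in> D_Ch d m"
    using assms by (auto simp: A_Ch_def)
  have [measurable]: "wgrad d m f \<in> borel_measurable m" using wgrad_L2[OF f] by auto
  have sq: "AE x in m. \<bar>(wgrad d m f x)\<^sup>2\<bar> \<le> C^2"
    using C by eventually_elim (auto simp: abs_le_square_iff[symmetric] intro: order_trans[OF _ abs_ge_self])
  have "slope_norm f r \<le> \<bar>C\<bar>" for r
  proof (cases "r \<in> {0..1}")
    case True
    have "(\<integral>x. (wgrad d m f x)^2 * \<rho> r x \<partial>m) \<le> C^2"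
      using prob_density_bounded(2)[OF \<rho>[OF True] _ sq] by auto
    then show ?thesis using True by (simp add: slope_norm_def real_le_lsqrt real_sqrt_le_iff flip: real_sqrt_abs)
  qed (auto simp: slope_norm_def)
  moreover have "0 \<le> slope_norm f r" for r
  proof (cases "r \<in> {0..1}")
    case True
    have "AE x in m. 0 \<le> \<rho> r x" using \<rho>[OF True] by (simp add: prob_density_def)
    then have "AE x in m. 0 \<le> (wgrad d m f x)^2 * \<rho> r x" by eventually_elim simp
    then show ?thesis using True by (simp add: slope_norm_def integral_nonneg_AE)
  qed (auto simp: slope_norm_def)
  ultimately show ?thesis using that[of "\<bar>C\<bar>"] by auto
qed

lemma L2_01_integrable:
  assumes c: "c \<in> borel_measurable borel" "\<And>r. r \<notin> {0<..<1} \<Longrightarrow> c r = 0" "integrable lborel (\<lambda>r. (c r)^2)"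
  shows "integrable lborel (c :: real \<Rightarrow> real)"
proof (rule Bochner_Integration.integrable_bound)
  have "integrable lborel (\<lambda>r::real. indicator {0..1} r *\<^sub>R (1::real))"
    by (rule borel_integrable_compact) auto
  then show "integrable lborel (\<lambda>r. indicator {0..1} r *\<^sub>R 1 + (c r)^2)" using c(3) by (rule Bochner_Integration.integrable_add)
  have "\<bar>c r\<bar> \<le> indicator {0..1} r *\<^sub>R 1 + (c r)^2" for r
  proof (cases "r \<in> {0<..<1}")
    case True
    have "0 \<le> (\<bar>c r\<bar> - 1)^2" by simp
    then show ?thesis using True by (simp add: power2_diff)
  qed (simp add: c(2))
  then show "AE r in lborel. norm (c r) \<le> norm (indicator {0..1} r *\<^sub>R 1 + (c r)^2)"
    by (auto intro!: AE_I2 order_trans[OF _ abs_ge_self])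
qed (use c in auto)

text \<open>The bounds of \<open>CE_bound\<close> matter only up to null sets of (0, 1) and are
  merely Lebesgue measurable. Here a representative is fixed that is Borel, nonnegative everywhere
  and 0 off (0, 1), so that pointwise minima, gluing and limits involve no exceptional sets.\<close>

definition borel_bound :: "(real \<Rightarrow> real) \<Rightarrow> bool" where
  "borel_bound c \<longleftrightarrow> c \<in> borel_measurable borel \<and> (\<forall>r. 0 \<le> c r) \<and> (\<forall>r. r \<notin> {0<..<1} \<longrightarrow> c r = 0) \<and>
     integrable lborel (\<lambda>r. (c r)^2) \<and>
     (\<forall>f\<in>A_Ch d m. \<forall>s t. 0 \<le> s \<and> s \<le> t \<and> t \<le> 1 \<longrightarrow>
        ennreal \<bar>(\<integral>x. f x * \<rho> t x \<partial>m) - (\<integral>x. f x * \<rho> s x \<partial>m)\<bar>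
          \<le> (\<integral>\<^sup>+r. ennreal (c r * slope_norm f r) * indicator {s<..<t} r \<partial>lborel))"

lemma borel_boundD:
  assumes "borel_bound c"
  shows "c \<in> borel_measurable borel" "\<And>r. 0 \<le> c r" "\<And>r. r \<notin> {0<..<1} \<Longrightarrow> c r = 0"
    "integrable lborel (\<lambda>r. (c r)^2)" "integrable lborel c"
    "\<And>f s t. f \<in> A_Ch d m \<Longrightarrow> 0 \<le> s \<Longrightarrow> s \<le> t \<Longrightarrow> t \<le> 1 \<Longrightarrow>
        ennreal \<bar>(\<integral>x. f x * \<rho> t x \<partial>m) - (\<integral>x. f x * \<rho> s x \<partial>m)\<bar>
          \<le> (\<integral>\<^sup>+r. ennreal (c r * slope_norm f r) * indicator {s<..<t} r \<partial>lborel)"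
proof -
  show 1: "c \<in> borel_measurable borel" "\<And>r. 0 \<le> c r" "\<And>r. r \<notin> {0<..<1} \<Longrightarrow> c r = 0"
    "integrable lborel (\<lambda>r. (c r)^2)"
    using assms unfolding borel_bound_def by blast+
  show "integrable lborel c" by (rule L2_01_integrable[OF 1(1,3,4)])
  show "\<And>f s t. f \<in> A_Ch d m \<Longrightarrow> 0 \<le> s \<Longrightarrow> s \<le> t \<Longrightarrow> t \<le> 1 \<Longrightarrow>
        ennreal \<bar>(\<integral>x. f x * \<rho> t x \<partial>m) - (\<integral>x. f x * \<rho> s x \<partial>m)\<bar>
          \<le> (\<integral>\<^sup>+r. ennreal (c r * slope_norm f r) * indicator {s<..<t} r \<partial>lborel)"
    using assms unfolding borel_bound_def by blast
qed

section \<open>Bounds with Borel representatives\<close>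

lemma CE_rhs_eq:
  assumes "0 \<le> s" "t \<le> 1" "AE r in lebesgue_on {0<..<1}. c r = c' r"
  shows "(\<integral>\<^sup>+r. ennreal (c r * sqrt (\<integral>x. (wgrad d m f x)^2 * \<rho> r x \<partial>m)) \<partial>lebesgue_on {s<..<t})
    = (\<integral>\<^sup>+r. ennreal (c' r * slope_norm f r) * indicator {s<..<t} r \<partial>lborel)"
proof -
  have "AE r in lebesgue. r \<in> {0<..<1} \<longrightarrow> c r = c' r" using assms(3) by (subst (asm) AE_restrict_space_iff) auto
  then have "AE r in lebesgue. ennreal (c r * sqrt (\<integral>x. (wgrad d m f x)^2 * \<rho> r x \<partial>m)) * indicator {s<..<t} r
    = ennreal (c' r * slope_norm f r) * indicator {s<..<t} r"
    by eventually_elim (use assms(1,2) in \<open>auto simp: slope_norm_def indicator_def\<close>)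
  then have "(\<integral>\<^sup>+r. ennreal (c r * sqrt (\<integral>x. (wgrad d m f x)^2 * \<rho> r x \<partial>m)) * indicator {s<..<t} r \<partial>lebesgue)
    = (\<integral>\<^sup>+r. ennreal (c' r * slope_norm f r) * indicator {s<..<t} r \<partial>lebesgue)"
    by (rule nn_integral_cong_AE)
  \<comment> \<open>Completion of the measure leaves \<open>nn_integral\<close> unchanged for every
    function, so this step can precede the measurability of \<open>slope_norm\<close>.\<close>
  also have "\<dots> = (\<integral>\<^sup>+r. ennreal (c' r * slope_norm f r) * indicator {s<..<t} r \<partial>lborel)"
    by (rule nn_integral_completion)
  finally show ?thesis by (subst nn_integral_restrict_space) auto
qed

lemma borel_bound_CE_bound:
  assumes c: "borel_bound c" shows "CE_bound d m \<rho> c"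
proof -
  note D = borel_boundD[OF c]
  have "c \<in> L2 (lebesgue_on {0<..<1})"
  proof -
    have "integrable lebesgue (\<lambda>r. (c r)^2)" using D(1,4) by (subst integrable_completion) auto
    moreover have "(\<lambda>r. indicator {0<..<1} r *\<^sub>R (c r)\<^sup>2) = (\<lambda>r. (c r)^2)"
    proof
      show "indicator {0<..<1} r *\<^sub>R (c r)\<^sup>2 = (c r)^2" for r using D(3)[of r] by (cases "r \<in> {0<..<1}") auto
    qed
    ultimately have "integrable (lebesgue_on {0<..<1}) (\<lambda>r. (c r)^2)"
      by (subst integrable_restrict_space) auto
    moreover have "c \<in> borel_measurable (lebesgue_on {0<..<1})"
      using D(1) by (intro measurable_restrict_space1 measurable_completion) auto
    ultimately show ?thesis by (simp add: L2_def)
  qed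
  then show ?thesis
    unfolding CE_bound_def using D(2,6) CE_rhs_eq[of _ _ c c] by auto
qed

lemma CE_bound_representative:
  assumes c: "CE_bound d m \<rho> c"
  obtains c' where "borel_bound c'" "AE r in lebesgue_on {0<..<1}. c r = c' r"
proof -
  have cL: "c \<in> L2 (lebesgue_on {0<..<1})" "AE r in lebesgue_on {0<..<1}. 0 \<le> c r"
    using c by (auto simp: CE_bound_def)
  have cm: "c \<in> borel_measurable (lebesgue_on {0<..<1})" using cL(1) by auto
  then have "(\<lambda>r. indicator {0<..<1} r *\<^sub>R c r) \<in> borel_measurable lebesgue"
    by (subst (asm) borel_measurable_restrict_space_iff) auto
  then obtain g where g: "g \<in> borel_measurable lborel" "AE r in lborel. indicator {0<..<1} r *\<^sub>R c r = g r"
    using completion_ex_borel_measurable_real by blast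
  define c' where "c' r = indicator {0<..<1} r * max 0 (g r)" for r
  have [measurable]: "g \<in> borel_measurable borel" using g(1) by simp
  have c'm[measurable]: "c' \<in> borel_measurable borel" unfolding c'_def by measurable
  have "AE r in lebesgue. indicator {0<..<1} r *\<^sub>R c r = g r" using g(2) by (rule AE_completion)
  then have "AE r in lebesgue_on {0<..<1}. indicator {0<..<1} r *\<^sub>R c r = g r"
    by (subst AE_restrict_space_iff) auto
  then have eq: "AE r in lebesgue_on {0<..<1}. c r = c' r"
    using cL(2) AE_space by eventually_elim (auto simp: c'_def)
  have "integrable (lebesgue_on {0<..<1}) (\<lambda>r. (c' r)^2)"
  proof (rule integrable_cong_AE_imp)
    show "integrable (lebesgue_on {0<..<1}) (\<lambda>r. (c r)^2)" using cL(1) by auto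
    show "(\<lambda>r. (c' r)^2) \<in> borel_measurable (lebesgue_on {0<..<1})"
      by (intro measurable_restrict_space1 measurable_completion) simp
    show "AE r in lebesgue_on {0<..<1}. (c r)^2 = (c' r)^2" using eq by eventually_elim simp
  qed
  then have "integrable lebesgue (\<lambda>r. indicator {0<..<1} r *\<^sub>R (c' r)\<^sup>2)"
    by (subst (asm) integrable_restrict_space) auto
  moreover have "(\<lambda>r. indicator {0<..<1} r *\<^sub>R (c' r)\<^sup>2) = (\<lambda>r. (c' r)^2)"
    by (auto simp: c'_def indicator_def)
  ultimately have "integrable lborel (\<lambda>r. (c' r)^2)" by (subst (asm) integrable_completion) auto
  then have "borel_bound c'"
    using c CE_rhs_eq[OF _ _ eq] unfolding borel_bound_def CE_bound_def by (auto simp: c'_def)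
  then show ?thesis using eq that by blast
qed

text \<open>Joint measurability of the densities in time and space is not given. Against a Lipschitz
  function their integral varies by at most \<open>C\<close> times the increment of the primitive
  \<open>\<Gamma>\<close> of \<open>c\<close>, so it is a difference of two monotone functions of
  time.\<close>

lemma density_integral_measurable_Lip:
  assumes f: "f \<in> Lip_b d"
  shows "(\<lambda>t. \<integral>x. f x * \<rho> t x \<partial>m) \<in> borel_measurable (restrict_space borel {0..1})"
proof -
  obtain c0 where "CE_bound d m \<rho> c0" using ex_bound by blast
  then obtain c where c: "borel_bound c" by (rule CE_bound_representative)
  note D = borel_boundD[OF c]
  have fA: "f \<in> A_Ch d m" by (rule Lip_b_A_Ch[OF f])
  obtain C where C: "0 \<le> C" "\<And>r. 0 \<le> slope_norm f r" "\<And>r. slope_norm f r \<le> C"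
    using slope_norm_bounded[OF fA] by blast
  define F where "F t = (\<integral>x. f x * \<rho> t x \<partial>m)" for t
  define \<Gamma> where "\<Gamma> t = (\<integral>r. indicator {0<..<t} r * c r \<partial>lborel)" for t
  have gi: "integrable lborel (\<lambda>r. indicator A r * c r)" if "A \<in> sets borel" for A
    using integrable_mult_indicator[of A lborel c] that D(5) by simp
  have incr: "C * (\<integral>r. indicator {s<..<t} r * c r \<partial>lborel) \<le> C * (\<Gamma> t - \<Gamma> s)" if "0 \<le> s" "s \<le> t" for s t
  proof (rule mult_left_mono[OF _ C(1)])
    have "\<Gamma> s + (\<integral>r. indicator {s<..<t} r * c r \<partial>lborel) = (\<integral>r. indicator {0<..<s} r * c r + indicator {s<..<t} r * c r \<partial>lborel)"
      unfolding \<Gamma>_def using gi by simp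
    also have "\<dots> \<le> \<Gamma> t" unfolding \<Gamma>_def
    proof (rule integral_mono)
      show "indicator {0<..<s} r * c r + indicator {s<..<t} r * c r \<le> indicator {0<..<t} r * c r" for r
        using D(2)[of r] that by (auto simp: indicator_def)
    qed (intro Bochner_Integration.integrable_add gi; simp)+
    finally show "(\<integral>r. indicator {s<..<t} r * c r \<partial>lborel) \<le> \<Gamma> t - \<Gamma> s" by simp
  qed
  have bd: "\<bar>F t - F s\<bar> \<le> C * (\<Gamma> t - \<Gamma> s)" if st: "0 \<le> s" "s \<le> t" "t \<le> 1" for s t
  proof -
    have "ennreal \<bar>F t - F s\<bar> \<le> (\<integral>\<^sup>+r. ennreal (c r * slope_norm f r) * indicator {s<..<t} r \<partial>lborel)"
      unfolding F_def by (rule D(6)[OF fA st])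
    also have "\<dots> \<le> (\<integral>\<^sup>+r. ennreal (C * (indicator {s<..<t} r * c r)) \<partial>lborel)"
      using mult_left_mono[OF C(3) D(2)]
      by (intro nn_integral_mono) (auto simp: indicator_def mult.commute[of C] intro!: ennreal_leI)
    also have "\<dots> = ennreal (C * (\<integral>r. indicator {s<..<t} r * c r \<partial>lborel))"
      using gi D(2) C by (subst nn_integral_eq_integral) auto
    finally show ?thesis using incr[OF st(1,2)] C D(2)
      by (subst (asm) ennreal_le_iff) (auto intro!: mult_nonneg_nonneg integral_nonneg_AE)
  qed
  have "mono_on {0..1} (\<lambda>t. F t + C * \<Gamma> t)" "mono_on {0..1} (\<lambda>t. C * \<Gamma> t)"
    using bd by (auto intro!: mono_onI) (smt (verit) right_diff_distrib)+
  then have "(\<lambda>t. F t + C * \<Gamma> t) \<in> borel_measurable (restrict_space borel {0..1})"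
    "(\<lambda>t. C * \<Gamma> t) \<in> borel_measurable (restrict_space borel {0..1})"
    by (auto intro: borel_measurable_mono_on_fnc)
  then have "(\<lambda>t. (F t + C * \<Gamma> t) - C * \<Gamma> t) \<in> borel_measurable (restrict_space borel {0..1})" by measurable
  then show ?thesis by (simp add: F_def)
qed

text \<open>Integrals against Lipschitz functions are measurable in time by bounded variation,
  indicators are limits of such functions by \<open>indicator_approx\<close>, and the usual
  induction does the rest.\<close>

lemma density_nn_integral_measurable:
  fixes g :: "'a \<Rightarrow> ennreal"
  assumes g: "g \<in> borel_measurable m"
  shows "(\<lambda>t. \<integral>\<^sup>+x. g x * ennreal (\<rho> t x) \<partial>m) \<in> borel_measurable (restrict_space borel {0..1})"
proof -
  have \<rho>m: "\<rho> t \<in> borel_measurable m" if "t \<in> {0..1}" for t using \<rho>[OF that] by (simp add: prob_density_def)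
  show ?thesis using g
  proof (induction rule: borel_measurable_induct)
    case (cong f g)
    then show ?case by (simp cong: nn_integral_cong_simp)
  next
    case (set B)
    have B[measurable]: "B \<in> sets borel" using set by simp
    obtain u where u: "\<And>n::nat. u n \<in> Lip_b d" "\<And>n y. 0 \<le> u n y" "\<And>n y. u n y \<le> 1"
      "AE y in m. (\<lambda>n. u n y) \<longlonglongrightarrow> indicator B y" using indicator_approx[OF B] by blast
    have [measurable]: "u n \<in> borel_measurable m" for n using Lip_b_measurable u by auto
    have "(\<lambda>t. \<integral>x. indicator B x * \<rho> t x \<partial>m) \<in> borel_measurable (restrict_space borel {0..1})"
    proof (rule borel_measurable_LIMSEQ_real)
      show "(\<lambda>t. \<integral>x. u n x * \<rho> t x \<partial>m) \<in> borel_measurable (restrict_space borel {0..1})" for n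
        by (rule density_integral_measurable_Lip[OF u(1)])
      fix t assume "t \<in> space (restrict_space borel {0..1::real})"
      then have t: "t \<in> {0..1}" by (simp add: space_restrict_space)
      have [measurable]: "\<rho> t \<in> borel_measurable m" by (rule \<rho>m[OF t])
      show "(\<lambda>n. \<integral>x. u n x * \<rho> t x \<partial>m) \<longlonglongrightarrow> (\<integral>x. indicator B x * \<rho> t x \<partial>m)"
      proof (rule integral_dominated_convergence[where w = "\<lambda>x. norm (\<rho> t x)"])
        show "AE x in m. (\<lambda>n. u n x * \<rho> t x) \<longlonglongrightarrow> indicator B x * \<rho> t x"
          using u(4) by eventually_elim (intro tendsto_intros)
        show "AE x in m. norm (u n x * \<rho> t x) \<le> norm (\<rho> t x)" for n
          using u(2,3) by (auto simp: abs_mult intro!: mult_left_le_one_le)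
      qed (use prob_density_integrable[OF \<rho>[OF t]] in auto)
    qed
    then have "(\<lambda>t. ennreal (\<integral>x. indicator B x * \<rho> t x \<partial>m)) \<in> borel_measurable (restrict_space borel {0..1})"
      by measurable
    moreover have "ennreal (\<integral>x. indicator B x * \<rho> t x \<partial>m) = (\<integral>\<^sup>+x. indicator B x * ennreal (\<rho> t x) \<partial>m)"
      if t: "t \<in> space (restrict_space borel {0..1::real})" for t
    proof -
      have t: "t \<in> {0..1}" using t by (simp add: space_restrict_space)
      have nn: "AE x in m. 0 \<le> indicator B x * \<rho> t x"
        using \<rho>[OF t] unfolding prob_density_def by (auto elim!: eventually_mono)
      have "integrable m (\<lambda>x. indicator B x * \<rho> t x)"
        using integrable_mult_indicator[OF _ prob_density_integrable(1)[OF \<rho>[OF t]], of B] by simp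
      from nn_integral_eq_integral[OF this nn] show ?thesis
        by (simp add: ennreal_mult' ennreal_indicator flip: ennreal_indicator)
    qed
    ultimately show ?case by (rule measurable_cong[THEN iffD1, rotated])
  next
    case (mult u c)
    have eq: "(\<integral>\<^sup>+x. c * u x * ennreal (\<rho> t x) \<partial>m) = c * (\<integral>\<^sup>+x. u x * ennreal (\<rho> t x) \<partial>m)"
      if t: "t \<in> space (restrict_space borel {0..1::real})" for t
      using mult \<rho>m[of t] t by (simp add: mult.assoc nn_integral_cmult space_restrict_space)
    show ?case by (subst measurable_cong[OF eq]) (use mult in auto)
  next
    case (add u v)
    have eq: "(\<integral>\<^sup>+x. (v x + u x) * ennreal (\<rho> t x) \<partial>m) = (\<integral>\<^sup>+x. v x * ennreal (\<rho> t x) \<partial>m) + (\<integral>\<^sup>+x. u x * ennreal (\<rho> t x) \<partial>m)"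
      if t: "t \<in> space (restrict_space borel {0..1::real})" for t
      using add \<rho>m[of t] t by (simp add: distrib_right nn_integral_add space_restrict_space)
    show ?case by (subst measurable_cong[OF eq]) (use add in auto)
  next
    case (seq U)
    have eq: "(\<integral>\<^sup>+x. (SUP i. U i) x * ennreal (\<rho> t x) \<partial>m) = (SUP i. \<integral>\<^sup>+x. U i x * ennreal (\<rho> t x) \<partial>m)"
      if t: "t \<in> space (restrict_space borel {0..1::real})" for t
    proof -
      have [measurable]: "\<rho> t \<in> borel_measurable m" using \<rho>m t by (simp add: space_restrict_space)
      have "(\<integral>\<^sup>+x. (SUP i. U i) x * ennreal (\<rho> t x) \<partial>m) = (\<integral>\<^sup>+x. (SUP i. U i x * ennreal (\<rho> t x)) \<partial>m)"
        by (simp add: SUP_apply SUP_mult_right_ennreal image_image)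
      also have "\<dots> = (SUP i. \<integral>\<^sup>+x. U i x * ennreal (\<rho> t x) \<partial>m)"
        using seq by (intro nn_integral_monotone_convergence_SUP)
          (auto simp: incseq_def le_fun_def intro!: mult_right_mono)
      finally show ?thesis .
    qed
    show ?case by (subst measurable_cong[OF eq]) (use seq in auto)
  qed
qed

lemma slope_norm_measurable [measurable]:
  assumes f: "f \<in> A_Ch d m" shows "slope_norm f \<in> borel_measurable borel"
proof -
  have fD: "f \<in> D_Ch d m" using f by (auto simp: A_Ch_def)
  have [measurable]: "wgrad d m f \<in> borel_measurable m" using wgrad_L2[OF fD] by auto
  have "(\<lambda>t. \<integral>\<^sup>+x. ennreal ((wgrad d m f x)^2) * ennreal (\<rho> t x) \<partial>m) \<in> borel_measurable (restrict_space borel {0..1})"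
    by (rule density_nn_integral_measurable) measurable
  then have "(\<lambda>t. sqrt (enn2real (\<integral>\<^sup>+x. ennreal ((wgrad d m f x)^2) * ennreal (\<rho> t x) \<partial>m))) \<in> borel_measurable (restrict_space borel {0..1})"
    by measurable
  then have "(\<lambda>t. indicator {0..1} t *\<^sub>R sqrt (enn2real (\<integral>\<^sup>+x. ennreal ((wgrad d m f x)^2) * ennreal (\<rho> t x) \<partial>m))) \<in> borel_measurable borel"
    by (subst (asm) borel_measurable_restrict_space_iff) auto
  moreover have "indicator {0..1} t *\<^sub>R sqrt (enn2real (\<integral>\<^sup>+x. ennreal ((wgrad d m f x)^2) * ennreal (\<rho> t x) \<partial>m)) = slope_norm f t" for t
  proof (cases "t \<in> {0..1}")
    case True
    have [measurable]: "\<rho> t \<in> borel_measurable m" using \<rho>[OF True] by (simp add: prob_density_def)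
    have nn: "AE x in m. 0 \<le> (wgrad d m f x)^2 * \<rho> t x"
      using \<rho>[OF True] unfolding prob_density_def by (auto elim!: eventually_mono)
    have "(\<integral>x. (wgrad d m f x)^2 * \<rho> t x \<partial>m) = enn2real (\<integral>\<^sup>+x. ennreal ((wgrad d m f x)^2 * \<rho> t x) \<partial>m)"
      using nn by (intro integral_eq_nn_integral) auto
    then show ?thesis using True by (simp add: slope_norm_def ennreal_mult')
  qed (auto simp: slope_norm_def)
  ultimately show ?thesis by simp
qed

section \<open>The least velocity bound\<close>

lemma borel_bound_dominated_limit:
  assumes c: "\<And>n::nat. borel_bound (c n)" and e: "\<And>n r. c n r \<le> e r"
    and e': "e \<in> borel_measurable borel" "\<And>r. r \<notin> {0<..<1} \<Longrightarrow> e r = 0" "integrable lborel (\<lambda>r. (e r)^2)"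
    and lim: "\<And>r. (\<lambda>n. c n r) \<longlonglongrightarrow> c' r"
  shows "borel_bound c'"
proof -
  note D = borel_boundD[OF c]
  have [measurable]: "c n \<in> borel_measurable borel" "e \<in> borel_measurable borel" for n using D e' by auto
  have c'm[measurable]: "c' \<in> borel_measurable borel" by (rule borel_measurable_LIMSEQ_real[OF lim]) auto
  have nn: "0 \<le> c' r" for r by (rule LIMSEQ_le_const[OF lim]) (use D(2) in auto)
  have le: "c' r \<le> e r" for r by (rule LIMSEQ_le_const2[OF lim]) (use e in auto)
  have z: "c' r = 0" if "r \<notin> {0<..<1}" for r using le[of r] nn[of r] e'(2)[OF that] by simp
  have ei: "integrable lborel e" by (rule L2_01_integrable[OF e'])
  have e0: "0 \<le> e r" for r using nn le order_trans by blast
  show ?thesis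
    unfolding borel_bound_def
  proof (intro conjI allI ballI impI)
    show "integrable lborel (\<lambda>r. (c' r)^2)"
      by (rule Bochner_Integration.integrable_bound[OF e'(3)]) (use nn le in \<open>auto intro!: power_mono\<close>)
    fix f and s t :: real assume f: "f \<in> A_Ch d m" and st: "0 \<le> s \<and> s \<le> t \<and> t \<le> 1"
    have [measurable]: "slope_norm f \<in> borel_measurable borel" by (rule slope_norm_measurable[OF f])
    obtain C where C: "0 \<le> C" "\<And>r. 0 \<le> slope_norm f r" "\<And>r. slope_norm f r \<le> C"
      using slope_norm_bounded[OF f] by blast
    have "(\<lambda>n. \<integral>\<^sup>+r. ennreal (c n r * slope_norm f r) * indicator {s<..<t} r \<partial>lborel)
      \<longlonglongrightarrow> (\<integral>\<^sup>+r. ennreal (c' r * slope_norm f r) * indicator {s<..<t} r \<partial>lborel)"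
    proof (rule nn_integral_dominated_convergence[where w = "\<lambda>r. ennreal (e r * C)"])
      show "AE r in lborel. ennreal (c n r * slope_norm f r) * indicator {s<..<t} r \<le> ennreal (e r * C)" for n
        using e C e0 D(2) by (intro AE_I2) (auto simp: indicator_def intro!: ennreal_leI mult_mono)
      have "(\<integral>\<^sup>+r. ennreal (e r * C) \<partial>lborel) = ennreal (\<integral>r. e r * C \<partial>lborel)"
        using ei e0 C by (intro nn_integral_eq_integral) auto
      then show "(\<integral>\<^sup>+r. ennreal (e r * C) \<partial>lborel) < \<infinity>" by simp
      show "AE r in lborel. (\<lambda>n. ennreal (c n r * slope_norm f r) * indicator {s<..<t} r)
        \<longlonglongrightarrow> ennreal (c' r * slope_norm f r) * indicator {s<..<t} r"
        by (intro AE_I2) (auto simp: indicator_def intro!: tendsto_ennrealI tendsto_intros lim)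
    qed auto
    then show "ennreal \<bar>(\<integral>x. f x * \<rho> t x \<partial>m) - (\<integral>x. f x * \<rho> s x \<partial>m)\<bar>
        \<le> (\<integral>\<^sup>+r. ennreal (c' r * slope_norm f r) * indicator {s<..<t} r \<partial>lborel)"
      by (rule LIMSEQ_le_const) (use D(6) f st in auto)
  qed (use c'm nn z in auto)
qed

text \<open>Half lines may be switched because the left-hand side of the bound is subadditive along \<open>[s, t]\<close>;
  the sets that may be switched form a sigma-algebra.\<close>

lemma borel_bound_switch:
  assumes "E \<in> sets (borel :: real measure)" "borel_bound c1" "borel_bound c2"
  shows "borel_bound (\<lambda>r. if r \<in> E then c1 r else c2 r)"
proof -
  have "E \<in> sigma_sets UNIV (range atMost)"
    using assms(1) unfolding borel_eq_atMost by (subst (asm) sets_measure_of) auto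
  then show ?thesis using assms(2,3)
  proof (induction arbitrary: c1 c2 rule: sigma_sets.induct)
    case (Basic E)
    then obtain a where E: "E = {..a}" by auto
    note D1 = borel_boundD[OF Basic(2)] note D2 = borel_boundD[OF Basic(3)]
    have [measurable]: "c1 \<in> borel_measurable borel" "c2 \<in> borel_measurable borel" using D1 D2 by auto
    have cm[measurable]: "(\<lambda>r. if r \<in> E then c1 r else c2 r) \<in> borel_measurable borel" unfolding E by measurable
    show ?case
      unfolding borel_bound_def
    proof (intro conjI allI ballI impI)
      show "integrable lborel (\<lambda>r. (if r \<in> E then c1 r else c2 r)^2)"
        by (rule Bochner_Integration.integrable_bound[OF Bochner_Integration.integrable_add[OF D1(4) D2(4)]]) (use cm in auto)
      fix f and s t :: real assume f: "f \<in> A_Ch d m" and st: "0 \<le> s \<and> s \<le> t \<and> t \<le> 1"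
      have [measurable]: "slope_norm f \<in> borel_measurable borel" by (rule slope_norm_measurable[OF f])
      define F where "F t = (\<integral>x. f x * \<rho> t x \<partial>m)" for t
      let ?R = "\<lambda>(c :: real \<Rightarrow> real) (s :: real) (t :: real). \<integral>\<^sup>+r. ennreal (c r * slope_norm f r) * indicator {s<..<t} r \<partial>lborel"
      let ?c = "\<lambda>r. if r \<in> E then c1 r else c2 r"
      consider "a \<le> s" | "s \<le> a" "a \<le> t" | "t \<le> a" by linarith
      then have "ennreal \<bar>F t - F s\<bar> \<le> ?R ?c s t"
      proof cases
        case 1
        have "?R ?c s t = ?R c2 s t" using 1 by (intro nn_integral_cong) (auto simp: E indicator_def)
        then show ?thesis using D2(6)[OF f, of s t] st by (simp add: F_def)
      next
        case 3
        have "?R ?c s t = ?R c1 s t" using 3 by (intro nn_integral_cong) (auto simp: E indicator_def)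
        then show ?thesis using D1(6)[OF f, of s t] st by (simp add: F_def)
      next
        case 2
        have "ennreal \<bar>F t - F s\<bar> \<le> ennreal (\<bar>F a - F s\<bar> + \<bar>F t - F a\<bar>)" by (intro ennreal_leI) linarith
        also have "\<dots> = ennreal \<bar>F a - F s\<bar> + ennreal \<bar>F t - F a\<bar>" by simp
        also have "\<dots> \<le> ?R c1 s a + ?R c2 a t"
          using D1(6)[OF f, of s a] D2(6)[OF f, of a t] st 2 unfolding F_def by (intro add_mono) auto
        also have "\<dots> = (\<integral>\<^sup>+r. ennreal (c1 r * slope_norm f r) * indicator {s<..<a} r
            + ennreal (c2 r * slope_norm f r) * indicator {a<..<t} r \<partial>lborel)"
          by (rule nn_integral_add[symmetric]) auto
        also have "\<dots> \<le> ?R ?c s t"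
          using 2 by (intro nn_integral_mono) (auto simp: E indicator_def)
        finally show ?thesis .
      qed
      then show "ennreal \<bar>(\<integral>x. f x * \<rho> t x \<partial>m) - (\<integral>x. f x * \<rho> s x \<partial>m)\<bar> \<le> ?R ?c s t" by (simp add: F_def)
    qed (use cm D1 D2 in auto)
  next
    case Empty
    then show ?case by simp
  next
    case (Compl E)
    have "(\<lambda>r. if r \<in> UNIV - E then c1 r else c2 r) = (\<lambda>r. if r \<in> E then c2 r else c1 r)" by auto
    then show ?case using Compl.IH[OF Compl.prems(2,1)] by simp
  next
    case (Union A)
    note D1 = borel_boundD[OF Union.prems(1)] note D2 = borel_boundD[OF Union.prems(2)]
    \<comment> \<open>Finite unions are switched set by set; the countable union is their limit,
      dominated by \<open>c1 + c2\<close>.\<close>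
    have fin: "borel_bound (\<lambda>r. if r \<in> (\<Union>i<n. A i) then c1 r else c2 r)" for n
    proof (induction n)
      case (Suc n)
      have "(\<lambda>r. if r \<in> (\<Union>i<Suc n. A i) then c1 r else c2 r)
        = (\<lambda>r. if r \<in> A n then c1 r else (\<lambda>r. if r \<in> (\<Union>i<n. A i) then c1 r else c2 r) r)"
        by (auto simp: lessThan_Suc)
      then show ?case using Union.IH[OF Union.prems(1) Suc.IH, of n] by simp
    qed (use Union.prems in simp)
    show ?case
    proof (rule borel_bound_dominated_limit[OF fin, where e = "\<lambda>r. c1 r + c2 r"])
      show "integrable lborel (\<lambda>r. (c1 r + c2 r)^2)"
      proof -
        have "c1 \<in> L2 lborel" "c2 \<in> L2 lborel" using D1 D2 by (auto simp: L2_def)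
        from L2_add[OF this] show ?thesis by auto
      qed
      show "(\<lambda>n. if r \<in> (\<Union>i<n. A i) then c1 r else c2 r) \<longlonglongrightarrow> (if r \<in> (\<Union>i. A i) then c1 r else c2 r)" for r
      proof (cases "r \<in> (\<Union>i. A i)")
        case True
        then obtain k where "r \<in> A k" by auto
        then have "(if r \<in> (\<Union>i<n. A i) then c1 r else c2 r) = c1 r" if "Suc k \<le> n" for n
          using that by (auto intro!: bexI[of _ k])
        then have "\<forall>\<^sub>F n in sequentially. (if r \<in> (\<Union>i<n. A i) then c1 r else c2 r) = c1 r"
          unfolding eventually_sequentially by blast
        moreover have "(if r \<in> (\<Union>i. A i) then c1 r else c2 r) = c1 r" using True by simp
        ultimately show ?thesis by (simp only: tendsto_eventually)
      qed (auto intro: tendsto_eventually)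
    qed (use D1 D2 in auto)
  qed
qed

text \<open>The bounds are stable under minima, by switching on \<open>{r. k r \<le> l r}\<close>,
  and under decreasing limits. So \<open>ex_AE_least\<close> provides a least one, and the
  \<open>SOME\<close> in \<open>CE_speed\<close> denotes a bound.\<close>

lemma CE_speed_bound: "CE_bound d m \<rho> (CE_speed d m \<rho>)"
proof -
  obtain c0 where "CE_bound d m \<rho> c0" using ex_bound by blast
  then obtain c1 where c1: "borel_bound c1" by (rule CE_bound_representative)
  obtain h where h: "borel_bound h" "\<And>k. borel_bound k \<Longrightarrow> AE r in lborel. h r \<le> k r"
  proof (rule ex_AE_least[of "{c. borel_bound c}" lborel])
    show "{c. borel_bound c} \<noteq> {}" using c1 by auto
    show "(\<lambda>x. min (k x) (l x)) \<in> {c. borel_bound c}" if "k \<in> {c. borel_bound c}" "l \<in> {c. borel_bound c}" for k l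
    proof -
      have [measurable]: "k \<in> borel_measurable borel" "l \<in> borel_measurable borel" using that by (auto dest: borel_boundD)
      have "{r\<in>space borel. k r \<le> l r} \<in> sets borel" by measurable
      then have E: "{r. k r \<le> l r} \<in> sets borel" by simp
      have "(\<lambda>x. min (k x) (l x)) = (\<lambda>r. if r \<in> {r. k r \<le> l r} then k r else l r)" by (auto simp: min_def)
      then show ?thesis using borel_bound_switch[OF E] that by simp
    qed
    show "(\<lambda>x. INF n. F n x) \<in> {c. borel_bound c}"
      if F: "\<And>n::nat. F n \<in> {c. borel_bound c}" "\<And>n x. F (Suc n) x \<le> F n x" for F
    proof -
      have Fb: "borel_bound (F n)" for n using F(1) by simp
      note D = borel_boundD[OF Fb]
      have dec: "decseq (\<lambda>n. F n x)" for x by (rule decseq_SucI) (rule F(2))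
      have "borel_bound (\<lambda>x. INF n. F n x)"
      proof (rule borel_bound_dominated_limit[OF Fb, where e = "F 0"])
        show "F n r \<le> F 0 r" for n r using decseqD[OF dec, of 0 n] by simp
        show "(\<lambda>n. F n r) \<longlonglongrightarrow> (INF n. F n r)" for r
          by (rule LIMSEQ_decseq_INF[OF _ dec]) (auto intro!: bdd_belowI[of _ 0] D)
      qed (use D in auto)
      then show ?thesis by simp
    qed
  qed (auto dest: borel_boundD)
  have least: "AE r in lebesgue_on {0<..<1}. h r \<le> c' r" if c': "CE_bound d m \<rho> c'" for c'
  proof -
    obtain k where k: "borel_bound k" "AE r in lebesgue_on {0<..<1}. c' r = k r"
      using c' by (rule CE_bound_representative)
    have "AE r in lebesgue. h r \<le> k r" by (rule AE_completion[OF h(2)[OF k(1)]])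
    then have "AE r in lebesgue_on {0<..<1}. h r \<le> k r" by (subst AE_restrict_space_iff) auto
    with k(2) show ?thesis by eventually_elim auto
  qed
  define best where "best c \<longleftrightarrow> CE_bound d m \<rho> c \<and>
    (\<forall>c'. CE_bound d m \<rho> c' \<longrightarrow> (AE t in lebesgue_on {0<..<1}. c t \<le> c' t))" for c
  have "best h" unfolding best_def
    using borel_bound_CE_bound[OF h(1)] least by (intro conjI allI impI)
  then have "best (SOME c. best c)" by (rule someI[where P = best])
  moreover have "CE_speed d m \<rho> = (SOME c. best c)" by (simp add: CE_speed_def best_def)
  ultimately show ?thesis by (simp add: best_def)
qed

end

section \<open>The dual distance is bounded by the dynamic one\<close>

lemma integral_affine_kernel:
  fixes g :: "real \<Rightarrow> real"
  assumes "0 < \<epsilon>" shows "(\<integral>r. g ((r - \<tau>) / \<epsilon>) \<partial>lborel) = \<epsilon> * (\<integral>u. g u \<partial>lborel)"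
  using lborel_integral_real_affine[of \<epsilon> "\<lambda>r. g ((r - \<tau>) / \<epsilon>)" \<tau>] assms by simp

text \<open>A crude modulus of continuity along the curve under a constant slope bound; it only has
  to vanish when the time interval shrinks.\<close>

lemma (in density_curve) density_pairing_diff_le:
  assumes c: "borel_bound c" and f: "f \<in> D_Ch d m" and fA: "f \<in> A_Ch d m"
    and S: "0 \<le> S" "AE x in m. (wgrad d m f x)^2 \<le> S^2" and rt: "0 \<le> r" "r \<le> t" "t \<le> 1"
  shows "\<bar>(\<integral>x. f x * \<rho> t x \<partial>m) - (\<integral>x. f x * \<rho> r x \<partial>m)\<bar> \<le> S * (\<integral>u. indicator {r<..<t} u * c u \<partial>lborel)"
proof -
  note D = borel_boundD[OF c]
  have [measurable]: "wgrad d m f \<in> borel_measurable m" using wgrad_L2[OF f] by auto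
  have sn: "slope_norm f u \<le> S" for u
  proof (cases "u \<in> {0..1}")
    case True
    have "(\<integral>x. (wgrad d m f x)^2 * \<rho> u x \<partial>m) \<le> S^2"
      using prob_density_bounded(2)[OF \<rho>[OF True], of "\<lambda>x. (wgrad d m f x)^2" "S^2"] S(2) by simp
    then show ?thesis using True S(1) by (simp add: slope_norm_def real_le_lsqrt)
  qed (use S in \<open>auto simp: slope_norm_def\<close>)
  have gi: "integrable lborel (\<lambda>u. indicator {r<..<t} u * c u)"
    using integrable_mult_indicator[of "{r<..<t}" lborel c] D(5) by simp
  have "ennreal \<bar>(\<integral>x. f x * \<rho> t x \<partial>m) - (\<integral>x. f x * \<rho> r x \<partial>m)\<bar>
    \<le> (\<integral>\<^sup>+u. ennreal (c u * slope_norm f u) * indicator {r<..<t} u \<partial>lborel)" by (rule D(6)[OF fA rt])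
  also have "\<dots> \<le> (\<integral>\<^sup>+u. ennreal (S * (indicator {r<..<t} u * c u)) \<partial>lborel)"
    using mult_left_mono[OF sn D(2)]
    by (intro nn_integral_mono) (auto simp: indicator_def mult.commute[of S] intro!: ennreal_leI)
  also have "\<dots> = ennreal (S * (\<integral>u. indicator {r<..<t} u * c u \<partial>lborel))"
    using gi D(2) S(1) by (subst nn_integral_eq_integral) auto
  finally show ?thesis using S(1) D(2)
    by (subst (asm) ennreal_le_iff) (auto intro!: mult_nonneg_nonneg integral_nonneg_AE)
qed

lemma sum_interval_integrals_le:
  fixes g :: "real \<Rightarrow> real"
  assumes g: "integrable lborel g" "\<And>u. 0 \<le> g u" and N: "0 < N"
  shows "(\<Sum>i<N. \<integral>u. indicator {real i / real N<..<real (Suc i) / real N} u * g u \<partial>lborel) \<le> (\<integral>u. g u \<partial>lborel)"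
proof -
  have gi: "integrable lborel (\<lambda>u. indicator {a<..<b} u * g u)" for a b :: real
    using integrable_mult_indicator[of "{a<..<b}" lborel g] g by simp
  have "(\<Sum>i<N. \<integral>u. indicator {real i / real N<..<real (Suc i) / real N} u * g u \<partial>lborel)
    = (\<integral>u. (\<Sum>i<N. indicator {real i / real N<..<real (Suc i) / real N} u * g u) \<partial>lborel)"
    by (rule Bochner_Integration.integral_sum[symmetric]) (rule gi)
  also have "\<dots> \<le> (\<integral>u. g u \<partial>lborel)"
  proof (rule integral_mono[OF _ g(1)])
    show "integrable lborel (\<lambda>u. \<Sum>i<N. indicator {real i / real N<..<real (Suc i) / real N} u * g u)"
      by (intro Bochner_Integration.integrable_sum gi)
    fix u :: real
    have "(\<Sum>i<N. indicator {real i / real N<..<real (Suc i) / real N} u :: real) \<le> 1"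
    proof (cases "\<exists>i<N. u \<in> {real i / real N<..<real (Suc i) / real N}")
      case True
      then obtain i where i: "i < N" "u \<in> {real i / real N<..<real (Suc i) / real N}" by blast
      have "indicator {real j / real N<..<real (Suc j) / real N} u = (if j = i then 1 else 0 :: real)" for j
      proof (cases "j = i")
        case False
        have "u \<notin> {real j / real N<..<real (Suc j) / real N}"
        proof
          assume "u \<in> {real j / real N<..<real (Suc j) / real N}"
          then have "real j < u * N" "u * N < real (Suc j)" "real i < u * N" "u * N < real (Suc i)"
            using i(2) N by (auto simp: field_simps)
          then have "j < Suc i" "i < Suc j" by (metis less_trans of_nat_less_iff)+
          with False show False by simp
        qed
        then show ?thesis using False by simp
      qed (use i in simp)
      then show ?thesis using i(1) by (simp add: sum.delta)
    next
      case False
      then have "(\<Sum>i<N. indicator {real i / real N<..<real (Suc i) / real N} u :: real) = 0"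
        by (intro sum.neutral) auto
      then show ?thesis by linarith
    qed
    then have "(\<Sum>i<N. indicator {real i / real N<..<real (Suc i) / real N} u) * g u \<le> 1 * g u"
      using g(2) by (intro mult_right_mono) auto
    then show "(\<Sum>i<N. indicator {real i / real N<..<real (Suc i) / real N} u * g u) \<le> g u"
      by (simp add: sum_distrib_right)
  qed
  finally show ?thesis .
qed

locale potential_along_curve = dual_potential d m \<phi> + density_curve d m \<rho>
  for d :: "'a::t2_space \<Rightarrow> 'a \<Rightarrow> ennreal" and m \<phi> \<rho>
begin

definition pairing :: "('a \<Rightarrow> real) \<Rightarrow> real \<Rightarrow> real" where
  "pairing g t = (\<integral>x. g x * \<rho> t x \<partial>m)"

text \<open>While the curve runs through [0, 1], the averaged potential runs through
  \<open>\<tau>\<close> from 0 to \<open>1 - \<epsilon>\<close>, the range where its kernel stays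
  inside (0, 1). In each of \<open>N\<close> time steps the move of the density costs half the
  weighted action plus a multiple of \<open>pairing (G \<tau>)\<close>, by Young's inequality, and
  the move of the potential gains nearly the same multiple, because \<open>G\<close> is minus its
  derivative in \<open>\<tau>\<close>.\<close>

lemma regularized_action_estimate:
  assumes c: "borel_bound c" and \<epsilon>: "0 < \<epsilon>" "\<epsilon> < 1"
    and \<kappa>: "\<And>t. 0 \<le> \<kappa> t" "(\<integral>t. \<kappa> t \<partial>lborel) = 1" "\<And>t. t \<notin> {1/3..2/3} \<Longrightarrow> \<kappa> t = 0" "\<And>t. t \<notin> {1/3..2/3} \<Longrightarrow> \<kappa>' t = 0"
      "continuous_on UNIV \<kappa>" "continuous_on UNIV \<kappa>'"
    and K: "0 \<le> K" "\<And>x h. \<bar>\<kappa> (x + h) - \<kappa> x - h * \<kappa>' x\<bar> \<le> K * h^2"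
    and test: "\<And>\<epsilon> \<tau>. 0 < \<epsilon> \<Longrightarrow> 0 < \<tau> + \<epsilon>/3 \<Longrightarrow> \<tau> + 2*\<epsilon>/3 < 1 \<Longrightarrow> test_fun_01 (\<lambda>r. \<kappa> ((r - \<tau>) / \<epsilon>) / \<epsilon>)"
    and der: "\<And>\<epsilon> \<tau>. 0 < \<epsilon> \<Longrightarrow> deriv (\<lambda>r. \<kappa> ((r - \<tau>) / \<epsilon>) / \<epsilon>) = (\<lambda>r. \<kappa>' ((r - \<tau>) / \<epsilon>) / \<epsilon>^2)"
  shows "pairing (time_avg (\<lambda>r. \<kappa> ((r - (1 - \<epsilon>)) / \<epsilon>) / \<epsilon>)) 1 - pairing (time_avg (\<lambda>r. \<kappa> ((r - 0) / \<epsilon>) / \<epsilon>)) 0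
    \<le> (\<integral>r. (c r)^2 \<partial>lborel) / (2 * (1 - \<epsilon>))"
proof -
  note D = borel_boundD[OF c]
  obtain C where C: "0 \<le> C" "\<And>t x. \<bar>\<Phi> t x\<bar> \<le> C" using \<Phi>_bounded by blast
  define \<eta> where "\<eta> \<tau> r = \<kappa> ((r - \<tau>) / \<epsilon>) / \<epsilon>" for \<tau> r
  define \<eta>' where "\<eta>' \<tau> r = \<kappa>' ((r - \<tau>) / \<epsilon>) / \<epsilon>^2" for \<tau> r
  define f where "f \<tau> = time_avg (\<eta> \<tau>)" for \<tau>
  define G where "G \<tau> = time_avg (\<eta>' \<tau>)" for \<tau>
  have der': "deriv (\<eta> \<tau>) = \<eta>' \<tau>" for \<tau> unfolding \<eta>_def \<eta>'_def by (rule der[OF \<epsilon>(1)])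
  have supp: "(r - \<tau>) / \<epsilon> \<notin> {1/3..2/3}" if "r \<notin> {\<tau> + \<epsilon>/3..\<tau> + 2*\<epsilon>/3}" for r \<tau>
    using that \<epsilon>(1) by (auto simp: field_simps)
  have i\<eta>: "integrable lborel (\<eta> \<tau>)" for \<tau>
  proof (rule integrable_compact_support[of _ "\<tau> + \<epsilon>/3" "\<tau> + 2*\<epsilon>/3"])
    show "continuous_on UNIV (\<eta> \<tau>)" unfolding \<eta>_def
      using \<epsilon> by (intro continuous_intros continuous_on_compose2[OF \<kappa>(5)]) auto
  qed (use supp \<kappa>(3) in \<open>simp add: \<eta>_def\<close>)
  have i\<eta>': "integrable lborel (\<eta>' \<tau>)" for \<tau>
  proof (rule integrable_compact_support[of _ "\<tau> + \<epsilon>/3" "\<tau> + 2*\<epsilon>/3"])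
    show "continuous_on UNIV (\<eta>' \<tau>)" unfolding \<eta>'_def
      using \<epsilon> by (intro continuous_intros continuous_on_compose2[OF \<kappa>(6)]) auto
  qed (use supp \<kappa>(4) in \<open>simp add: \<eta>'_def\<close>)
  have [measurable]: "\<eta> \<tau> \<in> borel_measurable borel" "\<eta>' \<tau> \<in> borel_measurable borel" for \<tau>
    using i\<eta>[of \<tau>] i\<eta>'[of \<tau>] by auto
  have fm[measurable]: "f \<tau> \<in> borel_measurable m" and Gm[measurable]: "G \<tau> \<in> borel_measurable m" for \<tau>
    unfolding f_def G_def by measurable
  have \<eta>0: "0 \<le> \<eta> \<tau> r" for \<tau> r using \<kappa>(1) \<epsilon> by (simp add: \<eta>_def)
  have \<eta>1: "(\<integral>r. \<eta> \<tau> r \<partial>lborel) = 1" for \<tau>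
    unfolding \<eta>_def using integral_affine_kernel[OF \<epsilon>(1), of \<kappa> \<tau>] \<kappa>(2) \<epsilon> by simp
  have f_bd: "\<bar>f \<tau> x\<bar> \<le> C" for \<tau> x
    using time_avg_bound[OF i\<eta> C(2), of \<tau> x] \<eta>0 \<eta>1 by (simp add: f_def)
  define Gb where "Gb = C * ((\<integral>u. \<bar>\<kappa>' u\<bar> \<partial>lborel) / \<epsilon>)"
  have Gb0: "0 \<le> Gb" unfolding Gb_def using C \<epsilon> by (intro mult_nonneg_nonneg divide_nonneg_nonneg integral_nonneg_AE) auto
  have G_bd: "\<bar>G \<tau> x\<bar> \<le> Gb" for \<tau> x
  proof -
    have "(\<integral>r. \<bar>\<eta>' \<tau> r\<bar> \<partial>lborel) = (\<integral>u. \<bar>\<kappa>' u\<bar> \<partial>lborel) / \<epsilon>"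
      unfolding \<eta>'_def using integral_affine_kernel[OF \<epsilon>(1), of "\<lambda>u. \<bar>\<kappa>' u\<bar>" \<tau>] \<epsilon>
      by (simp add: abs_divide power2_eq_square)
    then show ?thesis using time_avg_bound[OF i\<eta>' C(2), of \<tau> x] by (simp add: G_def Gb_def)
  qed
  \<comment> \<open>A uniform bound for the slopes: \<open>G\<close> is bounded by
    \<open>Gb\<close>, and the squared slope by \<open>2 * G\<close>. It places
    \<open>f \<tau>\<close> in \<open>A_Ch\<close>, against which the curve can be tested.\<close>
  define S where "S = sqrt (2 * Gb)"
  have S: "0 \<le> S" "S^2 = 2 * Gb" using Gb0 by (auto simp: S_def)
  have slope: "f \<tau> \<in> D_Ch d m" "AE x in m. (wgrad d m (f \<tau>) x)^2 \<le> 2 * G \<tau> x"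
    "f \<tau> \<in> A_Ch d m" "AE x in m. (wgrad d m (f \<tau>) x)^2 \<le> S^2"
    if \<tau>: "0 < \<tau> + \<epsilon>/3" "\<tau> + 2*\<epsilon>/3 < 1" for \<tau>
  proof -
    have "test_fun_01 (\<eta> \<tau>)" using test[OF \<epsilon>(1) \<tau>] by (simp add: \<eta>_def[abs_def])
    note sl = time_avg_slope[OF this \<eta>0 \<eta>1, folded f_def]
    show fD: "f \<tau> \<in> D_Ch d m" by (rule sl)
    show 1: "AE x in m. (wgrad d m (f \<tau>) x)^2 \<le> 2 * G \<tau> x" using sl(2) by (simp add: der' G_def)
    show 2: "AE x in m. (wgrad d m (f \<tau>) x)^2 \<le> S^2"
      using 1 by eventually_elim (use G_bd[of \<tau>] S(2) in \<open>smt (verit) abs_ge_self\<close>)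
    show "f \<tau> \<in> A_Ch d m"
    proof (rule A_ChI[OF wgrad_minimal(1)[OF fD], of "max C S"])
      show "AE x in m. \<bar>f \<tau> x\<bar> \<le> max C S" using f_bd by (auto simp: le_max_iff_disj)
      show "AE x in m. wgrad d m (f \<tau>) x \<le> max C S"
        using 2 by eventually_elim (use S(1) in \<open>auto simp: le_max_iff_disj dest: power2_le_imp_le\<close>)
    qed
  qed
  \<comment> \<open>The Taylor error \<open>K * (\<delta> / \<epsilon>)^2\<close> of the kernel,
    divided by \<open>\<epsilon>\<close> from its normalization and multiplied by the bound
    \<open>C\<close> of the potential.\<close>
  define K2 where "K2 = C * K / \<epsilon>^3"
  have K2: "0 \<le> K2" using C K \<epsilon> by (simp add: K2_def)
  have Taylor: "\<bar>f (\<tau> + \<delta>) x - f \<tau> x + \<delta> * G \<tau> x\<bar> \<le> K2 * \<delta>^2" for \<tau> \<delta> x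
  proof -
    have pt: "\<bar>\<eta> (\<tau> + \<delta>) r - \<eta> \<tau> r + \<delta> * \<eta>' \<tau> r\<bar> \<le> K * \<delta>^2 / \<epsilon>^3" for r
    proof -
      define y where "y = (r - \<tau>) / \<epsilon>"
      have e: "(r - (\<tau> + \<delta>)) / \<epsilon> = y + (- \<delta> / \<epsilon>)" by (simp add: y_def diff_divide_distrib add_divide_distrib)
      have "\<eta> (\<tau> + \<delta>) r - \<eta> \<tau> r + \<delta> * \<eta>' \<tau> r = (\<kappa> (y + (- \<delta> / \<epsilon>)) - \<kappa> y - (- \<delta> / \<epsilon>) * \<kappa>' y) / \<epsilon>"
        unfolding \<eta>_def \<eta>'_def e y_def[symmetric] using \<epsilon> by (simp add: field_simps power2_eq_square)
      also have "\<bar>\<dots>\<bar> \<le> K * (- \<delta> / \<epsilon>)^2 / \<epsilon>"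
        using K(2)[of y "- \<delta> / \<epsilon>"] \<epsilon> by (simp add: abs_divide divide_right_mono)
      also have "\<dots> = K * \<delta>^2 / \<epsilon>^3" using \<epsilon> by (simp add: power2_eq_square power3_eq_cube field_simps)
      finally show ?thesis .
    qed
    note ti = time_avg_integrable[OF i\<eta>] time_avg_integrable[OF i\<eta>']
    define w where "w r = (\<eta> (\<tau> + \<delta>) r - \<eta> \<tau> r + \<delta> * \<eta>' \<tau> r) * \<Phi> r x" for r
    have w_eq: "w r = \<eta> (\<tau> + \<delta>) r * \<Phi> r x - \<eta> \<tau> r * \<Phi> r x + \<delta> * (\<eta>' \<tau> r * \<Phi> r x)" for r
      by (simp add: w_def algebra_simps)
    have wi: "integrable lborel w" unfolding w_eq using ti by auto
    have "f (\<tau> + \<delta>) x - f \<tau> x + \<delta> * G \<tau> x = (\<integral>r. w r \<partial>lborel)"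
      unfolding w_eq f_def G_def time_avg_def using ti by simp
    also have "\<bar>\<dots>\<bar> \<le> (\<integral>r. \<bar>w r\<bar> \<partial>lborel)" by (rule integral_abs_bound)
    also have "\<dots> \<le> (\<integral>r. indicator {0..1::real} r * (K2 * \<delta>^2) \<partial>lborel)"
    proof (rule integral_mono)
      show "integrable lborel (\<lambda>r. indicator {0..1::real} r * (K2 * \<delta>^2))" by simp
      fix r
      show "\<bar>w r\<bar> \<le> indicator {0..1} r * (K2 * \<delta>^2)"
      proof (cases "r \<in> {0..1}")
        case True
        have "\<bar>w r\<bar> \<le> (K * \<delta>^2 / \<epsilon>^3) * C"
          unfolding w_def abs_mult using C \<epsilon> K by (intro mult_mono pt) auto
        then show ?thesis using True by (simp add: K2_def mult_ac)
      qed (simp add: w_def \<Phi>_def)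
    qed (use wi in auto)
    also have "\<dots> = K2 * \<delta>^2" by simp
    finally show ?thesis .
  qed
  have Pi: "integrable m (\<lambda>x. f \<tau> x * \<rho> t x)" "integrable m (\<lambda>x. G \<tau> x * \<rho> t x)" if "t \<in> {0..1}" for \<tau> t
    using prob_density_bounded(1)[OF \<rho>[OF that] fm, of \<tau> C] prob_density_bounded(1)[OF \<rho>[OF that] Gm, of \<tau> Gb]
      f_bd G_bd by auto
  have PT: "\<bar>pairing (f (\<tau> + \<delta>)) t - pairing (f \<tau>) t + \<delta> * pairing (G \<tau>) t\<bar> \<le> K2 * \<delta>^2" if t: "t \<in> {0..1}" for \<tau> \<delta> t
  proof -
    have "pairing (f (\<tau> + \<delta>)) t - pairing (f \<tau>) t + \<delta> * pairing (G \<tau>) t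
      = (\<integral>x. (f (\<tau> + \<delta>) x - f \<tau> x + \<delta> * G \<tau> x) * \<rho> t x \<partial>m)"
    proof -
      have "(\<lambda>x. (f (\<tau> + \<delta>) x - f \<tau> x + \<delta> * G \<tau> x) * \<rho> t x)
        = (\<lambda>x. f (\<tau> + \<delta>) x * \<rho> t x - f \<tau> x * \<rho> t x + \<delta> * (G \<tau> x * \<rho> t x))" by (auto simp: algebra_simps)
      then show ?thesis using Pi[OF t] by (simp add: pairing_def)
    qed
    also have "\<bar>\<dots>\<bar> \<le> K2 * \<delta>^2"
      by (rule prob_density_bounded(2)[OF \<rho>[OF t]]) (use Taylor in auto)
    finally show ?thesis .
  qed
  define J where "J = (\<integral>r. (c r)^2 \<partial>lborel)"
  define I where "I = (\<integral>r. c r \<partial>lborel)"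
  have main: "pairing (f (1 - \<epsilon>)) 1 - pairing (f 0) 0
      \<le> J / (2 * (1 - \<epsilon>)) + (K2 / N + (2 * K2 * h + (2 * S / h) * (I / N)))"
    if N: "0 < N" and h: "0 < h" "h < \<epsilon> / 3" for N :: nat and h :: real
  proof -
    define \<tau> where "\<tau> i = (1 - \<epsilon>) * (real i / real N)" for i :: nat
    define \<delta> where "\<delta> = (1 - \<epsilon>) / N"
    have \<delta>: "0 \<le> \<delta>" using \<epsilon> by (simp add: \<delta>_def)
    define t where "t i = real i / real N" for i :: nat
    define Ii where "Ii i = (\<integral>r. indicator {t i<..<t (Suc i)} r * c r \<partial>lborel)" for i
    define Ji where "Ji i = (\<integral>r. indicator {t i<..<t (Suc i)} r * (c r)^2 \<partial>lborel)" for i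
    have Ii0: "0 \<le> Ii i" for i unfolding Ii_def using D(2) by (intro integral_nonneg_AE) auto
    have step: "pairing (f (\<tau> (Suc i))) (t (Suc i)) - pairing (f (\<tau> i)) (t i)
      \<le> Ji i / (2 * (1 - \<epsilon>)) + (K2 * \<delta>^2 + (1 / N) * (2 * K2 * h + (2 * S / h) * Ii i))" if i: "i < N" for i
    proof -
      have t: "t i \<in> {0..1}" "t (Suc i) \<in> {0..1}" "t i \<le> t (Suc i)" "t (Suc i) - t i = 1 / N"
        using i N by (auto simp: t_def field_simps)
      have "real i / real N \<le> 1" using i N by simp
      then have \<tau>i: "0 \<le> \<tau> i" "\<tau> i \<le> 1 - \<epsilon>"
        unfolding \<tau>_def using \<epsilon> mult_left_mono[of "real i / real N" 1 "1 - \<epsilon>"] by auto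
      have \<tau>Suc: "\<tau> (Suc i) = \<tau> i + \<delta>" by (simp add: \<tau>_def \<delta>_def field_simps add_divide_distrib)
      have v1: "0 < \<tau> i + \<epsilon>/3" "\<tau> i + 2*\<epsilon>/3 < 1" and v2: "0 < \<tau> i + h + \<epsilon>/3" "\<tau> i + h + 2*\<epsilon>/3 < 1"
        using \<tau>i \<epsilon> h by auto
      note s1 = slope[OF v1] note s2 = slope[OF v2]
      let ?T = "t (Suc i)"
      have A: "pairing (f (\<tau> (Suc i))) ?T - pairing (f (\<tau> i)) ?T \<le> - \<delta> * pairing (G (\<tau> i)) ?T + K2 * \<delta>^2"
        using PT[OF t(2), of "\<tau> i" \<delta>] unfolding \<tau>Suc by linarith
      \<comment> \<open>A bound for \<open>pairing (G (\<tau> i))\<close> on the whole time step in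
        terms of its value at the right end. Since \<open>G\<close> is not known to lie in
        \<open>A_Ch\<close>, it cannot be followed along the curve directly. It is replaced by the
        difference quotient of \<open>f\<close> with increment \<open>h\<close>, both of whose terms
        lie there; this costs \<open>2 * K2 * h\<close> and a modulus of continuity divided by
        \<open>h\<close>.\<close>
      define Q where "Q = pairing (G (\<tau> i)) ?T + 2 * K2 * h + (2 * S / h) * Ii i"
      have PG: "pairing (G (\<tau> i)) r \<le> Q" if r: "r \<in> {t i<..<?T}" for r
      proof -
        have r01: "r \<in> {0..1}" "0 \<le> r" "r \<le> ?T" "?T \<le> 1" using r t by auto
        have Ir: "(\<integral>u. indicator {r<..<?T} u * c u \<partial>lborel) \<le> Ii i"
          unfolding Ii_def
        proof (rule integral_mono)
          show "integrable lborel (\<lambda>u. indicator {r<..<?T} u * c u)" "integrable lborel (\<lambda>u. indicator {t i<..<?T} u * c u)"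
            using integrable_mult_indicator[of _ lborel c] D(5) by simp_all
        qed (use r D(2) in \<open>auto simp: indicator_def\<close>)
        have d1: "\<bar>pairing (f (\<tau> i)) ?T - pairing (f (\<tau> i)) r\<bar> \<le> S * Ii i"
          using density_pairing_diff_le[OF c s1(1,3) S(1) s1(4) r01(2-4)] mult_left_mono[OF Ir S(1)]
          unfolding pairing_def by linarith
        have d2: "\<bar>pairing (f (\<tau> i + h)) ?T - pairing (f (\<tau> i + h)) r\<bar> \<le> S * Ii i"
          using density_pairing_diff_le[OF c s2(1,3) S(1) s2(4) r01(2-4)] mult_left_mono[OF Ir S(1)]
          unfolding pairing_def by linarith
        have "h * pairing (G (\<tau> i)) r \<le> h * pairing (G (\<tau> i)) ?T + 2 * (K2 * h^2) + 2 * (S * Ii i)"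
          using PT[OF r01(1), of "\<tau> i" h] PT[OF t(2), of "\<tau> i" h] d1 d2 by linarith
        also have "\<dots> = h * Q" using h by (simp add: Q_def field_simps power2_eq_square)
        finally show ?thesis using h by simp
      qed
      have nnG: "0 \<le> pairing (G (\<tau> i)) ?T"
      proof -
        have "AE x in m. 0 \<le> G (\<tau> i) x * \<rho> ?T x"
        proof -
          have "AE x in m. 0 \<le> \<rho> ?T x" using \<rho>[OF t(2)] by (simp add: prob_density_def)
          with s1(2) show ?thesis
          proof eventually_elim
            case (elim x)
            have "0 \<le> G (\<tau> i) x" using elim(1) zero_le_power2[of "wgrad d m (f (\<tau> i)) x"] by linarith
            then show ?case using elim(2) by simp
          qed
        qed
        then show ?thesis unfolding pairing_def by (rule integral_nonneg_AE)
      qed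
      have Q0: "0 \<le> Q" unfolding Q_def using nnG K2 h S Ii0 by (intro add_nonneg_nonneg mult_nonneg_nonneg) auto
      have B: "pairing (f (\<tau> i)) ?T - pairing (f (\<tau> i)) (t i) \<le> Ji i / (2 * (1 - \<epsilon>)) + (1 - \<epsilon>) * Q * (1 / N)"
      proof -
        \<comment> \<open>Young's inequality with the weight \<open>1 - \<epsilon>\<close>, the
          speed of the parameter \<open>\<tau>\<close>: this makes the slope term match the decrease
          \<open>\<delta> * pairing (G \<tau>)\<close> produced by the potential.\<close>
        have pt: "c r * slope_norm (f (\<tau> i)) r \<le> (1 / (2 * (1 - \<epsilon>))) * (c r)^2 + (1 - \<epsilon>) * Q" if r: "r \<in> {t i<..<?T}" for r
        proof -
          have r01: "r \<in> {0..1}" using r t by auto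
          define s where "s = slope_norm (f (\<tau> i)) r"
          have [measurable]: "wgrad d m (f (\<tau> i)) \<in> borel_measurable m" using wgrad_L2[OF s1(1)] by auto
          have "AE x in m. 0 \<le> \<rho> r x" using \<rho>[OF r01] by (simp add: prob_density_def)
          then have nn: "AE x in m. 0 \<le> (wgrad d m (f (\<tau> i)) x)^2 * \<rho> r x" by eventually_elim simp
          have "s^2 = (\<integral>x. (wgrad d m (f (\<tau> i)) x)^2 * \<rho> r x \<partial>m)"
            unfolding s_def slope_norm_def using r01 integral_nonneg_AE[OF nn] by simp
          also have "\<dots> \<le> (\<integral>x. 2 * (G (\<tau> i) x * \<rho> r x) \<partial>m)"
          proof (rule integral_mono_AE)
            show "integrable m (\<lambda>x. (wgrad d m (f (\<tau> i)) x)^2 * \<rho> r x)"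
              by (rule prob_density_bounded(1)[OF \<rho>[OF r01], of _ "S^2"]) (use s1(4) in auto)
            show "integrable m (\<lambda>x. 2 * (G (\<tau> i) x * \<rho> r x))" using Pi(2)[OF r01] by auto
            show "AE x in m. (wgrad d m (f (\<tau> i)) x)^2 * \<rho> r x \<le> 2 * (G (\<tau> i) x * \<rho> r x)"
              using s1(2) \<open>AE x in m. 0 \<le> \<rho> r x\<close>
            proof eventually_elim
              case (elim x)
              then show ?case using mult_right_mono[OF elim] by (simp add: mult.assoc)
            qed
          qed
          also have "\<dots> = 2 * pairing (G (\<tau> i)) r" by (simp add: pairing_def)
          finally have s2: "s^2 \<le> 2 * Q" using PG[OF r] by linarith
          have "0 \<le> (c r / (1 - \<epsilon>) - s)^2" by simp
          then have "2 * (c r * s) / (1 - \<epsilon>) \<le> (c r)^2 / (1 - \<epsilon>)^2 + s^2"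
            by (simp add: power2_diff power_divide)
          then have "((1 - \<epsilon>) / 2) * (2 * (c r * s) / (1 - \<epsilon>)) \<le> ((1 - \<epsilon>) / 2) * ((c r)^2 / (1 - \<epsilon>)^2 + s^2)"
            using \<epsilon> by (intro mult_left_mono) auto
          then have "c r * s \<le> (1 / (2 * (1 - \<epsilon>))) * (c r)^2 + ((1 - \<epsilon>) / 2) * s^2"
            using \<epsilon> by (simp add: distrib_left power2_eq_square)
          also have "\<dots> \<le> (1 / (2 * (1 - \<epsilon>))) * (c r)^2 + ((1 - \<epsilon>) / 2) * (2 * Q)"
            using s2 \<epsilon> by (intro add_left_mono mult_left_mono) auto
          finally show ?thesis by (simp add: s_def)
        qed
        define R where "R r = (1 / (2 * (1 - \<epsilon>))) * (indicator {t i<..<?T} r * (c r)^2) + (1 - \<epsilon>) * Q * indicator {t i<..<?T} r" for r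
        have ci: "integrable lborel (\<lambda>r. indicator {t i<..<?T} r * (c r)^2)"
          using integrable_mult_indicator[of "{t i<..<?T}" lborel "\<lambda>r. (c r)^2"] D(4) by simp
        have ii: "integrable lborel (indicator {t i<..<?T} :: real \<Rightarrow> real)"
          by (rule integrable_real_indicator) (use t(3) in simp_all)
        have Ri: "integrable lborel R" unfolding R_def using ci ii by (intro Bochner_Integration.integrable_add integrable_mult_right) auto
        have R0: "0 \<le> R r" for r using Q0 \<epsilon> by (auto simp: R_def)
        have RI: "(\<integral>r. R r \<partial>lborel) = Ji i / (2 * (1 - \<epsilon>)) + (1 - \<epsilon>) * Q * (1 / N)"
        proof -
          have "(\<integral>r. R r \<partial>lborel) = (1 / (2 * (1 - \<epsilon>))) * Ji i + (1 - \<epsilon>) * Q * (\<integral>r. indicator {t i<..<?T} r \<partial>lborel)"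
            unfolding R_def Ji_def using ci ii by (subst Bochner_Integration.integral_add) (auto intro!: integrable_mult_right)
          then show ?thesis using t by simp
        qed
        have "ennreal \<bar>pairing (f (\<tau> i)) ?T - pairing (f (\<tau> i)) (t i)\<bar>
          \<le> (\<integral>\<^sup>+r. ennreal (c r * slope_norm (f (\<tau> i)) r) * indicator {t i<..<?T} r \<partial>lborel)"
          unfolding pairing_def by (rule D(6)[OF s1(3)]) (use t in auto)
        also have "\<dots> \<le> (\<integral>\<^sup>+r. ennreal (R r) \<partial>lborel)"
          using pt by (intro nn_integral_mono) (auto simp: R_def indicator_def intro!: ennreal_leI)
        also have "\<dots> = ennreal (\<integral>r. R r \<partial>lborel)" using Ri R0 by (intro nn_integral_eq_integral) auto
        finally have "\<bar>pairing (f (\<tau> i)) ?T - pairing (f (\<tau> i)) (t i)\<bar> \<le> (\<integral>r. R r \<partial>lborel)"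
          using R0 by (subst (asm) ennreal_le_iff) (auto intro: integral_nonneg_AE)
        then show ?thesis unfolding RI by linarith
      qed
      have "(1 - \<epsilon>) * Q * (1 / N) = \<delta> * Q" by (simp add: \<delta>_def)
      then have "- \<delta> * pairing (G (\<tau> i)) ?T + (1 - \<epsilon>) * Q * (1 / N) = \<delta> * (Q - pairing (G (\<tau> i)) ?T)"
        by (simp add: algebra_simps)
      also have "Q - pairing (G (\<tau> i)) ?T = 2 * K2 * h + (2 * S / h) * Ii i" by (simp add: Q_def)
      also have "\<delta> * (2 * K2 * h + (2 * S / h) * Ii i) \<le> (1 / N) * (2 * K2 * h + (2 * S / h) * Ii i)"
        using \<epsilon> K2 h S Ii0[of i] by (intro mult_right_mono) (auto simp: \<delta>_def divide_right_mono)
      finally show ?thesis using A B by linarith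
    qed
    have tN: "t N = 1" "t 0 = 0" "\<tau> N = 1 - \<epsilon>" "\<tau> 0 = 0" using N by (auto simp: t_def \<tau>_def)
    have "pairing (f (1 - \<epsilon>)) 1 - pairing (f 0) 0 = (\<Sum>i<N. pairing (f (\<tau> (Suc i))) (t (Suc i)) - pairing (f (\<tau> i)) (t i))"
      by (subst sum_lessThan_telescope) (simp add: tN)
    also have "\<dots> \<le> (\<Sum>i<N. Ji i / (2 * (1 - \<epsilon>)) + (K2 * \<delta>^2 + (1 / N) * (2 * K2 * h + (2 * S / h) * Ii i)))"
      by (rule sum_mono) (use step in auto)
    also have "\<dots> = (\<Sum>i<N. Ji i) / (2 * (1 - \<epsilon>)) + (N * (K2 * \<delta>^2) + ((1 / N) * (N * (2 * K2 * h) + (2 * S / h) * (\<Sum>i<N. Ii i))))"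
      by (simp only: sum.distrib sum_divide_distrib[symmetric] sum_distrib_left[symmetric] sum_distrib_right[symmetric] sum_constant card_lessThan ac_simps)
    also have "\<dots> \<le> J / (2 * (1 - \<epsilon>)) + (K2 / N + ((1 / N) * (N * (2 * K2 * h) + (2 * S / h) * I)))"
    proof (intro add_mono mult_left_mono divide_right_mono)
      show "(\<Sum>i<N. Ji i) \<le> J" unfolding Ji_def t_def J_def
        by (rule sum_interval_integrals_le[OF D(4) _ N]) auto
      show "(\<Sum>i<N. Ii i) \<le> I" unfolding Ii_def t_def I_def
        by (rule sum_interval_integrals_le[OF D(5,2) N])
      have "\<delta>^2 \<le> (1 / N)^2" using \<epsilon> by (intro power_mono) (auto simp: \<delta>_def divide_right_mono)
      then have "N * (K2 * \<delta>^2) \<le> N * (K2 * (1 / N)^2)" using K2 by (intro mult_left_mono) auto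
      also have "\<dots> = K2 / N" using N by (simp add: power2_eq_square)
      finally show "N * (K2 * \<delta>^2) \<le> K2 / N" .
    qed (use \<epsilon> S h K2 in auto)
    also have "\<dots> = J / (2 * (1 - \<epsilon>)) + (K2 / N + (2 * K2 * h + (2 * S / h) * (I / N)))"
      using N by (simp add: distrib_left)
    finally show ?thesis .
  qed
  \<comment> \<open>First the time steps shrink with \<open>h\<close> fixed, which removes the term
    with \<open>h\<close> in the denominator; afterwards \<open>h\<close> tends to 0.\<close>
  have limN: "pairing (f (1 - \<epsilon>)) 1 - pairing (f 0) 0 \<le> J / (2 * (1 - \<epsilon>)) + 2 * K2 * h"
    if h: "0 < h" "h < \<epsilon> / 3" for h
  proof (rule LIMSEQ_le_const)
    have l: "(\<lambda>n. x / real (Suc n)) \<longlonglongrightarrow> 0" for x :: real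
      using tendsto_mult[OF tendsto_const LIMSEQ_inverse_real_of_nat, of x] by (simp add: divide_inverse)
    have "(\<lambda>n. J / (2 * (1 - \<epsilon>)) + (K2 / real (Suc n) + (2 * K2 * h + (2 * S / h) * (I / real (Suc n)))))
      \<longlonglongrightarrow> J / (2 * (1 - \<epsilon>)) + (0 + (2 * K2 * h + (2 * S / h) * 0))"
      by (intro tendsto_intros l)
    then show "(\<lambda>n. J / (2 * (1 - \<epsilon>)) + (K2 / real (Suc n) + (2 * K2 * h + (2 * S / h) * (I / real (Suc n)))))
      \<longlonglongrightarrow> J / (2 * (1 - \<epsilon>)) + 2 * K2 * h" by simp
    show "\<exists>N. \<forall>n\<ge>N. pairing (f (1 - \<epsilon>)) 1 - pairing (f 0) 0
      \<le> J / (2 * (1 - \<epsilon>)) + (K2 / real (Suc n) + (2 * K2 * h + (2 * S / h) * (I / real (Suc n))))"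
      using main[OF zero_less_Suc h] by blast
  qed
  have "((\<lambda>h. J / (2 * (1 - \<epsilon>)) + 2 * K2 * h) \<longlongrightarrow> J / (2 * (1 - \<epsilon>)) + 2 * K2 * 0) (at_right 0)"
    by (intro tendsto_intros)
  then have "pairing (f (1 - \<epsilon>)) 1 - pairing (f 0) 0 \<le> J / (2 * (1 - \<epsilon>)) + 2 * K2 * 0"
    by (rule tendsto_lowerbound)
       (use limN \<epsilon> in \<open>auto simp: eventually_at_right_field intro!: exI[of _ "\<epsilon> / 3"]\<close>)
  then show ?thesis by (simp add: f_def \<eta>_def[abs_def] J_def)
qed

lemma kernel_average_close:
  assumes \<kappa>: "\<And>t. 0 \<le> \<kappa> t" "(\<integral>t. \<kappa> t \<partial>lborel) = 1" "\<And>t. t \<notin> {1/3..2/3} \<Longrightarrow> \<kappa> t = 0"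
      "continuous_on UNIV \<kappa>" and \<epsilon>: "0 < \<epsilon>"
    and s: "s \<in> {0..1}" and close: "\<And>r. r \<in> {\<tau>..\<tau> + \<epsilon>} \<Longrightarrow> \<bar>(\<integral>x. \<Phi> r x * \<rho> s x \<partial>m) - y\<bar> \<le> e"
  shows "\<bar>pairing (time_avg (\<lambda>r. \<kappa> ((r - \<tau>) / \<epsilon>) / \<epsilon>)) s - y\<bar> \<le> e"
proof -
  define \<eta> where "\<eta> r = \<kappa> ((r - \<tau>) / \<epsilon>) / \<epsilon>" for r
  have supp: "\<eta> r = 0" if "r \<notin> {\<tau>..\<tau> + \<epsilon>}" for r
  proof -
    have "(r - \<tau>) / \<epsilon> \<notin> {1/3..2/3}" using that \<epsilon> by (auto simp: field_simps)
    then show ?thesis using \<kappa>(3) by (simp add: \<eta>_def)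
  qed
  have "continuous_on UNIV \<eta>" unfolding \<eta>_def
    using \<epsilon> by (intro continuous_intros continuous_on_compose2[OF \<kappa>(4)]) auto
  then have i: "integrable lborel \<eta>" by (rule integrable_compact_support) (rule supp)
  have \<eta>0: "0 \<le> \<eta> r" for r using \<kappa>(1) \<epsilon> by (simp add: \<eta>_def)
  have \<eta>1: "(\<integral>r. \<eta> r \<partial>lborel) = 1"
    unfolding \<eta>_def using integral_affine_kernel[OF \<epsilon>, of \<kappa> \<tau>] \<kappa>(2) \<epsilon> by simp
  note ti = time_avg_integral[OF i prob_density_integrable(1)[OF \<rho>[OF s]]]
  have "pairing (time_avg \<eta>) s - y = (\<integral>r. \<eta> r * (\<integral>x. \<Phi> r x * \<rho> s x \<partial>m) - y * \<eta> r \<partial>lborel)"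
    unfolding pairing_def using ti i \<eta>1 by simp
  also have "\<bar>\<dots>\<bar> \<le> (\<integral>r. \<bar>\<eta> r * (\<integral>x. \<Phi> r x * \<rho> s x \<partial>m) - y * \<eta> r\<bar> \<partial>lborel)" by (rule integral_abs_bound)
  also have "\<dots> \<le> (\<integral>r. e * \<eta> r \<partial>lborel)"
  proof (rule integral_mono)
    show "integrable lborel (\<lambda>r. \<bar>\<eta> r * (\<integral>x. \<Phi> r x * \<rho> s x \<partial>m) - y * \<eta> r\<bar>)"
      using ti(3) i by (intro integrable_abs Bochner_Integration.integrable_diff integrable_mult_right) auto
    fix r
    show "\<bar>\<eta> r * (\<integral>x. \<Phi> r x * \<rho> s x \<partial>m) - y * \<eta> r\<bar> \<le> e * \<eta> r"
    proof (cases "r \<in> {\<tau>..\<tau> + \<epsilon>}")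
      case True
      define X where "X = (\<integral>x. \<Phi> r x * \<rho> s x \<partial>m)"
      have "\<eta> r * X - y * \<eta> r = (X - y) * \<eta> r" by (simp add: algebra_simps)
      then have "\<bar>\<eta> r * (\<integral>x. \<Phi> r x * \<rho> s x \<partial>m) - y * \<eta> r\<bar> = \<bar>(\<integral>x. \<Phi> r x * \<rho> s x \<partial>m) - y\<bar> * \<eta> r"
        unfolding X_def[symmetric] using \<eta>0[of r] by (simp add: abs_mult)
      also have "\<dots> \<le> e * \<eta> r" using close[OF True] \<eta>0 by (rule mult_right_mono)
      finally show ?thesis .
    qed (simp add: supp)
  qed (use i in auto)
  also have "\<dots> = e" using \<eta>1 by simp
  finally show ?thesis by (simp add: \<eta>_def[abs_def])
qed

text \<open>The averages at the two ends use windows inside [0, 1] that start at 0 and end at 1.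
  Weak-star continuity, tested with the integrable densities \<open>\<rho> 0\<close> and
  \<open>\<rho> 1\<close>, recovers the boundary values as \<open>\<epsilon>\<close> tends to
  0.\<close>

lemma potential_difference_le_action:
  assumes c: "borel_bound c"
  shows "(\<integral>x. \<phi> 1 x * \<rho> 1 x \<partial>m) - (\<integral>x. \<phi> 0 x * \<rho> 0 x \<partial>m) \<le> (\<integral>r. (c r)^2 \<partial>lborel) / 2"
proof -
  obtain \<kappa> \<kappa>' K where \<kappa>: "\<And>t. 0 \<le> \<kappa> t" "(\<integral>t. \<kappa> t \<partial>lborel) = 1" "\<And>t. t \<notin> {1/3..2/3} \<Longrightarrow> \<kappa> t = 0"
      "\<And>t. t \<notin> {1/3..2/3} \<Longrightarrow> \<kappa>' t = 0" "continuous_on UNIV \<kappa>" "continuous_on UNIV \<kappa>'"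
    and K: "0 \<le> K" "\<And>x h. \<bar>\<kappa> (x + h) - \<kappa> x - h * \<kappa>' x\<bar> \<le> K * h^2"
    and test: "\<And>\<epsilon> \<tau>. 0 < \<epsilon> \<Longrightarrow> 0 < \<tau> + \<epsilon>/3 \<Longrightarrow> \<tau> + 2*\<epsilon>/3 < 1 \<Longrightarrow> test_fun_01 (\<lambda>r. \<kappa> ((r - \<tau>) / \<epsilon>) / \<epsilon>)"
    and der: "\<And>\<epsilon> \<tau>. 0 < \<epsilon> \<Longrightarrow> deriv (\<lambda>r. \<kappa> ((r - \<tau>) / \<epsilon>) / \<epsilon>) = (\<lambda>r. \<kappa>' ((r - \<tau>) / \<epsilon>) / \<epsilon>^2)"
    using ex_time_kernel by blast
  define J where "J = (\<integral>r. (c r)^2 \<partial>lborel)"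
  define y where "y s r = (\<integral>x. \<Phi> r x * \<rho> s x \<partial>m)" for s r
  have cont: "continuous_on {0..1} (y s)" if s: "s \<in> {0..1}" for s
  proof -
    have "weak_star_continuous_01 m \<phi>" using admissible unfolding dual_admissible_def by blast
    then have "continuous_on {0..1} (\<lambda>r. \<integral>x. \<phi> r x * \<rho> s x \<partial>m)"
      unfolding weak_star_continuous_01_def using prob_density_integrable(1)[OF \<rho>[OF s]] by blast
    then show ?thesis by (rule continuous_on_cong[THEN iffD1, rotated 2]) (auto simp: y_def \<Phi>_def)
  qed
  have le: "y 1 1 - y 0 0 \<le> J / (2 * (1 - \<epsilon>)) + 2 * e"
    if \<epsilon>: "0 < \<epsilon>" "\<epsilon> < 1" and 1: "\<And>r. r \<in> {1 - \<epsilon>..1} \<Longrightarrow> \<bar>y 1 r - y 1 1\<bar> \<le> e"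
      and 0: "\<And>r. r \<in> {0..\<epsilon>} \<Longrightarrow> \<bar>y 0 r - y 0 0\<bar> \<le> e" for \<epsilon> e
  proof -
    have "\<bar>pairing (time_avg (\<lambda>r. \<kappa> ((r - (1 - \<epsilon>)) / \<epsilon>) / \<epsilon>)) 1 - y 1 1\<bar> \<le> e"
      by (rule kernel_average_close[OF \<kappa>(1-3,5) \<epsilon>(1)]) (use 1 in \<open>auto simp: y_def\<close>)
    moreover have "\<bar>pairing (time_avg (\<lambda>r. \<kappa> ((r - 0) / \<epsilon>) / \<epsilon>)) 0 - y 0 0\<bar> \<le> e"
      by (rule kernel_average_close[OF \<kappa>(1-3,5) \<epsilon>(1)]) (use 0 in \<open>auto simp: y_def\<close>)
    moreover have "pairing (time_avg (\<lambda>r. \<kappa> ((r - (1 - \<epsilon>)) / \<epsilon>) / \<epsilon>)) 1 - pairing (time_avg (\<lambda>r. \<kappa> ((r - 0) / \<epsilon>) / \<epsilon>)) 0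
      \<le> J / (2 * (1 - \<epsilon>))"
      unfolding J_def by (rule regularized_action_estimate[OF c \<epsilon> \<kappa> K test der])
    ultimately show ?thesis by linarith
  qed
  have "y 1 1 - y 0 0 \<le> J / 2 + 2 * e" if e: "0 < e" for e
  proof -
    obtain d1 where d1: "0 < d1" "\<And>r. r \<in> {0..1} \<Longrightarrow> dist r 1 < d1 \<Longrightarrow> dist (y 1 r) (y 1 1) < e"
      using cont[of 1] e unfolding continuous_on_iff by (metis atLeastAtMost_iff order_refl zero_le_one)
    obtain d0 where d0: "0 < d0" "\<And>r. r \<in> {0..1} \<Longrightarrow> dist r 0 < d0 \<Longrightarrow> dist (y 0 r) (y 0 0) < e"
      using cont[of 0] e unfolding continuous_on_iff by (metis atLeastAtMost_iff order_refl zero_le_one)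
    define \<epsilon>0 where "\<epsilon>0 = min 1 (min d0 d1)"
    have \<epsilon>0: "0 < \<epsilon>0" using d0 d1 by (simp add: \<epsilon>0_def)
    have "((\<lambda>\<epsilon>. J / (2 * (1 - \<epsilon>)) + 2 * e) \<longlongrightarrow> J / (2 * (1 - 0)) + 2 * e) (at_right 0)"
      by (intro tendsto_intros) auto
    then have "y 1 1 - y 0 0 \<le> J / (2 * (1 - 0)) + 2 * e"
    proof (rule tendsto_lowerbound)
      show "\<forall>\<^sub>F \<epsilon> in at_right 0. y 1 1 - y 0 0 \<le> J / (2 * (1 - \<epsilon>)) + 2 * e"
        unfolding eventually_at_right_field
      proof (intro exI[of _ \<epsilon>0] conjI allI impI \<epsilon>0)
        fix \<epsilon> assume \<epsilon>: "0 < \<epsilon>" "\<epsilon> < \<epsilon>0"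
        show "y 1 1 - y 0 0 \<le> J / (2 * (1 - \<epsilon>)) + 2 * e"
        proof (rule le)
          show "\<bar>y 1 r - y 1 1\<bar> \<le> e" if "r \<in> {1 - \<epsilon>..1}" for r
            using d1(2)[of r] that \<epsilon> by (auto simp: \<epsilon>0_def dist_real_def)
          show "\<bar>y 0 r - y 0 0\<bar> \<le> e" if "r \<in> {0..\<epsilon>}" for r
            using d0(2)[of r] that \<epsilon> by (auto simp: \<epsilon>0_def dist_real_def)
        qed (use \<epsilon> in \<open>auto simp: \<epsilon>0_def\<close>)
      qed
    qed simp
    then show ?thesis by simp
  qed
  then have "y 1 1 - y 0 0 \<le> J / 2 + e" if "0 < e" for e using that[THEN half_gt_zero] by (metis mult_2 field_sum_of_halves)
  then have "y 1 1 - y 0 0 \<le> J / 2" by (rule field_le_epsilon)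
  then show ?thesis by (simp add: y_def \<Phi>_def J_def)
qed

end

section \<open>Hopf--Lax potentials\<close>

lemma continuous_on_Min_image:
  fixes f :: "'i \<Rightarrow> 'b::topological_space \<Rightarrow> real"
  assumes "finite I" "I \<noteq> {}" "\<And>i. i \<in> I \<Longrightarrow> continuous_on A (f i)"
  shows "continuous_on A (\<lambda>x. Min ((\<lambda>i. f i x) ` I))"
  using assms by (induction I rule: finite_ne_induct) (auto intro!: continuous_on_min)

lemma continuous_on_if_abs_diff_le:
  fixes f :: "real \<Rightarrow> real"
  assumes "\<And>s t. \<bar>f s - f t\<bar> \<le> L * \<bar>s - t\<bar>"
  shows "continuous_on A f"
proof (rule lipschitz_on_continuous_on, rule lipschitz_onI)
  show "dist (f x) (f y) \<le> \<bar>L\<bar> * dist x y" for x y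
    using assms[of x y] by (smt (verit) abs_ge_self mult_right_mono abs_ge_zero dist_real_def)
qed simp

text \<open>The functions \<open>e i\<close> stand for distances that are continuous for the
  topology as well as 1-Lipschitz for \<open>d\<close>. The shift \<open>\<epsilon>\<close> keeps
  the formula Lipschitz in time down to the initial time, where \<open>1 / (2 * t)\<close> is
  singular.\<close>

locale hopf_lax = ext_mm_space +
  fixes I :: "'i set" and u :: "'i \<Rightarrow> real" and e :: "'i \<Rightarrow> 'a \<Rightarrow> real" and M \<epsilon> :: real
  assumes I: "finite I" "I \<noteq> {}"
    and e_bounds: "i \<in> I \<Longrightarrow> 0 \<le> e i x" "i \<in> I \<Longrightarrow> e i x \<le> M"
    and e_continuous: "i \<in> I \<Longrightarrow> continuous_on UNIV (e i)"
    and e_Lipschitz: "i \<in> I \<Longrightarrow> d x y < top \<Longrightarrow> \<bar>e i x - e i y\<bar> \<le> enn2real (d x y)"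
    and \<epsilon>: "0 < \<epsilon>"
begin

definition hl :: "real \<Rightarrow> 'a \<Rightarrow> real" where
  "hl s x = Min ((\<lambda>i. u i + (e i x)^2 / (2 * s)) ` I)"

text \<open>Freezing time at negative arguments makes the potential Lipschitz in time on the whole
  line, so that its pairings are continuous there and can be translated freely.\<close>

definition pot :: "real \<Rightarrow> 'a \<Rightarrow> real" where
  "pot t = hl (max t 0 + \<epsilon>)"

lemma M_nonneg: "0 \<le> M"
  using order_trans[OF e_bounds] I(2) by blast

lemma hl_le: "i \<in> I \<Longrightarrow> hl s x \<le> u i + (e i x)^2 / (2 * s)"
  unfolding hl_def using I by simp

lemma hl_attained: obtains i where "i \<in> I" "hl s x = u i + (e i x)^2 / (2 * s)"
proof -
  have "hl s x \<in> (\<lambda>i. u i + (e i x)^2 / (2 * s)) ` I"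
    unfolding hl_def using I by (intro Min_in) auto
  then show ?thesis using that by blast
qed

lemma e_sq: "i \<in> I \<Longrightarrow> (e i x)\<^sup>2 \<le> M^2"
  using e_bounds by (intro power_mono) auto

lemma hl_bounded:
  assumes "\<epsilon> \<le> s" shows "\<bar>hl s x\<bar> \<le> (\<Sum>i\<in>I. \<bar>u i\<bar>) + M^2 / (2 * \<epsilon>)"
proof -
  obtain i where i: "i \<in> I" "hl s x = u i + (e i x)^2 / (2 * s)" by (rule hl_attained)
  have "\<bar>u i\<bar> \<le> (\<Sum>i\<in>I. \<bar>u i\<bar>)" using I i by (intro member_le_sum) auto
  moreover have "(e i x)^2 / (2 * s) \<le> M^2 / (2 * \<epsilon>)"
    using e_sq[OF i(1)] assms \<epsilon> by (intro frac_le) auto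
  moreover have "0 \<le> (e i x)^2 / (2 * s)" using assms \<epsilon> by simp
  ultimately show ?thesis unfolding i(2) by linarith
qed

lemma hl_time:
  assumes "\<epsilon> \<le> s" "\<epsilon> \<le> s'"
  shows "\<bar>hl s x - hl s' x\<bar> \<le> M^2 / (2 * \<epsilon>^2) * \<bar>s - s'\<bar>"
proof -
  have *: "hl s x - hl s' x \<le> M^2 / (2 * \<epsilon>^2) * \<bar>s - s'\<bar>" if s: "\<epsilon> \<le> s" "\<epsilon> \<le> s'" for s s'
  proof -
    obtain i where i: "i \<in> I" "hl s' x = u i + (e i x)^2 / (2 * s')" by (rule hl_attained)
    have p: "0 < s" "0 < s'" using s \<epsilon> by auto
    have "hl s x - hl s' x \<le> (e i x)^2 / (2 * s) - (e i x)\<^sup>2 / (2 * s')"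
      using hl_le[OF i(1), of s x] i(2) by simp
    also have "\<dots> = (e i x)^2 / (2 * (s * s')) * (s' - s)" using p by (simp add: field_simps)
    also have "\<dots> \<le> (e i x)^2 / (2 * (s * s')) * \<bar>s - s'\<bar>"
      using p by (intro mult_left_mono) auto
    also have "\<dots> \<le> M^2 / (2 * \<epsilon>^2) * \<bar>s - s'\<bar>"
    proof (intro mult_right_mono frac_le)
      show "2 * \<epsilon>^2 \<le> 2 * (s * s')" unfolding power2_eq_square using s \<epsilon> by (simp add: mult_mono)
    qed (use e_sq[OF i(1)] \<epsilon> in auto)
    finally show ?thesis .
  qed
  from *[OF assms] *[OF assms(2,1)] show ?thesis by (simp add: abs_minus_commute abs_le_iff)
qed

lemma hl_space:
  assumes "\<epsilon> \<le> s" "d x y < top"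
  shows "\<bar>hl s x - hl s y\<bar> \<le> M / \<epsilon> * enn2real (d x y)"
proof -
  have *: "hl s x - hl s y \<le> M / \<epsilon> * enn2real (d x y)" if "d x y < top" for x y
  proof -
    obtain i where i: "i \<in> I" "hl s y = u i + (e i y)^2 / (2 * s)" by (rule hl_attained)
    have "hl s x - hl s y \<le> (e i x)^2 / (2 * s) - (e i y)\<^sup>2 / (2 * s)"
      using hl_le[OF i(1), of s x] i(2) by simp
    also have "\<dots> = (e i x - e i y) * (e i x + e i y) / (2 * s)"
      by (simp add: power2_eq_square algebra_simps diff_divide_distrib[symmetric])
    also have "\<dots> \<le> enn2real (d x y) * (M + M) / (2 * \<epsilon>)"
      using e_Lipschitz[OF i(1) that] e_bounds[OF i(1)] assms \<epsilon> M_nonneg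
      by (intro frac_le mult_mono add_mono) auto
    also have "\<dots> = M / \<epsilon> * enn2real (d x y)" by simp
    finally show ?thesis .
  qed
  from *[OF assms(2)] *[of y x] assms(2) show ?thesis by (simp add: d_sym[of y x] abs_le_iff)
qed

text \<open>The index active at time \<open>s\<close> also competes at time \<open>s + h\<close>,
  where its value is lower by \<open>h / (2 * s * (s + h))\<close> times
  \<open>(e i z)^2\<close>.\<close>

lemma hl_drop:
  assumes "\<epsilon> \<le> s" "0 < h" "i \<in> I" "hl s z = u i + (e i z)^2 / (2 * s)"
  shows "(e i z)^2 \<le> (2 * s * (s + h) / h) * (hl s z - hl (s + h) z)"
proof -
  have p: "0 < s" "0 < s + h" using assms \<epsilon> by auto
  have "(e i z)^2 = (2 * s * (s + h) / h) * ((e i z)^2 / (2 * s) - (e i z)\<^sup>2 / (2 * (s + h)))"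
  proof -
    have "(e i z)^2 / (2 * s) - (e i z)\<^sup>2 / (2 * (s + h)) = h / (2 * s * (s + h)) * (e i z)^2"
      using p by (simp add: field_simps)
    then show ?thesis using p assms(2) by simp
  qed
  also have "\<dots> \<le> (2 * s * (s + h) / h) * (hl s z - hl (s + h) z)"
    using p assms(2,4) hl_le[OF assms(3), of "s + h" z] by (intro mult_left_mono) auto
  finally show ?thesis .
qed

lemma hl_antimono:
  assumes "\<epsilon> \<le> s" "0 < h" shows "hl (s + h) x \<le> hl s x"
proof -
  obtain i where i: "i \<in> I" "hl s x = u i + (e i x)^2 / (2 * s)" by (rule hl_attained)
  have "(e i x)^2 / (2 * (s + h)) \<le> (e i x)^2 / (2 * s)" using assms \<epsilon> by (intro frac_le) auto
  then show ?thesis using hl_le[OF i(1), of "s + h" x] i(2) by simp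
qed

lemma hl_continuous: "continuous_on UNIV (hl s)"
  unfolding hl_def divide_inverse using I e_continuous
  by (intro continuous_on_Min_image continuous_intros) auto

lemma hl_Lip_b: "\<epsilon> \<le> s \<Longrightarrow> hl s \<in> Lip_b d"
  by (rule Lip_bI[OF hl_bounded hl_continuous _ hl_space]) (use M_nonneg \<epsilon> in auto)

text \<open>At an active index the time decrement of the formula controls the square of \<open>e\<close>, hence the
  local Lipschitz constant.\<close>

lemma hl_lip_a:
  assumes s: "\<epsilon> \<le> s" and h: "0 < h"
  shows "lip_a d (hl s) x \<le> sqrt (2 * (s + h) / (s * h) * (hl s x - hl (s + h) x))"
proof -
  define F where "F = (\<lambda>z. hl s z - hl (s + h) z)"
  define L where "L = 2 * M / \<epsilon>"
  define c where "c = 2 * s * (s + h) / h"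
  \<comment> \<open>The Lipschitz bound on the ball of radius \<open>r\<close>: an index active at
    \<open>z\<close> has \<open>e i z\<close> at most this square root, because the decrement
    \<open>F\<close> is \<open>L\<close>-Lipschitz, and \<open>e i y + e i z\<close> exceeds
    \<open>2 * e i z\<close> by at most \<open>2 * r\<close>.\<close>
  define k where "k = (\<lambda>r. (sqrt (c * (F x + L * r)) + r) / s)"
  have s0: "0 < s" using s \<epsilon> by simp
  have c0: "0 \<le> c" using s0 h by (simp add: c_def)
  have F0: "0 \<le> F z" for z using hl_antimono[OF s h] by (simp add: F_def)
  have L0: "0 \<le> L" using M_nonneg \<epsilon> by (simp add: L_def)
  have FL: "F z \<le> F x + L * enn2real (d z x)" if "d z x < top" for z
    using hl_space[OF s that] hl_space[of "s + h", OF _ that] s h by (simp add: F_def L_def)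
  have le: "lip_a d (hl s) x \<le> k r" if r: "0 < r" for r
  proof (rule lip_a_le)
    show "0 \<le> k r" using r s0 F0[of x] L0 c0 by (simp add: k_def)
    have *: "hl s y - hl s z \<le> k r * enn2real (d y z)" if yz: "d y x < ennreal r" "d z x < ennreal r" for y z
    proof -
      have t: "d y x < top" "enn2real (d y x) < r" "d z x < top" "enn2real (d z x) < r"
        using yz r by (auto simp: less_ennreal_iff_rd)
      define D where "D = enn2real (d y z)"
      have yz2: "d y z < top" using rd_triangle(1)[of y x z] t d_sym[of x z] by simp
      have D: "0 \<le> D" "D \<le> 2 * r"
        using rd_triangle(2)[of y x z] t unfolding D_def d_sym[of x z] by (simp, linarith)
      obtain i where i: "i \<in> I" "hl s z = u i + (e i z)^2 / (2 * s)" by (rule hl_attained)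
      have "(e i z)^2 \<le> c * F z" using hl_drop[OF s h i] by (simp add: c_def F_def)
      also have "\<dots> \<le> c * (F x + L * r)"
      proof (intro mult_left_mono c0)
        have "L * enn2real (d z x) \<le> L * r" by (rule mult_left_mono[OF less_imp_le[OF t(4)] L0])
        then show "F z \<le> F x + L * r" using FL[OF t(3)] by simp
      qed
      finally have ez: "e i z \<le> sqrt (c * (F x + L * r))" by (rule real_le_rsqrt)
      have "hl s y - hl s z \<le> (e i y)^2 / (2 * s) - (e i z)\<^sup>2 / (2 * s)"
        using hl_le[OF i(1), of s y] i(2) by simp
      also have "\<dots> = (e i y - e i z) * (e i y + e i z) / (2 * s)"
        by (simp add: power2_eq_square algebra_simps diff_divide_distrib[symmetric])
      also have "\<dots> \<le> D * (2 * e i z + D) / (2 * s)"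
        using e_Lipschitz[OF i(1) yz2] e_bounds(1)[OF i(1)] s0 D
        by (intro divide_right_mono mult_mono) (auto simp: D_def[symmetric] abs_le_iff)
      also have "\<dots> \<le> D * (2 * sqrt (c * (F x + L * r)) + 2 * r) / (2 * s)"
        using ez D s0 by (intro divide_right_mono mult_left_mono) auto
      also have "\<dots> = k r * D" using s0 by (simp add: k_def field_simps)
      finally show ?thesis by (simp add: D_def)
    qed
    show "\<bar>hl s y - hl s z\<bar> \<le> k r * enn2real (d y z)" if yz: "d y x < ennreal r" "d z x < ennreal r" for y z
      using *[OF yz] *[OF yz(2,1)] by (simp add: d_sym[of z y] abs_le_iff)
  qed (use r in auto)
  have "(k \<longlongrightarrow> (sqrt (c * (F x + L * 0)) + 0) / s) (at_right 0)"
    unfolding k_def using s0 by (intro tendsto_intros) auto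
  then have "lip_a d (hl s) x \<le> (sqrt (c * (F x + L * 0)) + 0) / s"
  proof (rule tendsto_lowerbound)
    show "\<forall>\<^sub>F r in at_right 0. lip_a d (hl s) x \<le> k r"
      unfolding eventually_at_right_field using le by (intro exI[of _ 1]) auto
  qed simp
  also have "\<dots> = sqrt (c * F x) / sqrt (s^2)" using s0 by simp
  also have "\<dots> = sqrt (c * F x / s^2)" by (simp add: real_sqrt_divide)
  also have "c * F x / s^2 = 2 * (s + h) / (s * h) * F x"
    using s0 h by (simp add: c_def power2_eq_square field_simps)
  finally show ?thesis by (simp add: F_def)
qed

lemma hl_D_Ch: "\<epsilon> \<le> s \<Longrightarrow> hl s \<in> D_Ch d m"
  by (rule strong_slope_imp_D_Ch[OF Lip_b_strong_slope[OF hl_Lip_b]])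

text \<open>A discrete Hamilton--Jacobi inequality, with a difference quotient in place of the time
  derivative; \<open>1 + h / \<epsilon>\<close> bounds the error factor \<open>1 + h / s\<close>
  uniformly in \<open>s\<close>.\<close>

lemma hl_wgrad:
  assumes s: "\<epsilon> \<le> s" and h: "0 < h"
  shows "AE x in m. (wgrad d m (hl s) x)^2 \<le> 2 / h * (1 + h / \<epsilon>) * (hl s x - hl (s + h) x)"
proof -
  define k where "k = (\<lambda>x. sqrt (2 * (s + h) / (s * h) * (hl s x - hl (s + h) x)))"
  have sh: "\<epsilon> \<le> s + h" using s h by simp
  have "k \<in> borel_measurable m"
    unfolding k_def using Lip_b_measurable[OF hl_Lip_b[OF s]] Lip_b_measurable[OF hl_Lip_b[OF sh]] by measurable
  then have "AE x in m. lip_a_star d m (hl s) x \<le> k x"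
    by (rule lip_a_star_least[OF hl_Lip_b[OF s]]) (use hl_lip_a[OF s h] in \<open>auto simp: k_def\<close>)
  with wgrad_le_lip_a_star[OF hl_Lip_b[OF s]] wgrad_nonneg[OF hl_D_Ch[OF s]] show ?thesis
  proof eventually_elim
    case (elim x)
    have F: "0 \<le> hl s x - hl (s + h) x" using hl_antimono[OF s h] by simp
    have p: "0 < s" using s \<epsilon> by simp
    have "(wgrad d m (hl s) x)^2 \<le> (k x)^2" using elim by (intro power_mono) auto
    also have "\<dots> = 2 * (s + h) / (s * h) * (hl s x - hl (s + h) x)"
      unfolding k_def using F p h by (intro real_sqrt_pow2 mult_nonneg_nonneg) auto
    also have "2 * (s + h) / (s * h) = 2 / h * (1 + h / s)" using p h by (simp add: field_simps)
    also have "2 / h * (1 + h / s) * (hl s x - hl (s + h) x) \<le> 2 / h * (1 + h / \<epsilon>) * (hl s x - hl (s + h) x)"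
      using F p h s \<epsilon> by (intro mult_right_mono mult_left_mono add_left_mono divide_left_mono) auto
    finally show ?case .
  qed
qed

section \<open>Admissibility of the Hopf--Lax potentials\<close>

lemma pot_bounded: "\<bar>pot t x\<bar> \<le> (\<Sum>i\<in>I. \<bar>u i\<bar>) + M^2 / (2 * \<epsilon>)"
  unfolding pot_def by (rule hl_bounded) simp

lemma pot_time: "\<bar>pot s x - pot t x\<bar> \<le> M^2 / (2 * \<epsilon>^2) * \<bar>s - t\<bar>"
proof -
  have "\<bar>pot s x - pot t x\<bar> \<le> M^2 / (2 * \<epsilon>^2) * \<bar>(max s 0 + \<epsilon>) - (max t 0 + \<epsilon>)\<bar>"
    unfolding pot_def by (rule hl_time) auto
  also have "\<dots> \<le> M^2 / (2 * \<epsilon>^2) * \<bar>s - t\<bar>" by (intro mult_left_mono) auto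
  finally show ?thesis .
qed

lemma pot_Lip_b: "pot t \<in> Lip_b d"
  unfolding pot_def by (rule hl_Lip_b) simp

lemma pot_pairing_integrable:
  assumes g: "integrable m g" shows "integrable m (\<lambda>x. pot t x * g x)"
proof (rule Bochner_Integration.integrable_bound)
  define C where "C = (\<Sum>i\<in>I. \<bar>u i\<bar>) + M^2 / (2 * \<epsilon>)"
  have C: "\<bar>pot t x\<bar> \<le> C" for x unfolding C_def by (rule pot_bounded)
  show "integrable m (\<lambda>x. C * g x)" using g by simp
  show "(\<lambda>x. pot t x * g x) \<in> borel_measurable m" using Lip_b_measurable[OF pot_Lip_b, of t] g by simp
  have "\<bar>pot t x\<bar> * \<bar>g x\<bar> \<le> \<bar>C\<bar> * \<bar>g x\<bar>" for x
    by (rule mult_right_mono[OF order_trans[OF C abs_ge_self] abs_ge_zero])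
  then show "AE x in m. norm (pot t x * g x) \<le> norm (C * g x)" by (simp add: abs_mult)
qed

lemma pot_pairing_time:
  assumes g: "integrable m g"
  shows "\<bar>(\<integral>x. pot s x * g x \<partial>m) - (\<integral>x. pot t x * g x \<partial>m)\<bar> \<le> M^2 / (2 * \<epsilon>^2) * (\<integral>x. \<bar>g x\<bar> \<partial>m) * \<bar>s - t\<bar>"
proof -
  have "\<bar>\<integral>x. pot s x * g x - pot t x * g x \<partial>m\<bar> \<le> (\<integral>x. M^2 / (2 * \<epsilon>^2) * \<bar>s - t\<bar> * \<bar>g x\<bar> \<partial>m)"
  proof (rule order_trans[OF integral_abs_bound integral_mono])
    show "\<bar>pot s x * g x - pot t x * g x\<bar> \<le> M^2 / (2 * \<epsilon>^2) * \<bar>s - t\<bar> * \<bar>g x\<bar>" for x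
      using mult_right_mono[OF pot_time[of s x t] abs_ge_zero[of "g x"]] by (simp only: abs_mult[symmetric] left_diff_distrib)
  qed (use pot_pairing_integrable[OF g] g in auto)
  then show ?thesis using pot_pairing_integrable[OF g] by (simp add: mult_ac)
qed

lemma pot_pairing_continuous:
  assumes g: "integrable m g" shows "continuous_on A (\<lambda>t. \<integral>x. pot t x * g x \<partial>m)"
  by (rule continuous_on_if_abs_diff_le[OF pot_pairing_time[OF g]])

lemma pot_L1_D_Ch: "L1_D_Ch d m pot"
  unfolding L1_D_Ch_def
proof (intro conjI)
  define K where "K = M^2 / (2 * \<epsilon>^2)"
  have K0: "0 \<le> K" by (simp add: K_def)
  have L2: "pot t \<in> L2 m" for t by (rule Lip_b_L2[OF pot_Lip_b])
  have L2K: "L2norm m (\<lambda>x. pot s x - pot t x) \<le> ennreal (K * \<bar>s - t\<bar>)" for s t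
  proof -
    have "L2sq m (\<lambda>x. pot s x - pot t x) \<le> L2sq m (\<lambda>_. K * \<bar>s - t\<bar>)"
      by (rule L2sq_mono) (use pot_time[of s _ t] K0 L2_diff[OF L2 L2] in
        \<open>auto simp: L2_def K_def[symmetric] abs_mult intro!: order_trans[OF _ abs_ge_self]\<close>)
    also have "\<dots> = (K * \<bar>s - t\<bar>)^2" using prob_space by (simp add: L2sq_def)
    finally have "sqrt (L2sq m (\<lambda>x. pot s x - pot t x)) \<le> K * \<bar>s - t\<bar>"
      using K0 by (intro real_le_lsqrt) auto
    then show ?thesis by (simp add: L2norm_eq[OF L2_diff[OF L2 L2]] ennreal_leI)
  qed
  \<comment> \<open>Lipschitz dependence on time in the norm makes the preimages of norm-open sets
    open.\<close>
  show "pot \<in> measurable (lebesgue_on {0<..<1}) (L2_borel m)"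
    unfolding L2_borel_def
  proof (rule measurable_measure_of)
    show "{U. L2_open m U} \<subseteq> Pow (L2 m)" by (auto simp: L2_open_def)
    show "pot \<in> space (lebesgue_on {0<..<1}) \<rightarrow> L2 m" using L2 by auto
    show "pot -` U \<inter> space (lebesgue_on {0<..<1}) \<in> sets (lebesgue_on {0<..<1})" if "U \<in> {U. L2_open m U}" for U
    proof -
      have "open (pot -` U)"
        unfolding open_dist
      proof safe
        fix t assume "pot t \<in> U"
        then obtain \<delta> where \<delta>: "0 < \<delta>" "\<And>g. g \<in> L2 m \<Longrightarrow> L2norm m (\<lambda>x. g x - pot t x) < ennreal \<delta> \<Longrightarrow> g \<in> U"
          using \<open>U \<in> {U. L2_open m U}\<close> unfolding L2_open_def by blast
        show "\<exists>e>0. \<forall>s. dist s t < e \<longrightarrow> s \<in> pot -` U"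
        proof (intro exI[of _ "\<delta> / (K + 1)"] conjI allI impI)
          show "0 < \<delta> / (K + 1)" using \<delta> K0 by simp
          fix s assume "dist s t < \<delta> / (K + 1)"
          then have "\<bar>s - t\<bar> * (K + 1) < \<delta>" using K0 by (simp add: dist_real_def field_simps)
          then have "K * \<bar>s - t\<bar> < \<delta>" by (simp add: algebra_simps)
          then have "ennreal (K * \<bar>s - t\<bar>) < ennreal \<delta>" using \<delta>(1) by (simp add: ennreal_less_iff K0)
          with L2K[of s t] have "L2norm m (\<lambda>x. pot s x - pot t x) < ennreal \<delta>" by (rule order.strict_trans1)
          then show "s \<in> pot -` U" using \<delta>(2)[OF L2] by simp
        qed
      qed
      then show ?thesis by (auto simp: sets_restrict_space intro!: imageI)
    qed
  qed
  show "AE t in lebesgue_on {0<..<1}. pot t \<in> D_Ch d m"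
    by (rule AE_I2) (simp add: pot_def hl_D_Ch)
  define C where "C = (\<Sum>i\<in>I. \<bar>u i\<bar>) + M^2 / (2 * \<epsilon>)"
  have C0: "0 \<le> C" using \<epsilon> by (simp add: C_def sum_nonneg)
  have bound: "Ch_norm d m (pot t) \<le> ennreal (sqrt (C^2 + (M / \<epsilon>)^2))" for t
  proof -
    have "L2sq m (pot t) \<le> L2sq m (\<lambda>_. C)"
      by (rule L2sq_mono) (use pot_bounded C0 Lip_b_measurable[OF pot_Lip_b] in \<open>auto simp: L2_def C_def\<close>)
    then have 1: "L2sq m (pot t) \<le> C^2" using prob_space by (simp add: L2sq_def)
    have "AE x in m. \<bar>lip_a_star d m (pot t) x\<bar> \<le> M / \<epsilon>"
      unfolding pot_def by (rule lip_a_star_bounded[OF hl_Lip_b _ hl_space]) (use M_nonneg \<epsilon> in auto)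
    then have "L2sq m (lip_a_star d m (pot t)) \<le> L2sq m (\<lambda>_. M / \<epsilon>)"
      using M_nonneg \<epsilon> by (intro L2sq_mono) (auto simp: L2_def intro: lip_a_star_measurable pot_Lip_b)
    then have 2: "L2sq m (lip_a_star d m (pot t)) \<le> (M / \<epsilon>)^2" using prob_space by (simp add: L2sq_def)
    have "(L2norm m (pot t))^2 + Ch d m (pot t) \<le> ennreal (C^2) + ennreal ((M / \<epsilon>)^2)"
    proof (intro add_mono)
      show "(L2norm m (pot t))^2 \<le> ennreal (C^2)"
        using 1 by (simp add: L2norm_eq[OF L2] ennreal_power ennreal_leI)
      show "Ch d m (pot t) \<le> ennreal ((M / \<epsilon>)^2)"
        using Lip_b_Ch_le[OF pot_Lip_b] 2 by (meson ennreal_leI order_trans)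
    qed
    then have "Ch_norm d m (pot t) \<le> esqrt (ennreal (C^2 + (M / \<epsilon>)^2))"
      unfolding Ch_norm_def by (intro esqrt_mono) simp
    then show ?thesis using esqrt_ennreal[of "C^2 + (M / \<epsilon>)^2"] by simp
  qed
  have "(\<integral>\<^sup>+t. Ch_norm d m (pot t) \<partial>lebesgue_on {0<..<1})
    \<le> (\<integral>\<^sup>+t. ennreal (sqrt (C^2 + (M / \<epsilon>)^2)) \<partial>lebesgue_on {0<..<1::real})"
    by (rule nn_integral_mono) (rule bound)
  also have "\<dots> < top" by (simp add: emeasure_restrict_space ennreal_mult_less_top)
  finally show "(\<integral>\<^sup>+t. Ch_norm d m (pot t) \<partial>lebesgue_on {0<..<1}) < top" .
qed

text \<open>No time derivative of the potential is taken: the discrete inequality is integrated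
  against \<open>\<eta>\<close>, the time shift is moved to \<open>\<eta>\<close> by translation,
  and there the difference quotient converges to \<open>deriv \<eta>\<close>.\<close>

lemma pot_HJ: "HJ_subsolution d m pot"
  unfolding HJ_subsolution_def
proof (intro ballI impI allI)
  fix \<psi> \<eta> assume \<psi>: "\<psi> \<in> A_Ch d m" "AE x in m. 0 \<le> \<psi> x" and "test_fun_01 \<eta> \<and> (\<forall>t. 0 \<le> \<eta> t)"
  then have \<eta>: "test_fun_01 \<eta>" "\<And>t. 0 \<le> \<eta> t" by auto
  from \<eta>(1) obtain a b where ab: "0 < a" "b < 1" "\<And>t. t \<notin> {a..b} \<Longrightarrow> \<eta> t = 0"
    "\<And>t. t \<notin> {a..b} \<Longrightarrow> deriv \<eta> t = 0" and d\<eta>: "\<And>t. (\<eta> has_real_derivative deriv \<eta> t) (at t)"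
    and c\<eta>: "continuous_on UNIV \<eta>" "continuous_on UNIV (deriv \<eta>)"
    by (rule test_fun_01E) blast
  define y where "y = (\<lambda>t. \<integral>x. pot t x * \<psi> x \<partial>m)"
  define E where "E = (\<lambda>t. \<integral>\<^sup>+x. ennreal (\<psi> x * (wgrad d m (pot t) x)^2) \<partial>m)"
  define h where "h = (\<lambda>n. 1 / real (Suc n))"
  define A where "A = (\<integral>t. deriv \<eta> t * y t \<partial>lborel)"
  define q where "q = (\<lambda>n t. (\<eta> t - \<eta> (t - h n)) / h n * y t)"
  have h: "0 < h n" "h n \<le> 1" for n by (auto simp: h_def)
  have h0: "h \<longlonglongrightarrow> 0" unfolding h_def using LIMSEQ_inverse_real_of_nat by (simp add: divide_inverse)
  have \<psi>i: "integrable m \<psi>" using \<psi>(1) by (auto simp: A_Ch_def D_Ch_def intro: L2_integrable)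
  have yc: "continuous_on UNIV y" unfolding y_def by (rule pot_pairing_continuous[OF \<psi>i])
  have \<eta>0: "\<eta> t = 0" if "t \<notin> {0<..<1}" for t using ab(1,2) that by (intro ab(3)) auto
  have d\<eta>0: "deriv \<eta> t = 0" if "t \<notin> {0<..<1}" for t using ab(1,2) that by (intro ab(4)) auto
  have E_le: "E t \<le> ennreal (2 / h n * (1 + h n / \<epsilon>) * (y t - y (t + h n)))"
    and dy: "y (t + h n) \<le> y t" if t: "0 < t" for t n
  proof -
    have s: "\<epsilon> \<le> t + \<epsilon>" and e: "pot t = hl (t + \<epsilon>)" "pot (t + h n) = hl (t + \<epsilon> + h n)"
      using t h[of n] by (auto simp: pot_def add_ac)
    define k where "k = 2 / h n * (1 + h n / \<epsilon>)"
    have k: "0 \<le> k" using h[of n] \<epsilon> by (simp add: k_def)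
    have i: "integrable m (\<lambda>x. k * (pot t x * \<psi> x - pot (t + h n) x * \<psi> x))"
      using pot_pairing_integrable[OF \<psi>i] by simp
    have nn: "AE x in m. 0 \<le> k * (pot t x * \<psi> x - pot (t + h n) x * \<psi> x)" using \<psi>(2)
    proof eventually_elim
      case (elim x)
      then show ?case using hl_antimono[OF s h(1)[of n], of x] k unfolding e
        by (simp add: mult_right_mono)
    qed
    have "E t \<le> (\<integral>\<^sup>+x. ennreal (k * (pot t x * \<psi> x - pot (t + h n) x * \<psi> x)) \<partial>m)"
      unfolding E_def
    proof (rule nn_integral_mono_AE)
      show "AE x in m. ennreal (\<psi> x * (wgrad d m (pot t) x)^2) \<le> ennreal (k * (pot t x * \<psi> x - pot (t + h n) x * \<psi> x))"
        using hl_wgrad[OF s h(1)[of n]] \<psi>(2) unfolding e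
      proof eventually_elim
        case (elim x)
        then have "\<psi> x * (wgrad d m (hl (t + \<epsilon>)) x)^2 \<le> \<psi> x * (k * (hl (t + \<epsilon>) x - hl (t + \<epsilon> + h n) x))"
          unfolding k_def by (intro mult_left_mono) auto
        then show ?case by (intro ennreal_leI) (simp add: algebra_simps)
      qed
    qed
    also have "\<dots> = ennreal (\<integral>x. k * (pot t x * \<psi> x - pot (t + h n) x * \<psi> x) \<partial>m)"
      by (rule nn_integral_eq_integral[OF i nn])
    also have "(\<integral>x. k * (pot t x * \<psi> x - pot (t + h n) x * \<psi> x) \<partial>m) = k * (y t - y (t + h n))"
      using pot_pairing_integrable[OF \<psi>i] by (simp add: y_def)
    finally show "E t \<le> ennreal (2 / h n * (1 + h n / \<epsilon>) * (y t - y (t + h n)))" by (simp add: k_def)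
    have "0 \<le> (\<integral>x. pot t x * \<psi> x - pot (t + h n) x * \<psi> x \<partial>m)"
      by (rule integral_nonneg_AE) (use \<psi>(2) in eventually_elim, use hl_antimono[OF s h(1)[of n]] in \<open>simp add: e mult_right_mono\<close>)
    then show "y (t + h n) \<le> y t" using pot_pairing_integrable[OF \<psi>i] by (simp add: y_def)
  qed
  have cshift: "continuous_on UNIV (\<lambda>t. f (t + c))" if "continuous_on UNIV f" for f :: "real \<Rightarrow> real" and c
    by (rule continuous_on_compose2[OF that]) (auto intro: continuous_intros)
  have i1: "integrable lborel (\<lambda>t. \<eta> t * y t)"
    by (rule integrable_compact_support[of _ 0 1]) (auto intro!: continuous_intros c\<eta> yc \<eta>0)
  have i2: "integrable lborel (\<lambda>t. \<eta> t * y (t + c))" for c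
    by (rule integrable_compact_support[of _ 0 1]) (auto intro!: continuous_intros c\<eta> cshift[OF yc] \<eta>0)
  have shift: "(\<integral>t. \<eta> t * (y t - y (t + h n)) \<partial>lborel) = h n * (\<integral>t. q n t \<partial>lborel)" for n
  proof -
    have i3: "integrable lborel (\<lambda>t. \<eta> (t - h n) * y t)"
      using lborel_integrable_real_affine[OF i2[of "h n"], of 1 "- h n"] by simp
    have "(\<integral>t. \<eta> t * y (t + h n) \<partial>lborel) = (\<integral>t. \<eta> (t - h n) * y t \<partial>lborel)"
      using lborel_integral_real_affine[of 1 "\<lambda>t. \<eta> t * y (t + h n)" "- h n"] by simp
    then have "(\<integral>t. \<eta> t * (y t - y (t + h n)) \<partial>lborel) = (\<integral>t. \<eta> t * y t - \<eta> (t - h n) * y t \<partial>lborel)"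
      using i1 i2[of "h n"] i3 by (simp add: right_diff_distrib)
    also have "\<dots> = (\<integral>t. h n * q n t \<partial>lborel)"
      using h[of n] by (intro Bochner_Integration.integral_cong) (auto simp: q_def field_simps)
    finally show ?thesis by simp
  qed
  have ub: "(\<integral>\<^sup>+t. ennreal (\<eta> t) * E t \<partial>lebesgue_on {0<..<1}) \<le> ennreal (2 * (1 + h n / \<epsilon>) * (\<integral>t. q n t \<partial>lborel))"
    and q0: "0 \<le> (\<integral>t. q n t \<partial>lborel)" for n
  proof -
    define k where "k = 2 / h n * (1 + h n / \<epsilon>)"
    have k: "0 \<le> k" using h[of n] \<epsilon> by (simp add: k_def)
    define g where "g = (\<lambda>t. k * (\<eta> t * (y t - y (t + h n))))"
    have gi: "integrable lborel g" unfolding g_def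
      using i1 i2[of "h n"] by (simp add: right_diff_distrib)
    have g0: "0 \<le> g t" for t
    proof (cases "t \<in> {0<..<1}")
      case True
      then show ?thesis using k \<eta>(2)[of t] dy[of t n] by (simp add: g_def)
    qed (simp add: g_def \<eta>0)
    have gm: "g \<in> borel_measurable borel" using gi by auto
    have "(\<integral>\<^sup>+t. ennreal (\<eta> t) * E t \<partial>lebesgue_on {0<..<1}) \<le> (\<integral>\<^sup>+t. ennreal (g t) \<partial>lebesgue_on {0<..<1})"
    proof (rule nn_integral_mono)
      fix t assume "t \<in> space (lebesgue_on {0<..<1::real})"
      then have "ennreal (\<eta> t) * E t \<le> ennreal (\<eta> t) * ennreal (k * (y t - y (t + h n)))"
        using E_le[of t n] by (intro mult_left_mono) (auto simp: k_def)
      also have "\<dots> = ennreal (g t)" by (simp add: g_def ennreal_mult'[symmetric] \<eta>(2) mult_ac)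
      finally show "ennreal (\<eta> t) * E t \<le> ennreal (g t)" .
    qed
    also have "\<dots> = (\<integral>\<^sup>+t. ennreal (g t) \<partial>lborel)"
      by (rule nn_integral_lebesgue_on_01) (use gm in \<open>auto simp: g_def \<eta>0\<close>)
    also have "\<dots> = ennreal (\<integral>t. g t \<partial>lborel)" by (rule nn_integral_eq_integral[OF gi]) (use g0 in auto)
    also have "(\<integral>t. g t \<partial>lborel) = k * (h n * (\<integral>t. q n t \<partial>lborel))" by (simp add: g_def shift)
    also have "\<dots> = 2 * (1 + h n / \<epsilon>) * (\<integral>t. q n t \<partial>lborel)" using h[of n] by (simp add: k_def)
    finally show "(\<integral>\<^sup>+t. ennreal (\<eta> t) * E t \<partial>lebesgue_on {0<..<1}) \<le> ennreal (2 * (1 + h n / \<epsilon>) * (\<integral>t. q n t \<partial>lborel))" .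
    have "0 \<le> (\<integral>t. \<eta> t * (y t - y (t + h n)) \<partial>lborel)"
    proof (rule integral_nonneg_AE[OF AE_I2])
      fix t show "0 \<le> \<eta> t * (y t - y (t + h n))"
        using \<eta>(2)[of t] dy[of t n] \<eta>0[of t] by (cases "t \<in> {0<..<1}") auto
    qed
    then show "0 \<le> (\<integral>t. q n t \<partial>lborel)" unfolding shift using h[of n] by (simp add: zero_le_mult_iff)
  qed
  have lim: "(\<lambda>n. \<integral>t. q n t \<partial>lborel) \<longlonglongrightarrow> A"
  proof -
    have "bounded (deriv \<eta> ` {0..1})"
      by (intro compact_imp_bounded compact_continuous_image continuous_on_subset[OF c\<eta>(2)]) auto
    then obtain B0 where B0: "\<forall>t\<in>{0..1}. \<bar>deriv \<eta> t\<bar> \<le> B0" unfolding bounded_iff by auto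
    have B0': "\<bar>deriv \<eta> t\<bar> \<le> \<bar>B0\<bar>" for t
      using bspec[OF B0, of t] d\<eta>0[of t] by (cases "t \<in> {0..1}") auto
    \<comment> \<open>The shifts are at most 1, so \<open>\<eta> t\<close> and
      \<open>\<eta> (t - h n)\<close> both vanish outside this interval.\<close>
    have "bounded (y ` {-1..2})"
      by (intro compact_imp_bounded compact_continuous_image continuous_on_subset[OF yc]) auto
    then obtain Y where Y: "\<forall>t\<in>{-1..2}. \<bar>y t\<bar> \<le> Y" unfolding bounded_iff by auto
    have Y0: "0 \<le> Y" using bspec[OF Y, of 0] by simp
    have quot: "\<bar>(\<eta> t - \<eta> (t - h n)) / h n\<bar> \<le> \<bar>B0\<bar>" for t n
    proof -
      obtain z where "\<eta> t - \<eta> (t - h n) = (t - (t - h n)) * deriv \<eta> z"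
        using MVT2[of "t - h n" t \<eta> "deriv \<eta>"] d\<eta> h[of n] by auto
      then show ?thesis using B0'[of z] h[of n] by simp
    qed
    show ?thesis unfolding A_def
    proof (rule integral_dominated_convergence[where w = "\<lambda>t. \<bar>B0\<bar> * Y * indicator {-1..2::real} t"])
      show "(\<lambda>t. deriv \<eta> t * y t) \<in> borel_measurable lborel"
        using borel_measurable_continuous_onI[OF c\<eta>(2)] borel_measurable_continuous_onI[OF yc] by measurable
      have "q n = (\<lambda>t. (\<eta> t - \<eta> (t + - h n)) / h n * y t)" for n by (simp add: q_def)
      then show "q n \<in> borel_measurable lborel" for n
        using borel_measurable_continuous_onI[OF c\<eta>(1)] borel_measurable_continuous_onI[OF yc]
          borel_measurable_continuous_onI[OF cshift[OF c\<eta>(1), of "- h n"]] by simp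
      show "integrable lborel (\<lambda>t. \<bar>B0\<bar> * Y * indicator {- 1..2::real} t)" by simp
      show "AE t in lborel. (\<lambda>n. q n t) \<longlonglongrightarrow> deriv \<eta> t * y t"
      proof (rule AE_I2)
        fix t
        have "filterlim (\<lambda>n. - h n) (at 0) sequentially"
          unfolding filterlim_at using tendsto_minus[OF h0] h by (auto simp: less_imp_neq[symmetric])
        moreover have "((\<lambda>h. (\<eta> (t + h) - \<eta> t) / h) \<longlongrightarrow> deriv \<eta> t) (at 0)" using d\<eta>[of t] by (simp add: DERIV_def)
        ultimately have "(\<lambda>n. (\<eta> (t + - h n) - \<eta> t) / (- h n)) \<longlonglongrightarrow> deriv \<eta> t" by (rule filterlim_compose[rotated])
        then have "(\<lambda>n. (\<eta> (t + - h n) - \<eta> t) / (- h n) * y t) \<longlonglongrightarrow> deriv \<eta> t * y t" by (intro tendsto_intros)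
        moreover have "(\<eta> (t + - h n) - \<eta> t) / (- h n) * y t = q n t" for n
          using h[of n] by (simp add: q_def field_simps)
        ultimately show "(\<lambda>n. q n t) \<longlonglongrightarrow> deriv \<eta> t * y t" by simp
      qed
      show "AE t in lborel. norm (q n t) \<le> \<bar>B0\<bar> * Y * indicator {- 1..2::real} t" for n
      proof (rule AE_I2)
        fix t
        show "norm (q n t) \<le> \<bar>B0\<bar> * Y * indicator {- 1..2::real} t"
        proof (cases "t \<in> {-1..2}")
          case True
          then show ?thesis using mult_mono[OF quot[of t n] bspec[OF Y True]] by (simp add: q_def abs_mult abs_divide)
        next
          case False
          then have "\<eta> t = 0" "\<eta> (t - h n) = 0" using h[of n] by (auto intro!: \<eta>0)
          then show ?thesis using Y0 by (simp add: q_def)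
        qed
      qed
    qed
  qed
  have "(\<integral>\<^sup>+t. ennreal (\<eta> t) * E t \<partial>lebesgue_on {0<..<1}) \<le> ennreal (2 * (1 + 0 / \<epsilon>) * A)"
  proof (rule LIMSEQ_le_const)
    show "(\<lambda>n. ennreal (2 * (1 + h n / \<epsilon>) * (\<integral>t. q n t \<partial>lborel))) \<longlonglongrightarrow> ennreal (2 * (1 + 0 / \<epsilon>) * A)"
      using \<epsilon> by (intro tendsto_ennrealI tendsto_intros lim h0) auto
  qed (use ub in blast)
  then have "enn2ereal (\<integral>\<^sup>+t. ennreal (\<eta> t) * E t \<partial>lebesgue_on {0<..<1}) \<le> enn2ereal (ennreal (2 * A))"
    by (simp add: less_eq_ennreal.rep_eq)
  also have "\<dots> = ereal (2 * A)" using LIMSEQ_le_const[OF lim] q0 by (intro enn2ereal_ennreal) auto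
  finally have "ereal (1/2) * enn2ereal (\<integral>\<^sup>+t. ennreal (\<eta> t) * E t \<partial>lebesgue_on {0<..<1}) \<le> ereal (1/2) * ereal (2 * A)"
    by (intro ereal_mult_left_mono) auto
  then have "ereal (- A) + ereal (1/2) * enn2ereal (\<integral>\<^sup>+t. ennreal (\<eta> t) * E t \<partial>lebesgue_on {0<..<1})
      \<le> ereal (- A) + ereal (1/2) * ereal (2 * A)"
    by (intro add_left_mono)
  moreover have "(\<integral>t. deriv \<eta> t * y t \<partial>lebesgue_on {0<..<1}) = A" unfolding A_def
    by (rule integral_lebesgue_on_01)
      (use borel_measurable_continuous_onI[OF c\<eta>(2)] borel_measurable_continuous_onI[OF yc] d\<eta>0 in auto)
  ultimately show "ereal (- (\<integral>t. deriv \<eta> t * (\<integral>x. pot t x * \<psi> x \<partial>m) \<partial>lebesgue_on {0<..<1}))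
      + ereal (1/2) * enn2ereal (\<integral>\<^sup>+t. ennreal (\<eta> t)
          * (\<integral>\<^sup>+x. ennreal (\<psi> x * (wgrad d m (pot t) x)^2) \<partial>m) \<partial>lebesgue_on {0<..<1}) \<le> 0"
    by (simp add: y_def E_def zero_ereal_def)
qed

theorem pot_admissible: "pot \<in> dual_admissible d m"
  unfolding dual_admissible_def
proof (intro CollectI conjI)
  have "continuous_on ({0..1} \<times> UNIV) (\<lambda>p. Min ((\<lambda>i. u i + (e i (snd p))^2 / (2 * (max (fst p) 0 + \<epsilon>))) ` I))"
    using I \<epsilon> by (intro continuous_on_Min_image continuous_intros continuous_on_compose2[OF e_continuous]) auto
  then show "(\<lambda>(t, x). pot t x) \<in> borel_measurable (restrict_space borel ({0..1} \<times> UNIV))"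
    by (intro borel_measurable_continuous_on_restrict) (simp add: pot_def hl_def case_prod_beta)
  show "\<exists>C. \<forall>t\<in>{0..1}. \<forall>x. \<bar>pot t x\<bar> \<le> C" using pot_bounded by blast
  show "weak_star_continuous_01 m pot"
    unfolding weak_star_continuous_01_def using pot_pairing_continuous by blast
qed (rule pot_L1_D_Ch pot_HJ)+

end

section \<open>Finite transport duality\<close>

lemma pos_part_square_le: "(max 0 (a + x))^2 \<le> (max 0 a)^2 + 2 * max 0 a * x + (x::real)^2"
proof -
  have "max 0 (a + x) \<le> \<bar>max 0 a + x\<bar>" by (auto simp: max_def)
  then have "(max 0 (a + x))^2 \<le> \<bar>max 0 a + x\<bar>^2" by (intro power_mono) auto
  then show ?thesis by (simp add: power2_sum algebra_simps)
qed

text \<open>The plan is found by minimising the squared defect of the constraints over the simplex; if the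
  minimum were positive, the first-order conditions would produce a pair of potentials violating the
  hypothesis.\<close>

lemma finite_transport_duality:
  fixes p :: "'i \<Rightarrow> real" and q :: "'j \<Rightarrow> real" and c :: "'i \<Rightarrow> 'j \<Rightarrow> real"
  assumes I: "finite I" and J: "finite J"
    and p: "\<And>i. i \<in> I \<Longrightarrow> 0 \<le> p i" "(\<Sum>i\<in>I. p i) = 1" and q: "\<And>j. j \<in> J \<Longrightarrow> 0 \<le> q j" "(\<Sum>j\<in>J. q j) = 1"
    and dual: "\<And>u v. (\<And>i j. i \<in> I \<Longrightarrow> j \<in> J \<Longrightarrow> v j - u i \<le> c i j) \<Longrightarrow> (\<Sum>j\<in>J. q j * v j) - (\<Sum>i\<in>I. p i * u i) \<le> b"
  obtains M where "\<And>i j. i \<in> I \<Longrightarrow> j \<in> J \<Longrightarrow> 0 \<le> M i j" "\<And>i. i \<in> I \<Longrightarrow> (\<Sum>j\<in>J. M i j) = p i"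
    "\<And>j. j \<in> J \<Longrightarrow> (\<Sum>i\<in>I. M i j) = q j" "(\<Sum>i\<in>I. \<Sum>j\<in>J. M i j * c i j) \<le> b"
proof -
  \<comment> \<open>Matrices are functions on the whole type, and their entries outside
    \<open>I \<times> J\<close> remain free in [0, 1]; this makes the set compact by Tychonoff's
    theorem.\<close>
  define S where "S = {M :: 'i \<times> 'j \<Rightarrow> real. (\<forall>k. 0 \<le> M k \<and> M k \<le> 1) \<and> (\<Sum>i\<in>I. \<Sum>j\<in>J. M (i, j)) = 1}"
  define al where "al M i = (\<Sum>j\<in>J. M (i, j)) - p i" for M i
  define ga where "ga M j = (\<Sum>i\<in>I. M (i, j)) - q j" for M j
  define ta where "ta M = (\<Sum>i\<in>I. \<Sum>j\<in>J. M (i, j) * c i j) - b" for M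
  \<comment> \<open>The cost enters with its positive part, since only an excess over
    \<open>b\<close> is a defect.\<close>
  define F where "F M = (\<Sum>i\<in>I. (al M i)^2) + (\<Sum>j\<in>J. (ga M j)^2) + (max 0 (ta M))^2" for M
  have coord: "continuous_on A (\<lambda>M :: 'i \<times> 'j \<Rightarrow> real. M k)" for A k
    by (rule continuous_on_subset[OF continuous_on_product_coordinates]) auto
  have "compactin (product_topology (\<lambda>_. euclidean) UNIV) (PiE UNIV (\<lambda>_ :: 'i \<times> 'j. {0..1::real}))"
    by (subst compactin_PiE) auto
  then have "compact (PiE UNIV (\<lambda>_ :: 'i \<times> 'j. {0..1::real}))"
    by (simp add: euclidean_product_topology compactin_euclidean_iff)
  moreover have "closed {M :: 'i \<times> 'j \<Rightarrow> real. (\<Sum>i\<in>I. \<Sum>j\<in>J. M (i, j)) = 1}"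
    by (intro closed_Collect_eq continuous_intros coord)
  ultimately have "compact (PiE UNIV (\<lambda>_ :: 'i \<times> 'j. {0..1::real}) \<inter> {M. (\<Sum>i\<in>I. \<Sum>j\<in>J. M (i, j)) = 1})"
    by (rule compact_Int_closed)
  moreover have "PiE UNIV (\<lambda>_ :: 'i \<times> 'j. {0..1::real}) \<inter> {M. (\<Sum>i\<in>I. \<Sum>j\<in>J. M (i, j)) = 1} = S"
    by (auto simp: S_def PiE_iff)
  ultimately have "compact S" by simp
  moreover have "(\<lambda>(i, j). if i \<in> I \<and> j \<in> J then p i * q j else 0) \<in> S"
  proof -
    have le1: "p i \<le> 1" if "i \<in> I" for i using member_le_sum[of i I p] p I that by auto
    have le1': "q j \<le> 1" if "j \<in> J" for j using member_le_sum[of j J q] q J that by auto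
    have "(\<Sum>i\<in>I. \<Sum>j\<in>J. if i \<in> I \<and> j \<in> J then p i * q j else 0) = (\<Sum>i\<in>I. \<Sum>j\<in>J. p i * q j)"
      by (intro sum.cong) auto
    also have "\<dots> = 1" by (simp add: sum_distrib_left[symmetric] q p)
    finally show ?thesis unfolding S_def using le1 le1' p q by (auto intro: mult_le_one)
  qed
  moreover have "continuous_on S F" unfolding F_def al_def ga_def ta_def
    by (intro continuous_intros coord)
  ultimately obtain M where M: "M \<in> S" and min: "\<And>M'. M' \<in> S \<Longrightarrow> F M \<le> F M'"
    using continuous_attains_inf[of S F] by blast
  have M0: "0 \<le> M k" for k using M by (cases k) (auto simp: S_def)
  have M1: "(\<Sum>i\<in>I. \<Sum>j\<in>J. M (i, j)) = 1" using M by (auto simp: S_def)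
  define T where "T = max 0 (ta M)"
  define R where "R i = (\<Sum>j\<in>J. M (i, j))" for i
  define C where "C j = (\<Sum>i\<in>I. M (i, j))" for j
  define W where "W = (\<Sum>i\<in>I. \<Sum>j\<in>J. M (i, j) * c i j)"
  define k where "k = (\<Sum>i\<in>I. al M i * R i) + (\<Sum>j\<in>J. ga M j * C j) + T * W"
  \<comment> \<open>The derivative of \<open>F\<close> at \<open>M\<close> towards the unit mass at
    \<open>(i0, j0)\<close> is \<open>2 * L\<close>, which is nonnegative at a minimum;
    \<open>k\<close> collects the terms that do not depend on the point.\<close>
  have opt: "k \<le> al M i0 + ga M j0 + T * c i0 j0" if ij: "i0 \<in> I" "j0 \<in> J" for i0 j0
  proof -
    define di where "di i = (if i = i0 then 1 else 0) - R i" for i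
    define dj where "dj j = (if j = j0 then 1 else 0) - C j" for j
    define dW where "dW = c i0 j0 - W"
    define L where "L = (\<Sum>i\<in>I. al M i * di i) + (\<Sum>j\<in>J. ga M j * dj j) + T * dW"
    define Q where "Q = (\<Sum>i\<in>I. (di i)^2) + (\<Sum>j\<in>J. (dj j)^2) + dW^2"
    have "(\<Sum>i\<in>I. al M i * di i) = (\<Sum>i\<in>I. (if i = i0 then al M i else 0) - al M i * R i)"
      by (intro sum.cong) (auto simp: di_def algebra_simps)
    moreover have "(\<Sum>j\<in>J. ga M j * dj j) = (\<Sum>j\<in>J. (if j = j0 then ga M j else 0) - ga M j * C j)"
      by (intro sum.cong) (auto simp: dj_def algebra_simps)
    ultimately have L_eq: "L = al M i0 + ga M j0 + T * c i0 j0 - k"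
      using ij I J by (simp add: L_def dW_def k_def right_diff_distrib sum_subtractf sum.delta)
    have var: "0 \<le> 2 * L + s * Q" if s: "0 < s" "s \<le> 1" for s
    proof -
      define N where "N = (\<lambda>x. (1 - s) * M x + s * (if x = (i0, j0) then 1 else 0))"
      have row: "(\<Sum>j\<in>J. N (i, j)) = R i + s * di i" if "i \<in> I" for i
      proof -
        have "(\<Sum>j\<in>J. N (i, j)) = (1 - s) * R i + s * (\<Sum>j\<in>J. if (i, j) = (i0, j0) then 1 else 0)"
          by (simp only: N_def sum.distrib sum_distrib_left R_def)
        also have "(\<Sum>j\<in>J. if (i, j) = (i0, j0) then 1 else 0 :: real) = (if i = i0 then 1 else 0)"
          using ij J by (cases "i = i0") (auto simp: sum.delta)
        finally show ?thesis by (simp add: di_def algebra_simps)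
      qed
      have col: "(\<Sum>i\<in>I. N (i, j)) = C j + s * dj j" if "j \<in> J" for j
      proof -
        have "(\<Sum>i\<in>I. N (i, j)) = (1 - s) * C j + s * (\<Sum>i\<in>I. if (i, j) = (i0, j0) then 1 else 0)"
          by (simp only: N_def sum.distrib sum_distrib_left C_def)
        also have "(\<Sum>i\<in>I. if (i, j) = (i0, j0) then 1 else 0 :: real) = (if j = j0 then 1 else 0)"
          using ij I by (cases "j = j0") (auto simp: sum.delta)
        finally show ?thesis by (simp add: dj_def algebra_simps)
      qed
      have cost: "(\<Sum>i\<in>I. \<Sum>j\<in>J. N (i, j) * c i j) = W + s * dW"
      proof -
        have "(\<Sum>i\<in>I. \<Sum>j\<in>J. N (i, j) * c i j)
          = (1 - s) * W + s * (\<Sum>i\<in>I. \<Sum>j\<in>J. (if (i, j) = (i0, j0) then 1 else 0) * c i j)"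
          by (simp only: N_def distrib_right sum.distrib sum_distrib_left W_def mult.assoc)
        also have "(\<Sum>i\<in>I. \<Sum>j\<in>J. (if (i, j) = (i0, j0) then 1 else 0) * c i j)
          = (\<Sum>i\<in>I. if i = i0 then c i0 j0 else 0)"
        proof (rule sum.cong[OF refl])
          show "(\<Sum>j\<in>J. (if (i, j) = (i0, j0) then 1 else 0) * c i j) = (if i = i0 then c i0 j0 else 0)" for i
          proof (cases "i = i0")
            case True
            then have "(\<Sum>j\<in>J. (if (i, j) = (i0, j0) then 1 else 0) * c i j) = (\<Sum>j\<in>J. if j = j0 then c i0 j else 0)"
              by (intro sum.cong) auto
            then show ?thesis using True ij J by (simp add: sum.delta)
          qed simp
        qed
        also have "\<dots> = c i0 j0" using ij I by (simp add: sum.delta)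
        finally show ?thesis by (simp add: dW_def algebra_simps)
      qed
      have "N \<in> S"
      proof -
        have "0 \<le> N x \<and> N x \<le> 1" for x
        proof -
          have "M x \<le> 1" using M by (cases x) (auto simp: S_def)
          then have "(1 - s) * M x \<le> 1 - s" using s by (simp add: mult_left_le)
          then show ?thesis using M0[of x] s by (auto simp: N_def)
        qed
        moreover have "(\<Sum>i\<in>I. \<Sum>j\<in>J. N (i, j)) = (\<Sum>i\<in>I. R i + s * di i)" using row by (intro sum.cong) auto
        moreover have "(\<Sum>i\<in>I. R i + s * di i) = 1"
        proof -
          have "(\<Sum>i\<in>I. di i) = 0" using ij I M1 by (simp add: di_def sum_subtractf sum.delta R_def)
          then show ?thesis using M1 by (simp add: sum.distrib R_def flip: sum_distrib_left)
        qed
        ultimately show ?thesis by (simp add: S_def)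
      qed
      from min[OF this] have "F M \<le> F N" .
      moreover have "F N \<le> F M + s * (2 * L + s * Q)"
      proof -
        have "(\<Sum>i\<in>I. (al N i)^2) = (\<Sum>i\<in>I. (al M i)^2 + 2 * s * (al M i * di i) + s^2 * (di i)^2)"
        proof (rule sum.cong[OF refl])
          fix i assume "i \<in> I"
          then have "al N i = al M i + s * di i" by (simp add: al_def row R_def[symmetric])
          then show "(al N i)^2 = (al M i)^2 + 2 * s * (al M i * di i) + s^2 * (di i)^2"
            by (simp add: power2_sum power_mult_distrib)
        qed
        moreover have "(\<Sum>j\<in>J. (ga N j)^2) = (\<Sum>j\<in>J. (ga M j)^2 + 2 * s * (ga M j * dj j) + s^2 * (dj j)^2)"
        proof (rule sum.cong[OF refl])
          fix j assume "j \<in> J"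
          then have "ga N j = ga M j + s * dj j" by (simp add: ga_def col C_def[symmetric])
          then show "(ga N j)^2 = (ga M j)^2 + 2 * s * (ga M j * dj j) + s^2 * (dj j)^2"
            by (simp add: power2_sum power_mult_distrib)
        qed
        moreover have "(max 0 (ta N))^2 \<le> T^2 + 2 * T * (s * dW) + (s * dW)^2"
        proof -
          have "ta N = ta M + s * dW" by (simp add: ta_def cost W_def[symmetric])
          then show ?thesis using pos_part_square_le[of "ta M" "s * dW"] by (simp add: T_def)
        qed
        ultimately have "F N \<le> (\<Sum>i\<in>I. (al M i)^2 + 2 * s * (al M i * di i) + s^2 * (di i)^2)
          + (\<Sum>j\<in>J. (ga M j)^2 + 2 * s * (ga M j * dj j) + s^2 * (dj j)^2) + (T^2 + 2 * T * (s * dW) + (s * dW)^2)"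
          by (simp add: F_def)
        also have "(\<Sum>i\<in>I. (al M i)^2 + 2 * s * (al M i * di i) + s^2 * (di i)^2)
          = (\<Sum>i\<in>I. (al M i)^2) + 2 * s * (\<Sum>i\<in>I. al M i * di i) + s^2 * (\<Sum>i\<in>I. (di i)^2)"
          by (simp only: sum.distrib sum_distrib_left)
        also have "(\<Sum>j\<in>J. (ga M j)^2 + 2 * s * (ga M j * dj j) + s^2 * (dj j)^2)
          = (\<Sum>j\<in>J. (ga M j)^2) + 2 * s * (\<Sum>j\<in>J. ga M j * dj j) + s^2 * (\<Sum>j\<in>J. (dj j)^2)"
          by (simp only: sum.distrib sum_distrib_left)
        also have "(\<Sum>i\<in>I. (al M i)^2) + 2 * s * (\<Sum>i\<in>I. al M i * di i) + s^2 * (\<Sum>i\<in>I. (di i)^2)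
          + ((\<Sum>j\<in>J. (ga M j)^2) + 2 * s * (\<Sum>j\<in>J. ga M j * dj j) + s^2 * (\<Sum>j\<in>J. (dj j)^2))
          + (T^2 + 2 * T * (s * dW) + (s * dW)^2) = F M + s * (2 * L + s * Q)"
          unfolding F_def L_def Q_def T_def[symmetric] by (simp add: algebra_simps power2_eq_square)
        finally show ?thesis .
      qed
      ultimately have "0 \<le> s * (2 * L + s * Q)" by linarith
      then show ?thesis using s by (simp add: zero_le_mult_iff)
    qed
    have "((\<lambda>s. 2 * L + s * Q) \<longlongrightarrow> 2 * L + 0 * Q) (at_right 0)" by (intro tendsto_intros)
    then have "0 \<le> 2 * L + 0 * Q"
      by (rule tendsto_lowerbound) (use var in \<open>auto simp: eventually_at_right_field intro!: exI[of _ 1]\<close>)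
    then show ?thesis using L_eq by simp
  qed
  define A where "A = (\<Sum>i\<in>I. p i * al M i)"
  define B where "B = (\<Sum>j\<in>J. q j * ga M j)"
  have k_eq: "k = F M + A + B + T * b"
  proof -
    have "(\<Sum>i\<in>I. al M i * R i) = (\<Sum>i\<in>I. (al M i)^2) + A"
      unfolding A_def sum.distrib[symmetric] by (intro sum.cong) (auto simp: al_def R_def power2_eq_square algebra_simps)
    moreover have "(\<Sum>j\<in>J. ga M j * C j) = (\<Sum>j\<in>J. (ga M j)^2) + B"
      unfolding B_def sum.distrib[symmetric] by (intro sum.cong) (auto simp: ga_def C_def power2_eq_square algebra_simps)
    moreover have "T * W = T^2 + T * b"
    proof -
      have "ta M = W - b" by (simp only: ta_def W_def)
      then show ?thesis by (auto simp: T_def max_def power2_eq_square algebra_simps)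
    qed
    ultimately show ?thesis by (simp add: k_def F_def T_def)
  qed
  have F0: "0 \<le> F M" unfolding F_def by (intro add_nonneg_nonneg sum_nonneg) auto
  have FM: "F M = 0"
  proof (rule ccontr)
    assume "F M \<noteq> 0"
    then have Fp: "0 < F M" using F0 by simp
    show False
    proof (cases "T = 0")
      \<comment> \<open>With no excess cost the first-order conditions do not involve
        \<open>c\<close>; averaging them with the weights \<open>p i * q j\<close> gives
        \<open>k \<le> A + B\<close>, against \<open>k_eq\<close>.\<close>
      case True
      have "(\<Sum>i\<in>I. \<Sum>j\<in>J. p i * q j * k) \<le> (\<Sum>i\<in>I. \<Sum>j\<in>J. p i * q j * (al M i + ga M j))"
        using opt True p q by (intro sum_mono mult_left_mono) auto
      also have "\<dots> = (\<Sum>i\<in>I. \<Sum>j\<in>J. q j * (p i * al M i)) + (\<Sum>i\<in>I. \<Sum>j\<in>J. p i * (q j * ga M j))"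
        by (simp add: sum.distrib[symmetric] algebra_simps)
      also have "(\<Sum>i\<in>I. \<Sum>j\<in>J. q j * (p i * al M i)) = A"
        by (simp add: A_def q(2) flip: sum_distrib_right)
      also have "(\<Sum>i\<in>I. \<Sum>j\<in>J. p i * (q j * ga M j)) = B"
        by (simp add: B_def[symmetric] p(2) flip: sum_distrib_left sum_distrib_right)
      also have "(\<Sum>i\<in>I. \<Sum>j\<in>J. p i * q j * k) = k"
        by (simp add: p(2) q(2) flip: sum_distrib_left sum_distrib_right)
      finally show False using k_eq True Fp by simp
    next
      case False
      then have T: "0 < T" by (simp add: T_def max_def split: if_splits)
      \<comment> \<open>After division by \<open>T\<close> the first-order conditions say that these
        potentials satisfy the dual constraint.\<close>
      have "(\<Sum>j\<in>J. q j * (- ga M j / T)) - (\<Sum>i\<in>I. p i * ((al M i - k) / T)) \<le> b"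
      proof (rule dual)
        fix i j assume "i \<in> I" "j \<in> J"
        from opt[OF this] show "- ga M j / T - (al M i - k) / T \<le> c i j" using T by (simp add: field_simps)
      qed
      moreover have "(\<Sum>j\<in>J. q j * (- ga M j / T)) = - B / T"
        by (simp add: B_def sum_negf sum_divide_distrib)
      moreover have "(\<Sum>i\<in>I. p i * ((al M i - k) / T)) = (A - k) / T"
      proof -
        have "(\<Sum>i\<in>I. p i * ((al M i - k) / T)) = (\<Sum>i\<in>I. (p i * al M i - p i * k) / T)"
          by (intro sum.cong) (auto simp: algebra_simps diff_divide_distrib)
        also have "\<dots> = (A - k) / T"
          by (simp add: A_def sum_divide_distrib[symmetric] sum_subtractf p(2) flip: sum_distrib_right)
        finally show ?thesis .
      qed
      ultimately have "- B / T - (A - k) / T \<le> b" by simp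
      then have "k - A - B \<le> T * b" using T by (simp add: field_simps)
      then show False using k_eq Fp by simp
    qed
  qed
  have z: "(\<Sum>i\<in>I. (al M i)^2) = 0" "(\<Sum>j\<in>J. (ga M j)^2) = 0" "(max 0 (ta M))^2 = 0"
  proof -
    have "0 \<le> (\<Sum>i\<in>I. (al M i)^2)" "0 \<le> (\<Sum>j\<in>J. (ga M j)^2)" by (auto intro: sum_nonneg)
    then show "(\<Sum>i\<in>I. (al M i)^2) = 0" "(\<Sum>j\<in>J. (ga M j)^2) = 0" "(max 0 (ta M))^2 = 0"
      using FM zero_le_power2[of "max 0 (ta M)"] unfolding F_def by linarith+
  qed
  show ?thesis
  proof (rule that[of "\<lambda>i j. M (i, j)"])
    show "(\<Sum>j\<in>J. M (i, j)) = p i" if "i \<in> I" for i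
      using z(1) that I by (auto simp: sum_nonneg_eq_0_iff al_def)
    show "(\<Sum>i\<in>I. M (i, j)) = q j" if "j \<in> J" for j
      using z(2) that J by (auto simp: sum_nonneg_eq_0_iff ga_def)
    show "(\<Sum>i\<in>I. \<Sum>j\<in>J. M (i, j) * c i j) \<le> b" using z(3) by (simp add: ta_def max_def split: if_splits)
  qed (use M0 in auto)
qed

section \<open>Radon measures from tight finitely additive ones\<close>

lemma t2_separate_compact:
  fixes C D :: "'b::t2_space set"
  assumes "compact C" "compact D" "C \<inter> D = {}"
  obtains U V where "open U" "open V" "C \<subseteq> U" "D \<subseteq> V" "U \<inter> V = {}"
proof -
  have "Hausdorff_space (euclidean :: 'b topology)"
    unfolding Hausdorff_space_def using hausdorff by (auto simp: disjnt_def)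
  from Hausdorff_space_compact_separation[OF this, of C D] assms that show ?thesis
    by (auto simp: disjnt_def compactin_euclidean_iff)
qed

text \<open>The charge is finitely additive on all subsets, as pointwise limits of discrete plans
  are. Tightness prevents mass from being lost when the charge is regularized to a measure.\<close>

locale tight_charge =
  fixes \<beta> :: "'b::t2_space set \<Rightarrow> real"
  assumes nonneg: "0 \<le> \<beta> A"
    and additive: "A \<inter> B = {} \<Longrightarrow> \<beta> (A \<union> B) = \<beta> A + \<beta> B"
    and total: "\<beta> UNIV = 1"
    and tight: "0 < e \<Longrightarrow> \<exists>K. compact K \<and> 1 - e \<le> \<beta> K"
begin

lemma charge_mono: "A \<subseteq> B \<Longrightarrow> \<beta> A \<le> \<beta> B"
  using additive[of A "B - A"] nonneg[of "B - A"] by (simp add: Un_absorb1)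

lemma charge_subadd: "\<beta> (A \<union> B) \<le> \<beta> A + \<beta> B"
  using additive[of A "B - A"] charge_mono[of "B - A" B] by auto

lemma charge_empty: "\<beta> {} = 0"
  using additive[of "{}" "{}"] by simp

text \<open>Outer regular values on compact sets, then inner regular values on open sets, then the induced
  outer measure.\<close>

definition lam :: "'b set \<Rightarrow> real" where "lam C = (INF U\<in>{U. open U \<and> C \<subseteq> U}. \<beta> U)"
definition th :: "'b set \<Rightarrow> real" where "th U = (SUP C\<in>{C. compact C \<and> C \<subseteq> U}. lam C)"
definition om :: "'b set \<Rightarrow> ennreal" where "om E = (INF U\<in>{U. open U \<and> E \<subseteq> U}. ennreal (th U))"

lemma bdd_below_charge: "bdd_below (\<beta> ` X)"
  by (rule bdd_belowI[of _ 0]) (auto simp: nonneg)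

lemma lam_le: "open U \<Longrightarrow> C \<subseteq> U \<Longrightarrow> lam C \<le> \<beta> U"
  unfolding lam_def by (intro cINF_lower bdd_below_charge) auto

lemma lam_ge: "\<beta> C \<le> lam C"
  unfolding lam_def by (intro cINF_greatest charge_mono) auto

lemma lam_nonneg: "0 \<le> lam C"
  using lam_ge[of C] nonneg[of C] by linarith

lemma lam_approx: "0 < e \<Longrightarrow> \<exists>U. open U \<and> C \<subseteq> U \<and> \<beta> U < lam C + e"
  using cInf_lessD[of "\<beta> ` {U. open U \<and> C \<subseteq> U}" "lam C + e"] unfolding lam_def by auto

lemma lam_mono: "C \<subseteq> D \<Longrightarrow> lam C \<le> lam D"
  unfolding lam_def by (rule cINF_superset_mono) (auto intro: bdd_below_charge)

lemma lam_le_1: "lam C \<le> 1"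
  using lam_le[of UNIV C] total by simp

lemma lam_empty: "lam {} = 0"
  using lam_le[of "{}" "{}"] charge_empty lam_nonneg[of "{}"] by simp

lemma lam_subadd: "lam (C \<union> D) \<le> lam C + lam D"
proof (rule field_le_epsilon)
  fix e :: real assume e: "0 < e"
  obtain U V where "open U" "C \<subseteq> U" "\<beta> U < lam C + e/2" "open V" "D \<subseteq> V" "\<beta> V < lam D + e/2"
    using lam_approx[of "e/2" C] lam_approx[of "e/2" D] e by auto
  moreover from this have "lam (C \<union> D) \<le> \<beta> (U \<union> V)" by (intro lam_le) auto
  ultimately show "lam (C \<union> D) \<le> lam C + lam D + e" using charge_subadd[of U V] by linarith
qed

lemma lam_additive:
  assumes "compact C" "compact D" "C \<inter> D = {}" shows "lam (C \<union> D) = lam C + lam D"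
proof (rule antisym[OF lam_subadd], rule field_le_epsilon)
  fix e :: real assume e: "0 < e"
  obtain U V where UV: "open U" "open V" "C \<subseteq> U" "D \<subseteq> V" "U \<inter> V = {}" using t2_separate_compact[OF assms] by blast
  obtain W where W: "open W" "C \<union> D \<subseteq> W" "\<beta> W < lam (C \<union> D) + e" using lam_approx[OF e] by blast
  have "lam C + lam D \<le> \<beta> (U \<inter> W) + \<beta> (V \<inter> W)" using UV W by (intro add_mono lam_le) auto
  also have "\<dots> = \<beta> ((U \<inter> W) \<union> (V \<inter> W))" using UV by (subst additive) auto
  also have "\<dots> \<le> \<beta> W" by (rule charge_mono) auto
  finally show "lam C + lam D \<le> lam (C \<union> D) + e" using W by linarith
qed

lemma th_ge: "compact C \<Longrightarrow> C \<subseteq> U \<Longrightarrow> lam C \<le> th U"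
  unfolding th_def by (intro cSUP_upper bdd_aboveI2[of _ _ 1] lam_le_1) auto

lemma th_least: "(\<And>C. compact C \<Longrightarrow> C \<subseteq> U \<Longrightarrow> lam C \<le> x) \<Longrightarrow> th U \<le> x"
  unfolding th_def by (rule cSUP_least) (auto intro: exI[of _ "{}"])

lemma th_le_charge: "open U \<Longrightarrow> th U \<le> \<beta> U"
  by (rule th_least) (auto intro: lam_le)

lemma th_nonneg: "0 \<le> th U"
  using th_ge[of "{}" U] lam_empty by simp

lemma th_mono: "U \<subseteq> V \<Longrightarrow> th U \<le> th V"
  by (rule th_least) (auto intro: th_ge)

lemma th_approx: "0 < e \<Longrightarrow> \<exists>C. compact C \<and> C \<subseteq> U \<and> th U - e < lam C"
  using less_cSupD[of "lam ` {C. compact C \<and> C \<subseteq> U}" "th U - e"] unfolding th_def by (auto intro: exI[of _ "{}"])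

text \<open>A compact set covered by two open sets is the union of two compact pieces, each inside
  one of them: the parts left uncovered by either set are disjoint and compact, and disjoint
  neighbourhoods of them are removed. Induction on the number of sets follows.\<close>

lemma lam_le_sum_th:
  assumes "finite I" "\<And>i. i \<in> I \<Longrightarrow> open (A i)" "compact C" "C \<subseteq> (\<Union>i\<in>I. A i)"
  shows "lam C \<le> (\<Sum>i\<in>I. th (A i))"
  using assms
proof (induction I arbitrary: C rule: finite_induct)
  case empty
  then show ?case using lam_empty by simp
next
  case (insert i I)
  have opn: "open (\<Union>j\<in>I. A j)" using insert.prems by auto
  have c1: "compact (C - (\<Union>j\<in>I. A j))" and c2: "compact (C - A i)"
    using insert.prems opn by (auto intro!: compact_diff)
  have "(C - (\<Union>j\<in>I. A j)) \<inter> (C - A i) = {}" using insert.prems by auto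
  from t2_separate_compact[OF c1 c2 this] obtain U V where UV: "open U" "open V"
    "C - (\<Union>j\<in>I. A j) \<subseteq> U" "C - A i \<subseteq> V" "U \<inter> V = {}" by blast
  have d1: "compact (C - V)" "C - V \<subseteq> A i" and d2: "compact (C - U)" "C - U \<subseteq> (\<Union>j\<in>I. A j)"
    using UV insert.prems by (auto intro!: compact_diff)
  have "lam C \<le> lam ((C - V) \<union> (C - U))" using UV by (intro lam_mono) auto
  also have "\<dots> \<le> lam (C - V) + lam (C - U)" by (rule lam_subadd)
  also have "\<dots> \<le> th (A i) + (\<Sum>j\<in>I. th (A j))"
    using d1 d2 insert.prems by (intro add_mono th_ge insert.IH) auto
  finally show ?case using insert.hyps by simp
qed

lemma om_le: "open U \<Longrightarrow> E \<subseteq> U \<Longrightarrow> om E \<le> ennreal (th U)"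
  unfolding om_def by (rule INF_lower) auto

lemma om_open: "open U \<Longrightarrow> om U = ennreal (th U)"
  unfolding om_def by (rule antisym) (auto intro!: INF_greatest INF_lower ennreal_leI th_mono)

lemma om_mono: "A \<subseteq> B \<Longrightarrow> om A \<le> om B"
  unfolding om_def by (rule INF_superset_mono) auto

lemma om_approx:
  assumes "0 < e" obtains U where "open U" "E \<subseteq> U" "ennreal (th U) \<le> om E + ennreal e"
proof -
  have "om E \<le> ennreal (th UNIV)" by (rule om_le) auto
  then have "om E < top" by (rule le_less_trans) simp
  then have "om E < om E + ennreal e" using assms by simp
  then have "\<exists>U\<in>{U. open U \<and> E \<subseteq> U}. ennreal (th U) < om E + ennreal e" unfolding om_def by (simp only: INF_less_iff)
  then show ?thesis using that less_imp_le by blast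
qed

text \<open>A compact subset of a union of open sets is covered by finitely many of them, so the
  countable case reduces to \<open>lam_le_sum_th\<close>.\<close>

lemma om_countably_subadditive: "om (\<Union>i. A i) \<le> (\<Sum>i::nat. om (A i))"
proof (rule ennreal_le_epsilon)
  fix e :: real assume e: "0 < e"
  have "\<exists>U. open U \<and> A i \<subseteq> U \<and> ennreal (th U) \<le> om (A i) + ennreal (e * (1/2) ^ Suc i)" for i
  proof -
    have "0 < e * (1/2) ^ Suc i" using e by simp
    then show ?thesis by (rule om_approx[of _ "A i"]) blast
  qed
  then obtain U where U: "\<And>i. open (U i)" "\<And>i. A i \<subseteq> U i"
    "\<And>i. ennreal (th (U i)) \<le> om (A i) + ennreal (e * (1/2) ^ Suc i)" by metis
  have "om (\<Union>i. A i) \<le> ennreal (th (\<Union>i. U i))" using U by (intro om_le) auto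
  also have "\<dots> \<le> (\<Sum>i. ennreal (th (U i)))"
  proof -
    have key: "ennreal (lam C) \<le> (\<Sum>i. ennreal (th (U i)))" if C: "compact C" "C \<subseteq> (\<Union>i. U i)" for C
    proof -
      obtain I where I: "finite I" "C \<subseteq> (\<Union>i\<in>I. U i)"
        using compactE_image[OF C(1), of UNIV U] U(1) C(2) by auto
      have "lam C \<le> (\<Sum>i\<in>I. th (U i))" by (rule lam_le_sum_th[OF I(1) U(1) C(1) I(2)])
      then have "ennreal (lam C) \<le> ennreal (\<Sum>i\<in>I. th (U i))" by (rule ennreal_leI)
      also have "\<dots> = (\<Sum>i\<in>I. ennreal (th (U i)))" by (rule sum_ennreal[symmetric]) (rule th_nonneg)
      also have "\<dots> \<le> (\<Sum>i. ennreal (th (U i)))" by (rule sum_le_suminf) (auto simp: I)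
      finally show ?thesis .
    qed
    show ?thesis
    proof (cases "(\<Sum>i. ennreal (th (U i)))" rule: ennreal_cases)
      case (real r)
      have "th (\<Union>i. U i) \<le> r" by (rule th_least) (use key real in auto)
      then show ?thesis using real by (simp add: ennreal_leI)
    qed simp
  qed
  also have "\<dots> \<le> (\<Sum>i. om (A i) + ennreal (e * (1/2) ^ Suc i))" by (intro suminf_le U) auto
  also have "\<dots> = (\<Sum>i. om (A i)) + (\<Sum>i. ennreal (e * (1/2) ^ Suc i))" by (rule suminf_add[symmetric]) auto
  also have "(\<Sum>i. ennreal (e * (1/2) ^ Suc i)) = ennreal (e * 1)"
    using e by (intro suminf_ennreal_eq sums_mult power_half_series) auto
  finally show "om (\<Union>i. A i) \<le> (\<Sum>i. om (A i)) + ennreal e" by simp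
qed

lemma om_empty: "om {} = 0"
  using om_open[of "{}"] th_le_charge[of "{}"] charge_empty by (simp add: ennreal_eq_0_iff)

lemma om_outer: "outer_measure_space (Pow UNIV) om"
  unfolding outer_measure_space_def positive_def increasing_def countably_subadditive_def
  using om_empty om_mono om_countably_subadditive by auto

lemma om_subadd: "om (A \<union> B) \<le> om A + om B"
proof -
  have "om (\<Union>i. binaryset A B i) \<le> (\<Sum>i. om (binaryset A B i))" by (rule om_countably_subadditive)
  then show ?thesis by (simp add: UN_binaryset_eq suminf_binaryset_eq om_empty)
qed

text \<open>Caratheodory's criterion is first checked for open test sets \<open>V\<close>: a compact
  \<open>C\<close> nearly fills \<open>V \<inter> U\<close>, a compact \<open>D\<close> nearly fills
  the open set \<open>V - C\<close>, and \<open>lam\<close> is additive on the disjoint union of the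
  two.\<close>

lemma open_in_lambda_system:
  assumes U: "open U" shows "U \<in> lambda_system UNIV (Pow UNIV) om"
proof -
  have split_open: "ennreal (th (V \<inter> U)) + om (V - U) \<le> ennreal (th V)" if V: "open V" for V
  proof (rule ennreal_le_epsilon)
    fix e :: real assume e: "0 < e"
    obtain C where C: "compact C" "C \<subseteq> V \<inter> U" "th (V \<inter> U) - e/2 < lam C" using th_approx[of "e/2" "V \<inter> U"] half_gt_zero[OF e] by blast
    have oVC: "open (V - C)" using V compact_imp_closed[OF C(1)] by (rule open_Diff)
    obtain D where D: "compact D" "D \<subseteq> V - C" "th (V - C) - e/2 < lam D" using th_approx[of "e/2" "V - C"] half_gt_zero[OF e] by blast
    have "th (V \<inter> U) + th (V - C) \<le> lam C + lam D + e" using C D by linarith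
    also have "lam C + lam D = lam (C \<union> D)" using C D by (intro lam_additive[symmetric]) auto
    also have "lam (C \<union> D) \<le> th V" using C D by (intro th_ge compact_Un) auto
    finally have *: "th (V \<inter> U) + th (V - C) \<le> th V + e" by simp
    have "om (V - U) \<le> ennreal (th (V - C))" using C by (intro om_le oVC) auto
    then have "ennreal (th (V \<inter> U)) + om (V - U) \<le> ennreal (th (V \<inter> U)) + ennreal (th (V - C))"
      by (rule add_left_mono)
    also have "\<dots> = ennreal (th (V \<inter> U) + th (V - C))" by (simp add: th_nonneg)
    also have "\<dots> \<le> ennreal (th V + e)" using * by (rule ennreal_leI)
    also have "\<dots> = ennreal (th V) + ennreal e" using e by (simp add: th_nonneg)
    finally show "ennreal (th (V \<inter> U)) + om (V - U) \<le> ennreal (th V) + ennreal e" .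
  qed
  have "om (U \<inter> E) + om ((UNIV - U) \<inter> E) = om E" for E
  proof (rule antisym)
    show "om (U \<inter> E) + om ((UNIV - U) \<inter> E) \<le> om E"
    proof (rule ennreal_le_epsilon)
      fix e :: real assume e: "0 < e"
      obtain V where V: "open V" "E \<subseteq> V" "ennreal (th V) \<le> om E + ennreal e" using om_approx[OF e] by blast
      have "om (U \<inter> E) + om ((UNIV - U) \<inter> E) \<le> om (V \<inter> U) + om (V - U)"
        using V by (intro add_mono om_mono) auto
      also have "om (V \<inter> U) = ennreal (th (V \<inter> U))" using U V by (intro om_open) auto
      finally show "om (U \<inter> E) + om ((UNIV - U) \<inter> E) \<le> om E + ennreal e"
        using split_open[OF V(1)] V(3) by (meson order_trans)
    qed
    have "(U \<inter> E) \<union> ((UNIV - U) \<inter> E) = E" by auto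
    then show "om E \<le> om (U \<inter> E) + om ((UNIV - U) \<inter> E)" using om_subadd[of "U \<inter> E" "(UNIV - U) \<inter> E"] by simp
  qed
  then show ?thesis by (simp add: lambda_system_def)
qed

text \<open>On open sets the measure is \<open>th\<close>, which lies below the charge, and
  tightness gives it total mass 1. Inner regularity at \<open>B\<close> comes from removing from a
  large compact set an open set that barely exceeds the complement of \<open>B\<close>.\<close>

theorem ex_radon_prob: "\<exists>\<pi>. radon_prob \<pi> \<and> (\<forall>U. open U \<longrightarrow> measure \<pi> U \<le> \<beta> U)"
proof -
  define L where "L = lambda_system UNIV (Pow UNIV) om"
  interpret P: sigma_algebra "UNIV :: 'b set" "Pow UNIV" by (rule sigma_algebra_Pow)
  have ms: "measure_space UNIV L om" unfolding L_def by (rule P.caratheodory_lemma[OF om_outer])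
  then have sL: "sigma_algebra UNIV L" and cL: "countably_additive L om"
    by (auto simp: measure_space_def)
  have "sets (borel :: 'b measure) = sigma_sets UNIV {U. open U}" unfolding borel_def by (rule sets_measure_of) simp
  also have "\<dots> \<subseteq> L"
    using sigma_algebra.sigma_sets_subset[OF sL, of "{U. open U}"] open_in_lambda_system by (auto simp: L_def)
  finally have bL: "sets borel \<subseteq> L" .
  define \<pi> where "\<pi> = measure_of UNIV (sets (borel :: 'b measure)) om"
  have sets_\<pi>: "sets \<pi> = sets borel"
    unfolding \<pi>_def using sets.sigma_sets_eq[of "borel :: 'b measure"] by (simp add: sets.space_closed[of borel, simplified])
  have space_\<pi>: "space \<pi> = UNIV" using sets_eq_imp_space_eq[OF sets_\<pi>] by simp
  have em: "emeasure \<pi> A = om A" if "A \<in> sets borel" for A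
  proof (rule emeasure_measure_of[OF \<pi>_def])
    show "positive (sets \<pi>) om" by (simp add: positive_def om_empty)
    show "countably_additive (sets \<pi>) om"
      unfolding countably_additive_def sets_\<pi>
    proof (intro allI impI)
      fix A :: "nat \<Rightarrow> 'b set"
      assume "range A \<subseteq> sets borel" "disjoint_family A" "\<Union> (range A) \<in> sets borel"
      then have "range A \<subseteq> L" "disjoint_family A" "\<Union> (range A) \<in> L" using bL by auto
      then show "(\<Sum>i. om (A i)) = om (\<Union> (range A))" using cL unfolding countably_additive_def by blast
    qed
  qed (use that sets_\<pi> in auto)
  have th1: "th UNIV = 1"
  proof (rule antisym)
    show "th UNIV \<le> 1" using th_le_charge[of UNIV] total by simp
    show "1 \<le> th UNIV"
    proof (rule field_le_epsilon)
      fix e :: real assume "0 < e"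
      from tight[OF this] obtain K where "compact K" "1 - e \<le> \<beta> K" by blast
      then show "1 \<le> th UNIV + e" using lam_ge[of K] th_ge[of K UNIV] by simp
    qed
  qed
  have ps: "prob_space \<pi>"
    by (rule prob_spaceI) (simp add: space_\<pi> em om_open th1)
  then interpret prob_space \<pi> .
  have lam_pi: "lam C \<le> measure \<pi> C" if C: "compact C" for C
  proof -
    have "ennreal (lam C) \<le> om C" unfolding om_def
      by (rule INF_greatest) (auto intro!: ennreal_leI th_ge C)
    also have "om C = ennreal (measure \<pi> C)"
      using em[of C] compact_imp_closed[OF C] by (simp add: emeasure_eq_measure)
    finally show ?thesis by simp
  qed
  have op: "measure \<pi> U = th U" if "open U" for U
    using em[of U] om_open[OF that] that th_nonneg by (simp add: emeasure_eq_measure)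
  have inner: "emeasure \<pi> B = (SUP K\<in>{K. compact K \<and> K \<subseteq> B}. emeasure \<pi> K)" if B: "B \<in> sets borel" for B
  proof (rule antisym)
    show "(SUP K\<in>{K. compact K \<and> K \<subseteq> B}. emeasure \<pi> K) \<le> emeasure \<pi> B"
      using B by (intro SUP_least emeasure_mono) (auto simp: sets_\<pi>)
    show "emeasure \<pi> B \<le> (SUP K\<in>{K. compact K \<and> K \<subseteq> B}. emeasure \<pi> K)"
    proof (rule ennreal_le_epsilon)
      fix e :: real assume e: "0 < e"
      then obtain K where K: "compact K" "1 - e/2 \<le> \<beta> K" using tight[of "e/2"] by auto
      obtain U where U: "open U" "- B \<subseteq> U" "ennreal (th U) \<le> om (- B) + ennreal (e/2)" using om_approx[OF half_gt_zero[OF e], of "- B"] by blast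
      have KU: "compact (K - U)" "K - U \<subseteq> B" using K U by (auto intro!: compact_diff)
      have [measurable]: "K \<in> sets borel" "U \<in> sets borel" using compact_imp_closed[OF K(1)] U by auto
      have "om (- B) = ennreal (measure \<pi> (- B))" using em[of "- B"] B by (simp add: emeasure_eq_measure)
      then have "th U \<le> measure \<pi> (- B) + e/2"
        using U(3) e by (simp add: ennreal_plus[symmetric] del: ennreal_plus)
      moreover have "measure \<pi> (- B) = 1 - measure \<pi> B"
        using prob_compl[of B] B by (simp add: sets_\<pi> space_\<pi> Compl_eq_Diff_UNIV)
      moreover have "1 - e/2 \<le> measure \<pi> K" using K lam_ge[of K] lam_pi[OF K(1)] by linarith
      moreover have "measure \<pi> K \<le> measure \<pi> (K - U) + measure \<pi> U"
      proof -
        have "measure \<pi> K \<le> measure \<pi> ((K - U) \<union> U)" by (rule finite_measure_mono) (auto simp: sets_\<pi>)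
        also have "\<dots> \<le> measure \<pi> (K - U) + measure \<pi> U" by (rule measure_Un_le) (auto simp: sets_\<pi>)
        finally show ?thesis .
      qed
      ultimately have "measure \<pi> B \<le> measure \<pi> (K - U) + e" using op[OF U(1)] by linarith
      then have "emeasure \<pi> B \<le> emeasure \<pi> (K - U) + ennreal e"
        using e by (simp add: emeasure_eq_measure ennreal_plus[symmetric] del: ennreal_plus)
      also have "\<dots> \<le> (SUP K\<in>{K. compact K \<and> K \<subseteq> B}. emeasure \<pi> K) + ennreal e"
        using KU by (intro add_right_mono SUP_upper) auto
      finally show "emeasure \<pi> B \<le> (SUP K\<in>{K. compact K \<and> K \<subseteq> B}. emeasure \<pi> K) + ennreal e" .
    qed
  qed
  have "radon_prob \<pi>" unfolding radon_prob_def using ps sets_\<pi> inner by blast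
  then show ?thesis using op th_le_charge by auto
qed

end

section \<open>Plans with finitely many constraints\<close>

text \<open>The family in the definition of the space is only some family with supremum
  \<open>d\<close>. All bounded continuous semidistances below \<open>d\<close> have the same
  supremum and are closed under maxima, hence directed.\<close>

definition cont_semidistances :: "('a::topological_space \<Rightarrow> 'a \<Rightarrow> ennreal) \<Rightarrow> ('a \<Rightarrow> 'a \<Rightarrow> real) set" where
  "cont_semidistances d = {\<delta>. (\<forall>x y. 0 \<le> \<delta> x y) \<and> (\<forall>x. \<delta> x x = 0) \<and> (\<forall>x y. \<delta> x y = \<delta> y x) \<and>
     (\<forall>x y z. \<delta> x z \<le> \<delta> x y + \<delta> y z) \<and> (\<exists>C. \<forall>x y. \<delta> x y \<le> C) \<and>
     continuous_on UNIV (\<lambda>(x, y). \<delta> x y) \<and> (\<forall>x y. ennreal (\<delta> x y) \<le> d x y)}"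

text \<open>Summed over \<open>k\<close> and divided by \<open>n\<close>, the masses of these sets
  form a lower sum for the integral of the squared semidistance; counting from \<open>Suc k\<close>
  makes it a lower one. The strict inequality makes the layers of a continuous semidistance
  open.\<close>

definition cost_layer :: "('a \<Rightarrow> 'a \<Rightarrow> real) \<Rightarrow> nat \<Rightarrow> nat \<Rightarrow> ('a \<times> 'a) set" where
  "cost_layer \<delta> n k = {p. real (Suc k) / real n < (\<delta> (fst p) (snd p))^2}"

lemma cont_semidistancesD:
  assumes "\<delta> \<in> cont_semidistances d"
  shows "0 \<le> \<delta> x y" "\<delta> x x = 0" "\<delta> x y = \<delta> y x" "\<delta> x z \<le> \<delta> x y + \<delta> y z"
    "\<exists>C. \<forall>x y. \<delta> x y \<le> C" "continuous_on UNIV (\<lambda>(x, y). \<delta> x y)" "ennreal (\<delta> x y) \<le> d x y"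
  using assms unfolding cont_semidistances_def by blast+

lemma cont_semidistances_zero: "(\<lambda>_ _. 0) \<in> cont_semidistances d"
  by (auto simp: cont_semidistances_def)

lemma cont_semidistances_max:
  assumes a: "\<delta> \<in> cont_semidistances d" and b: "\<delta>' \<in> cont_semidistances d"
  shows "(\<lambda>x y. max (\<delta> x y) (\<delta>' x y)) \<in> cont_semidistances d"
proof -
  obtain C where C: "\<forall>x y. \<delta> x y \<le> C" using cont_semidistancesD(5)[OF a] by blast
  obtain C' where C': "\<forall>x y. \<delta>' x y \<le> C'" using cont_semidistancesD(5)[OF b] by blast
  have "max (\<delta> x y) (\<delta>' x y) \<le> max C C'" for x y
    using spec[OF spec[OF C]] spec[OF spec[OF C']] by (intro max.mono)
  then have bd: "\<exists>C. \<forall>x y. max (\<delta> x y) (\<delta>' x y) \<le> C" by blast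
  have tri: "max (\<delta> x z) (\<delta>' x z) \<le> max (\<delta> x y) (\<delta>' x y) + max (\<delta> y z) (\<delta>' y z)" for x y z
    using cont_semidistancesD(4)[OF a, of x z y] cont_semidistancesD(4)[OF b, of x z y] by linarith
  have co: "continuous_on UNIV (\<lambda>(x, y). max (\<delta> x y) (\<delta>' x y))"
    using continuous_on_max[OF cont_semidistancesD(6)[OF a] cont_semidistancesD(6)[OF b]]
    by (simp add: case_prod_beta)
  have le: "ennreal (max (\<delta> x y) (\<delta>' x y)) \<le> d x y" for x y
    using cont_semidistancesD(7)[OF a, of x y] cont_semidistancesD(7)[OF b, of x y] by (simp add: max_def)
  have sym: "max (\<delta> x y) (\<delta>' x y) = max (\<delta> y x) (\<delta>' y x)" for x y
    using cont_semidistancesD(3)[OF a, of x y] cont_semidistancesD(3)[OF b, of x y] by simp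
  have nn: "0 \<le> max (\<delta> x y) (\<delta>' x y)" for x y
    using cont_semidistancesD(1)[OF a, of x y] by (simp add: le_max_iff_disj)
  show ?thesis unfolding cont_semidistances_def
    by (intro CollectI conjI allI; (rule bd tri co le sym nn)?) (simp add: cont_semidistancesD(2)[OF a] cont_semidistancesD(2)[OF b])
qed

lemma cont_semidistances_directed:
  assumes "finite F" "F \<subseteq> cont_semidistances d"
  shows "\<exists>\<delta>\<in>cont_semidistances d. \<forall>\<delta>'\<in>F. \<forall>x y. \<delta>' x y \<le> \<delta> x y"
  using assms
proof (induction F rule: finite_induct)
  case empty
  then show ?case using cont_semidistances_zero by blast
next
  case (insert \<delta>' F)
  then have \<delta>': "\<delta>' \<in> cont_semidistances d" and F: "F \<subseteq> cont_semidistances d" by simp_all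
  from insert.IH[OF F] obtain \<delta> where \<delta>: "\<delta> \<in> cont_semidistances d" "\<forall>\<delta>'\<in>F. \<forall>x y. \<delta>' x y \<le> \<delta> x y" by (rule bexE)
  have "\<eta> x y \<le> max (\<delta> x y) (\<delta>' x y)" if "\<eta> \<in> insert \<delta>' F" for \<eta> x y
  proof (cases "\<eta> = \<delta>'")
    case False
    then have "\<eta> \<in> F" using that by blast
    from bspec[OF \<delta>(2) this] have "\<eta> x y \<le> \<delta> x y" by (rule allE) (rule spec)
    then show ?thesis by (rule max.coboundedI1)
  qed simp
  then have "\<forall>\<eta>\<in>insert \<delta>' F. \<forall>x y. \<eta> x y \<le> max (\<delta> x y) (\<delta>' x y)" by (intro ballI allI)
  then show ?case by (rule bexI[OF _ cont_semidistances_max[OF \<delta>(1) \<delta>']])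
qed

context ext_mm_space
begin

lemma d_eq_SUP: "d x y = (SUP \<delta>\<in>cont_semidistances d. ennreal (\<delta> x y))"
proof (rule antisym)
  have "\<exists>\<Delta> :: ('a \<Rightarrow> 'a \<Rightarrow> real) set.
      (\<forall>\<delta>\<in>\<Delta>. (\<forall>x y. 0 \<le> \<delta> x y) \<and> semidistance (\<lambda>x y. ennreal (\<delta> x y)) \<and>
        (\<exists>C. \<forall>x y. \<delta> x y \<le> C) \<and> continuous_on UNIV (\<lambda>(x, y). \<delta> x y)) \<and>
      (\<forall>x y. d x y = (SUP \<delta>\<in>\<Delta>. ennreal (\<delta> x y)))"
    using emms unfolding ext_metric_measure_space_def ext_metric_topological_space_def by (elim conjE)
  then obtain \<Delta> :: "('a \<Rightarrow> 'a \<Rightarrow> real) set" where \<Delta>: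
      "\<forall>\<delta>\<in>\<Delta>. (\<forall>x y. 0 \<le> \<delta> x y) \<and> semidistance (\<lambda>x y. ennreal (\<delta> x y)) \<and>
        (\<exists>C. \<forall>x y. \<delta> x y \<le> C) \<and> continuous_on UNIV (\<lambda>(x, y). \<delta> x y)"
    and sup: "\<forall>x y. d x y = (SUP \<delta>\<in>\<Delta>. ennreal (\<delta> x y))"
    by (elim exE conjE)
  have sup: "d x y = (SUP \<delta>\<in>\<Delta>. ennreal (\<delta> x y))" for x y using sup by (rule allE) (rule spec)
  have "\<Delta> \<subseteq> cont_semidistances d"
  proof
    fix \<delta> assume \<delta>: "\<delta> \<in> \<Delta>"
    note p = bspec[OF \<Delta> \<delta>]
    have nn: "0 \<le> \<delta> x y" for x y using conjunct1[OF p] by (rule allE) (rule spec)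
    have s: "ennreal (\<delta> x x) = 0" "ennreal (\<delta> x y) = ennreal (\<delta> y x)"
      "ennreal (\<delta> x z) \<le> ennreal (\<delta> x y) + ennreal (\<delta> y z)" for x y z
      using conjunct1[OF conjunct2[OF p]] unfolding semidistance_def by blast+
    have zero: "\<delta> x x = 0" for x using s(1)[of x] nn[of x x] by simp
    have sym: "\<delta> x y = \<delta> y x" for x y using s(2)[of x y] nn by simp
    have tri: "\<delta> x z \<le> \<delta> x y + \<delta> y z" for x y z
      using s(3)[of x z y] nn by (simp add: ennreal_plus[symmetric] del: ennreal_plus)
    have le: "ennreal (\<delta> x y) \<le> d x y" for x y unfolding sup using \<delta> by (rule SUP_upper)
    show "\<delta> \<in> cont_semidistances d"
      unfolding cont_semidistances_def
      by (intro CollectI conjI allI; (rule zero sym tri le nn)?) (use p in simp_all)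
  qed
  then show "d x y \<le> (SUP \<delta>\<in>cont_semidistances d. ennreal (\<delta> x y))" unfolding sup by (rule SUP_subset_mono) simp
  show "(SUP \<delta>\<in>cont_semidistances d. ennreal (\<delta> x y)) \<le> d x y"
    by (rule SUP_least) (rule cont_semidistancesD(7))
qed

text \<open>The dual constraints are tested with the Hopf--Lax potentials of the distances from finitely
  many cells; a minimal discrete plan then yields a finitely additive one.\<close>

lemma ex_discrete_plan:
  assumes \<mu>: "radon_prob \<mu>" and \<nu>: "radon_prob \<nu>"
    and dual: "\<And>\<phi>. \<phi> \<in> dual_admissible d m \<Longrightarrow> (\<integral>x. \<phi> 1 x \<partial>\<nu>) - (\<integral>x. \<phi> 0 x \<partial>\<mu>) \<le> b"
    and \<delta>: "\<delta> \<in> cont_semidistances d" and \<A>: "finite \<A>" "\<A> \<subseteq> sets borel" and e: "0 < e"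
  obtains \<beta> :: "('a \<times> 'a) set \<Rightarrow> real" where "\<And>S. 0 \<le> \<beta> S" "\<And>S. \<beta> S \<le> 1" "\<And>S T. S \<inter> T = {} \<Longrightarrow> \<beta> (S \<union> T) = \<beta> S + \<beta> T"
    "\<beta> UNIV = 1" "\<And>A. A \<in> \<A> \<Longrightarrow> \<beta> (A \<times> UNIV) = measure \<mu> A" "\<And>B. B \<in> \<A> \<Longrightarrow> \<beta> (UNIV \<times> B) = measure \<nu> B"
    "\<And>n N. 0 < n \<Longrightarrow> (\<Sum>k<N. \<beta> (cost_layer \<delta> n k)) / real n \<le> 2 * b + e"
proof -
  interpret M: prob_space \<mu> using \<mu> by (simp add: radon_prob_def)
  interpret N: prob_space \<nu> using \<nu> by (simp add: radon_prob_def)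
  have sets: "sets \<mu> = sets borel" "sets \<nu> = sets borel" using \<mu> \<nu> by (auto simp: radon_prob_def)
  have sp: "space \<mu> = UNIV" "space \<nu> = UNIV" using sets_eq_imp_space_eq[OF sets(1)] sets_eq_imp_space_eq[OF sets(2)] by auto
  note D = cont_semidistancesD[OF \<delta>]
  \<comment> \<open>The members of \<open>\<A>\<close> containing \<open>x\<close> label the atom in
    which \<open>x\<close> lies: the fibres of \<open>sig\<close> are the atoms of the finite
    algebra generated by \<open>\<A>\<close>.\<close>
  define sig where "sig = (\<lambda>x. {A \<in> \<A>. x \<in> A})"
  define J where "J = range sig"
  define cell where "cell = (\<lambda>j. {x. sig x = j})"
  have J: "finite J" "J \<noteq> {}"
    unfolding J_def sig_def by (rule finite_subset[of _ "Pow \<A>"]) (use \<A> in auto)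
  have cell_ne: "\<exists>x. x \<in> cell j" if "j \<in> J" for j using that by (auto simp: J_def cell_def)
  have cell_sets: "cell j \<in> sets borel" for j
  proof -
    have "cell j = (if j \<subseteq> \<A> then (\<Inter>A\<in>j. A) \<inter> (\<Inter>A\<in>\<A> - j. - A) else {})"
      by (auto simp: cell_def sig_def)
    moreover have "(\<Inter>A\<in>j. A) \<in> sets borel" if "j \<subseteq> \<A>" for j
    proof (cases "j = {}")
      case False
      then show ?thesis by (rule sets.finite_INT[OF finite_subset[OF that \<A>(1)]]) (use that \<A>(2) in blast)
    qed simp
    moreover have "(\<Inter>A\<in>\<A> - j. - A) \<in> sets borel"
    proof (cases "\<A> - j = {}")
      case False
      have "- A \<in> sets borel" if "A \<in> \<A> - j" for A
        using \<A>(2) that sets.compl_sets[of A borel] by (auto simp: Compl_eq_Diff_UNIV)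
      then show ?thesis by (rule sets.finite_INT[OF finite_Diff[OF \<A>(1)] False])
    next
      case True
      show ?thesis unfolding True by simp
    qed
    ultimately show ?thesis by (cases "j \<subseteq> \<A>") (simp_all only: if_True if_False sets.Int sets.empty_sets simp_thms)
  qed
  have cell_disj: "disjoint_family_on cell K" for K by (auto simp: disjoint_family_on_def cell_def)
  have split: "measure L A = (\<Sum>j\<in>{j \<in> J. A \<in> j}. measure L (cell j))"
    if L: "sets L = sets borel" "prob_space L" and A: "A \<in> \<A>" for L A
  proof -
    interpret L: prob_space L by fact
    have "A = (\<Union>j\<in>{j \<in> J. A \<in> j}. cell j)" using A by (auto simp: cell_def J_def sig_def)
    then show ?thesis
      using L.finite_measure_finite_Union[of "{j \<in> J. A \<in> j}" cell] J cell_sets cell_disj L by auto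
  qed
  have total: "(\<Sum>j\<in>J. measure L (cell j)) = 1" if L: "sets L = sets borel" "prob_space L" for L
  proof -
    interpret L: prob_space L by fact
    have "(\<Union>j\<in>J. cell j) = UNIV" by (auto simp: cell_def J_def)
    then have "space L = (\<Union>j\<in>J. cell j)" using sets_eq_imp_space_eq[OF L(1)] by simp
    then show ?thesis
      using L.finite_measure_finite_Union[of J cell] J cell_sets cell_disj L L.prob_space by auto
  qed
  obtain C where "\<forall>x y. \<delta> x y \<le> C" using D(5) by blast
  then have C: "\<delta> x y \<le> C" for x y by blast
  \<comment> \<open>Half the infimum of the squared semidistance between two cells: a cost that the
    Hopf--Lax potentials can detect, and that single points of the cells realize up to the tolerance
    \<open>e\<close>.\<close>
  define c where "c = (\<lambda>i j. (INF p\<in>cell i \<times> cell j. (\<delta> (fst p) (snd p))^2) / 2)"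
  have bddc: "bdd_below ((\<lambda>p. (\<delta> (fst p) (snd p))^2) ` K)" for K by (rule bdd_belowI[of _ 0]) auto
  have c_le: "2 * c i j \<le> (\<delta> x y)^2" if "x \<in> cell i" "y \<in> cell j" for i j x y
    using cINF_lower[OF bddc, of "(x, y)" "cell i \<times> cell j"] that by (simp add: c_def)
  have ex_pt: "\<exists>p. p \<in> cell i \<times> cell j \<and> (\<delta> (fst p) (snd p))\<^sup>2 < 2 * c i j + e" if "i \<in> J" "j \<in> J" for i j
    using cInf_lessD[of "(\<lambda>p. (\<delta> (fst p) (snd p))^2) ` (cell i \<times> cell j)" "2 * c i j + e"]
      cell_ne[OF that(1)] cell_ne[OF that(2)] e by (auto simp: c_def)
  define dist where "dist = (\<lambda>i x. INF y\<in>cell i. \<delta> x y)"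
  have bddd: "bdd_below (\<delta> x ` K)" for x K by (rule bdd_belowI[of _ 0]) (auto simp: D(1))
  have dist_le: "dist i x \<le> \<delta> x y" if "y \<in> cell i" for i x y
    unfolding dist_def by (rule cINF_lower[OF bddd that])
  have dist_ge: "a \<le> dist i x" if "i \<in> J" "\<And>y. y \<in> cell i \<Longrightarrow> a \<le> \<delta> x y" for a i x
    unfolding dist_def using cell_ne[OF that(1)] that(2) by (intro cINF_greatest) auto
  have dist_lip: "\<bar>dist i x - dist i y\<bar> \<le> \<delta> x y" if i: "i \<in> J" for i x y
  proof -
    have *: "dist i x - \<delta> x y \<le> dist i y" for x y
    proof (rule dist_ge[OF i])
      fix z assume "z \<in> cell i"
      then show "dist i x - \<delta> x y \<le> \<delta> y z" using dist_le[of z i x] D(4)[of x z y] by linarith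
    qed
    from *[of x y] *[of y x] show ?thesis unfolding D(3)[of y x] by linarith
  qed
  have dist_cont: "continuous_on UNIV (dist i)" if i: "i \<in> J" for i
    unfolding continuous_on_def
  proof
    fix x
    have "((\<lambda>y. \<delta> x y) \<longlongrightarrow> \<delta> x x) (at x)"
    proof -
      have "continuous_on UNIV (\<lambda>y. case (x, y) of (x, y) \<Rightarrow> \<delta> x y)"
        by (rule continuous_on_compose2[OF D(6)]) (auto intro: continuous_intros)
      then show ?thesis by (simp add: continuous_on_def)
    qed
    then have "((\<lambda>y. dist i y - dist i x) \<longlongrightarrow> 0) (at x)"
      unfolding D(2) by (rule Lim_null_comparison[rotated])
        (use dist_lip[OF i, of _ x] D(3)[of _ x] in \<open>simp add: always_eventually\<close>)
    then show "(dist i \<longlongrightarrow> dist i x) (at x within UNIV)" by (simp add: LIM_zero_iff)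
  qed
  have duality: "(\<Sum>j\<in>J. measure \<nu> (cell j) * v j) - (\<Sum>i\<in>J. measure \<mu> (cell i) * u i) \<le> b"
    if uv: "\<And>i j. i \<in> J \<Longrightarrow> j \<in> J \<Longrightarrow> v j - u i \<le> c i j" for u v
  proof (rule field_le_epsilon)
    fix \<epsilon>0 :: real assume \<epsilon>0: "0 < \<epsilon>0"
    \<comment> \<open>The time shift in the Hopf--Lax formula costs at most
      \<open>\<epsilon> / 2 * C^2\<close>, which this choice keeps below \<open>\<epsilon>0\<close>;
      the added 1 avoids division by 0.\<close>
    define w where "w = \<epsilon>0 / (C^2 + 1)"
    define \<epsilon> where "\<epsilon> = 2 * w"
    have \<epsilon>: "0 < \<epsilon>" using \<epsilon>0 by (simp add: \<epsilon>_def w_def add_nonneg_pos)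
    have "C^2 / (C^2 + 1) \<le> 1" by (simp add: divide_le_eq add_nonneg_pos)
    then have "\<epsilon>0 * (C^2 / (C^2 + 1)) \<le> \<epsilon>0 * 1" using \<epsilon>0 by (intro mult_left_mono) auto
    then have "w * C^2 \<le> \<epsilon>0" by (simp add: w_def)
    then have \<epsilon>C: "\<epsilon> / 2 * C^2 \<le> \<epsilon>0" by (simp add: \<epsilon>_def)
    interpret H: hopf_lax d m J u dist C \<epsilon>
    proof
      fix i x y assume i: "i \<in> J"
      show "0 \<le> dist i x" by (rule dist_ge[OF i]) (rule D(1))
      show "dist i x \<le> C" using cell_ne[OF i] dist_le[of _ i x] C order_trans by blast
      show "continuous_on UNIV (dist i)" by (rule dist_cont[OF i])
      assume "d x y < top"
      then have "\<delta> x y \<le> enn2real (d x y)"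
        using enn2real_mono[OF D(7)[of x y]] D(1)[of x y] by simp
      then show "\<bar>dist i x - dist i y\<bar> \<le> enn2real (d x y)" using dist_lip[OF i, of x y] by linarith
    qed (use J \<epsilon> in auto)
    have pm: "H.pot t \<in> borel_measurable L" if "sets L = sets borel" for L t
      using Lip_b_measurable[OF H.pot_Lip_b, of t] by (simp add: measurable_cong_sets[OF that refl])
    have pi: "integrable \<mu> (H.pot 0)" "integrable \<nu> (H.pot 1)"
      by (rule M.integrable_const_bound[OF AE_I2] N.integrable_const_bound[OF AE_I2],
          rule order_trans[OF eq_refl[OF real_norm_def] H.pot_bounded], rule pm, rule sets)+
    have step: "(\<Sum>j\<in>J. w j * indicator (cell j) x) = w (sig x)" for w :: "'a set set \<Rightarrow> real" and x
    proof -
      have "(\<Sum>j\<in>J. w j * indicator (cell j) x) = (\<Sum>j\<in>{sig x}. w j * indicator (cell j) x)"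
        by (rule sum.mono_neutral_right) (use J in \<open>auto simp: J_def cell_def indicator_def split: if_splits\<close>)
      then show ?thesis by (simp add: cell_def)
    qed
    have int: "integrable L (\<lambda>x. \<Sum>j\<in>J. w j * indicator (cell j) x)"
      "(\<integral>x. (\<Sum>j\<in>J. w j * indicator (cell j) x) \<partial>L) = (\<Sum>j\<in>J. measure L (cell j) * w j)"
      if L: "sets L = sets borel" "prob_space L" for L and w :: "'a set set \<Rightarrow> real"
    proof -
      interpret L: prob_space L by fact
      have i: "integrable L (\<lambda>x. w j * indicator (cell j) x)" for j
        using cell_sets[of j] L(1) by (simp add: L.emeasure_eq_measure)
      then show "integrable L (\<lambda>x. \<Sum>j\<in>J. w j * indicator (cell j) x)" by simp
      show "(\<integral>x. (\<Sum>j\<in>J. w j * indicator (cell j) x) \<partial>L) = (\<Sum>j\<in>J. measure L (cell j) * w j)"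
        by (subst Bochner_Integration.integral_sum[OF i])
          (use cell_sets sets_eq_imp_space_eq[OF L(1)] L(1) in \<open>auto simp: mult.commute\<close>)
    qed
    \<comment> \<open>Every point has distance 0 from its own cell, so at time 0 the potential is at
      most the value of \<open>u\<close> on that cell, whatever the shift.\<close>
    have "(\<integral>x. H.pot 0 x \<partial>\<mu>) \<le> (\<integral>x. (\<Sum>j\<in>J. u j * indicator (cell j) x) \<partial>\<mu>)"
    proof (rule integral_mono[OF pi(1) int(1)[OF sets(1) M.prob_space_axioms]])
      fix x
      have "sig x \<in> J" by (simp add: J_def)
      moreover have "dist (sig x) x \<le> 0" using dist_le[of x "sig x" x] D(2) by (simp add: cell_def)
      ultimately have "dist (sig x) x = 0" using H.e_bounds(1)[of "sig x" x] by simp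
      then show "H.pot 0 x \<le> (\<Sum>j\<in>J. u j * indicator (cell j) x)"
        using H.hl_le[OF \<open>sig x \<in> J\<close>, of \<epsilon> x] by (simp add: step H.pot_def)
    qed
    then have 0: "(\<integral>x. H.pot 0 x \<partial>\<mu>) \<le> (\<Sum>i\<in>J. measure \<mu> (cell i) * u i)"
      by (simp add: int(2)[OF sets(1) M.prob_space_axioms])
    \<comment> \<open>At time 1 half the squared distance from an active cell \<open>i\<close> is at
      least \<open>c i (sig x)\<close>, so the constraint on \<open>u\<close> and \<open>v\<close>
      puts the potential above \<open>v\<close>, up to the loss caused by the shift.\<close>
    have "(\<integral>x. (\<Sum>j\<in>J. (v j - \<epsilon> / 2 * C^2) * indicator (cell j) x) \<partial>\<nu>) \<le> (\<integral>x. H.pot 1 x \<partial>\<nu>)"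
    proof (rule integral_mono[OF int(1)[OF sets(2) N.prob_space_axioms] pi(2)])
      fix x
      obtain i where i: "i \<in> J" "H.hl (1 + \<epsilon>) x = u i + (dist i x)^2 / (2 * (1 + \<epsilon>))" by (rule H.hl_attained)
      have "sqrt (2 * c i (sig x)) \<le> dist i x"
        using c_le[of _ i x "sig x"] D(1) D(3)[of x]
        by (intro dist_ge[OF i(1)] real_le_lsqrt) (auto simp: cell_def)
      moreover have "0 \<le> 2 * c i (sig x)"
      proof -
        have "cell i \<times> cell (sig x) \<noteq> {}" using cell_ne[OF i(1)] by (auto simp: cell_def)
        then show ?thesis unfolding c_def by (simp add: cINF_greatest)
      qed
      ultimately have cd: "2 * c i (sig x) \<le> (dist i x)^2"
        using power_mono[of "sqrt (2 * c i (sig x))" "dist i x" 2] by simp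
      have "v (sig x) - u i \<le> c i (sig x)" by (rule uv[OF i(1)]) (simp add: J_def)
      then have "v (sig x) \<le> u i + (dist i x)^2 / 2" using cd by simp
      moreover have "(dist i x)^2 / 2 - \<epsilon> / 2 * C^2 \<le> (dist i x)^2 / (2 * (1 + \<epsilon>))"
      proof -
        have "(dist i x)^2 / 2 - (dist i x)\<^sup>2 / (2 * (1 + \<epsilon>)) = \<epsilon> / (2 * (1 + \<epsilon>)) * (dist i x)^2"
          using \<epsilon> by (simp add: field_simps)
        also have "\<dots> \<le> \<epsilon> / 2 * C^2"
          using \<epsilon> H.e_sq[OF i(1), of x] by (intro mult_mono divide_left_mono) auto
        finally show ?thesis by linarith
      qed
      ultimately show "(\<Sum>j\<in>J. (v j - \<epsilon> / 2 * C^2) * indicator (cell j) x) \<le> H.pot 1 x"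
        unfolding step by (simp add: H.pot_def i(2))
    qed
    then have "(\<Sum>j\<in>J. measure \<nu> (cell j) * (v j - \<epsilon> / 2 * C^2)) \<le> (\<integral>x. H.pot 1 x \<partial>\<nu>)"
      by (simp only: int(2)[OF sets(2) N.prob_space_axioms])
    then have "(\<Sum>j\<in>J. measure \<nu> (cell j) * v j) - (\<Sum>j\<in>J. measure \<nu> (cell j)) * (\<epsilon> / 2 * C^2) \<le> (\<integral>x. H.pot 1 x \<partial>\<nu>)"
      by (simp only: right_diff_distrib sum_subtractf sum_distrib_right)
    then have "(\<Sum>j\<in>J. measure \<nu> (cell j) * v j) - \<epsilon> / 2 * C^2 \<le> (\<integral>x. H.pot 1 x \<partial>\<nu>)"
      unfolding total[OF sets(2) N.prob_space_axioms] by simp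
    with 0 dual[OF H.pot_admissible] \<epsilon>C
    show "(\<Sum>j\<in>J. measure \<nu> (cell j) * v j) - (\<Sum>i\<in>J. measure \<mu> (cell i) * u i) \<le> b + \<epsilon>0" by linarith
  qed
  have "\<exists>P. (\<forall>i\<in>J. \<forall>j\<in>J. 0 \<le> P i j) \<and> (\<forall>i\<in>J. (\<Sum>j\<in>J. P i j) = measure \<mu> (cell i))
    \<and> (\<forall>j\<in>J. (\<Sum>i\<in>J. P i j) = measure \<nu> (cell j)) \<and> (\<Sum>i\<in>J. \<Sum>j\<in>J. P i j * c i j) \<le> b"
  proof (rule finite_transport_duality[OF J(1) J(1) _ total[OF sets(1) M.prob_space_axioms] _
        total[OF sets(2) N.prob_space_axioms] duality])
    fix P assume "\<And>i j. i \<in> J \<Longrightarrow> j \<in> J \<Longrightarrow> 0 \<le> P i j"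
      "\<And>i. i \<in> J \<Longrightarrow> (\<Sum>j\<in>J. P i j) = measure \<mu> (cell i)" "\<And>j. j \<in> J \<Longrightarrow> (\<Sum>i\<in>J. P i j) = measure \<nu> (cell j)"
      "(\<Sum>i\<in>J. \<Sum>j\<in>J. P i j * c i j) \<le> b"
    then show ?thesis by (intro exI[of _ P] conjI ballI)
  qed (rule measure_nonneg)+
  then obtain P where P': "\<forall>i\<in>J. \<forall>j\<in>J. 0 \<le> P i j" "\<forall>i\<in>J. (\<Sum>j\<in>J. P i j) = measure \<mu> (cell i)"
    "\<forall>j\<in>J. (\<Sum>i\<in>J. P i j) = measure \<nu> (cell j)" and P4: "(\<Sum>i\<in>J. \<Sum>j\<in>J. P i j * c i j) \<le> b"
    by (elim exE conjE)
  have P: "0 \<le> P i j" if "i \<in> J" "j \<in> J" for i j by (rule bspec[OF bspec[OF P'(1) that(1)] that(2)])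
  define p where "p = (\<lambda>i j. SOME p. p \<in> cell i \<times> cell j \<and> (\<delta> (fst p) (snd p))\<^sup>2 < 2 * c i j + e)"
  have p: "p i j \<in> cell i \<times> cell j" "(\<delta> (fst (p i j)) (snd (p i j)))^2 < 2 * c i j + e"
    if "i \<in> J" "j \<in> J" for i j
    using someI_ex[OF ex_pt[OF that]] unfolding p_def by (rule conjunct1, rule conjunct2)
  \<comment> \<open>The mass of each pair of cells sits at a single point of the pair, so that all
    subsets receive a mass and those generated by \<open>\<A>\<close> receive the prescribed
    one.\<close>
  define \<beta> where "\<beta> = (\<lambda>S. \<Sum>i\<in>J. \<Sum>j\<in>J. P i j * indicator S (p i j))"
  have PT: "(\<Sum>i\<in>J. \<Sum>j\<in>J. P i j) = 1"
    using P'(2) total[OF sets(1) M.prob_space_axioms] by simp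
  show thesis
  proof (rule that[of \<beta>])
    show "0 \<le> \<beta> S" for S unfolding \<beta>_def using P by (intro sum_nonneg mult_nonneg_nonneg) auto
    have "\<beta> S \<le> (\<Sum>i\<in>J. \<Sum>j\<in>J. P i j * 1)" for S
      unfolding \<beta>_def using P by (intro sum_mono mult_left_mono) (auto simp: indicator_def)
    then show "\<beta> S \<le> 1" for S using PT by simp
    show "\<beta> (S \<union> T) = \<beta> S + \<beta> T" if "S \<inter> T = {}" for S T
      unfolding \<beta>_def sum.distrib[symmetric] distrib_left[symmetric] using that
      by (intro sum.cong refl arg_cong2[where f = "(*)"]) (auto simp: indicator_def)
    show "\<beta> UNIV = 1" using PT by (simp add: \<beta>_def)
    show "\<beta> (A \<times> UNIV) = measure \<mu> A" if A: "A \<in> \<A>" for A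
    proof -
      have "\<beta> (A \<times> UNIV) = (\<Sum>i\<in>J. if A \<in> i then (\<Sum>j\<in>J. P i j) else 0)"
        unfolding \<beta>_def
      proof (intro sum.cong refl)
        fix i assume i: "i \<in> J"
        have "indicator (A \<times> UNIV) (p i j) = (if A \<in> i then 1 else 0 :: real)" if "j \<in> J" for j
          using p(1)[OF i that] A by (auto simp: cell_def sig_def indicator_def)
        then show "(\<Sum>j\<in>J. P i j * indicator (A \<times> UNIV) (p i j)) = (if A \<in> i then \<Sum>j\<in>J. P i j else 0)"
          by (auto intro!: sum.cong)
      qed
      also have "\<dots> = (\<Sum>i\<in>{i \<in> J. A \<in> i}. measure \<mu> (cell i))"
        by (subst sum.inter_filter[OF J(1)], rule sum.cong[OF refl]) (use P'(2) in simp)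
      finally show ?thesis using split[OF sets(1) M.prob_space_axioms A] by simp
    qed
    show "\<beta> (UNIV \<times> A) = measure \<nu> A" if A: "A \<in> \<A>" for A
    proof -
      have "\<beta> (UNIV \<times> A) = (\<Sum>j\<in>J. if A \<in> j then (\<Sum>i\<in>J. P i j) else 0)"
        unfolding \<beta>_def
      proof (subst sum.swap, intro sum.cong refl)
        fix j assume j: "j \<in> J"
        have "indicator (UNIV \<times> A) (p i j) = (if A \<in> j then 1 else 0 :: real)" if "i \<in> J" for i
          using p(1)[OF that j] A by (auto simp: cell_def sig_def indicator_def)
        then show "(\<Sum>i\<in>J. P i j * indicator (UNIV \<times> A) (p i j)) = (if A \<in> j then \<Sum>i\<in>J. P i j else 0)"
          by (auto intro!: sum.cong)
      qed
      also have "\<dots> = (\<Sum>i\<in>{i \<in> J. A \<in> i}. measure \<nu> (cell i))"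
        by (subst sum.inter_filter[OF J(1)], rule sum.cong[OF refl]) (use P'(3) in simp)
      finally show ?thesis using split[OF sets(2) N.prob_space_axioms A] by simp
    qed
    fix n N :: nat assume n: "0 < n"
    \<comment> \<open>At most the integer part of \<open>t * n\<close> many levels lie strictly
      below \<open>t\<close>, which is why the layer sum does not exceed \<open>t\<close>.\<close>
    have layers: "(\<Sum>k<N. indicator {t. real (Suc k) / real n < t} t) / real n \<le> t" if "0 \<le> t" for t :: real
    proof -
      have "(\<Sum>k<N. indicator {t. real (Suc k) / real n < t} t) = real (card {k. k < N \<and> real (Suc k) / real n < t})"
        by (simp add: indicator_def sum.If_cases Int_def conj_commute)
      also have "\<dots> \<le> real (card {..<nat \<lfloor>t * n\<rfloor>})"
      proof (intro of_nat_mono card_mono subsetI)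
        fix k assume "k \<in> {k. k < N \<and> real (Suc k) / real n < t}"
        then have "real (Suc k) < t * n" using n by (simp add: divide_less_eq)
        then show "k \<in> {..<nat \<lfloor>t * n\<rfloor>}" by (simp add: zless_nat_eq_int_zless) linarith
      qed simp
      also have "\<dots> \<le> t * n" using that by simp
      finally show ?thesis using n by (simp add: divide_le_eq)
    qed
    define f where "f = (\<lambda>q. (\<delta> (fst q) (snd q))^2)"
    have "(\<Sum>k<N. \<beta> {q. real (Suc k) / real n < f q}) / real n
      = (\<Sum>i\<in>J. \<Sum>j\<in>J. P i j * ((\<Sum>k<N. indicator {t. real (Suc k) / real n < t} (f (p i j))) / real n))"
    proof -
      have "(\<Sum>k<N. \<beta> {q. real (Suc k) / real n < f q})
        = (\<Sum>i\<in>J. \<Sum>j\<in>J. \<Sum>k<N. P i j * indicator {t. real (Suc k) / real n < t} (f (p i j)))"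
        unfolding \<beta>_def by (subst sum.swap, intro sum.cong refl, subst sum.swap) (simp add: indicator_def)
      then show ?thesis by (simp only: sum_distrib_left sum_divide_distrib times_divide_eq_right)
    qed
    also have "\<dots> \<le> (\<Sum>i\<in>J. \<Sum>j\<in>J. P i j * (2 * c i j + e))"
    proof (intro sum_mono mult_left_mono P)
      fix i j assume ij: "i \<in> J" "j \<in> J"
      have "0 \<le> f (p i j)" by (simp add: f_def)
      from order_trans[OF layers[OF this]] p(2)[OF ij]
      show "(\<Sum>k<N. indicator {t. real (Suc k) / real n < t} (f (p i j))) / real n \<le> 2 * c i j + e"
        by (simp add: f_def)
    qed
    also have "\<dots> = 2 * (\<Sum>i\<in>J. \<Sum>j\<in>J. P i j * c i j) + e * (\<Sum>i\<in>J. \<Sum>j\<in>J. P i j)"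
      by (simp add: distrib_left sum.distrib sum_distrib_left mult_ac)
    also have "\<dots> \<le> 2 * b + e" using P4 PT by simp
    finally show "(\<Sum>k<N. \<beta> (cost_layer \<delta> n k)) / real n \<le> 2 * b + e"
      by (simp add: f_def cost_layer_def)
  qed
qed

end

section \<open>Optimal plans\<close>

text \<open>Tychonoff's theorem turns the discrete plans into one finitely additive plan satisfying all the
  marginal and cost constraints.\<close>

lemma (in ext_mm_space) ex_finitely_additive_plan:
  assumes \<mu>: "radon_prob \<mu>" and \<nu>: "radon_prob \<nu>"
    and dual: "\<And>\<phi>. \<phi> \<in> dual_admissible d m \<Longrightarrow> (\<integral>x. \<phi> 1 x \<partial>\<nu>) - (\<integral>x. \<phi> 0 x \<partial>\<mu>) \<le> b"
  obtains \<beta> :: "('a \<times> 'a) set \<Rightarrow> real" where "\<And>S. 0 \<le> \<beta> S" "\<And>S T. S \<inter> T = {} \<Longrightarrow> \<beta> (S \<union> T) = \<beta> S + \<beta> T"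
    "\<beta> UNIV = 1" "\<And>A. A \<in> sets borel \<Longrightarrow> \<beta> (A \<times> UNIV) = measure \<mu> A" "\<And>B. B \<in> sets borel \<Longrightarrow> \<beta> (UNIV \<times> B) = measure \<nu> B"
    "\<And>\<delta> n N. \<delta> \<in> cont_semidistances d \<Longrightarrow> 0 < n \<Longrightarrow>
      (\<Sum>k<N. \<beta> (cost_layer \<delta> n k)) / real n \<le> 2 * b"
proof -
  define S where "S = PiE UNIV (\<lambda>_ :: ('a \<times> 'a) set. {0..1::real})"
  define T where "T = (\<lambda>(\<delta>, \<A>, e). {\<beta>. (\<forall>S T. S \<inter> T = {} \<longrightarrow> \<beta> (S \<union> T) = \<beta> S + \<beta> T) \<and> \<beta> UNIV = 1
      \<and> (\<forall>A. A \<in> \<A> \<longrightarrow> \<beta> (A \<times> UNIV) = measure \<mu> A) \<and> (\<forall>A. A \<in> \<A> \<longrightarrow> \<beta> (UNIV \<times> A) = measure \<nu> A)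
      \<and> (\<forall>n N. 0 < n \<longrightarrow> (\<Sum>k<N. \<beta> (cost_layer \<delta> n k)) / real n \<le> 2 * b + e)})"
  define Q where "Q = cont_semidistances d \<times> {\<A> :: 'a set set. finite \<A> \<and> \<A> \<subseteq> sets borel} \<times> {e::real. 0 < e}"
  have coord: "continuous_on UNIV (\<lambda>\<beta> :: ('a \<times> 'a) set \<Rightarrow> real. \<beta> A)" for A
    by (rule continuous_on_product_coordinates)
  have "compactin (product_topology (\<lambda>_. euclidean) UNIV) S"
    unfolding S_def by (subst compactin_PiE) auto
  then have S: "compact S" by (simp add: euclidean_product_topology compactin_euclidean_iff)
  have closed: "closed F" if "F \<in> T ` Q" for F
  proof -
    obtain \<delta> \<A> e where F: "F = T (\<delta>, \<A>, e)" using \<open>F \<in> T ` Q\<close> by (auto simp: Q_def)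
    show ?thesis unfolding F T_def prod.case divide_inverse
      by (intro closed_Collect_conj closed_Collect_all closed_Collect_imp open_Collect_const closed_Collect_eq
          closed_Collect_le continuous_intros coord)
  qed
  \<comment> \<open>A larger semidistance has larger layers, a larger collection of sets prescribes
    more marginals, and a smaller \<open>e\<close> is stricter, so finitely many constraints follow
    from a single one.\<close>
  have fip: "S \<inter> \<Inter>\<F> \<noteq> {}" if F: "finite \<F>" "\<F> \<subseteq> T ` Q" for \<F>
  proof -
    obtain Q0 where Q0: "Q0 \<subseteq> Q" "finite Q0" "\<F> = T ` Q0" using finite_subset_image[OF F] by blast
    have "finite (fst ` Q0)" "fst ` Q0 \<subseteq> cont_semidistances d" using Q0(1,2) by (auto simp: Q_def)
    from cont_semidistances_directed[OF this] obtain \<delta> where \<delta>: "\<delta> \<in> cont_semidistances d"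
      "\<forall>\<delta>'\<in>fst ` Q0. \<forall>x y. \<delta>' x y \<le> \<delta> x y" by (rule bexE)
    define \<A> where "\<A> = (\<Union>q\<in>Q0. fst (snd q))"
    \<comment> \<open>Inserting 1 provides a value even when the family of constraints is
      empty.\<close>
    define e where "e = Min (insert 1 ((\<lambda>q. snd (snd q)) ` Q0))"
    have q0: "fst q \<in> cont_semidistances d" "finite (fst (snd q))" "fst (snd q) \<subseteq> sets borel" "0 < snd (snd q)"
      if "q \<in> Q0" for q using subsetD[OF Q0(1) that] by (simp_all add: Q_def mem_Times_iff)
    have \<A>: "finite \<A>" "\<A> \<subseteq> sets borel" unfolding \<A>_def using Q0(2) q0(2,3) by (simp_all add: UN_least)
    have e: "0 < e" unfolding e_def using Q0(2) q0(4) by (subst Min_gr_iff) auto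
    show ?thesis
    proof (rule ex_discrete_plan[OF \<mu> \<nu> dual \<delta>(1) \<A> e])
      fix \<beta> :: "('a \<times> 'a) set \<Rightarrow> real"
      assume b: "\<And>S. 0 \<le> \<beta> S" "\<And>S. \<beta> S \<le> 1" "\<And>S T. S \<inter> T = {} \<Longrightarrow> \<beta> (S \<union> T) = \<beta> S + \<beta> T"
        "\<beta> UNIV = 1" "\<And>A. A \<in> \<A> \<Longrightarrow> \<beta> (A \<times> UNIV) = measure \<mu> A" "\<And>B. B \<in> \<A> \<Longrightarrow> \<beta> (UNIV \<times> B) = measure \<nu> B"
        "\<And>n N. 0 < n \<Longrightarrow> (\<Sum>k<N. \<beta> (cost_layer \<delta> n k)) / real n \<le> 2 * b + e"
      have mono: "\<beta> A \<le> \<beta> B" if "A \<subseteq> B" for A B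
        using b(3)[of A "B - A"] b(1)[of "B - A"] that by (simp add: Un_absorb1)
      have "\<beta> \<in> T (\<delta>', \<A>', e')" if q: "(\<delta>', \<A>', e') \<in> Q0" for \<delta>' \<A>' e'
      proof -
        have A: "A \<in> \<A>" if "A \<in> \<A>'" for A using q that unfolding \<A>_def by (intro UN_I[OF q]) simp
        have e': "e \<le> e'" unfolding e_def using Q0(2) q by (intro Min_le) (auto simp: image_iff intro!: bexI[OF _ q])
        have \<delta>': "\<delta>' x y \<le> \<delta> x y" for x y
            using bspec[OF \<delta>(2) imageI[OF q, of fst]] by simp
        have \<delta>0: "0 \<le> \<delta>' x y" for x y
          using cont_semidistancesD(1)[OF q0(1)[OF q]] by simp
        have lay: "cost_layer \<delta>' n k \<subseteq> cost_layer \<delta> n k" for n k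
          unfolding cost_layer_def by (intro Collect_mono impI) (erule order.strict_trans2, rule power_mono[OF \<delta>' \<delta>0])
        have "(\<Sum>k<N. \<beta> (cost_layer \<delta>' n k)) / real n \<le> 2 * b + e'" if n: "0 < n" for n N
        proof -
          have "(\<Sum>k<N. \<beta> (cost_layer \<delta>' n k)) / real n \<le> (\<Sum>k<N. \<beta> (cost_layer \<delta> n k)) / real n"
            by (intro divide_right_mono sum_mono mono lay) simp
          also have "\<dots> \<le> 2 * b + e" by (rule b(7)[OF n])
          finally show ?thesis using e' by linarith
        qed
        then show ?thesis unfolding T_def prod.case
          by (intro CollectI conjI allI impI) (simp_all add: b(3,4) b(5,6)[OF A])
      qed
      then have "\<beta> \<in> \<Inter>\<F>" unfolding Q0(3) by (intro InterI) (auto simp: image_iff)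
      moreover have "\<beta> \<in> S" using b(1,2) by (simp add: S_def PiE_UNIV_domain)
      ultimately show ?thesis by blast
    qed
  qed
  have "S \<inter> \<Inter>(T ` Q) \<noteq> {}" by (rule compact_imp_fip[OF S closed fip])
  then obtain \<beta> where \<beta>: "\<beta> \<in> S" "\<And>q. q \<in> Q \<Longrightarrow> \<beta> \<in> T q" by auto
  have TD: "(\<forall>S T. S \<inter> T = {} \<longrightarrow> \<beta> (S \<union> T) = \<beta> S + \<beta> T) \<and> \<beta> UNIV = 1
      \<and> (\<forall>A. A \<in> \<A> \<longrightarrow> \<beta> (A \<times> UNIV) = measure \<mu> A) \<and> (\<forall>A. A \<in> \<A> \<longrightarrow> \<beta> (UNIV \<times> A) = measure \<nu> A)
      \<and> (\<forall>n N. 0 < n \<longrightarrow> (\<Sum>k<N. \<beta> (cost_layer \<delta> n k)) / real n \<le> 2 * b + e)"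
    if "\<delta> \<in> cont_semidistances d" "finite \<A>" "\<A> \<subseteq> sets borel" "0 < e" for \<delta> \<A> e
    using \<beta>(2)[of "(\<delta>, \<A>, e)"] that unfolding T_def Q_def by simp
  \<comment> \<open>The marginal constraints do not involve the semidistance and are read off at the
    zero one.\<close>
  note TD0 = TD[OF cont_semidistances_zero]
  show thesis
  proof (rule that[of \<beta>])
    show "0 \<le> \<beta> A" for A using PiE_mem[OF \<beta>(1)[unfolded S_def], of A] by simp
    show "\<beta> (A \<union> B) = \<beta> A + \<beta> B" if "A \<inter> B = {}" for A B using TD0[of "{}" 1] that by simp
    show "\<beta> UNIV = 1" using TD0[of "{}" 1] by simp
    show "\<beta> (A \<times> UNIV) = measure \<mu> A" "\<beta> (UNIV \<times> A) = measure \<nu> A" if "A \<in> sets borel" for A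
      using TD0[of "{A}" 1] that by simp_all
    fix \<delta> and n N :: nat assume \<delta>: "\<delta> \<in> cont_semidistances d" and n: "0 < n"
    show "(\<Sum>k<N. \<beta> (cost_layer \<delta> n k)) / real n \<le> 2 * b"
      by (rule field_le_epsilon) (use TD[OF \<delta>, of "{}"] n in simp)
  qed
qed

text \<open>Inner regularity of \<open>N\<close> extends the inequality from compact to Borel sets;
  applied to complements as well it becomes an equality, since both masses are 1.\<close>

lemma radon_prob_eqI:
  assumes N: "radon_prob N" and M: "prob_space M" "sets M = sets borel"
    and le: "\<And>K. compact K \<Longrightarrow> measure N K \<le> measure M K"
  shows "M = N"
proof -
  interpret M: prob_space M by (rule M(1))
  interpret N: prob_space N using N by (simp add: radon_prob_def)
  have sN: "sets N = sets borel" using N by (simp add: radon_prob_def)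
  have sp: "space M = UNIV" "space N = UNIV" using sets_eq_imp_space_eq[OF M(2)] sets_eq_imp_space_eq[OF sN] by auto
  have *: "measure N A \<le> measure M A" if A: "A \<in> sets borel" for A
  proof -
    have "emeasure N A = (SUP K\<in>{K. compact K \<and> K \<subseteq> A}. emeasure N K)"
      using N A by (simp add: radon_prob_def)
    also have "\<dots> \<le> emeasure M A"
    proof (rule SUP_least)
      fix K assume "K \<in> {K. compact K \<and> K \<subseteq> A}"
      then have K: "compact K" "K \<subseteq> A" by auto
      have "emeasure N K \<le> emeasure M K"
        using le[OF K(1)] by (simp add: M.emeasure_eq_measure N.emeasure_eq_measure)
      also have "\<dots> \<le> emeasure M A" using K A M(2) by (intro emeasure_mono) auto
      finally show "emeasure N K \<le> emeasure M A" .
    qed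
    finally show ?thesis by (simp add: M.emeasure_eq_measure N.emeasure_eq_measure)
  qed
  show ?thesis
  proof (rule measure_eqI)
    fix A assume A: "A \<in> sets M"
    then have "A \<in> sets borel" "- A \<in> sets borel" using M(2) by (auto simp: Compl_eq_Diff_UNIV)
    moreover have "measure M (- A) = 1 - measure M A" "measure N (- A) = 1 - measure N A"
      using M.prob_compl[of A] N.prob_compl[of A] A M(2) sN by (simp_all add: sp Compl_eq_Diff_UNIV)
    ultimately have "measure M A = measure N A" using *[of A] *[of "- A"] by simp
    then show "emeasure M A = emeasure N A" by (simp add: M.emeasure_eq_measure N.emeasure_eq_measure)
  qed (simp add: M(2) sN)
qed

text \<open>A compact set nearly filling the union is covered by finitely many of the open sets, and
  directedness puts these inside one. This is continuity from below for a family that may be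
  uncountable.\<close>

lemma radon_prob_directed_Union:
  assumes \<pi>: "radon_prob \<pi>" and V: "\<And>\<delta>. \<delta> \<in> D \<Longrightarrow> open (V \<delta>)" and e: "0 < e"
    and dir: "\<And>F. finite F \<Longrightarrow> F \<subseteq> D \<Longrightarrow> \<exists>\<delta>\<in>D. \<forall>\<delta>'\<in>F. V \<delta>' \<subseteq> V \<delta>"
  shows "\<exists>\<delta>\<in>D. measure \<pi> (\<Union>\<delta>\<in>D. V \<delta>) \<le> measure \<pi> (V \<delta>) + e"
proof -
  interpret prob_space \<pi> using \<pi> by (simp add: radon_prob_def)
  have s: "sets \<pi> = sets borel" using \<pi> by (simp add: radon_prob_def)
  define U where "U = (\<Union>\<delta>\<in>D. V \<delta>)"
  have oU: "open U" unfolding U_def using V by auto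
  show ?thesis
  proof (cases "measure \<pi> U \<le> e")
    case True
    then show ?thesis using dir[of "{}"] by (auto simp: U_def intro!: add_increasing)
  next
    case False
    have "ennreal (measure \<pi> U - e) < emeasure \<pi> U"
      using e False by (simp add: emeasure_eq_measure ennreal_less_iff)
    also have "\<dots> = (SUP K\<in>{K. compact K \<and> K \<subseteq> U}. emeasure \<pi> K)"
      using \<pi> oU by (simp add: radon_prob_def)
    finally obtain K where K: "compact K" "K \<subseteq> U" "ennreal (measure \<pi> U - e) < emeasure \<pi> K"
      by (auto simp: less_SUP_iff)
    obtain F where F: "F \<subseteq> D" "finite F" "K \<subseteq> (\<Union>\<delta>\<in>F. V \<delta>)"
      using compactE_image[OF K(1), of D V] V K(2) unfolding U_def by metis
    obtain \<delta> where \<delta>: "\<delta> \<in> D" "\<forall>\<delta>'\<in>F. V \<delta>' \<subseteq> V \<delta>" using dir[OF F(2,1)] by blast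
    have "measure \<pi> U - e < measure \<pi> K"
      using K(3) False by (simp add: emeasure_eq_measure ennreal_less_iff)
    also have "\<dots> \<le> measure \<pi> (V \<delta>)"
    proof (rule finite_measure_mono)
      show "K \<subseteq> V \<delta>" using F(3) \<delta>(2) by blast
      show "V \<delta> \<in> sets \<pi>" using V[OF \<delta>(1)] s by auto
    qed
    finally show ?thesis using \<delta>(1) by (intro bexI[of _ \<delta>]) (auto simp: U_def)
  qed
qed

lemma le_sum_layers:
  fixes r :: real
  assumes "0 < n" "r \<le> real N / real n"
  shows "r \<le> 1 / real n + (\<Sum>k<N. indicator {t. real (Suc k) / real n < t} r) / real n"
proof -
  \<comment> \<open>The number of \<open>k\<close> with \<open>Suc k < r * n\<close>: one less than
    the ceiling because the inequality is strict, and \<open>nat\<close> makes it 0 when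
    \<open>r\<close> is small or negative.\<close>
  define l where "l = nat (\<lceil>r * n\<rceil> - 1)"
  have rn: "r * n \<le> N" using assms by (simp add: field_simps)
  have "r * n - 1 \<le> real l" by (simp add: l_def) linarith
  also have "\<dots> = (\<Sum>k<l. 1)" by simp
  also have "\<dots> \<le> (\<Sum>k<l. indicator {t. real (Suc k) / real n < t} r)"
  proof (rule sum_mono)
    fix k assume "k \<in> {..<l}"
    then have "int k < \<lceil>r * n\<rceil> - 1" by (simp add: l_def)
    then have "real (Suc k) < r * n" by linarith
    then show "1 \<le> (indicator {t. real (Suc k) / real n < t} r :: real)" using assms(1) by (simp add: divide_less_eq)
  qed
  also have "\<dots> \<le> (\<Sum>k<N. indicator {t. real (Suc k) / real n < t} r)"
  proof (rule sum_mono2)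
    have "\<lceil>r * n\<rceil> \<le> int N" using rn by linarith
    then show "{..<l} \<subseteq> {..<N}" by (auto simp: l_def)
  qed (auto simp: indicator_def)
  finally show ?thesis using assms(1) by (simp add: field_simps)
qed

text \<open>The layer sum approximates from below with error \<open>1 / n\<close>. At infinity every
  layer is present and the series diverges, so the bound persists for extended values.\<close>

lemma ennreal_le_layers:
  fixes t :: ennreal
  assumes n: "0 < n"
  shows "t \<le> ennreal (1 / real n) + (\<Sum>k. ennreal (1 / real n) * indicator {t. ennreal (real (Suc k) / real n) < t} t)"
proof (cases t rule: ennreal_cases)
  case (real r)
  obtain N :: nat where "r * n \<le> real N" using real_arch_simple by blast
  then have N: "r \<le> real N / real n" using n by (simp add: field_simps)
  have "t \<le> ennreal (1 / real n + (\<Sum>k<N. indicator {t. real (Suc k) / real n < t} r) / real n)"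
    unfolding real(2) by (intro ennreal_leI le_sum_layers n N)
  also have "\<dots> = ennreal (1 / real n) + (\<Sum>k<N. ennreal (1 / real n) * indicator {t. ennreal (real (Suc k) / real n) < t} t)"
  proof -
    have "ennreal (indicator {t. real (Suc k) / real n < t} r / real n)
      = ennreal (1 / real n) * indicator {t. ennreal (real (Suc k) / real n) < t} t" for k
      unfolding real(2) using real(1) by (auto simp: indicator_def ennreal_less_iff)
    then have "(\<Sum>k<N. ennreal (1 / real n) * indicator {t. ennreal (real (Suc k) / real n) < t} t)
      = ennreal (\<Sum>k<N. indicator {t. real (Suc k) / real n < t} r / real n)"
      by (subst sum_ennreal[symmetric]) auto
    then show ?thesis by (simp add: ennreal_plus[symmetric] sum_divide_distrib sum_nonneg del: ennreal_plus)
  qed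
  also have "\<dots> \<le> ennreal (1 / real n) + (\<Sum>k. ennreal (1 / real n) * indicator {t. ennreal (real (Suc k) / real n) < t} t)"
    by (intro add_left_mono sum_le_suminf) auto
  finally show ?thesis .
next
  case top
  define X where "X = (\<Sum>k::nat. ennreal (1 / real n) * indicator {t. ennreal (real (Suc k) / real n) < t} t)"
  have "X = top"
  proof (rule ccontr)
    assume "X \<noteq> top"
    then have x: "0 \<le> enn2real X" "X = ennreal (enn2real X)" by (simp_all add: less_top)
    obtain N :: nat where N: "enn2real X * n < real N" using reals_Archimedean2 by blast
    have ind: "(indicator {t. ennreal (real (Suc k) / real n) < t} t :: ennreal) = 1" for k by (simp add: top)
    have "X = (\<Sum>k::nat. ennreal (1 / real n))" unfolding X_def ind by (simp only: mult_1_right)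
    then have "(\<Sum>k<N. ennreal (1 / real n)) \<le> ennreal (enn2real X)"
      using sum_le_suminf[of "\<lambda>k. ennreal (1 / real n)" "{..<N}"] x(2) by (simp only: summableI finite_lessThan zero_le simp_thms)
    moreover have "(\<Sum>k<N. ennreal (1 / real n)) = ennreal (real N / real n)"
      by (subst sum_ennreal) auto
    ultimately have "real N / real n \<le> enn2real X" using x(1) by (simp only: ennreal_le_iff)
    then have "real N \<le> enn2real X * n" using n by (simp add: divide_le_eq)
    then show False using N by simp
  qed
  then show ?thesis by (simp add: X_def)
qed

context ext_mm_space
begin

text \<open>Being below the charge on open sets, the measure is above it on closed sets. Comparison
  on cylinders over compact sets identifies both marginals, and comparison on open layers transfers
  the cost.\<close>

lemma ex_coupling:
  assumes \<mu>: "radon_prob \<mu>" and \<nu>: "radon_prob \<nu>"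
    and dual: "\<And>\<phi>. \<phi> \<in> dual_admissible d m \<Longrightarrow> (\<integral>x. \<phi> 1 x \<partial>\<nu>) - (\<integral>x. \<phi> 0 x \<partial>\<mu>) \<le> b"
  shows "\<exists>\<pi>\<in>couplings \<mu> \<nu>. (\<integral>\<^sup>+p. (d (fst p) (snd p))^2 \<partial>\<pi>) \<le> ennreal (2 * b)"
proof (rule ex_finitely_additive_plan[OF \<mu> \<nu> dual])
  fix \<beta> :: "('a \<times> 'a) set \<Rightarrow> real" assume \<beta>: "\<And>S. 0 \<le> \<beta> S" "\<And>S T. S \<inter> T = {} \<Longrightarrow> \<beta> (S \<union> T) = \<beta> S + \<beta> T"
      "\<beta> UNIV = 1"
    and marg: "\<And>A. A \<in> sets borel \<Longrightarrow> \<beta> (A \<times> UNIV) = measure \<mu> A" "\<And>B. B \<in> sets borel \<Longrightarrow> \<beta> (UNIV \<times> B) = measure \<nu> B"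
    and cost: "\<And>\<delta> n N. \<delta> \<in> cont_semidistances d \<Longrightarrow> 0 < n \<Longrightarrow>
      (\<Sum>k<N. \<beta> (cost_layer \<delta> n k)) / real n \<le> 2 * b"
  have tight_marginal: "\<exists>K. compact K \<and> 1 - e \<le> measure L K" if L: "radon_prob L" and e: "0 < e" for L :: "'a measure" and e
  proof -
    interpret L: prob_space L using L by (simp add: radon_prob_def)
    have "ennreal (1 - e) < 1" using e by (simp add: ennreal_less_one_iff)
    also have "1 = emeasure L UNIV"
      using L.emeasure_space_1 sets_eq_imp_space_eq[of L borel] L by (simp add: radon_prob_def)
    also have "\<dots> = (SUP K\<in>{K. compact K \<and> K \<subseteq> UNIV}. emeasure L K)"
      using L by (simp add: radon_prob_def)
    finally obtain K where "compact K" "ennreal (1 - e) < emeasure L K" by (auto simp: less_SUP_iff)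
    then show ?thesis by (intro exI[of _ K]) (auto simp: L.emeasure_eq_measure dest!: less_imp_le)
  qed
  interpret tight_charge \<beta>
  proof
    fix e :: real assume e: "0 < e"
    obtain K where K: "compact K" "1 - e / 2 \<le> measure \<mu> K" using tight_marginal[OF \<mu>, of "e / 2"] e by auto
    obtain L where L: "compact L" "1 - e / 2 \<le> measure \<nu> L" using tight_marginal[OF \<nu>, of "e / 2"] e by auto
    have add: "\<beta> A \<le> \<beta> B" if "A \<subseteq> B" for A B
      using \<beta>(2)[of A "B - A"] \<beta>(1)[of "B - A"] that by (simp add: Un_absorb1)
    have K1: "\<beta> (K \<times> UNIV) = measure \<mu> K" "\<beta> (UNIV \<times> L) = measure \<nu> L"
      using K L by (auto intro!: marg borel_compact)
    have "\<beta> (K \<times> UNIV) = \<beta> (K \<times> L) + \<beta> (K \<times> - L)"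
      by (subst \<beta>(2)[symmetric]) (auto intro!: arg_cong[where f = \<beta>])
    moreover have "\<beta> (K \<times> - L) \<le> \<beta> (UNIV \<times> - L)" by (rule add) auto
    moreover have "\<beta> UNIV = \<beta> (UNIV \<times> L) + \<beta> (UNIV \<times> - L)"
      by (subst \<beta>(2)[symmetric]) (auto intro!: arg_cong[where f = \<beta>])
    ultimately have "1 - e \<le> \<beta> (K \<times> L)" using K1 K(2) L(2) \<beta>(3) by linarith
    then show "\<exists>K. compact K \<and> 1 - e \<le> \<beta> K" using compact_Times[OF K(1) L(1)] by blast
  qed (use \<beta> in auto)
  obtain \<pi> where \<pi>: "radon_prob \<pi>" and le: "\<And>U. open U \<Longrightarrow> measure \<pi> U \<le> \<beta> U" using ex_radon_prob by blast
  interpret P: prob_space \<pi> using \<pi> by (simp add: radon_prob_def)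
  have s: "sets \<pi> = sets borel" using \<pi> by (simp add: radon_prob_def)
  have sp: "space \<pi> = UNIV" using sets_eq_imp_space_eq[OF s] by simp
  have ge: "\<beta> C \<le> measure \<pi> C" if "closed C" for C
  proof -
    have "C \<in> sets \<pi>" unfolding s using that by auto
    then have "measure \<pi> (- C) = 1 - measure \<pi> C" using P.prob_compl[of C] by (simp add: sp Compl_eq_Diff_UNIV)
    moreover have "\<beta> C + \<beta> (- C) = 1" using \<beta>(2)[of C "- C"] \<beta>(3) by simp
    ultimately show ?thesis using le[of "- C"] that by (simp add: open_Compl)
  qed
  have fstm: "fst \<in> measurable \<pi> borel" "snd \<in> measurable \<pi> borel"
    unfolding measurable_cong_sets[OF s refl]
    by (auto intro!: borel_measurable_continuous_onI continuous_intros)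
  have "distr \<pi> borel fst = \<mu>"
  proof (rule radon_prob_eqI[OF \<mu> P.prob_space_distr[OF fstm(1)]])
    fix K :: "'a set" assume K: "compact K"
    have "fst -` K \<inter> space \<pi> = K \<times> UNIV" by (auto simp: sp)
    then have "measure (distr \<pi> borel fst) K = measure \<pi> (K \<times> UNIV)"
      using K by (subst measure_distr[OF fstm(1)]) (auto simp: borel_compact)
    moreover have "\<beta> (K \<times> UNIV) \<le> measure \<pi> (K \<times> UNIV)" using K by (intro ge closed_Times closed_UNIV compact_imp_closed)
    moreover have "\<beta> (K \<times> UNIV) = measure \<mu> K" using K by (intro marg) (auto simp: borel_compact)
    ultimately show "measure \<mu> K \<le> measure (distr \<pi> borel fst) K" by simp
  qed simp
  moreover have "distr \<pi> borel snd = \<nu>"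
  proof (rule radon_prob_eqI[OF \<nu> P.prob_space_distr[OF fstm(2)]])
    fix K :: "'a set" assume K: "compact K"
    have "snd -` K \<inter> space \<pi> = UNIV \<times> K" by (auto simp: sp)
    then have "measure (distr \<pi> borel snd) K = measure \<pi> (UNIV \<times> K)"
      using K by (subst measure_distr[OF fstm(2)]) (auto simp: borel_compact)
    moreover have "\<beta> (UNIV \<times> K) \<le> measure \<pi> (UNIV \<times> K)" using K by (intro ge closed_Times closed_UNIV compact_imp_closed)
    moreover have "\<beta> (UNIV \<times> K) = measure \<nu> K" using K by (intro marg) (auto simp: borel_compact)
    ultimately show "measure \<nu> K \<le> measure (distr \<pi> borel snd) K" by simp
  qed simp
  ultimately have coup: "\<pi> \<in> couplings \<mu> \<nu>" unfolding couplings_def using \<pi> by blast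
  define V where "V = (\<lambda>n k. {p. ennreal (real (Suc k) / real n) < (d (fst p) (snd p))^2})"
  \<comment> \<open>Since \<open>d\<close> is the supremum of the semidistances, its strict
    superlevel sets are unions of open layers. This makes them open, hence measurable, and exhibits
    them as directed unions.\<close>
  have V_eq: "V n k = (\<Union>\<delta>\<in>cont_semidistances d. cost_layer \<delta> n k)" for n k
  proof (intro set_eqI iffI)
    fix p :: "'a \<times> 'a"
    define x y where "x = fst p" and "y = snd p"
    define a where "a = sqrt (real (Suc k) / real n)"
    have a0: "0 \<le> a" unfolding a_def by (intro real_sqrt_ge_zero divide_nonneg_nonneg) auto
    have aa: "real (Suc k) / real n = a^2" unfolding a_def by (rule real_sqrt_pow2[symmetric]) simp
    {
      assume "p \<in> V n k"
      then have "(ennreal a)^2 < (d x y)^2" unfolding V_def x_def y_def aa using a0 by (simp add: ennreal_power)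
      then have "\<not> d x y \<le> ennreal a" using power_mono[of "d x y" "ennreal a" 2] by (auto simp only: not_le[symmetric] zero_le)
      then have "ennreal a < d x y" by (simp only: not_le)
      then obtain \<delta> where \<delta>: "\<delta> \<in> cont_semidistances d" "ennreal a < ennreal (\<delta> x y)"
        unfolding d_eq_SUP[of x y] less_SUP_iff by (rule bexE)
      have "a < \<delta> x y" using \<delta>(2) a0 by (simp add: ennreal_less_iff)
      then have "a^2 < (\<delta> x y)^2" using a0 by (intro power_strict_mono) auto
      then have "p \<in> cost_layer \<delta> n k" unfolding cost_layer_def aa x_def y_def by simp
      then show "p \<in> (\<Union>\<delta>\<in>cont_semidistances d. cost_layer \<delta> n k)" by (rule UN_I[OF \<delta>(1)])
    next
      assume "p \<in> (\<Union>\<delta>\<in>cont_semidistances d. cost_layer \<delta> n k)"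
      then obtain \<delta> where \<delta>: "\<delta> \<in> cont_semidistances d" "p \<in> cost_layer \<delta> n k" by (rule UN_E)
      have "ennreal (a^2) < ennreal ((\<delta> x y)^2)"
        using \<delta>(2) unfolding cost_layer_def aa x_def y_def by (simp add: ennreal_less_iff)
      also have "\<dots> = (ennreal (\<delta> x y))^2" using cont_semidistancesD(1)[OF \<delta>(1)] by (simp add: ennreal_power)
      also have "\<dots> \<le> (d x y)^2" by (intro power_mono cont_semidistancesD(7)[OF \<delta>(1)]) simp
      finally show "p \<in> V n k" unfolding V_def aa x_def y_def by simp
    }
  qed
  have lay_open: "open (cost_layer \<delta> n k)" if "\<delta> \<in> cont_semidistances d" for \<delta> n k
    unfolding cost_layer_def using cont_semidistancesD(6)[OF that]
    by (intro open_Collect_less continuous_intros) (simp_all add: case_prod_beta)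
  have lay_mono: "cost_layer \<delta>' n k \<subseteq> cost_layer \<delta> n k"
    if "\<delta>' \<in> cont_semidistances d" "\<And>x y. \<delta>' x y \<le> \<delta> x y" for \<delta> \<delta>' n k
    unfolding cost_layer_def
    by (intro Collect_mono impI) (erule order.strict_trans2, rule power_mono[OF that(2) cont_semidistancesD(1)[OF that(1)]])
  have V_open: "open (V n k)" for n k unfolding V_eq by (intro open_UN ballI lay_open)
  then have V_sets: "V n k \<in> sets \<pi>" for n k unfolding s by (rule borel_open)
  have layers: "(\<Sum>k<N. measure \<pi> (V n k)) / real n \<le> 2 * b" if n: "0 < n" for n N
  proof (rule field_le_epsilon)
    fix \<epsilon> :: real assume \<epsilon>: "0 < \<epsilon>"
    \<comment> \<open>Each of the \<open>N\<close> layers is approximated up to \<open>e\<close>;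
      then one semidistance above the \<open>N\<close> chosen ones is taken, because the cost
      constraint concerns one semidistance at a time.\<close>
    define e where "e = \<epsilon> / (real N + 1)"
    have e: "0 < e" "real N * e \<le> \<epsilon>" using \<epsilon> by (auto simp: e_def field_simps)
    have "\<exists>\<delta>\<in>cont_semidistances d. measure \<pi> (V n k) \<le> measure \<pi> (cost_layer \<delta> n k) + e" for k
      unfolding V_eq
    proof (rule radon_prob_directed_Union[OF \<pi> lay_open e(1)])
      fix F assume F: "finite F" "F \<subseteq> cont_semidistances d"
      from cont_semidistances_directed[OF F] obtain \<delta> where \<delta>: "\<delta> \<in> cont_semidistances d"
        "\<forall>\<delta>'\<in>F. \<forall>x y. \<delta>' x y \<le> \<delta> x y" by (rule bexE)
      have "cost_layer \<delta>' n k \<subseteq> cost_layer \<delta> n k" if "\<delta>' \<in> F" for \<delta>'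
        using \<delta>(2) that F(2) by (intro lay_mono) auto
      then show "\<exists>\<delta>\<in>cont_semidistances d. \<forall>\<delta>'\<in>F. cost_layer \<delta>' n k \<subseteq> cost_layer \<delta> n k" using \<delta>(1) by blast
    qed
    then obtain \<delta>' where \<delta>': "\<And>k. \<delta>' k \<in> cont_semidistances d" "\<And>k. measure \<pi> (V n k) \<le> measure \<pi> (cost_layer (\<delta>' k) n k) + e"
      by metis
    have "finite (\<delta>' ` {..<N})" "\<delta>' ` {..<N} \<subseteq> cont_semidistances d" using \<delta>'(1) by auto
    from cont_semidistances_directed[OF this] obtain \<delta> where \<delta>: "\<delta> \<in> cont_semidistances d"
      "\<forall>\<eta>\<in>\<delta>' ` {..<N}. \<forall>x y. \<eta> x y \<le> \<delta> x y" by (rule bexE)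
    have "(\<Sum>k<N. measure \<pi> (V n k)) \<le> (\<Sum>k<N. \<beta> (cost_layer \<delta> n k) + e)"
    proof (rule sum_mono)
      fix k assume k: "k \<in> {..<N}"
      have "measure \<pi> (cost_layer (\<delta>' k) n k) \<le> \<beta> (cost_layer (\<delta>' k) n k)" by (rule le[OF lay_open[OF \<delta>'(1)]])
      also have "\<dots> \<le> \<beta> (cost_layer \<delta> n k)" using \<delta>(2) k by (intro charge_mono lay_mono \<delta>'(1)) auto
      finally show "measure \<pi> (V n k) \<le> \<beta> (cost_layer \<delta> n k) + e" using \<delta>'(2)[of k] by linarith
    qed
    also have "\<dots> = (\<Sum>k<N. \<beta> (cost_layer \<delta> n k)) + real N * e" by (simp add: sum.distrib)
    finally have "(\<Sum>k<N. measure \<pi> (V n k)) / real n \<le> ((\<Sum>k<N. \<beta> (cost_layer \<delta> n k)) + real N * e) / real n"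
      by (rule divide_right_mono) simp
    also have "\<dots> = (\<Sum>k<N. \<beta> (cost_layer \<delta> n k)) / real n + real N * e / real n" by (rule add_divide_distrib)
    also have "\<dots> \<le> 2 * b + \<epsilon>"
    proof (intro add_mono)
      show "(\<Sum>k<N. \<beta> (cost_layer \<delta> n k)) / real n \<le> 2 * b" by (rule cost[OF \<delta>(1) n])
      have "real N * e / real n \<le> real N * e / 1" using n e by (intro divide_left_mono) auto
      then show "real N * e / real n \<le> \<epsilon>" using e(2) by simp
    qed
    finally show "(\<Sum>k<N. measure \<pi> (V n k)) / real n \<le> 2 * b + \<epsilon>" .
  qed
  have "(\<integral>\<^sup>+p. (d (fst p) (snd p))^2 \<partial>\<pi>) \<le> ennreal (1 / real n) + ennreal (2 * b)" if n: "0 < n" for n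
  proof -
    have "(\<integral>\<^sup>+p. (d (fst p) (snd p))^2 \<partial>\<pi>)
      \<le> (\<integral>\<^sup>+p. ennreal (1 / real n) + (\<Sum>k. ennreal (1 / real n) * indicator (V n k) p) \<partial>\<pi>)"
    proof (rule nn_integral_mono)
      fix p
      have "(indicator {t. ennreal (real (Suc k) / real n) < t} ((d (fst p) (snd p))^2) :: ennreal) = indicator (V n k) p" for k
        by (simp add: indicator_def V_def)
      with ennreal_le_layers[OF n, of "(d (fst p) (snd p))^2"]
      show "(d (fst p) (snd p))^2 \<le> ennreal (1 / real n) + (\<Sum>k. ennreal (1 / real n) * indicator (V n k) p)" by (simp only:)
    qed
    also have "\<dots> = ennreal (1 / real n) + (\<Sum>k. ennreal (1 / real n) * emeasure \<pi> (V n k))"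
    proof -
      have m: "(\<lambda>p. ennreal (1 / real n) * indicator (V n k) p) \<in> borel_measurable \<pi>" for k
        using V_sets[of n k] by simp
      have "(\<integral>\<^sup>+p. ennreal (1 / real n) + (\<Sum>k. ennreal (1 / real n) * indicator (V n k) p) \<partial>\<pi>)
        = (\<integral>\<^sup>+p. ennreal (1 / real n) \<partial>\<pi>) + (\<integral>\<^sup>+p. (\<Sum>k. ennreal (1 / real n) * indicator (V n k) p) \<partial>\<pi>)"
        by (rule nn_integral_add[OF borel_measurable_const borel_measurable_suminf_order[OF m]])
      then show ?thesis
        by (simp only: nn_integral_suminf[OF m] nn_integral_cmult_indicator[OF V_sets] nn_integral_const
            P.emeasure_space_1 mult_1_right)
    qed
    also have "(\<Sum>k. ennreal (1 / real n) * emeasure \<pi> (V n k)) \<le> ennreal (2 * b)"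
    proof (rule suminf_le_const)
      fix N
      have "(\<Sum>k<N. ennreal (1 / real n) * emeasure \<pi> (V n k)) = (\<Sum>k<N. ennreal (measure \<pi> (V n k) / real n))"
        by (simp add: P.emeasure_eq_measure ennreal_mult'[symmetric])
      also have "\<dots> = ennreal ((\<Sum>k<N. measure \<pi> (V n k)) / real n)"
        by (subst sum_ennreal) (auto simp: sum_divide_distrib)
      also have "\<dots> \<le> ennreal (2 * b)" by (intro ennreal_leI layers n)
      finally show "(\<Sum>k<N. ennreal (1 / real n) * emeasure \<pi> (V n k)) \<le> ennreal (2 * b)" .
    qed simp
    finally show ?thesis by (simp add: add_left_mono)
  qed
  note bound = this
  have "(\<integral>\<^sup>+p. (d (fst p) (snd p))^2 \<partial>\<pi>) \<le> ennreal (2 * b)"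
  proof (rule ennreal_le_epsilon)
    fix e :: real assume "0 < e"
    then obtain n where n: "0 < n" "1 / real n < e" using ex_inverse_of_nat_less[of e] by (auto simp: inverse_eq_divide)
    have "ennreal (1 / real n) \<le> ennreal e" using n by (intro ennreal_leI) simp
    then have "ennreal (1 / real n) + ennreal (2 * b) \<le> ennreal e + ennreal (2 * b)" by (rule add_right_mono)
    with bound[OF n(1)] have "(\<integral>\<^sup>+p. (d (fst p) (snd p))^2 \<partial>\<pi>) \<le> ennreal e + ennreal (2 * b)" by (rule order_trans)
    then show "(\<integral>\<^sup>+p. (d (fst p) (snd p))^2 \<partial>\<pi>) \<le> ennreal (2 * b) + ennreal e" by (simp only: add.commute)
  qed
  with coup show "\<exists>\<pi>\<in>couplings \<mu> \<nu>. (\<integral>\<^sup>+p. (d (fst p) (snd p))^2 \<partial>\<pi>) \<le> ennreal (2 * b)" by (rule bexI[rotated])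
qed

end

section \<open>Comparison of the distances\<close>

lemma (in dual_potential) potential_slice:
  assumes "t \<in> {0..1}" shows "\<phi> t \<in> borel_measurable m" "\<exists>C. \<forall>x. \<bar>\<phi> t x\<bar> \<le> C"
proof -
  have "(\<lambda>x. \<Phi> t x) \<in> borel_measurable m" by measurable
  then show "\<phi> t \<in> borel_measurable m" using assms by (simp add: \<Phi>_def)
  show "\<exists>C. \<forall>x. \<bar>\<phi> t x\<bar> \<le> C" using admissible assms unfolding dual_admissible_def by fast
qed

lemma (in ext_mm_space) integral_dens:
  assumes \<mu>: "\<mu> \<in> Prob_ac m" and f: "f \<in> borel_measurable m" "\<And>x. \<bar>f x\<bar> \<le> C"
  shows "integrable m (\<lambda>x. f x * dens m \<mu> x)" "(\<integral>x. f x * dens m \<mu> x \<partial>m) = (\<integral>x. f x \<partial>\<mu>)"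
proof -
  have \<mu>': "radon_prob \<mu>" "absolutely_continuous m \<mu>" using \<mu> by (auto simp: Prob_ac_def)
  interpret M: prob_space \<mu> using \<mu>'(1) by (simp add: radon_prob_def)
  have s: "sets \<mu> = sets m" using \<mu>'(1) by (simp add: radon_prob_def)
  have "integrable \<mu> f"
    by (rule M.integrable_const_bound[of _ C]) (use f in \<open>auto simp: measurable_cong_sets[OF s refl]\<close>)
  then have "integrable m (\<lambda>x. enn2real (RN_deriv m \<mu> x) * f x)"
    using RN_deriv_integrable[OF M.sigma_finite_measure_axioms \<mu>'(2) s f(1)] by simp
  then show "integrable m (\<lambda>x. f x * dens m \<mu> x)" by (simp add: dens_def mult.commute)
  show "(\<integral>x. f x * dens m \<mu> x \<partial>m) = (\<integral>x. f x \<partial>\<mu>)"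
    using RN_deriv_integral[OF M.sigma_finite_measure_axioms \<mu>'(2) s f(1)] by (simp add: dens_def mult.commute)
qed

lemma (in ext_mm_space) integral_potential_dens:
  assumes \<mu>: "\<mu> \<in> Prob_ac m" and \<nu>: "\<nu> \<in> Prob_ac m" and \<phi>: "\<phi> \<in> dual_admissible d m"
  shows "(\<integral>x. \<phi> 1 x * dens m \<nu> x - \<phi> 0 x * dens m \<mu> x \<partial>m) = (\<integral>x. \<phi> 1 x \<partial>\<nu>) - (\<integral>x. \<phi> 0 x \<partial>\<mu>)"
    "(\<integral>x. \<phi> 1 x * dens m \<nu> x - \<phi> 0 x * dens m \<mu> x \<partial>m)
      = (\<integral>x. \<phi> 1 x * dens m \<nu> x \<partial>m) - (\<integral>x. \<phi> 0 x * dens m \<mu> x \<partial>m)"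
proof -
  interpret dual_potential d m \<phi> by unfold_locales (rule \<phi>)
  obtain C1 where C1: "\<forall>x. \<bar>\<phi> 1 x\<bar> \<le> C1" using potential_slice(2)[of 1] by auto
  obtain C0 where C0: "\<forall>x. \<bar>\<phi> 0 x\<bar> \<le> C0" using potential_slice(2)[of 0] by auto
  note 1 = integral_dens[OF \<nu> potential_slice(1)[of 1] spec[OF C1]]
    and 0 = integral_dens[OF \<mu> potential_slice(1)[of 0] spec[OF C0]]
  show "(\<integral>x. \<phi> 1 x * dens m \<nu> x - \<phi> 0 x * dens m \<mu> x \<partial>m)
      = (\<integral>x. \<phi> 1 x * dens m \<nu> x \<partial>m) - (\<integral>x. \<phi> 0 x * dens m \<mu> x \<partial>m)"
    by (rule Bochner_Integration.integral_diff) (use 1(1) 0(1) in simp_all)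
  then show "(\<integral>x. \<phi> 1 x * dens m \<nu> x - \<phi> 0 x * dens m \<mu> x \<partial>m) = (\<integral>x. \<phi> 1 x \<partial>\<nu>) - (\<integral>x. \<phi> 0 x \<partial>\<mu>)"
    using 1(2) 0(2) by simp
qed

lemma (in ext_mm_space) W_d_le_W_Ch_dual:
  assumes \<mu>: "\<mu> \<in> Prob_ac m" and \<nu>: "\<nu> \<in> Prob_ac m"
  shows "W_d d \<mu> \<nu> \<le> W_Ch_dual d m \<mu> \<nu>"
proof -
  define \<J> where "\<J> = (\<lambda>\<phi> :: real \<Rightarrow> 'a \<Rightarrow> real. \<integral>x. \<phi> 1 x * dens m \<nu> x - \<phi> 0 x * dens m \<mu> x \<partial>m)"
  define B where "B = (SUP \<phi>\<in>dual_admissible d m. ereal (\<J> \<phi>))"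
  have "(INF \<pi>\<in>couplings \<mu> \<nu>. \<integral>\<^sup>+p. (d (fst p) (snd p))^2 \<partial>\<pi>) \<le> e2ennreal (2 * B)"
  proof (cases "B = \<infinity>")
    case True
    then show ?thesis by simp
  next
    case False
    \<comment> \<open>With one index and all data 0 this provides an admissible potential, so the
      supremum \<open>B\<close> is not minus infinity.\<close>
    interpret hopf_lax d m "{()}" "\<lambda>_. 0" "\<lambda>_ _. 0" 0 1
      by unfold_locales auto
    have "ereal (\<J> pot) \<le> B" unfolding B_def by (rule SUP_upper[OF pot_admissible])
    with False obtain b where b: "B = ereal b" by (cases B) auto
    have "(\<integral>x. \<phi> 1 x \<partial>\<nu>) - (\<integral>x. \<phi> 0 x \<partial>\<mu>) \<le> b" if \<phi>: "\<phi> \<in> dual_admissible d m" for \<phi>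
    proof -
      have "ereal (\<J> \<phi>) \<le> ereal b" unfolding b[symmetric] B_def by (rule SUP_upper[OF \<phi>])
      then show ?thesis by (simp add: \<J>_def integral_potential_dens(1)[OF \<mu> \<nu> \<phi>])
    qed
    then obtain \<pi> where "\<pi> \<in> couplings \<mu> \<nu>" "(\<integral>\<^sup>+p. (d (fst p) (snd p))^2 \<partial>\<pi>) \<le> ennreal (2 * b)"
      using ex_coupling[of \<mu> \<nu> b] \<mu> \<nu> unfolding Prob_ac_def by blast
    then have "(INF \<pi>\<in>couplings \<mu> \<nu>. \<integral>\<^sup>+p. (d (fst p) (snd p))^2 \<partial>\<pi>) \<le> ennreal (2 * b)" by (rule INF_lower2)
    also have "\<dots> = e2ennreal (2 * B)" by (simp add: b)
    finally show ?thesis .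
  qed
  then show ?thesis unfolding W_d_def W_Ch_dual_def B_def \<J>_def by (rule esqrt_mono)
qed

lemma (in potential_along_curve) potential_difference_le_speed:
  assumes \<mu>: "\<mu> \<in> Prob_ac m" "AE x in m. \<rho> 0 x = dens m \<mu> x" and \<nu>: "\<nu> \<in> Prob_ac m" "AE x in m. \<rho> 1 x = dens m \<nu> x"
  shows "ennreal (2 * (\<integral>x. \<phi> 1 x * dens m \<nu> x - \<phi> 0 x * dens m \<mu> x \<partial>m))
    \<le> (\<integral>\<^sup>+t. ennreal ((CE_speed d m \<rho> t)^2) \<partial>lebesgue_on {0<..<1})"
proof -
  obtain c where c: "borel_bound c" and eq: "AE t in lebesgue_on {0<..<1}. CE_speed d m \<rho> t = c t"
    by (rule CE_bound_representative[OF CE_speed_bound])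
  note D = borel_boundD[OF c]
  have m: "\<rho> t \<in> borel_measurable m" if "t \<in> {0..1}" for t using \<rho>[OF that] by (simp add: prob_density_def)
  have dm: "dens m L \<in> borel_measurable m" for L unfolding dens_def by measurable
  have "(\<integral>x. \<phi> 1 x * dens m \<nu> x \<partial>m) = (\<integral>x. \<phi> 1 x * \<rho> 1 x \<partial>m)"
    by (rule integral_cong_AE) (use \<nu>(2) m[of 1] dm potential_slice(1)[of 1] in auto)
  moreover have "(\<integral>x. \<phi> 0 x * dens m \<mu> x \<partial>m) = (\<integral>x. \<phi> 0 x * \<rho> 0 x \<partial>m)"
    by (rule integral_cong_AE) (use \<mu>(2) m[of 0] dm potential_slice(1)[of 0] in auto)
  ultimately have "2 * (\<integral>x. \<phi> 1 x * dens m \<nu> x - \<phi> 0 x * dens m \<mu> x \<partial>m) \<le> (\<integral>r. (c r)^2 \<partial>lborel)"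
    using potential_difference_le_action[OF c] unfolding integral_potential_dens(2)[OF \<mu>(1) \<nu>(1) admissible] by simp
  then have "ennreal (2 * (\<integral>x. \<phi> 1 x * dens m \<nu> x - \<phi> 0 x * dens m \<mu> x \<partial>m)) \<le> ennreal (\<integral>r. (c r)^2 \<partial>lborel)"
    by (rule ennreal_leI)
  also have "\<dots> = (\<integral>\<^sup>+r. ennreal ((c r)^2) \<partial>lborel)"
    by (rule nn_integral_eq_integral[symmetric, OF D(4)]) simp
  also have "\<dots> = (\<integral>\<^sup>+t. ennreal ((c t)^2) \<partial>lebesgue_on {0<..<1})"
    by (rule nn_integral_lebesgue_on_01[symmetric]) (use D(1,3) in simp_all)
  also have "\<dots> = (\<integral>\<^sup>+t. ennreal ((CE_speed d m \<rho> t)^2) \<partial>lebesgue_on {0<..<1})"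
    by (rule nn_integral_cong_AE) (use eq in eventually_elim, simp)
  finally show ?thesis .
qed

lemma (in ext_mm_space) W_Ch_dual_le_W_Ch:
  assumes \<mu>: "\<mu> \<in> Prob_ac m" and \<nu>: "\<nu> \<in> Prob_ac m"
  shows "W_Ch_dual d m \<mu> \<nu> \<le> W_Ch d m \<mu> \<nu>"
  unfolding W_Ch_dual_def W_Ch_def
proof (rule esqrt_mono, rule INF_greatest)
  fix \<rho> assume curve: "\<rho> \<in> {\<rho> \<in> CE2 d m. (AE x in m. \<rho> 0 x = dens m \<mu> x) \<and> (AE x in m. \<rho> 1 x = dens m \<nu> x)}"
  define A where "A = (\<integral>\<^sup>+t. ennreal ((CE_speed d m \<rho> t)^2) \<partial>lebesgue_on {0<..<1})"
  define \<J> where "\<J> = (\<lambda>\<phi> :: real \<Rightarrow> 'a \<Rightarrow> real. \<integral>x. \<phi> 1 x * dens m \<nu> x - \<phi> 0 x * dens m \<mu> x \<partial>m)"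
  show "e2ennreal (2 * (SUP \<phi>\<in>dual_admissible d m.
      ereal (\<integral>x. \<phi> 1 x * dens m \<nu> x - \<phi> 0 x * dens m \<mu> x \<partial>m)))
    \<le> (\<integral>\<^sup>+t. ennreal ((CE_speed d m \<rho> t)^2) \<partial>lebesgue_on {0<..<1})"
    unfolding A_def[symmetric]
  proof (cases A rule: ennreal_cases)
    case (real a)
    have "ereal (\<J> \<phi>) \<le> ereal (a / 2)" if \<phi>: "\<phi> \<in> dual_admissible d m" for \<phi>
    proof -
      interpret potential_along_curve d m \<phi> \<rho>
        by unfold_locales (use \<phi> curve in \<open>auto simp: CE2_def\<close>)
      have "ennreal (2 * \<J> \<phi>) \<le> ennreal a"
        using potential_difference_le_speed[OF \<mu> _ \<nu>] curve unfolding A_def[symmetric] \<J>_def real(2) by blast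
      then have "2 * \<J> \<phi> \<le> a" using real(1) by (simp add: ennreal_le_iff)
      then show ?thesis by simp
    qed
    then have "(SUP \<phi>\<in>dual_admissible d m. ereal (\<J> \<phi>)) \<le> ereal (a / 2)" by (rule SUP_least)
    then have "2 * (SUP \<phi>\<in>dual_admissible d m. ereal (\<J> \<phi>)) \<le> 2 * ereal (a / 2)"
      by (rule ereal_mult_left_mono) simp
    then have "e2ennreal (2 * (SUP \<phi>\<in>dual_admissible d m. ereal (\<J> \<phi>))) \<le> e2ennreal (ereal a)"
      by (intro e2ennreal_mono) simp
    then show "e2ennreal (2 * (SUP \<phi>\<in>dual_admissible d m.
      ereal (\<integral>x. \<phi> 1 x * dens m \<nu> x - \<phi> 0 x * dens m \<mu> x \<partial>m))) \<le> A"
      unfolding real(2) \<J>_def by simp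
  qed simp
qed

theorem proposition7p9:
  fixes d :: "'a::t2_space \<Rightarrow> 'a \<Rightarrow> ennreal" and m \<mu> \<nu> :: "'a measure"
  assumes "ext_metric_measure_space d m"
    and "\<mu> \<in> Prob_ac m" and "\<nu> \<in> Prob_ac m"
  shows "W_d d \<mu> \<nu> \<le> W_Ch_dual d m \<mu> \<nu> \<and> W_Ch_dual d m \<mu> \<nu> \<le> W_Ch d m \<mu> \<nu>"
proof -
  interpret ext_mm_space d m by unfold_locales (rule assms)
  show ?thesis using W_d_le_W_Ch_dual[OF assms(2,3)] W_Ch_dual_le_W_Ch[OF assms(2,3)] by (rule conjI)
qed

end
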